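(* The almost-sure problem is in $\mathsf{NP}$.
   Context: A game structure is $G=(\Sigma,S,(A_p)_{p\in\Sigma},(\mathsf{Av}_p)_{p\in\Sigma},\delta)$ with players $\Sigma$, finite state set $S$, finite action sets $A_p$, nonempty available-action sets $\mathsf{Av}_p(s)\subseteq A_p$, and transition function $\delta$ mapping a state and an available action profile to a probability distribution on $S$. A game is $(G,\Pi,T,s_0)$ with team $\Pi\subseteq\Sigma$, absorbing target set $T$, initial state $s_0$, and $\Sigma\setminus\Pi=\{\mathsf O\}$ (opponent). Strategies map histories ending in $s$ to distributions over $\mathsf{Av}_p(s)$; a collective strategy is a tuple of strategies for the team players, who randomise independently (joint action probabilities are products of individual ones); a complete profile induces a probability measure on plays from $s_0$. Almost-sure problem: given a game, does there exist a collective strategy $\bar\sigma_\Pi$ such that for every opponent strategy, $T$ is reached with probability $1$? *)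

theory Defs
  imports "HOL-Analysis.Analysis"
begin

text \<open>Players are 0..m; the team is the set of players 0..<m and player m is the
 opponent O. States are 0..<ns, the action set of player p is {0..<acts!p},
 the available actions of p at s are the elements of av!p!s, and the transition
 function is a table of entries (s, action profile, distribution over states with
 rational probabilities). T is the target set and s0 the initial state.\<close>

datatype raw_game = RawGame
  (rg_ns: nat) (rg_m: nat) (rg_acts: "nat list") (rg_av: "nat list list list")
  (rg_delta: "(nat \<times> nat list \<times> rat list) list") (rg_T: "nat list") (rg_s0: nat)

definition av :: "raw_game \<Rightarrow> nat \<Rightarrow> nat \<Rightarrow> nat set" where
  "av g p s = set (rg_av g ! p ! s)"

definition profiles :: "raw_game \<Rightarrow> nat \<Rightarrow> nat list set" where
  "profiles g s = {a. length a = Suc (rg_m g) \<and> (\<forall>p<Suc (rg_m g). a ! p \<in> av g p s)}"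

definition dlt :: "raw_game \<Rightarrow> nat \<Rightarrow> nat list \<Rightarrow> nat \<Rightarrow> real" where
  "dlt g s a s' = (case find (\<lambda>(s1, a1, _). s1 = s \<and> a1 = a) (rg_delta g) of
      None \<Rightarrow> 0 | Some (_, _, d) \<Rightarrow> of_rat (d ! s'))"

definition wf_game :: "raw_game \<Rightarrow> bool" where
  "wf_game g \<longleftrightarrow>
     length (rg_acts g) = Suc (rg_m g) \<and> length (rg_av g) = Suc (rg_m g) \<and>
     (\<forall>p<Suc (rg_m g). length (rg_av g ! p) = rg_ns g \<and>
        (\<forall>s<rg_ns g. rg_av g ! p ! s \<noteq> [] \<and> set (rg_av g ! p ! s) \<subseteq> {..<rg_acts g ! p})) \<and>
     (\<forall>s<rg_ns g. \<forall>a\<in>profiles g s. \<exists>e\<in>set (rg_delta g). fst e = s \<and> fst (snd e) = a) \<and>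
     (\<forall>(s, a, d)\<in>set (rg_delta g). length d = rg_ns g \<and> (\<forall>q\<in>set d. q \<ge> 0) \<and> sum_list d = 1) \<and>
     set (rg_T g) \<subseteq> {..<rg_ns g} \<and> rg_s0 g < rg_ns g \<and>
     \<comment> \<open>T is absorbing\<close>
     (\<forall>s\<in>set (rg_T g). \<forall>a\<in>profiles g s. \<forall>s'<rg_ns g. s' \<notin> set (rg_T g) \<longrightarrow> dlt g s a s' = 0)"

definition is_strat :: "raw_game \<Rightarrow> nat \<Rightarrow> (nat list \<Rightarrow> nat \<Rightarrow> real) \<Rightarrow> bool" where
  "is_strat g p \<sigma> \<longleftrightarrow>
     (\<forall>h. h \<noteq> [] \<and> set h \<subseteq> {..<rg_ns g} \<longrightarrow>
        (\<forall>a. \<sigma> h a \<ge> 0) \<and> (\<forall>a. a \<notin> av g p (last h) \<longrightarrow> \<sigma> h a = 0) \<and>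
        (\<Sum>a\<in>av g p (last h). \<sigma> h a) = 1)"

fun reach_n :: "raw_game \<Rightarrow> (nat \<Rightarrow> nat list \<Rightarrow> nat \<Rightarrow> real) \<Rightarrow> (nat list \<Rightarrow> nat \<Rightarrow> real)
                 \<Rightarrow> nat \<Rightarrow> nat list \<Rightarrow> real" where
  "reach_n g \<sigma> \<tau> 0 h = (if last h \<in> set (rg_T g) then 1 else 0)"
| "reach_n g \<sigma> \<tau> (Suc n) h = (if last h \<in> set (rg_T g) then 1 else
     (\<Sum>a\<in>profiles g (last h). (\<Prod>p<rg_m g. \<sigma> p h (a ! p)) * \<tau> h (a ! rg_m g) *
        (\<Sum>s'<rg_ns g. dlt g (last h) a s' * reach_n g \<sigma> \<tau> n (h @ [s']))))"

text \<open>The probability of reaching T is the limit of the n-step reachability probabilities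
 (continuity of the induced measure on plays).\<close>

definition almost_sure :: "raw_game \<Rightarrow> bool" where
  "almost_sure g \<longleftrightarrow>
     (\<exists>\<sigma>. (\<forall>p<rg_m g. is_strat g p (\<sigma> p)) \<and>
        (\<forall>\<tau>. is_strat g (rg_m g) \<tau> \<longrightarrow>
           (\<lambda>n. reach_n g \<sigma> \<tau> n [rg_s0 g]) \<longlonglongrightarrow> 1))"

function ser_nat :: "nat \<Rightarrow> bool list" where
  "ser_nat n = (if n = 0 then [False] else True # odd n # ser_nat (n div 2))"
  by auto
termination by (relation "Wellfounded.measure id") auto

definition ser_int :: "int \<Rightarrow> bool list" where
  "ser_int i = (i < 0) # ser_nat (nat \<bar>i\<bar>)"

definition ser_rat :: "rat \<Rightarrow> bool list" where
  "ser_rat q = (case quotient_of q of (a, b) \<Rightarrow> ser_int a @ ser_nat (nat b))"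

definition ser_list :: "('a \<Rightarrow> bool list) \<Rightarrow> 'a list \<Rightarrow> bool list" where
  "ser_list f xs = concat (map (\<lambda>x. True # f x) xs) @ [False]"

definition ser_game :: "raw_game \<Rightarrow> bool list" where
  "ser_game g = ser_nat (rg_ns g) @ ser_nat (rg_m g) @ ser_list ser_nat (rg_acts g) @
     ser_list (ser_list (ser_list ser_nat)) (rg_av g) @
     ser_list (\<lambda>(s, a, d). ser_nat s @ ser_list ser_nat a @ ser_list ser_rat d) (rg_delta g) @
     ser_list ser_nat (rg_T g) @ ser_nat (rg_s0 g)"

definition almost_sure_lang :: "bool list set" where
  "almost_sure_lang = {ser_game g | g. wf_game g \<and> almost_sure g}"

datatype dir = Lft | Rgt | Stay

text \<open>Deterministic single-tape Turing machine with states 0..<tm_Q (0 start, 1 accept,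
 2 reject) and tape symbols 0..<tm_G (0 blank, 1 bit False, 2 bit True, 3 separator).\<close>

record tm =
  tm_Q :: nat
  tm_G :: nat
  tm_delta :: "nat \<Rightarrow> nat \<Rightarrow> nat \<times> nat \<times> dir"

definition wf_tm :: "tm \<Rightarrow> bool" where
  "wf_tm M \<longleftrightarrow> tm_Q M \<ge> 3 \<and> tm_G M \<ge> 4 \<and>
     (\<forall>q<tm_Q M. \<forall>x<tm_G M. fst (tm_delta M q x) < tm_Q M \<and> fst (snd (tm_delta M q x)) < tm_G M)"

definition shift :: "dir \<Rightarrow> int" where
  "shift d = (case d of Lft \<Rightarrow> -1 | Rgt \<Rightarrow> 1 | Stay \<Rightarrow> 0)"

definition tm_step :: "tm \<Rightarrow> nat \<times> (int \<Rightarrow> nat) \<times> int \<Rightarrow> nat \<times> (int \<Rightarrow> nat) \<times> int" where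
  "tm_step M c = (case c of (q, t, i) \<Rightarrow>
     if q = 1 \<or> q = 2 then (q, t, i)
     else (case tm_delta M q (t i) of (q', x', d) \<Rightarrow> (q', t(i := x'), i + shift d)))"

definition init_tape :: "nat list \<Rightarrow> int \<Rightarrow> nat" where
  "init_tape w i = (if 0 \<le> i \<and> i < int (length w) then w ! nat i else 0)"

definition accepts_within :: "tm \<Rightarrow> nat list \<Rightarrow> nat \<Rightarrow> bool" where
  "accepts_within M w n \<longleftrightarrow> fst ((tm_step M ^^ n) (0, init_tape w, 0)) = 1"

definition bit_sym :: "bool \<Rightarrow> nat" where
  "bit_sym b = (if b then 2 else 1)"

definition in_NP :: "bool list set \<Rightarrow> bool" where
  "in_NP L \<longleftrightarrow> (\<exists>M c k. wf_tm M \<and>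
     (\<forall>x. x \<in> L \<longleftrightarrow>
        (\<exists>y. length y \<le> c * (length x + 1) ^ k \<and>
           accepts_within M (map bit_sym x @ [3] @ map bit_sym y) (c * (length x + 1) ^ k))))"

end

theory Submission
  imports Defs "HOL-Library.Nat_Bijection"
begin

text \<open>A game is won almost surely iff there are a set W of states, supports D for the team and a rank r
  such that the actions in D never leave W and, against every opponent action, some of them decreases
  the rank with positive probability outside T. Given such a triple, the team plays uniformly on its
  supports, and 1 - \<eta>^(r + 1) is a Lyapunov function that makes the failure probability decay
  geometrically. Conversely, the supports of an almost surely winning strategy, collected over all
  histories that are still winning, admit an attractor to T whose layers are the rank.

  Membership in NP then follows as in Fagin's theorem. The triple, the positions reached by skipping
  list elements of the encoding, and the bits of the partial sums of the rational distributions form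
  a relation on numbers linear in the input length, and first-order formulas over these numbers check
  that the relation is right and that it witnesses a winning triple. A pebble machine evaluates a
  fixed first-order formula in polynomial time, and a Turing machine simulates it by storing the
  pebbles in its tape symbols.\<close>

section \<open>Pebble machines\<close>

text \<open>Winning almost surely depends only on which probabilities are positive, so the witness
  needs neither memory nor numerical strategies: the supports used after the many winning histories
  that end in a state can be replaced by one support per state. The harder half is that the language
  contains encodings of well-formed games only, so the check must also reject malformed words. Three
  conditions are not local at first sight: the table has an entry for every profile, each
  distribution sums to exactly 1, and each rational is written as \<open>quotient_of\<close> returns
  it. Numbers in the input may be exponential in its length, action names for example; they are
  compared bitwise at the positions where they are written, and quantifiers range only over
  positions and over numbers bounded by lengths of lists (states, players, indices, ranks). Since
  \<open>in_NP\<close> asks for a deterministic machine reading input and guess together, all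
  nondeterminism sits in the guessed relation, and the rest is a single fixed first-order
  formula.\<close>

datatype act = Inc | Dec | Sym nat | Same nat

datatype code = Prim nat act | Cond code code code | Loop code

abbreviation "Seq c d \<equiv> Cond c d d"

fun prim_res :: "nat list \<Rightarrow> nat \<Rightarrow> act \<Rightarrow> (nat \<Rightarrow> nat) \<Rightarrow> bool" where
  "prim_res w v Inc e = (Suc (e v) < length w)"
| "prim_res w v Dec e = (0 < e v)"
| "prim_res w v (Sym c) e = (w ! e v = c)"
| "prim_res w v (Same u) e = (e u = e v)"

fun prim_upd :: "nat list \<Rightarrow> nat \<Rightarrow> act \<Rightarrow> (nat \<Rightarrow> nat) \<Rightarrow> nat \<Rightarrow> nat" where
  "prim_upd w v Inc e = (if Suc (e v) < length w then e(v := Suc (e v)) else e)"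
| "prim_upd w v Dec e = (if 0 < e v then e(v := e v - 1) else e)"
| "prim_upd w v (Sym c) e = e"
| "prim_upd w v (Same u) e = e"

text \<open>The last argument counts primitive instructions only, since compiled branching costs no
  machine steps. A \<open>Loop\<close> can end only with answer False, so loops report their outcome
  through pebble positions.\<close>

inductive ev :: "nat list \<Rightarrow> code \<Rightarrow> (nat \<Rightarrow> nat) \<Rightarrow> bool \<Rightarrow> (nat \<Rightarrow> nat) \<Rightarrow> nat \<Rightarrow> bool" for w where
  ev_Prim: "ev w (Prim v a) e (prim_res w v a e) (prim_upd w v a e) 1"
| ev_CondT: "ev w c e True e1 n1 \<Longrightarrow> ev w c1 e1 b e2 n2 \<Longrightarrow> ev w (Cond c c1 c2) e b e2 (n1 + n2)"
| ev_CondF: "ev w c e False e1 n1 \<Longrightarrow> ev w c2 e1 b e2 n2 \<Longrightarrow> ev w (Cond c c1 c2) e b e2 (n1 + n2)"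
| ev_LoopT: "ev w c e True e1 n1 \<Longrightarrow> ev w (Loop c) e1 b e2 n2 \<Longrightarrow> ev w (Loop c) e b e2 (n1 + n2)"
| ev_LoopF: "ev w c e False e1 n1 \<Longrightarrow> ev w (Loop c) e False e1 n1"

text \<open>A tape cell packs the input symbol with the set of pebbles lying on it; a pebble-free cell
  is the input symbol itself, and only cells outside the input are 0.\<close>

definition cell :: "nat \<Rightarrow> nat set \<Rightarrow> nat" where
  "cell s A = s + 4 * set_encode A"

definition csym :: "nat \<Rightarrow> nat" where "csym z = z mod 4"
definition cset :: "nat \<Rightarrow> nat set" where "cset z = set_decode (z div 4)"

lemma csym_cell [simp]: "s < 4 \<Longrightarrow> csym (cell s A) = s"
  by (simp add: csym_def cell_def)

lemma cset_cell [simp]: "s < 4 \<Longrightarrow> finite A \<Longrightarrow> cset (cell s A) = A"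
  by (simp add: cset_def cell_def)

lemma cell_eq_0 [simp]: "0 < s \<Longrightarrow> cell s A \<noteq> 0"
  by (simp add: cell_def)

lemma set_encode_less: "A \<subseteq> {..<K} \<Longrightarrow> set_encode A < 2 ^ K"
proof -
  assume A: "A \<subseteq> {..<K}"
  have "set_encode A \<le> set_encode {..<K}"
    using A by (simp add: set_encode_def sum_mono2)
  also have "\<dots> = 2 ^ K - 1"
    by (simp add: set_encode_def mask_eq_sum_exp_nat lessThan_def)
  finally show ?thesis
    by (metis One_nat_def diff_less less_le_trans not_le pos2 zero_less_one zero_less_power
        linorder_not_less order.strict_trans1)
qed

lemma cell_less: "s < 4 \<Longrightarrow> A \<subseteq> {..<K} \<Longrightarrow> cell s A < 4 * 2 ^ K"
  using set_encode_less[of A K] by (simp add: cell_def)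

text \<open>Well-formedness of a machine quantifies over all symbols of its alphabet, including
  those that never occur on a tape, so the decoded pebble set must be bounded for every
  \<open>z\<close>.\<close>

lemma cset_subset: "z < 4 * 2 ^ K \<Longrightarrow> cset z \<subseteq> {..<K}"
proof
  fix v assume z: "z < 4 * 2 ^ K" and v: "v \<in> cset z"
  have "z div 4 < 2 ^ K" using z by (simp add: less_mult_imp_div_less mult.commute)
  moreover have "2 ^ v \<le> z div 4"
  proof -
    have "odd (z div 4 div 2 ^ v)" using v by (simp add: cset_def set_decode_def)
    then have "z div 4 div 2 ^ v \<noteq> 0" by (metis dvd_0_right)
    then show ?thesis by (meson div_less not_le)
  qed
  ultimately have "(2::nat) ^ v < 2 ^ K" by linarith
  then show "v \<in> {..<K}" by simp
qed

lemma csym_less [simp]: "csym z < 4"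
  by (simp add: csym_def)

definition tape :: "nat \<Rightarrow> nat list \<Rightarrow> (nat \<Rightarrow> nat) \<Rightarrow> int \<Rightarrow> nat" where
  "tape K w e i = (if 0 \<le> i \<and> i < int (length w) then cell (w ! nat i) {v. v < K \<and> e v = nat i} else 0)"

text \<open>The five rows implementing one pebble instruction: search, moving pebble arrives, return home
  with answer True, return home with answer False, and putting a pebble bounce that hit a border.\<close>

fun search_act :: "nat \<Rightarrow> nat \<Rightarrow> act \<Rightarrow> nat \<Rightarrow> nat \<times> nat \<times> dir" where
  "search_act b v Inc z = (b + 1, cell (csym z) (cset z - {v}), Rgt)"
| "search_act b v Dec z = (b + 1, cell (csym z) (cset z - {v}), Lft)"
| "search_act b v (Sym c) z = (if csym z = c then b + 2 else b + 3, z, Stay)"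
| "search_act b v (Same u) z = (if u \<in> cset z then b + 2 else b + 3, z, Stay)"

definition bounce :: "act \<Rightarrow> dir" where "bounce a = (if a = Inc then Lft else Rgt)"

definition prim_rows :: "nat \<Rightarrow> act \<Rightarrow> nat \<Rightarrow> nat \<Rightarrow> nat \<Rightarrow> (nat \<Rightarrow> nat \<times> nat \<times> dir) list" where
  "prim_rows v a b t f =
    [\<lambda>z. if v \<in> cset z then search_act b v a z else (b, z, Rgt),
     \<lambda>z. if z = 0 then (b + 4, z, bounce a) else (b + 2, cell (csym z) (insert v (cset z)), Stay),
     \<lambda>z. if z = 0 then (t, z, Rgt) else (b + 2, z, Lft),
     \<lambda>z. if z = 0 then (f, z, Rgt) else (b + 3, z, Lft),
     \<lambda>z. (b + 3, cell (csym z) (insert v (cset z)), Stay)]"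

fun clen :: "code \<Rightarrow> nat" where
  "clen (Prim v a) = 5"
| "clen (Cond c d e) = clen c + clen d + clen e"
| "clen (Loop c) = clen c"

text \<open>Continuation style: the block starting at state \<open>b\<close> leaves to state
  \<open>t\<close> or \<open>f\<close> according to its answer, so branching is merely a choice of
  exits. A loop uses its own start as the exit for True.\<close>

fun comp :: "code \<Rightarrow> nat \<Rightarrow> nat \<Rightarrow> nat \<Rightarrow> (nat \<Rightarrow> nat \<times> nat \<times> dir) list" where
  "comp (Prim v a) b t f = prim_rows v a b t f"
| "comp (Cond c d e) b t f =
     comp c b (b + clen c) (b + clen c + clen d) @ comp d (b + clen c) t f @ comp e (b + clen c + clen d) t f"
| "comp (Loop c) b t f = comp c b b f"

fun act_pebs :: "act \<Rightarrow> nat set" where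
  "act_pebs (Same u) = {u}" | "act_pebs _ = {}"

fun pebs :: "code \<Rightarrow> nat set" where
  "pebs (Prim v a) = insert v (act_pebs a)"
| "pebs (Cond c d e) = pebs c \<union> pebs d \<union> pebs e"
| "pebs (Loop c) = pebs c"

lemma finite_pebs [simp]: "finite (pebs c)"
proof -
  have "finite (act_pebs a)" for a by (cases a) auto
  then show ?thesis by (induction c) auto
qed

lemma clen_pos: "0 < clen c"
  by (induction c) auto

lemma length_comp [simp]: "length (comp c b t f) = clen c"
  by (induction c arbitrary: b t f) (auto simp: prim_rows_def)

lemma comp_bounds:
  assumes "pebs c \<subseteq> {..<K}" "b + clen c \<le> Q" "t < Q" "f < Q" "r \<in> set (comp c b t f)" "z < 4 * 2 ^ K"
  shows "fst (r z) < Q \<and> fst (snd (r z)) < 4 * 2 ^ K"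
  using assms
proof (induction c arbitrary: b t f)
  case (Prim v a)
  have *: "cell (csym z) (insert v (cset z)) < 4 * 2 ^ K" "cell (csym z) (cset z - {v}) < 4 * 2 ^ K"
    using Prim.prems cset_subset[of z K] by (auto intro!: cell_less)
  show ?case using Prim.prems * by (cases a) (auto simp: prim_rows_def)
next
  case (Cond c d e)
  note pos = clen_pos[of c] clen_pos[of d] clen_pos[of e]
  consider "r \<in> set (comp c b (b + clen c) (b + clen c + clen d))" | "r \<in> set (comp d (b + clen c) t f)"
    | "r \<in> set (comp e (b + clen c + clen d) t f)" using Cond.prems(5) by auto
  then show ?case
  proof cases
    case 1
    show ?thesis by (rule Cond.IH(1)[OF _ _ _ _ 1]) (use Cond.prems pos in auto)
  next
    case 2
    show ?thesis by (rule Cond.IH(2)[OF _ _ _ _ 2]) (use Cond.prems pos in auto)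
  next
    case 3
    show ?thesis by (rule Cond.IH(3)[OF _ _ _ _ 3]) (use Cond.prems pos in auto)
  qed
next
  case (Loop c)
  have "b < Q" using Loop.prems clen_pos[of c] by simp
  then show ?case using Loop by auto
qed

text \<open>The bound on \<open>b\<close> keeps blocks away from the start state 0 and from states 1
  and 2, in which \<open>tm_step\<close> stands still.\<close>

definition installed :: "tm \<Rightarrow> nat \<Rightarrow> (nat \<Rightarrow> nat \<times> nat \<times> dir) list \<Rightarrow> bool" where
  "installed M b rs \<longleftrightarrow> 3 \<le> b \<and> (\<forall>i<length rs. \<forall>z. tm_delta M (b + i) z = (rs ! i) z)"

lemma installed_appendD1: "installed M b (rs @ qs) \<Longrightarrow> installed M b rs"
  by (simp add: installed_def nth_append)

lemma installed_appendD2: "installed M b (rs @ qs) \<Longrightarrow> installed M (b + length rs) qs"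
  unfolding installed_def
proof (intro conjI allI impI)
  fix i z
  assume *: "3 \<le> b \<and> (\<forall>i<length (rs @ qs). \<forall>z. tm_delta M (b + i) z = ((rs @ qs) ! i) z)"
  show "3 \<le> b + length rs" using * by simp
  assume "i < length qs"
  then show "tm_delta M (b + length rs + i) z = (qs ! i) z"
    using *[THEN conjunct2, rule_format, of "length rs + i" z] by (simp add: nth_append add.assoc)
qed

section \<open>Runs of the compiled machine\<close>

definition steps_to :: "tm \<Rightarrow> nat \<times> (int \<Rightarrow> nat) \<times> int \<Rightarrow> nat \<Rightarrow> nat \<times> (int \<Rightarrow> nat) \<times> int \<Rightarrow> bool" where
  "steps_to M C n C' \<longleftrightarrow> (\<exists>m\<le>n. (tm_step M ^^ m) C = C')"

lemma steps_to_refl: "steps_to M C n C"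
  unfolding steps_to_def by (rule exI[of _ 0]) simp

lemma steps_to_trans:
  "steps_to M C m C' \<Longrightarrow> steps_to M C' n C'' \<Longrightarrow> m + n \<le> k \<Longrightarrow> steps_to M C k C''"
  unfolding steps_to_def
proof clarify
  fix i j assume "i \<le> m" "j \<le> n" "m + n \<le> k"
  then show "\<exists>l\<le>k. (tm_step M ^^ l) C = (tm_step M ^^ j) ((tm_step M ^^ i) C)"
    by (intro exI[of _ "j + i"]) (simp add: funpow_add)
qed

lemma steps_to_step: "tm_step M C = C' \<Longrightarrow> steps_to M C' n C'' \<Longrightarrow> steps_to M C (Suc n) C''"
  by (rule steps_to_trans[of _ _ 1 C']) (auto simp: steps_to_def intro!: exI[of _ 1])

lemma steps_to_mono: "steps_to M C m C' \<Longrightarrow> m \<le> n \<Longrightarrow> steps_to M C n C'"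
  unfolding steps_to_def using order_trans by blast

lemma tm_step_state:
  "3 \<le> q \<Longrightarrow> tm_step M (q, t, i) = (fst (tm_delta M q (t i)), t(i := fst (snd (tm_delta M q (t i)))),
     i + shift (snd (snd (tm_delta M q (t i)))))"
  by (simp add: tm_step_def split: prod.split)

text \<open>The blank at position -1 marks the left border: \<open>p + 1\<close> steps to the left
  reach it, and one step to the right leads back to cell 0.\<close>

lemma return_home:
  assumes d: "\<And>z. tm_delta M q z = (if z = 0 then (t, z, Rgt) else (q, z, Lft))" and q: "3 \<le> q"
    and T: "T (-1) = 0" "\<And>i. 0 \<le> i \<Longrightarrow> i \<le> int p \<Longrightarrow> T i \<noteq> 0"
  shows "steps_to M (q, T, int p) (p + 2) (t, T, 0)"
  using T(2)
proof (induction p)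
  case 0
  have "tm_step M (q, T, 0) = (q, T, -1)"
    using q 0 by (auto simp: tm_step_state d shift_def)
  moreover have "tm_step M (q, T, -1) = (t, T, 0)"
    using q T(1) by (auto simp: tm_step_state d shift_def)
  ultimately show ?case 
    by (auto intro!: steps_to_step steps_to_refl simp: numeral_2_eq_2)
next
  case (Suc p)
  have "tm_step M (q, T, int (Suc p)) = (q, T, int p)"
    using q Suc.prems[of "int (Suc p)"] by (auto simp: tm_step_state d shift_def)
  moreover have "steps_to M (q, T, int p) (p + 2) (t, T, 0)"
    by (rule Suc.IH) (rule Suc.prems, auto)
  ultimately show ?case by (simp add: steps_to_step)
qed

lemma find_pebble:
  assumes d: "\<And>z. v \<notin> cset z \<Longrightarrow> tm_delta M q z = (q, z, Rgt)" and q: "3 \<le> q"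
    and T: "\<And>i. i < p \<Longrightarrow> v \<notin> cset (T (int i))"
  shows "steps_to M (q, T, 0) p (q, T, int p)"
proof -
  have "k \<le> p \<Longrightarrow> steps_to M (q, T, int (p - k)) k (q, T, int p)" for k
  proof (induction k)
    case 0 show ?case by (simp add: steps_to_refl)
  next
    case (Suc k)
    have "tm_step M (q, T, int (p - Suc k)) = (q, T, int (p - k))"
      using q Suc.prems T[of "p - Suc k"] 
      by (auto simp: tm_step_state d shift_def)
    then show ?case using Suc by (simp add: steps_to_step)
  qed
  from this[of p] show ?thesis by simp
qed

definition good_word :: "nat list \<Rightarrow> bool" where
  "good_word w \<longleftrightarrow> w \<noteq> [] \<and> (\<forall>s\<in>set w. 0 < s \<and> s < 4)"

definition good_env :: "nat list \<Rightarrow> (nat \<Rightarrow> nat) \<Rightarrow> bool" where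
  "good_env w e \<longleftrightarrow> (\<forall>v. e v < length w)"

lemma tape_at:
  assumes "good_word w" "p < length w"
  shows "tape K w e (int p) = cell (w ! p) {v. v < K \<and> e v = p}"
    "csym (tape K w e (int p)) = w ! p" "cset (tape K w e (int p)) = {v. v < K \<and> e v = p}"
    "tape K w e (int p) \<noteq> 0"
  using assms by (auto simp: tape_def good_word_def)

lemma tape_outside: "tape K w e (-1) = 0" "tape K w e (int (length w)) = 0"
  by (auto simp: tape_def)

lemma tape_move:
  assumes "good_word w" "p < length w" "p' < length w" "e v = p" "p \<noteq> p'" "v < K"
  shows "(tape K w e)(int p := cell (w ! p) ({u. u < K \<and> e u = p} - {v}),
      int p' := cell (w ! p') (insert v {u. u < K \<and> e u = p'})) = tape K w (e(v := p'))"
proof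
  fix i
  have 1: "{u. u < K \<and> e u = p} - {v} = {u. u < K \<and> (e(v := p')) u = p}"
    and 2: "insert v {u. u < K \<and> e u = p'} = {u. u < K \<and> (e(v := p')) u = p'}"
    using assms by auto
  consider "i = int p" | "i = int p'" | "i \<noteq> int p" "i \<noteq> int p'" by blast
  then show "((tape K w e)(int p := cell (w ! p) ({u. u < K \<and> e u = p} - {v}),
      int p' := cell (w ! p') (insert v {u. u < K \<and> e u = p'}))) i = tape K w (e(v := p')) i"
  proof cases
    case 1
    then show ?thesis 
      using assms(5) \<open>_ - {v} = _\<close> tape_at(1)[OF assms(1,2), of K "e(v := p')"] by simp
  next
    case 2
    then show ?thesis 
      using \<open>insert v _ = _\<close> tape_at(1)[OF assms(1,3), of K "e(v := p')"] by simp
  next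
    case 3
    then have "0 \<le> i \<Longrightarrow> {u. u < K \<and> e u = nat i} = {u. u < K \<and> (e(v := p')) u = nat i}"
      using assms by auto
    then show ?thesis using 3 by (simp add: tape_def)
  qed
qed

lemma tape_put_back:
  assumes "good_word w" "p < length w" "e v = p" "v < K"
  shows "(tape K w e)(int p := cell (w ! p) (insert v ({u. u < K \<and> e u = p} - {v}))) = tape K w e"
  using assms by (auto simp: tape_at(1)[symmetric] insert_absorb)

text \<open>Searching takes less than \<open>length w\<close> steps, the way home at most
  \<open>length w + 1\<close>, and lifting, placing and bouncing at most three more.\<close>

lemma prim_correct:
  assumes M: "installed M b (prim_rows v a b t f)"
    and w: "good_word w" and e: "good_env w e" and K: "v < K" "act_pebs a \<subseteq> {..<K}"
  shows "steps_to M (b, tape K w e, 0) (2 * length w + 5)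
           (if prim_res w v a e then t else f, tape K w (prim_upd w v a e), 0)"
proof -
  define p where "p = e v"
  let ?T = "tape K w e" and ?N = "length w"
  let ?A = "{u. u < K \<and> e u = p}"
  have p: "p < ?N" using e by (simp add: p_def good_env_def)
  have b: "3 \<le> b" using M by (simp add: installed_def)
  note row = M[unfolded installed_def prim_rows_def, THEN conjunct2, rule_format]
  have d0: "tm_delta M b z = (if v \<in> cset z then search_act b v a z else (b, z, Rgt))" for z
    using row[of 0 z] by simp
  have d1: "tm_delta M (Suc b) z = (if z = 0 then (b + 4, z, bounce a)
      else (b + 2, cell (csym z) (insert v (cset z)), Stay))" for z
    using row[of 1 z] by simp
  have d2: "tm_delta M (b + 2) z = (if z = 0 then (t, z, Rgt) else (b + 2, z, Lft))" for z
    using row[of 2 z] by simp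
  have d3: "tm_delta M (b + 3) z = (if z = 0 then (f, z, Rgt) else (b + 3, z, Lft))" for z
    using row[of 3 z] by simp
  have d4: "tm_delta M (b + 4) z = (b + 3, cell (csym z) (insert v (cset z)), Stay)" for z
    using row[of 4 z] by simp
  have A: "?A \<noteq> {}" "v \<in> ?A" using K by (auto simp: p_def)
  note at = tape_at[OF w p, of K e]
  have find: "steps_to M (b, ?T, 0) p (b, ?T, int p)"
  proof (rule find_pebble[where v = v])
    fix i assume "i < p"
    then show "v \<notin> cset (?T (int i))"
      using p tape_at(3)[OF w, of i K e] by (simp add: p_def)
  qed (use b d0 in auto)
  have home: "steps_to M (if r then b + 2 else b + 3, tape K w e', int q) (q + 2) (if r then t else f, tape K w e', 0)"
    if "q < ?N" for r e' q
  proof (cases r)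
    case True
    show ?thesis unfolding if_P[OF True]
      by (rule return_home[OF d2]) (use b w that in \<open>auto simp: tape_def good_word_def\<close>)
  next
    case False
    show ?thesis unfolding if_not_P[OF False]
      by (rule return_home[OF d3]) (use b w that in \<open>auto simp: tape_def good_word_def\<close>)
  qed
  have dob: "tm_delta M b (?T (int p)) = search_act b v a (?T (int p))"
    using at A by (simp add: d0)
  have wp: "0 < w ! p" "w ! p < 4" using w p by (auto simp: good_word_def)
  have finA: "finite ?A" by simp
  have test: "steps_to M (b, ?T, 0) (2 * ?N + 5) (if r then t else f, ?T, 0)"
    if "tm_step M (b, ?T, int p) = (if r then b + 2 else b + 3, ?T, int p)" for r
    by (rule steps_to_trans[OF find steps_to_step[OF that home[OF p]]]) (use p in simp)
  have lift: "tm_step M (b, ?T, int p) = (b + 1, ?T(int p := cell (w ! p) (?A - {v})), int p + shift dr)"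
    if "a = Inc \<and> dr = Rgt \<or> a = Dec \<and> dr = Lft" for dr
    using that b dob at(2,3) by (elim disjE) (simp_all add: tm_step_state)
  have move: "steps_to M (b, ?T, 0) (2 * ?N + 5) (t, tape K w (e(v := p')), 0)"
    if "a = Inc \<and> dr = Rgt \<or> a = Dec \<and> dr = Lft" "int p + shift dr = int p'" "p' < ?N" "p' \<noteq> p" for dr p'
  proof -
    let ?T1 = "?T(int p := cell (w ! p) (?A - {v}))"
    have T1: "?T1 (int p') = ?T (int p')" using that by simp
    have "tm_step M (b + 1, ?T1, int p') = (b + 2, ?T1(int p' := cell (w ! p') (insert v {u. u < K \<and> e u = p'})), int p')"
      using b that(4) tape_at[OF w that(3), of K e] by (simp add: tm_step_state d1 shift_def)
    also have "\<dots> = (b + 2, tape K w (e(v := p')), int p')"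
      using tape_move[where e = e and v = v, OF w p that(3) p_def[symmetric] that(4)[symmetric] K(1)] by simp
    finally have s2: "tm_step M (b + 1, ?T1, int p') = (b + 2, tape K w (e(v := p')), int p')" .
    show ?thesis
      using steps_to_trans[OF find steps_to_step[OF lift[OF that(1), unfolded that(2)] steps_to_step[OF s2 home[OF that(3), where r = True, unfolded if_True]]]]
        p that(3) by simp
  qed
  \<comment> \<open>The pebble is lifted before the neighbouring cell has been inspected. A blank
    there reveals the border, and the pebble is put back on its old cell, which restores the tape
    exactly.\<close>
  have stuck: "steps_to M (b, ?T, 0) (2 * ?N + 5) (f, ?T, 0)"
    if "a = Inc \<and> dr = Rgt \<or> a = Dec \<and> dr = Lft" "?T (int p + shift dr) = 0" for dr
  proof -
    let ?T1 = "?T(int p := cell (w ! p) (?A - {v}))"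
    have ne: "int p + shift dr \<noteq> int p" using that(1) by (auto simp: shift_def)
    have s2: "tm_step M (b + 1, ?T1, int p + shift dr) = (b + 4, ?T1, int p)"
      using that b ne by (auto simp: tm_step_state d1 bounce_def shift_def)
    have s3: "tm_step M (b + 4, ?T1, int p) = (b + 3, ?T, int p)"
      using b wp finA tape_put_back[where e = e and v = v, OF w p p_def[symmetric] K(1)]
      by (simp add: tm_step_state d4 shift_def)
    show ?thesis
      using steps_to_trans[OF find steps_to_step[OF lift[OF that(1)] steps_to_step[OF s2 steps_to_step[OF s3 home[OF p, where r = False, unfolded if_False]]]]]
        p by simp
  qed
  show ?thesis
  proof (cases a)
    case Inc
    show ?thesis
    proof (cases "Suc p < ?N")
      case True
      with move[of Rgt "Suc p"] Inc show ?thesis by (simp add: shift_def p_def)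
    next
      case False
      then have "int p + shift Rgt = int ?N" using p by (simp add: shift_def)
      with False stuck[of Rgt] Inc show ?thesis by (simp add: p_def tape_outside)
    qed
  next
    case Dec
    show ?thesis
    proof (cases "0 < p")
      case True
      with move[of Lft "p - 1"] Dec p show ?thesis by (simp add: shift_def p_def)
    next
      case False
      then have "int p + shift Lft = -1" by (simp add: shift_def)
      with False stuck[of Lft] Dec show ?thesis by (simp add: p_def tape_outside)
    qed
  next
    case (Sym c)
    then show ?thesis
      using test[of "w ! p = c"] at(2,3) b dob by (simp add: tm_step_state shift_def p_def)
  next
    case (Same u)
    then show ?thesis
      using test[of "e u = e v"] at(2,3) b dob K by (simp add: tm_step_state shift_def p_def)
  qed
qed

lemma ev_good_env: "ev w c e b e' n \<Longrightarrow> good_env w e \<Longrightarrow> good_env w e'"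
proof (induction rule: ev.induct)
  case (ev_Prim v a e)
  then show ?case by (cases a) (auto simp: good_env_def intro: less_imp_diff_less)
qed auto

text \<open>Induction over the evaluation rather than over the code, because \<open>ev_LoopT\<close>
  re-enters the same block. Start and exits are generalised since every sub-block receives its
  own.\<close>

theorem comp_correct:
  assumes "ev w c e r e' n" "installed M b (comp c b t f)" "good_word w" "good_env w e" "pebs c \<subseteq> {..<K}"
  shows "steps_to M (b, tape K w e, 0) (n * (2 * length w + 5)) (if r then t else f, tape K w e', 0)"
  using assms
proof (induction arbitrary: b t f rule: ev.induct)
  case (ev_Prim v a e)
  then show ?case using prim_correct[of M b v a t f w e K] by simp
next
  case (ev_CondT c e e1 n1 c1 r e2 n2 c2)
  have i: "installed M b (comp c b (b + clen c) (b + clen c + clen c1))" "installed M (b + clen c) (comp c1 (b + clen c) t f)"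
    using ev_CondT.prems(1) installed_appendD1[of M b "comp c b (b + clen c) (b + clen c + clen c1)"]
      installed_appendD2[of M b "comp c b (b + clen c) (b + clen c + clen c1)", THEN installed_appendD1] by simp_all
  show ?case
    using steps_to_trans[OF ev_CondT.IH(1)[OF i(1), unfolded if_True] ev_CondT.IH(2)[OF i(2)], of "(n1 + n2) * (2 * length w + 5)"]
      ev_CondT.prems ev_good_env[OF ev_CondT.hyps(1)] by (simp add: algebra_simps)
next
  case (ev_CondF c e e1 n1 c2 r e2 n2 c1)
  have i: "installed M b (comp c b (b + clen c) (b + clen c + clen c1))" 
     "installed M (b + clen c + clen c1) (comp c2 (b + clen c + clen c1) t f)"
    using ev_CondF.prems(1) installed_appendD1[of M b "comp c b (b + clen c) (b + clen c + clen c1)"]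
      installed_appendD2[of M b "comp c b (b + clen c) (b + clen c + clen c1) @ comp c1 (b + clen c) t f"]
    by (simp_all add: add.assoc)
  show ?case
    using steps_to_trans[OF ev_CondF.IH(1)[OF i(1), unfolded if_False] ev_CondF.IH(2)[OF i(2)], of "(n1 + n2) * (2 * length w + 5)"]
      ev_CondF.prems ev_good_env[OF ev_CondF.hyps(1)] by (simp add: algebra_simps)
next
  case (ev_LoopT c e e1 n1 r e2 n2)
  have i: "installed M b (comp c b b f)" using ev_LoopT.prems(1) by simp
  show ?case
    using steps_to_trans[OF ev_LoopT.IH(1)[OF i, unfolded if_True] ev_LoopT.IH(2)[OF ev_LoopT.prems(1)], of "(n1 + n2) * (2 * length w + 5)"]
      ev_LoopT.prems ev_good_env[OF ev_LoopT.hyps(1)] by (simp add: algebra_simps)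
next
  case (ev_LoopF c e e1 n1)
  then show ?case using ev_LoopF.IH[of b b f] by simp
qed

text \<open>State 0 drops all pebbles on the first cell; the code starts at state 3 and exits to 1 or 2.\<close>

definition code_tm :: "nat \<Rightarrow> code \<Rightarrow> tm" where
  "code_tm K c = \<lparr>tm_Q = 3 + clen c, tm_G = 4 * 2 ^ K, tm_delta = (\<lambda>q z.
     if q = 0 then (3, cell (csym z) {..<K}, Stay)
     else if q < 3 then (q, z, Stay) else (comp c 3 1 2 ! (q - 3)) z)\<rparr>"

lemma wf_code_tm:
  assumes "pebs c \<subseteq> {..<K}" shows "wf_tm (code_tm K c)"
  unfolding wf_tm_def
proof (intro conjI allI impI)
  show "3 \<le> tm_Q (code_tm K c)" "4 \<le> tm_G (code_tm K c)" by (simp_all add: code_tm_def)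
  fix q z assume q: "q < tm_Q (code_tm K c)" and z: "z < tm_G (code_tm K c)"
  have *: "fst (r z) < 3 + clen c \<and> fst (snd (r z)) < 4 * 2 ^ K" if "r \<in> set (comp c 3 1 2)" for r
    by (rule comp_bounds[OF assms _ _ _ that]) (use z in \<open>auto simp: code_tm_def\<close>)
  have "cell (csym z) {..<K} < 4 * 2 ^ K" by (rule cell_less) auto
  with clen_pos[of c] have "fst (tm_delta (code_tm K c) q z) < 3 + clen c \<and> fst (snd (tm_delta (code_tm K c) q z)) < 4 * 2 ^ K"
    using q z * by (auto simp: code_tm_def)
  then show "fst (tm_delta (code_tm K c) q z) < tm_Q (code_tm K c)"
    "fst (snd (tm_delta (code_tm K c) q z)) < tm_G (code_tm K c)"
    by (simp_all add: code_tm_def)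
qed

text \<open>Both halting states are fixed points of \<open>tm_step\<close>, so a run that halts
  early still shows its answer after exactly \<open>m\<close> steps; this gives an equivalence, not
  just an implication.\<close>

theorem code_tm_accepts:
  assumes "ev w c (\<lambda>_. 0) r e' n" "good_word w" "pebs c \<subseteq> {..<K}" "1 + n * (2 * length w + 5) \<le> m"
  shows "accepts_within (code_tm K c) w m \<longleftrightarrow> r"
proof -
  let ?M = "code_tm K c"
  have len: "0 < length w" using assms(2) by (simp add: good_word_def)
  have "steps_to ?M (3, tape K w (\<lambda>_. 0), 0) (n * (2 * length w + 5)) (if r then 1 else 2, tape K w e', 0)"
    by (rule comp_correct) (use assms len in \<open>auto simp: installed_def code_tm_def good_env_def\<close>)
  moreover have "tm_step ?M (0, init_tape w, 0) = (3, tape K w (\<lambda>_. 0), 0)"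
  proof -
    have "w ! 0 < 4" using assms(2) len by (auto simp: good_word_def)
    then have "csym (w ! 0) = w ! 0" by (simp add: csym_def)
    moreover have "cell s {} = s" for s by (simp add: cell_def)
    ultimately show ?thesis
      using len by (auto simp: tm_step_def code_tm_def shift_def init_tape_def tape_def lessThan_def fun_eq_iff)
  qed
  ultimately have "steps_to ?M (0, init_tape w, 0) m (if r then 1 else 2, tape K w e', 0)"
    using steps_to_mono[OF steps_to_step] assms(4) by simp
  then obtain l where l: "l \<le> m" "(tm_step ?M ^^ l) (0, init_tape w, 0) = (if r then 1 else 2, tape K w e', 0)"
    by (auto simp: steps_to_def)
  have "(tm_step ?M ^^ k) (if r then 1 else 2, T, i) = (if r then 1 else 2, T, i)" for k T i
    by (induction k) (auto simp: tm_step_def)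
  then have "(tm_step ?M ^^ ((m - l) + l)) (0, init_tape w, 0) = (if r then 1 else 2, tape K w e', 0)"
    unfolding funpow_add using l by simp
  then show ?thesis using l(1) by (simp add: accepts_within_def)
qed

section \<open>First-order formulas on words\<close>

definition evb :: "nat list \<Rightarrow> code \<Rightarrow> (nat \<Rightarrow> nat) \<Rightarrow> bool \<Rightarrow> (nat \<Rightarrow> nat) \<Rightarrow> nat \<Rightarrow> bool" where
  "evb w c e b e' n \<longleftrightarrow> (\<exists>m\<le>n. ev w c e b e' m)"

lemma evb_mono: "evb w c e b e' m \<Longrightarrow> m \<le> n \<Longrightarrow> evb w c e b e' n"
  unfolding evb_def using order_trans by blast

lemma evb_Prim: "prim_res w v a e = b \<Longrightarrow> prim_upd w v a e = e' \<Longrightarrow> 1 \<le> n \<Longrightarrow> evb w (Prim v a) e b e' n"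
  unfolding evb_def using ev_Prim[of w v a e] by blast

lemma evb_Cond:
  "evb w c e r e1 n1 \<Longrightarrow> evb w (if r then c1 else c2) e1 b e2 n2 \<Longrightarrow> n1 + n2 \<le> n \<Longrightarrow> evb w (Cond c c1 c2) e b e2 n"
proof -
  assume "evb w c e r e1 n1" "evb w (if r then c1 else c2) e1 b e2 n2" and n: "n1 + n2 \<le> n"
  then obtain m1 m2 where *: "m1 \<le> n1" "m2 \<le> n2" "ev w c e r e1 m1" "ev w (if r then c1 else c2) e1 b e2 m2"
    unfolding evb_def by blast
  then have "ev w (Cond c c1 c2) e b e2 (m1 + m2)" by (cases r) (auto intro: ev_CondT ev_CondF)
  moreover have "m1 + m2 \<le> n" using * n by simp
  ultimately show ?thesis unfolding evb_def by blast
qed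

lemma evb_CondT:
  "evb w c e True e1 n1 \<Longrightarrow> evb w c1 e1 b e2 n2 \<Longrightarrow> n1 + n2 \<le> n \<Longrightarrow> evb w (Cond c c1 c2) e b e2 n"
  by (rule evb_Cond[where r = True]) auto

lemma evb_CondF:
  "evb w c e False e1 n1 \<Longrightarrow> evb w c2 e1 b e2 n2 \<Longrightarrow> n1 + n2 \<le> n \<Longrightarrow> evb w (Cond c c1 c2) e b e2 n"
  by (rule evb_Cond[where r = False]) auto

lemma evb_Seq:
  "evb w c e r e1 n1 \<Longrightarrow> evb w d e1 b e2 n2 \<Longrightarrow> n1 + n2 \<le> n \<Longrightarrow> evb w (Seq c d) e b e2 n"
  by (rule evb_Cond[where r = r]) auto

lemma evb_LoopT:
  "evb w c e True e1 n1 \<Longrightarrow> evb w (Loop c) e1 b e2 n2 \<Longrightarrow> n1 + n2 \<le> n \<Longrightarrow> evb w (Loop c) e b e2 n"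
  unfolding evb_def by (meson add_mono ev_LoopT order_trans)

lemma evb_LoopF: "evb w c e False e1 n1 \<Longrightarrow> evb w (Loop c) e False e1 n1"
  unfolding evb_def using ev_LoopF by blast

text \<open>Constant answers that move nothing: a pebble shares its cell with itself, and 0 is never
  the symbol of an input cell.\<close>

definition "ret_True = Prim 0 (Same 0)"
definition "ret_False = Prim 0 (Sym 0)"
definition "reset v = Loop (Prim v Dec)"
definition "walk v u = Loop (Cond (Prim u (Same v)) ret_False (Prim v Inc))"
text \<open>Pebble \<open>y\<close> moves before the counter \<open>s\<close>, so that both have
  made the same number of moves when \<open>y\<close> meets the end of the word. Overflow is then
  visible as \<open>s\<close> stopping short of \<open>a\<close>.\<close>

definition "add_loop a s y = Loop (Cond (Prim a (Same s)) ret_False (Cond (Prim y Inc) (Prim s Inc) ret_False))"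
text \<open>Repeated addition: \<open>s\<close> counts the rounds, \<open>s + 1\<close> accumulates,
  and \<open>s + 2\<close> counts within a round. An incomplete round ends the loop before
  \<open>s\<close> is advanced.\<close>

definition "mult_loop a b s = Loop (Cond (Prim a (Same s)) ret_False
   (Seq (add_loop b (s + 2) (s + 1))
     (Cond (Prim b (Same (s + 2))) (Seq (reset (s + 2)) (Prim s Inc)) ret_False)))"
definition "clear s c = Seq (reset s) (Seq (reset (s + 1)) (Seq (reset (s + 2)) c))"
text \<open>Comparing \<open>a\<close> with \<open>s\<close> rules out overflow. The scratch pebbles
  go home in both branches, so the test as a whole leaves the environment unchanged.\<close>

definition "finish a c s = Cond (Cond (Prim a (Same s)) (Prim c (Same (s + 1))) ret_False) (clear s ret_True) (clear s ret_False)"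
definition "plus_code a b c s = Seq (walk (s + 1) b) (Seq (add_loop a s (s + 1)) (finish a c s))"
definition "times_code a b c s = Seq (mult_loop a b s) (finish a c s)"

lemma good_envD: "good_env w e \<Longrightarrow> e v < length w"
  by (simp add: good_env_def)

lemma good_env_upd [simp]: "good_env w e \<Longrightarrow> x < length w \<Longrightarrow> good_env w (e(v := x))"
  by (simp add: good_env_def)

lemma evb_ret_True: "1 \<le> n \<Longrightarrow> evb w ret_True e True e n"
  unfolding ret_True_def by (rule evb_Prim) auto

lemma evb_ret_False: "good_word w \<Longrightarrow> good_env w e \<Longrightarrow> 1 \<le> n \<Longrightarrow> evb w ret_False e False e n"
  unfolding ret_False_def by (rule evb_Prim) (auto simp: good_word_def good_env_def)

lemma evb_reset: "evb w (reset v) e False (e(v := 0)) (Suc (e v))"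
proof (induction "e v" arbitrary: e)
  case 0
  show ?case unfolding reset_def
    by (rule evb_mono[OF evb_LoopF[OF evb_Prim[OF _ _ order_refl]]]) (use 0 in auto)
next
  case (Suc x)
  have *: "e(v := x, v := 0) = e(v := 0)" by simp
  have "evb w (reset v) (e(v := x)) False (e(v := 0)) (Suc x)"
    using Suc(1)[of "e(v := x)"] * by simp
  then show ?case unfolding reset_def
    by (rule evb_LoopT[OF evb_Prim[OF _ _ order_refl], rotated 2]) (use Suc(2) in \<open>auto simp flip: Suc(2)\<close>)
qed

lemma evb_walk:
  assumes "good_word w" "good_env w e" "u \<noteq> v" "e v \<le> e u"
  shows "evb w (walk v u) e False (e(v := e u)) (2 * (e u - e v) + 2)"
  using assms
proof (induction "e u - e v" arbitrary: e)
  case 0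
  then have *: "e v = e u" by simp
  then have "e(v := e u) = e" by (simp add: fun_eq_iff)
  then show ?case unfolding walk_def using 0 *
    by (auto intro!: evb_mono[OF evb_LoopF[OF evb_CondT[OF evb_Prim[OF _ _ order_refl] evb_ret_False]]])
next
  case (Suc x)
  let ?e = "e(v := Suc (e v))"
  have lt: "Suc (e v) < length w" using Suc.hyps(2) good_envD[OF Suc.prems(2), of u] by simp
  have x: "x = ?e u - ?e v" "?e v \<le> ?e u" "good_env w ?e" using Suc.hyps(2) Suc.prems lt by auto
  have IH: "evb w (walk v u) ?e False (e(v := e u)) (2 * x + 2)"
    using Suc.hyps(1)[of ?e, OF x(1) Suc.prems(1) x(3) Suc.prems(3) x(2)] Suc.prems(3) unfolding x(1)[symmetric] by (simp add: fun_upd_upd)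
  have "evb w (Cond (Prim u (Same v)) ret_False (Prim v Inc)) e True ?e 2"
    by (rule evb_CondF[OF evb_Prim[OF _ _ order_refl] evb_Prim[OF _ _ order_refl]]) (use lt Suc.hyps(2) in auto)
  then show ?case
    using IH Suc.hyps(2) unfolding walk_def by (auto intro: evb_LoopT)
qed

lemma evb_add_loop:
  assumes "good_word w" "good_env w e" "a \<noteq> s" "a \<noteq> y" "s \<noteq> y" "e s \<le> e a"
    and "x = min (e a - e s) (length w - 1 - e y)"
  shows "evb w (add_loop a s y) e False (e(s := e s + x, y := e y + x)) (3 * x + 3)"
  using assms
proof (induction x arbitrary: e)
  case 0
  have "evb w (Cond (Prim a (Same s)) ret_False (Cond (Prim y Inc) (Prim s Inc) ret_False)) e False e 3"
  proof (cases "e s = e a")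
    case True
    show ?thesis
      by (rule evb_CondT[OF evb_Prim[OF _ _ order_refl] evb_ret_False[OF _ _ order_refl]]) (use True 0 in auto)
  next
    case False
    then have *: "e y = length w - 1" using 0 good_envD[OF 0(2), of y] by (auto simp: min_def split: if_splits)
    show ?thesis
      by (rule evb_CondF[OF evb_Prim[OF _ _ order_refl] evb_CondF[OF evb_Prim[OF _ _ order_refl] evb_ret_False[OF _ _ order_refl] order_refl]])
        (use False * 0 in auto)
  qed
  then show ?case unfolding add_loop_def
    by (auto intro!: evb_mono[OF evb_LoopF] simp: fun_upd_idem)
next
  case (Suc x)
  let ?e = "e(s := Suc (e s), y := Suc (e y))"
  have lt: "e s < e a" "Suc (e y) < length w" "Suc (e s) < length w" 
    using Suc.prems good_envD[OF Suc.prems(2), of a] by auto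
  have "evb w (add_loop a s y) ?e False (?e(s := ?e s + x, y := ?e y + x)) (3 * x + 3)"
  proof (rule Suc.IH)
    show "good_env w ?e" using Suc.prems(2) lt by (intro good_env_upd) simp_all
  qed (use Suc.prems lt in auto)
  moreover have "?e(s := ?e s + x, y := ?e y + x) = e(s := e s + Suc x, y := e y + Suc x)"
    using Suc.prems by auto
  moreover have "evb w (Cond (Prim a (Same s)) ret_False (Cond (Prim y Inc) (Prim s Inc) ret_False)) e True ?e 3"
  proof -
    have 1: "evb w (Prim a (Same s)) e False e 1" by (rule evb_Prim) (use lt in auto)
    have 2: "evb w (Prim y Inc) e True (e(y := Suc (e y))) 1" by (rule evb_Prim) (use lt in auto)
    have 3: "evb w (Prim s Inc) (e(y := Suc (e y))) True ?e 1"
      by (rule evb_Prim) (use lt Suc.prems in \<open>auto simp: fun_upd_twist\<close>)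
    show ?thesis by (rule evb_CondF[OF 1 evb_CondT[OF 2 3 order_refl]]) simp
  qed
  ultimately have body: "evb w (Cond (Prim a (Same s)) ret_False (Cond (Prim y Inc) (Prim s Inc) ret_False)) e True ?e 3"
    and rest: "evb w (add_loop a s y) ?e False (e(s := e s + Suc x, y := e y + Suc x)) (3 * x + 3)" by simp_all
  have "evb w (add_loop a s y) e False (e(s := e s + Suc x, y := e y + Suc x)) (3 * Suc x + 3)"
    using evb_LoopT[OF body rest[unfolded add_loop_def], of "3 * Suc x + 3"] unfolding add_loop_def by simp
  then show ?case .
qed

text \<open>The last conjunct handles products that leave the word: then \<open>s\<close> stops
  short of \<open>a\<close>, and answering False is correct because a pebble \<open>c\<close> always
  lies inside the word.\<close>

lemma evb_mult_loop:
  assumes "good_word w" "good_env w e" "{a, b} \<inter> {s, s + 1, s + 2} = {}" "e s \<le> e a" "e (s + 1) = e s * e b" "e (s + 2) = 0"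
  shows "\<exists>e'. evb w (mult_loop a b s) e False e' (Suc (e a - e s) * (6 * length w)) \<and> (\<forall>v. v \<notin> {s, s + 1, s + 2} \<longrightarrow> e' v = e v) \<and>
     good_env w e' \<and> (if e' s = e a then e' (s + 1) = e a * e b else length w \<le> e a * e b)"
  using assms
proof (induction "e a - e s" arbitrary: e)
  case 0
  have N: "0 < length w" using 0 by (simp add: good_word_def)
  have "evb w (mult_loop a b s) e False e 2" unfolding mult_loop_def using 0
    by (auto intro!: evb_LoopF evb_CondT[OF evb_Prim[OF _ _ order_refl] evb_ret_False])
  then have "evb w (mult_loop a b s) e False e (Suc (e a - e s) * (6 * length w))"
    by (rule evb_mono) (use 0 N in \<open>cases w; simp\<close>)
  then show ?case using 0 by (intro exI[of _ e]) auto
next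
  case (Suc k)
  have N: "0 < length w" using Suc by (simp add: good_word_def)
  have ea: "e a < length w" "e b < length w" "e (s + 1) < length w" using Suc.prems good_envD by blast+
  define x where "x = min (e b) (length w - 1 - e (s + 1))"
  let ?e = "e(s + 2 := x, s + 1 := e (s + 1) + x)"
  let ?body = "Seq (add_loop b (s + 2) (s + 1)) (Cond (Prim b (Same (s + 2))) (Seq (reset (s + 2)) (Prim s Inc)) ret_False)"
  have add: "evb w (add_loop b (s + 2) (s + 1)) e False ?e (3 * x + 3)"
    using evb_add_loop[OF Suc.prems(1,2), of b "s + 2" "s + 1" x] Suc.prems by (auto simp: x_def)
  have "x < length w" "e (s + 1) + x < length w" using ea by (auto simp: x_def min_def)
  then have ge: "good_env w ?e" using Suc.prems(2) by simp
  have out: "evb w (Prim a (Same s)) e False e 1"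
    by (rule evb_Prim) (use Suc.hyps(2) in auto)
  have xN: "x < length w" using ea by (simp add: x_def)
  show ?case
  proof (cases "x = e b")
    case True
    let ?e1 = "e(s := Suc (e s), s + 1 := e (s + 1) + e b)"
    have "?e(s + 2 := 0, s := Suc (?e s)) = ?e1" using Suc.prems True by (auto simp: fun_eq_iff)
    moreover have lt: "Suc (e s) < length w" using Suc.hyps(2) ea by simp
    ultimately have inc: "evb w (Prim s Inc) (?e(s + 2 := 0)) True ?e1 1"
      by (intro evb_Prim) auto
    have res: "evb w (reset (s + 2)) ?e False (?e(s + 2 := 0)) (Suc x)" using evb_reset[of w "s + 2" ?e] by simp
    have chk: "evb w (Prim b (Same (s + 2))) ?e True ?e 1"
    proof (rule evb_Prim)
      have "?e b = e b" "?e (s + 2) = x" using Suc.prems(3) by auto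
      then have "?e (s + 2) = ?e b" using True by (simp only:)
      then show "prim_res w b (Same (s + 2)) ?e = True" unfolding prim_res.simps by simp
    qed auto
    have once: "evb w (Cond (Prim a (Same s)) ret_False ?body) e True ?e1 (1 + ((3 * x + 3) + (1 + (Suc x + 1))))"
      by (rule evb_CondF[OF out evb_Seq[OF add evb_CondT[OF chk evb_Seq[OF res inc order_refl] order_refl] order_refl] order_refl])
    have g1: "good_env w ?e1"
    proof (intro good_env_upd)
      show "e (s + 1) + e b < length w" using \<open>e (s + 1) + x < length w\<close> True by simp
    qed (use Suc.prems(2) lt in auto)
    obtain e' where e': "evb w (mult_loop a b s) ?e1 False e' (Suc (?e1 a - ?e1 s) * (6 * length w))"
      "\<forall>v. v \<notin> {s, s + 1, s + 2} \<longrightarrow> e' v = ?e1 v" "good_env w e'" 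
      "if e' s = ?e1 a then e' (s + 1) = ?e1 a * ?e1 b else length w \<le> ?e1 a * ?e1 b"
    proof -
      have 1: "k = ?e1 a - ?e1 s" "?e1 s \<le> ?e1 a" "?e1 (s + 1) = ?e1 s * ?e1 b" "?e1 (s + 2) = 0"
        using Suc.hyps(2) Suc.prems(3-6) by auto
      show ?thesis
        using Suc.hyps(1)[of ?e1, OF 1(1) Suc.prems(1) g1 Suc.prems(3) 1(2-4)] that by blast
    qed
    have "x * 4 + 7 \<le> 6 * length w + (if length w = 1 then 1 else 0)" using xN by auto
    have "(1 + ((3 * x + 3) + (1 + (Suc x + 1)))) + Suc (?e1 a - ?e1 s) * (6 * length w) \<le> Suc (e a - e s) * (6 * length w)"
    proof -
      \<comment> \<open>A round costs \<open>4 * x + 7\<close> with \<open>x < length w\<close>.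
        This fits into \<open>6 * length w\<close> only from two cells on, which the successful move
        of \<open>s\<close> guarantees.\<close>
      have "2 \<le> length w" using lt by simp
      then have "1 + ((3 * x + 3) + (1 + (Suc x + 1))) \<le> 6 * length w" using xN by simp
      moreover have "?e1 a - ?e1 s = k" using Suc.hyps(2) Suc.prems(3) by auto
      ultimately show ?thesis using Suc.hyps(2) by (simp flip: Suc.hyps(2))
    qed
    then have "evb w (mult_loop a b s) e False e' (Suc (e a - e s) * (6 * length w))"
      using evb_LoopT[OF once e'(1)[unfolded mult_loop_def]] unfolding mult_loop_def by blast
    then show ?thesis using e' Suc.prems(3) by (intro exI[of _ e']) auto
  next
    case False
    then have x: "x = length w - 1 - e (s + 1)" "x < e b" by (auto simp: x_def min_def split: if_splits)
    have chk: "evb w (Prim b (Same (s + 2))) ?e False ?e 1" by (rule evb_Prim) (use False Suc.prems in auto)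
    have once: "evb w (mult_loop a b s) e False ?e (1 + ((3 * x + 3) + (1 + 1)))"
      unfolding mult_loop_def
      by (rule evb_LoopF[OF evb_CondF[OF out evb_Seq[OF add evb_CondF[OF chk evb_ret_False[OF Suc.prems(1) ge order_refl] order_refl] order_refl] order_refl]])
    \<comment> \<open>The accumulator stopped on the last cell with part of \<open>b\<close> still
      to be added, so already \<open>Suc (e s) * e b\<close> lies beyond the word.\<close>
    have "length w \<le> e s * e b + e b" using x ea Suc.prems(5) by simp
    also have "\<dots> = Suc (e s) * e b" by simp
    also have "\<dots> \<le> e a * e b" using Suc.hyps(2) by (intro mult_right_mono) auto
    finally have *: "length w \<le> e a * e b" .
    have "1 + ((3 * x + 3) + (1 + 1)) \<le> Suc (e a - e s) * (6 * length w)"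
    proof -
      have "1 + ((3 * x + 3) + (1 + 1)) \<le> 1 * (6 * length w)" using xN by simp
      also have "\<dots> \<le> Suc (e a - e s) * (6 * length w)" by (rule mult_right_mono) auto
      finally show ?thesis .
    qed
    with once have "evb w (mult_loop a b s) e False ?e (Suc (e a - e s) * (6 * length w))" by (rule evb_mono)
    then show ?thesis using * ge Suc.prems Suc.hyps(2)
      by (intro exI[of _ ?e]) auto
  qed
qed

lemma evb_clear:
  assumes "evb w c (e(s := 0, s + 1 := 0, s + 2 := 0)) r e' 1" "good_env w e"
  shows "evb w (clear s c) e r e' (3 * length w + 1)"
proof -
  have 1: "evb w (reset s) e False (e(s := 0)) (length w)"
    by (rule evb_mono[OF evb_reset]) (use good_envD[OF assms(2), of s] in auto)
  have 2: "evb w (reset (s + 1)) (e(s := 0)) False (e(s := 0, s + 1 := 0)) (length w)"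
    by (rule evb_mono[OF evb_reset]) (use good_envD[OF assms(2), of "s + 1"] in auto)
  have 3: "evb w (reset (s + 2)) (e(s := 0, s + 1 := 0)) False (e(s := 0, s + 1 := 0, s + 2 := 0)) (length w)"
    by (rule evb_mono[OF evb_reset]) (use good_envD[OF assms(2), of "s + 2"] in auto)
  show ?thesis unfolding clear_def
    by (rule evb_Seq[OF 1 evb_Seq[OF 2 evb_Seq[OF 3 assms(1) order_refl] order_refl]]) auto
qed

lemma evb_finish:
  assumes w: "good_word w" "good_env w e" and e0: "e(s := 0, s + 1 := 0, s + 2 := 0) = e0"
  shows "evb w (finish a c s) e (e a = e s \<and> e c = e (s + 1)) e0 (3 * length w + 3)"
proof -
  let ?r = "e a = e s \<and> e c = e (s + 1)"
  have test: "evb w (Cond (Prim a (Same s)) (Prim c (Same (s + 1))) ret_False) e ?r e 2"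
  proof (cases "e a = e s")
    case True
    show ?thesis
      by (rule evb_CondT[OF evb_Prim[OF _ _ order_refl] evb_Prim[OF _ _ order_refl]]) (use True in auto)
  next
    case False
    show ?thesis using False
      by (auto intro!: evb_CondF[OF evb_Prim[OF _ _ order_refl] evb_ret_False[OF w order_refl]])
  qed
  have N: "0 < length w" using w by (simp add: good_word_def)
  have "good_env w e0" unfolding e0[symmetric] using w N by (simp add: good_env_def)
  then have "evb w (clear s ret_True) e True e0 (3 * length w + 1)" "evb w (clear s ret_False) e False e0 (3 * length w + 1)"
    by (auto intro!: evb_clear evb_ret_True evb_ret_False w simp: e0 simp del: One_nat_def add_2_eq_Suc' add_Suc_right)
  then have "evb w (if ?r then clear s ret_True else clear s ret_False) e ?r e0 (3 * length w + 1)"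
    by auto
  then show ?thesis unfolding finish_def by (rule evb_Cond[OF test]) simp
qed

lemma evb_plus_code:
  assumes w: "good_word w" "good_env w e" and s: "e s = 0" "e (s + 1) = 0" "e (s + 2) = 0" "a < s" "b < s" "c < s"
  shows "evb w (plus_code a b c s) e (e a + e b = e c) e (8 * length w + 8)"
proof -
  define x where "x = min (e a) (length w - 1 - e b)"
  let ?e1 = "e(s + 1 := e b)"
  let ?e2 = "e(s := x, s + 1 := e b + x)"
  have le: "e a < length w" "e b < length w" "e c < length w" using w good_envD by blast+
  have 1: "evb w (walk (s + 1) b) e False ?e1 (2 * (e b - e (s + 1)) + 2)"
    by (rule evb_walk) (use w s in auto)
  have "?e1(s := x, s + 1 := e b + x) = ?e2" by (simp add: fun_eq_iff)
  moreover have "evb w (add_loop a s (s + 1)) ?e1 False (?e1(s := ?e1 s + x, s + 1 := ?e1 (s + 1) + x)) (3 * x + 3)"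
    by (rule evb_add_loop) (use w s le in \<open>auto simp: x_def\<close>)
  ultimately have 2: "evb w (add_loop a s (s + 1)) ?e1 False ?e2 (3 * x + 3)" using s by simp
  have "e(s := x, s + 1 := e b + x, s := 0, s + 1 := 0, s + 2 := 0) = e"
    using s by (auto simp: fun_eq_iff)
  moreover have "x < length w" "e b + x < length w" using le by (auto simp: x_def min_def)
  then have "good_env w ?e2" using w by simp
  ultimately have "evb w (finish a c s) ?e2 (?e2 a = ?e2 s \<and> ?e2 c = ?e2 (s + 1)) e (3 * length w + 3)"
    by (rule evb_finish[OF w(1), rotated])
  moreover have "(?e2 a = ?e2 s \<and> ?e2 c = ?e2 (s + 1)) \<longleftrightarrow> e a + e b = e c"
    using s le by (auto simp: x_def min_def)
  ultimately have 3: "evb w (finish a c s) ?e2 (e a + e b = e c) e (3 * length w + 3)" by simp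
  show ?thesis unfolding plus_code_def
    by (rule evb_Seq[OF 1 evb_Seq[OF 2 3 order_refl]]) (use le in \<open>auto simp: x_def\<close>)
qed

lemma evb_times_code:
  assumes w: "good_word w" "good_env w e" and s: "e s = 0" "e (s + 1) = 0" "e (s + 2) = 0" "a < s" "b < s" "c < s"
  shows "evb w (times_code a b c s) e (e a * e b = e c) e (length w * (6 * length w) + (3 * length w + 3))"
proof -
  have le: "e a < length w" "e c < length w" using w good_envD by blast+
  obtain e' where e': "evb w (mult_loop a b s) e False e' (Suc (e a - e s) * (6 * length w))"
      "\<forall>v. v \<notin> {s, s + 1, s + 2} \<longrightarrow> e' v = e v" "good_env w e'" 
      "if e' s = e a then e' (s + 1) = e a * e b else length w \<le> e a * e b"
    using evb_mult_loop[of w e a b s] w s by auto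
  have 0: "e'(s := 0, s + 1 := 0, s + 2 := 0) = e" using e'(2) s by (auto simp: fun_eq_iff)
  have eq: "(e' a = e' s \<and> e' c = e' (s + 1)) \<longleftrightarrow> e a * e b = e c"
    using e'(2,4) s le by (auto split: if_splits)
  have fin: "evb w (finish a c s) e' (e a * e b = e c) e (3 * length w + 3)"
    using evb_finish[OF w(1) e'(3) 0, of a c] unfolding eq .
  have "Suc (e a - e s) * (6 * length w) \<le> length w * (6 * length w)"
    using le by (intro mult_right_mono) auto
  then show ?thesis unfolding times_code_def
    by (intro evb_Seq[OF e'(1) fin]) simp
qed

section \<open>First-order formulas and their evaluation by pebbles\<close>

datatype fm = FSym nat nat | FEq nat nat | FPlus nat nat nat | FTimes nat nat nat
  | FNeg fm | FAnd fm fm | FEx fm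

primrec sat :: "nat list \<Rightarrow> (nat \<Rightarrow> nat) \<Rightarrow> fm \<Rightarrow> bool" where
  "sat w e (FSym i c) = (w ! e i = c)"
| "sat w e (FEq i j) = (e i = e j)"
| "sat w e (FPlus i j k) = (e i + e j = e k)"
| "sat w e (FTimes i j k) = (e i * e j = e k)"
| "sat w e (FNeg p) = (\<not> sat w e p)"
| "sat w e (FAnd p q) = (sat w e p \<and> sat w e q)"
| "sat w e (FEx p) = (\<exists>a<length w. sat w (case_nat a e) p)"

text \<open>At quantifier depth d, index i is held by pebble d - i. Truncated subtraction sends the free
  variables of a closed formula to pebble 0, which stays on the first cell; the pebbles above d are
  scratch space resting on the first cell.\<close>

primrec fm_code :: "nat \<Rightarrow> fm \<Rightarrow> code" where
  "fm_code d (FSym i c) = Prim (d - i) (Sym c)"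
| "fm_code d (FEq i j) = Prim (d - j) (Same (d - i))"
| "fm_code d (FPlus i j k) = plus_code (d - i) (d - j) (d - k) (d + 1)"
| "fm_code d (FTimes i j k) = times_code (d - i) (d - j) (d - k) (d + 1)"
| "fm_code d (FNeg p) = Cond (fm_code d p) ret_False ret_True"
| "fm_code d (FAnd p q) = Cond (fm_code d p) (fm_code d q) ret_False"
| "fm_code d (FEx p) = Seq (Loop (Cond (fm_code (d + 1) p) ret_False (Prim (d + 1) Inc)))
     (Cond (fm_code (d + 1) p) (Seq (reset (d + 1)) ret_True) (Seq (reset (d + 1)) ret_False))"

definition fm_env :: "nat list \<Rightarrow> nat \<Rightarrow> (nat \<Rightarrow> nat) \<Rightarrow> (nat \<Rightarrow> nat) \<Rightarrow> bool" where
  "fm_env w d e p \<longleftrightarrow> good_env w p \<and> (\<forall>v>d. p v = 0) \<and> (\<forall>i. e i = p (d - i))"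

lemma fm_env_Suc: "fm_env w d e p \<Longrightarrow> a < length w \<Longrightarrow> fm_env w (d + 1) (case_nat a e) (p(d + 1 := a))"
  by (auto simp: fm_env_def split: nat.split)

text \<open>The constants depend on the formula alone, not on the word or the depth. A quantifier
  runs its body at most once per cell and once more at the end, which raises the exponent by
  one.\<close>

lemma fm_code_correct:
  "\<exists>C k. \<forall>w d e p. good_word w \<longrightarrow> fm_env w d e p \<longrightarrow> evb w (fm_code d f) p (sat w e f) p (C * length w ^ k)"
proof (induction f)
  case (FSym i c)
  show ?case
    by (rule exI[of _ 1], rule exI[of _ 0]) (auto intro!: evb_Prim simp: fm_env_def)
next
  case (FEq i j)
  show ?case
    by (rule exI[of _ 1], rule exI[of _ 0]) (auto intro!: evb_Prim simp: fm_env_def)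
next
  case (FPlus i j k)
  show ?case
  proof (rule exI[of _ 16], rule exI[of _ 1], intro allI impI)
    fix w d e p assume w: "good_word w" and p: "fm_env w d e p"
    have N: "1 \<le> length w" using w by (cases w) (auto simp: good_word_def)
    have "evb w (fm_code d (FPlus i j k)) p (p (d - i) + p (d - j) = p (d - k)) p (8 * length w + 8)"
      unfolding fm_code.simps by (rule evb_plus_code) (use w p in \<open>auto simp: fm_env_def\<close>)
    from evb_mono[OF this, of "16 * length w"] N p
    show "evb w (fm_code d (FPlus i j k)) p (sat w e (FPlus i j k)) p (16 * length w ^ 1)"
      by (simp add: fm_env_def)
  qed
next
  case (FTimes i j k)
  show ?case
  proof (rule exI[of _ 12], rule exI[of _ 2], intro allI impI)
    fix w d e p assume w: "good_word w" and p: "fm_env w d e p"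
    have N: "0 < length w" using w by (simp add: good_word_def)
    have "1 * length w \<le> length w * length w" using N by (intro mult_le_mono1) linarith
    with N have "length w * (6 * length w) + (3 * length w + 3) \<le> 12 * length w ^ 2"
      unfolding power2_eq_square by linarith
    moreover have "evb w (fm_code d (FTimes i j k)) p (p (d - i) * p (d - j) = p (d - k)) p (length w * (6 * length w) + (3 * length w + 3))"
      unfolding fm_code.simps by (rule evb_times_code) (use w p in \<open>auto simp: fm_env_def\<close>)
    ultimately show "evb w (fm_code d (FTimes i j k)) p (sat w e (FTimes i j k)) p (12 * length w ^ 2)"
      using p by (auto simp: fm_env_def intro: evb_mono)
  qed
next
  case (FNeg f)
  then obtain C k where IH: "\<And>w d e p. good_word w \<Longrightarrow> fm_env w d e p \<Longrightarrow> evb w (fm_code d f) p (sat w e f) p (C * length w ^ k)"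
    by blast
  show ?case
  proof (rule exI[of _ "C + 1"], rule exI[of _ k], intro allI impI)
    fix w d e p assume w: "good_word w" and p: "fm_env w d e p"
    have "1 \<le> length w ^ k" using w by (simp add: good_word_def Suc_le_eq)
    then show "evb w (fm_code d (FNeg f)) p (sat w e (FNeg f)) p ((C + 1) * length w ^ k)"
      using w p by (auto intro!: evb_Cond[OF IH[OF w p], of _ _ _ _ 1] evb_ret_True evb_ret_False simp: fm_env_def)
  qed
next
  case (FAnd f g)
  then obtain C k D l where IH: "\<And>w d e p. good_word w \<Longrightarrow> fm_env w d e p \<Longrightarrow> evb w (fm_code d f) p (sat w e f) p (C * length w ^ k)"
     "\<And>w d e p. good_word w \<Longrightarrow> fm_env w d e p \<Longrightarrow> evb w (fm_code d g) p (sat w e g) p (D * length w ^ l)"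
    by blast
  show ?case
  proof (rule exI[of _ "C + (D + 1)"], rule exI[of _ "k + l"], intro allI impI)
    fix w d e p assume w: "good_word w" and p: "fm_env w d e p"
    have N: "1 \<le> length w" using w by (simp add: good_word_def Suc_le_eq)
    have *: "length w ^ k \<le> length w ^ (k + l)" "length w ^ l \<le> length w ^ (k + l)" "1 \<le> length w ^ (k + l)"
      using N by (auto intro: power_increasing)
    have le: "C * length w ^ k + (D * length w ^ l + 1) \<le> (C + (D + 1)) * length w ^ (k + l)"
      using mult_le_mono2[OF *(1), of C] mult_le_mono2[OF *(2), of D] *(3) unfolding add_mult_distrib by linarith
    have "evb w (if sat w e f then fm_code d g else ret_False) p (sat w e (FAnd f g)) p (D * length w ^ l + 1)"
      using w p by (auto intro!: evb_ret_False evb_mono[OF IH(2)] simp: fm_env_def)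
    then show "evb w (fm_code d (FAnd f g)) p (sat w e (FAnd f g)) p ((C + (D + 1)) * length w ^ (k + l))"
      unfolding fm_code.simps by (rule evb_Cond[OF IH(1)[OF w p] _ le])
  qed
next
  case (FEx f)
  then obtain C k where IH: "\<And>w d e p. good_word w \<Longrightarrow> fm_env w d e p \<Longrightarrow> evb w (fm_code d f) p (sat w e f) p (C * length w ^ k)"
    by blast
  show ?case
  proof (rule exI[of _ "2 * C + 5"], rule exI[of _ "k + 1"], intro allI impI)
    fix w d e p assume w: "good_word w" and p: "fm_env w d e p"
    let ?N = "length w"
    let ?b = "C * ?N ^ k"
    let ?S = "\<lambda>a. sat w (case_nat a e) f"
    let ?p = "\<lambda>a. p(d + 1 := a)"
    let ?L = "Loop (Cond (fm_code (d + 1) f) ret_False (Prim (d + 1) Inc))"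
    have N: "0 < ?N" using w by (simp add: good_word_def)
    have gp: "good_env w p" using p by (simp add: fm_env_def)
    have body: "evb w (fm_code (d + 1) f) (?p a) (?S a) (?p a) ?b" if "a < ?N" for a
      using IH[OF w fm_env_Suc[OF p that]] .
    \<comment> \<open>The loop stops at the first witness or on the last cell, and answers False in
      either case. That is why the body is evaluated once more afterwards.\<close>
    have loop: "\<exists>a'. a \<le> a' \<and> a' < ?N \<and> (\<forall>i. a \<le> i \<and> i < a' \<longrightarrow> \<not> ?S i) \<and> (?S a' \<or> Suc a' = ?N) \<and>
        evb w ?L (?p a) False (?p a') ((?N - a) * (?b + 1))" if "a < ?N" for a
      using that
    proof (induction "?N - Suc a" arbitrary: a)
      case 0
      then have a: "Suc a = ?N" by simp
      have "evb w (if ?S a then ret_False else Prim (d + 1) Inc) (?p a) False (?p a) 1"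
        using w gp 0 a by (auto intro!: evb_ret_False evb_Prim)
      then have "evb w ?L (?p a) False (?p a) (?b + 1)"
        by (rule evb_LoopF[OF evb_Cond[OF body[OF 0(2)] _ order_refl]])
      moreover have "?N - a = 1" using a by simp
      ultimately have "evb w ?L (?p a) False (?p a) ((?N - a) * (?b + 1))" by simp
      then show ?case using 0 a by (intro exI[of _ a] conjI) (simp_all del: fun_upd_apply, linarith)
    next
      case (Suc x)
      show ?case
      proof (cases "?S a")
        case True
        have "evb w ?L (?p a) False (?p a) (?b + 1)"
          by (intro evb_LoopF evb_CondT[OF body[OF Suc.prems, simplified True]] evb_ret_False) (use w gp Suc.prems in auto)
        then have "evb w ?L (?p a) False (?p a) ((?N - a) * (?b + 1))"
          by (rule evb_mono) (use Suc.prems in \<open>cases "?N - a"; simp\<close>)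
        then show ?thesis using Suc.prems True by (intro exI[of _ a]) auto
      next
        case False
        have a: "Suc a < ?N" using Suc.hyps(2) by simp
        have inc: "evb w (Cond (fm_code (d + 1) f) ret_False (Prim (d + 1) Inc)) (?p a) True (?p (Suc a)) (?b + 1)"
          by (intro evb_CondF[OF body[OF Suc.prems, simplified False]] evb_Prim) (use a in auto)
        obtain a' where a': "Suc a \<le> a'" "a' < ?N" "\<forall>i. Suc a \<le> i \<and> i < a' \<longrightarrow> \<not> ?S i" "?S a' \<or> Suc a' = ?N"
           "evb w ?L (?p (Suc a)) False (?p a') ((?N - Suc a) * (?b + 1))"
        proof -
          have "x = ?N - Suc (Suc a)" using Suc.hyps(2) by simp
          from Suc.hyps(1)[OF this a] that show ?thesis by blast
        qed
        have "?b + 1 + (?N - Suc a) * (?b + 1) = (?N - a) * (?b + 1)"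
          unfolding Suc_diff_Suc[OF Suc.prems, symmetric] mult_Suc ..
        then have "evb w ?L (?p a) False (?p a') ((?N - a) * (?b + 1))"
          using evb_LoopT[OF inc a'(5)] by simp
        moreover have "\<forall>i. a \<le> i \<and> i < a' \<longrightarrow> \<not> ?S i" using a'(3) False by (metis le_antisym not_less_eq_eq)
        ultimately show ?thesis using a' by (intro exI[of _ a']) auto
      qed
    qed
    obtain a where a: "a < ?N" "\<forall>i<a. \<not> ?S i" "?S a \<or> Suc a = ?N" "evb w ?L (?p 0) False (?p a) (?N * (?b + 1))"
      using loop[OF N] by auto
    have p0: "?p 0 = p" using p by (auto simp: fm_env_def)
    have S: "?S a = sat w e (FEx f)" using a(1-3) unfolding sat.simps by (metis less_antisym)
    have fin: "evb w (if ?S a then Seq (reset (d + 1)) ret_True else Seq (reset (d + 1)) ret_False) (?p a) (?S a) p (?N + 1)"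
    proof -
      have "evb w (reset (d + 1)) (?p a) False p ?N"
        using evb_reset[of w "d + 1" "?p a"] p0 a(1) by (auto intro: evb_mono)
      then show ?thesis
        using w gp by (auto intro!: evb_Seq[where r = False] evb_ret_True evb_ret_False)
    qed
    have all: "evb w (fm_code d (FEx f)) p (?S a) p (?N * (?b + 1) + (?b + (?N + 1)))"
      unfolding fm_code.simps
      by (rule evb_Seq[OF a(4)[unfolded p0] evb_Cond[OF body[OF a(1)] fin order_refl] order_refl])
    have "?N * (?b + 1) + (?b + (?N + 1)) \<le> (2 * C + 5) * ?N ^ (k + 1)"
    proof -
      have "?N ^ k \<le> ?N ^ (k + 1)" using N by (intro power_increasing) linarith+
      then have "?b \<le> C * ?N ^ (k + 1)" by (rule mult_le_mono2)
      moreover have "1 \<le> ?N ^ (k + 1)" "?N \<le> ?N ^ (k + 1)" using N by (auto simp: Suc_le_eq)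
      moreover have "?N * (?b + 1) = C * ?N ^ (k + 1) + ?N" by (simp add: algebra_simps)
      ultimately show ?thesis unfolding add_mult_distrib by linarith
    qed
    then show "evb w (fm_code d (FEx f)) p (sat w e (FEx f)) p ((2 * C + 5) * ?N ^ (k + 1))"
      using all S by (auto intro: evb_mono)
  qed
qed

theorem fm_decidable:
  "\<exists>M C k. wf_tm M \<and> (\<forall>w m. good_word w \<longrightarrow> C * length w ^ k \<le> m \<longrightarrow> (accepts_within M w m \<longleftrightarrow> sat w (\<lambda>_. 0) f))"
proof -
  obtain C k where C: "\<And>w d e p. good_word w \<Longrightarrow> fm_env w d e p \<Longrightarrow> evb w (fm_code d f) p (sat w e f) p (C * length w ^ k)"
    using fm_code_correct by blast
  define c where "c = fm_code 0 f"
  \<comment> \<open>The number of pebbles depends on the formula only, so the alphabet of size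
    \<open>4 * 2 ^ K\<close> is fixed. One instruction takes at most \<open>7 * length w\<close>
    machine steps, which explains the factor 7 and the extra exponent below.\<close>
  define K where "K = Suc (Max (pebs c))"
  have K: "pebs c \<subseteq> {..<K}" by (auto simp: K_def less_Suc_eq_le)
  have "accepts_within (code_tm K c) w m \<longleftrightarrow> sat w (\<lambda>_. 0) f"
    if w: "good_word w" and m: "(7 * C + 1) * length w ^ (k + 1) \<le> m" for w m
  proof -
    have N: "0 < length w" using w by (simp add: good_word_def)
    have "fm_env w 0 (\<lambda>_. 0) (\<lambda>_. 0)" using N by (simp add: fm_env_def good_env_def)
    then obtain n where n: "n \<le> C * length w ^ k" "ev w c (\<lambda>_. 0) (sat w (\<lambda>_. 0) f) (\<lambda>_. 0) n"
      using C[OF w] unfolding evb_def c_def by blast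
    have "n * (2 * length w + 5) \<le> (C * length w ^ k) * (7 * length w)"
    proof (rule mult_mono)
      show "2 * length w + 5 \<le> 7 * length w" using N by linarith
    qed (use n in auto)
    also have "\<dots> = 7 * C * length w ^ (k + 1)" by simp
    finally have "n * (2 * length w + 5) \<le> 7 * C * length w ^ (k + 1)" .
    moreover have "0 < length w ^ (k + 1)" using N by (rule zero_less_power)
    ultimately have "1 + n * (2 * length w + 5) \<le> (7 * C + 1) * length w ^ (k + 1)"
      unfolding add_mult_distrib by linarith
    then show ?thesis using code_tm_accepts[OF n(2) w K] m by (meson order_trans)
  qed
  then show ?thesis using wf_code_tm[OF K] by blast
qed

section \<open>Existential second-order definability\<close>

text \<open>A shallow embedding: formulas are written as HOL predicates, and only their definability
  is proved, by introduction rules that follow the syntax. Shifting the environment plays the role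
  of binding.\<close>

definition fo_definable :: "(nat list \<Rightarrow> (nat \<Rightarrow> nat) \<Rightarrow> bool) \<Rightarrow> bool" where
  "fo_definable P \<longleftrightarrow> (\<exists>f. \<forall>w e. (\<forall>i. e i < length w) \<longrightarrow> (sat w e f \<longleftrightarrow> P w e))"

lemma fo_atoms:
  "fo_definable (\<lambda>w e. w ! e i = c)" "fo_definable (\<lambda>w e. e i = e j)" "fo_definable (\<lambda>w e. e i + e j = e k)" "fo_definable (\<lambda>w e. e i * e j = e k)"
  unfolding fo_definable_def
  by (rule exI[of _ "FSym i c"] exI[of _ "FEq i j"] exI[of _ "FPlus i j k"] exI[of _ "FTimes i j k"]; simp)+

lemma fo_not: "fo_definable P \<Longrightarrow> fo_definable (\<lambda>w e. \<not> P w e)"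
  unfolding fo_definable_def by (metis sat.simps(5))

lemma fo_conj: "fo_definable P \<Longrightarrow> fo_definable Q \<Longrightarrow> fo_definable (\<lambda>w e. P w e \<and> Q w e)"
  unfolding fo_definable_def by (metis sat.simps(6))

lemma fo_ex: "fo_definable (\<lambda>w e. P w (\<lambda>i. e (Suc i)) (e 0)) \<Longrightarrow> fo_definable (\<lambda>w e. \<exists>a<length w. P w e a)"
  unfolding fo_definable_def
proof (elim exE)
  fix f assume f: "\<forall>w e. (\<forall>i. e i < length w) \<longrightarrow> (sat w e f \<longleftrightarrow> P w (\<lambda>i. e (Suc i)) (e 0))"
  show "\<exists>f. \<forall>w e. (\<forall>i. e i < length w) \<longrightarrow> (sat w e f \<longleftrightarrow> (\<exists>a<length w. P w e a))"
  proof (rule exI[of _ "FEx f"], intro allI impI)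
    fix w :: "nat list" and e :: "nat \<Rightarrow> nat" assume e: "\<forall>i. e i < length w"
    have "sat w (case_nat a e) f \<longleftrightarrow> P w e a" if "a < length w" for a
      using f[rule_format, of "case_nat a e" w] e that by (simp split: nat.split)
    then show "sat w e (FEx f) \<longleftrightarrow> (\<exists>a<length w. P w e a)" by auto
  qed
qed

lemma fo_cong: "fo_definable P \<Longrightarrow> (\<And>w e. (\<forall>i. e i < length w) \<Longrightarrow> P w e = Q w e) \<Longrightarrow> fo_definable Q"
  unfolding fo_definable_def by blast

text \<open>The number 1 is the only \<open>v\<close> with \<open>v * v = v\<close> and
  \<open>v + v \<noteq> v\<close>, and larger constants are reached by adding it. If
  \<open>c\<close> does not fit into the word, both sides are false.\<close>

lemma fo_const: "fo_definable (\<lambda>w e. e i = c)"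
proof (induction c arbitrary: i)
  case 0
  show ?case by (rule fo_cong[OF fo_atoms(3)[of i i i]]) simp
next
  case (Suc c)
  have "fo_definable (\<lambda>(w :: nat list) e. \<exists>u<length w. u = c \<and> (\<exists>v<length w. (v * v = v \<and> \<not> v + v = v) \<and> u + v = e i))"
    by (intro fo_ex fo_conj fo_not fo_atoms Suc)
  then show ?case
  proof (rule fo_cong)
    fix w :: "nat list" and e :: "nat \<Rightarrow> nat" assume e: "\<forall>i. e i < length w"
    show "(\<exists>u<length w. u = c \<and> (\<exists>v<length w. (v * v = v \<and> \<not> v + v = v) \<and> u + v = e i)) = (e i = Suc c)"
      using e[rule_format, of i] by (auto intro!: exI[of _ 1])
  qed
qed

lemma fo_less: "fo_definable (\<lambda>w e. e i < e j)"
proof -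
  have "fo_definable (\<lambda>(w :: nat list) e. \<exists>d<length w. \<not> d + d = d \<and> e i + d = e j)"
    by (intro fo_ex fo_conj fo_not fo_atoms)
  then show ?thesis
  proof (rule fo_cong)
    fix w :: "nat list" and e :: "nat \<Rightarrow> nat" assume e: "\<forall>i. e i < length w"
    show "(\<exists>d<length w. \<not> d + d = d \<and> e i + d = e j) = (e i < e j)"
      using e[rule_format, of j] by (auto intro!: exI[of _ "e j - e i"])
  qed
qed

text \<open>A relation on the numbers below bnd x is stored bitwise behind the separator, the tuple being read
  in base bnd x. The bound exceeds every tag used as first component below, and 2 ^ bnd x exceeds the
  product of any two numbers encoded in x.\<close>

type_synonym rel = "nat \<Rightarrow> nat \<Rightarrow> nat \<Rightarrow> nat \<Rightarrow> nat \<Rightarrow> bool"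

definition bnd :: "bool list \<Rightarrow> nat" where "bnd x = 2 * length x + 32"

definition cert :: "bool list \<Rightarrow> rel \<Rightarrow> bool list" where
  "cert x R = (let b = bnd x in map (\<lambda>p. R (p div b div b div b div b) (p div b div b div b mod b)
     (p div b div b mod b) (p div b mod b) (p mod b)) [0..<b * b * b * b * b])"

definition word :: "bool list \<Rightarrow> bool list \<Rightarrow> nat list" where
  "word x y = map bit_sym x @ [3] @ map bit_sym y"

text \<open>Here environments and quantifiers range over numbers below \<open>bnd x\<close> instead
  of all positions of the word, and the guessed relation becomes an atomic predicate.\<close>

definition so_definable :: "(bool list \<Rightarrow> rel \<Rightarrow> (nat \<Rightarrow> nat) \<Rightarrow> bool) \<Rightarrow> bool" where
  "so_definable P \<longleftrightarrow> (\<exists>f. \<forall>x R e. (\<forall>i. e i < bnd x) \<longrightarrow> (sat (word x (cert x R)) e f \<longleftrightarrow> P x R e))"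

lemma bit_sym_simps [simp]: "bit_sym b \<noteq> 3" "bit_sym b = 2 \<longleftrightarrow> b" "0 < bit_sym b" "bit_sym b < 4"
  by (auto simp: bit_sym_def)

lemma good_word_word: "good_word (word x y)"
  by (auto simp: good_word_def word_def bit_sym_def)

lemma length_word [simp]: "length (word x y) = length x + 1 + length y"
  by (simp add: word_def)

lemma length_cert [simp]: "length (cert x R) = bnd x * bnd x * bnd x * bnd x * bnd x"
  by (simp add: cert_def Let_def)

lemma word_sep: "p < length (word x y) \<Longrightarrow> word x y ! p = 3 \<longleftrightarrow> p = length x"
  by (auto simp: word_def nth_append nth_Cons split: nat.split)

lemma word_left: "p < length x \<Longrightarrow> word x y ! p = 2 \<longleftrightarrow> x ! p"
  by (auto simp: word_def nth_append)

lemma word_right: "p < length y \<Longrightarrow> word x y ! (length x + 1 + p) = 2 \<longleftrightarrow> y ! p"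
  by (auto simp: word_def nth_append)

lemma bnd_pos [simp]: "0 < bnd x"
  by (simp add: bnd_def)

lemma index_less:
  fixes q b l B :: nat
  assumes "q < B" "l < b" shows "q * b + l < B * b"
proof -
  have "q * b + l < Suc q * b" using assms by simp
  also have "\<dots> \<le> B * b" using assms by (intro mult_right_mono) auto
  finally show ?thesis .
qed

lemma cert_nth:
  assumes "t < b" "i < b" "j < b" "k < b" "l < b" "b = bnd x"
  shows "(((t * b + i) * b + j) * b + k) * b + l < b * b * b * b * b"
    "cert x R ! ((((t * b + i) * b + j) * b + k) * b + l) = R t i j k l"
proof -
  show *: "(((t * b + i) * b + j) * b + k) * b + l < b * b * b * b * b"
    by (intro index_less assms)
  show "cert x R ! ((((t * b + i) * b + j) * b + k) * b + l) = R t i j k l"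
    using * assms by (simp add: cert_def Let_def del: upt_Suc)
qed

text \<open>Every bit string of the right length encodes some relation, so checking the length of a
  guess is enough to read it as one.\<close>

lemma cert_surj:
  assumes "length y = bnd x * bnd x * bnd x * bnd x * bnd x"
  obtains R where "y = cert x R"
proof
  let ?b = "bnd x"
  let ?R = "\<lambda>t i j k l. y ! ((((t * ?b + i) * ?b + j) * ?b + k) * ?b + l)"
  show "y = cert x ?R"
    by (intro nth_equalityI) (simp_all add: assms cert_def Let_def)
qed

text \<open>The separator is the only symbol 3, so its position is \<open>length x\<close>, and the
  bound can be computed from the word itself.\<close>

definition is_bnd :: "nat list \<Rightarrow> nat \<Rightarrow> bool" where
  "is_bnd w b \<longleftrightarrow> (\<exists>n<length w. w ! n = 3 \<and> (\<exists>d<length w. n + n = d \<and> (\<exists>c<length w. c = 32 \<and> d + c = b)))"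

lemma fo_is_bnd: "fo_definable (\<lambda>w e. is_bnd w (e i))"
  unfolding is_bnd_def by (intro fo_ex fo_conj fo_atoms fo_const)

lemma ex_eq_less: "(\<exists>a<n. t = a \<and> P a) \<longleftrightarrow> t < n \<and> P t" for n t :: nat
  by auto

lemma is_bnd_word: "b < length (word x y) \<Longrightarrow> is_bnd (word x y) b \<longleftrightarrow> b = bnd x"
  by (auto simp: is_bnd_def bnd_def word_sep simp del: length_word intro!: exI[of _ "length x"])

lemma bnd_less_word: "bnd x < length (word x (cert x R))"
proof -
  have "bnd x * 1 \<le> bnd x * (bnd x * bnd x * bnd x * bnd x)" by (intro mult_left_mono) (auto simp: Suc_le_eq)
  then have "bnd x \<le> bnd x * bnd x * bnd x * bnd x * bnd x" by (simp only: mult_1_right mult.assoc)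
  then show ?thesis unfolding length_word length_cert by linarith
qed

lemma so_fo:
  assumes "fo_definable Q" "\<And>x R e. (\<forall>i. e i < bnd x) \<Longrightarrow> Q (word x (cert x R)) e = P x R e"
  shows "so_definable P"
proof -
  obtain f where f: "\<And>w e. (\<forall>i. e i < length w) \<Longrightarrow> sat w e f \<longleftrightarrow> Q w e"
    using assms(1) unfolding fo_definable_def by blast
  have "sat (word x (cert x R)) e f \<longleftrightarrow> P x R e" if "\<forall>i. e i < bnd x" for x R e
    using f[of e "word x (cert x R)"] assms(2)[OF that] that bnd_less_word[of x R] less_trans by metis
  then show ?thesis unfolding so_definable_def by blast
qed

lemma so_eq: "so_definable (\<lambda>x R e. e i = e j)" by (rule so_fo[OF fo_atoms(2)]) simp
lemma so_add: "so_definable (\<lambda>x R e. e i + e j = e k)" by (rule so_fo[OF fo_atoms(3)]) simp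
lemma so_less: "so_definable (\<lambda>x R e. e i < e j)" by (rule so_fo[OF fo_less]) simp
lemma so_const: "so_definable (\<lambda>x R e. e i = c)" by (rule so_fo[OF fo_const]) simp

lemma so_not: "so_definable P \<Longrightarrow> so_definable (\<lambda>x R e. \<not> P x R e)"
  unfolding so_definable_def by (metis sat.simps(5))

lemma so_conj: "so_definable P \<Longrightarrow> so_definable Q \<Longrightarrow> so_definable (\<lambda>x R e. P x R e \<and> Q x R e)"
  unfolding so_definable_def by (metis sat.simps(6))

lemma so_cong: "so_definable P \<Longrightarrow> (\<And>x R e. (\<forall>i. e i < bnd x) \<Longrightarrow> P x R e = Q x R e) \<Longrightarrow> so_definable Q"
  unfolding so_definable_def by blast

lemma so_disj: "so_definable P \<Longrightarrow> so_definable Q \<Longrightarrow> so_definable (\<lambda>x R e. P x R e \<or> Q x R e)"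
  by (rule so_cong[OF so_not[OF so_conj[OF so_not so_not]]]) auto

lemma so_imp: "so_definable P \<Longrightarrow> so_definable Q \<Longrightarrow> so_definable (\<lambda>x R e. P x R e \<longrightarrow> Q x R e)"
  by (rule so_cong[OF so_disj[OF so_not]]) auto

lemma so_iff: "so_definable P \<Longrightarrow> so_definable Q \<Longrightarrow> so_definable (\<lambda>x R e. P x R e \<longleftrightarrow> Q x R e)"
  by (rule so_cong[OF so_conj[OF so_imp[of P Q] so_imp[of Q P]]]) auto

text \<open>A quantifier over all positions of the word, relativised by the formula \<open>h\<close>
  that recovers the bound from the separator.\<close>

lemma so_ex:
  assumes "so_definable (\<lambda>x R e. P x R (\<lambda>i. e (Suc i)) (e 0))"
  shows "so_definable (\<lambda>x R e. \<exists>a<bnd x. P x R e a)"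
proof -
  obtain f where f: "\<And>x R e. (\<forall>i. e i < bnd x) \<Longrightarrow> sat (word x (cert x R)) e f \<longleftrightarrow> P x R (\<lambda>i. e (Suc i)) (e 0)"
    using assms unfolding so_definable_def by blast
  have "fo_definable (\<lambda>w e. \<exists>b<length w. is_bnd w b \<and> e 0 < b)"
    by (intro fo_ex fo_conj fo_is_bnd fo_less)
  then obtain h where h: "\<And>w e. (\<forall>i. e i < length w) \<Longrightarrow> sat w e h \<longleftrightarrow> (\<exists>b<length w. is_bnd w b \<and> e 0 < b)"
    unfolding fo_definable_def by blast
  have "sat (word x (cert x R)) e (FEx (FAnd h f)) \<longleftrightarrow> (\<exists>a<bnd x. P x R e a)" if e: "\<forall>i. e i < bnd x" for x R e
  proof -
    let ?w = "word x (cert x R)"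
    have lt: "bnd x < length ?w" by (rule bnd_less_word)
    have "sat ?w (case_nat a e) (FAnd h f) \<longleftrightarrow> a < bnd x \<and> P x R e a" if a: "a < length ?w" for a
    proof -
      have "\<forall>i. case_nat a e i < length ?w"
        using a e lt less_trans by (auto split: nat.split simp del: length_word)
      then have 1: "sat ?w (case_nat a e) h \<longleftrightarrow> a < bnd x"
        using h[of "case_nat a e" ?w] is_bnd_word[of _ x "cert x R"] lt by (auto simp del: length_word)
      have "sat ?w (case_nat a e) f \<longleftrightarrow> P x R e a" if "a < bnd x"
        using f[of "case_nat a e" x R] e that by (simp split: nat.split)
      with 1 show ?thesis by auto
    qed
    then show ?thesis using lt less_trans unfolding sat.simps(7) by blast
  qed
  then show ?thesis unfolding so_definable_def by blast
qed

lemma so_all: "so_definable (\<lambda>x R e. P x R (\<lambda>i. e (Suc i)) (e 0)) \<Longrightarrow> so_definable (\<lambda>x R e. \<forall>a<bnd x. P x R e a)"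
  by (rule so_cong[OF so_not[OF so_ex[OF so_not]]]) auto

lemma so_le: "so_definable (\<lambda>x R e. e i \<le> e j)"
  by (rule so_cong[OF so_not[OF so_less[of j i]]]) auto

lemma so_Suc: "so_definable (\<lambda>x R e. e i = Suc (e j))"
proof -
  have "so_definable (\<lambda>x R e. \<exists>v<bnd x. v = 1 \<and> e j + v = e i)"
    by (intro so_ex so_conj so_const so_add)
  then show ?thesis by (rule so_cong) (auto simp: bnd_def)
qed

lemma so_length: "so_definable (\<lambda>x R e. e i = length x)"
proof (rule so_fo[OF fo_atoms(1)[of i 3]])
  fix x R and e :: "nat \<Rightarrow> nat" assume "\<forall>i. e i < bnd x"
  then have "e i < length (word x (cert x R))" using bnd_less_word less_trans by blast
  then show "(word x (cert x R) ! e i = 3) = (e i = length x)" by (rule word_sep)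
qed

lemma so_bit: "so_definable (\<lambda>x R e. e i < length x \<and> x ! e i)"
proof -
  have "fo_definable (\<lambda>w e. \<exists>n<length w. w ! n = 3 \<and> e i < n \<and> w ! e i = 2)"
    by (intro fo_ex fo_conj fo_atoms fo_less)
  then show ?thesis
  proof (rule so_fo)
    fix x R and e :: "nat \<Rightarrow> nat"
    let ?w = "word x (cert x R)"
    have "length x < length ?w" by simp
    with word_sep[of _ x "cert x R"]
    have "(\<exists>n<length ?w. ?w ! n = 3 \<and> e i < n \<and> ?w ! e i = 2) \<longleftrightarrow> e i < length x \<and> ?w ! e i = 2"
      by blast
    then show "(\<exists>n<length ?w. ?w ! n = 3 \<and> e i < n \<and> ?w ! e i = 2) \<longleftrightarrow> e i < length x \<and> x ! e i"
      using word_left by blast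
  qed
qed

text \<open>The index of the tuple is evaluated by Horner's rule. Each intermediate value is at most
  the final index and hence a position of the word, so bounded quantifiers can name all of
  them.\<close>

lemma so_R: "so_definable (\<lambda>x R e. R (e t) (e i) (e j) (e k) (e l))"
proof -
  have "fo_definable (\<lambda>w e. \<exists>b<length w. is_bnd w b \<and> (\<exists>n<length w. w ! n = 3 \<and> (\<exists>n'<length w. (\<exists>v<length w. v = 1 \<and> n + v = n') \<and>
     (\<exists>a1<length w. e t * b = a1 \<and> (\<exists>a2<length w. a1 + e i = a2 \<and> (\<exists>a3<length w. a2 * b = a3 \<and>
     (\<exists>a4<length w. a3 + e j = a4 \<and> (\<exists>a5<length w. a4 * b = a5 \<and> (\<exists>a6<length w. a5 + e k = a6 \<and>
     (\<exists>a7<length w. a6 * b = a7 \<and> (\<exists>a8<length w. a7 + e l = a8 \<and> (\<exists>q<length w. n' + a8 = q \<and> w ! q = 2))))))))))))"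
    by (intro fo_ex fo_conj fo_is_bnd fo_atoms fo_const)
  then show ?thesis
  proof (rule so_fo)
    fix x R and e :: "nat \<Rightarrow> nat" assume e: "\<forall>i. e i < bnd x"
    let ?w = "word x (cert x R)"
    define b where "b = bnd x"
    define N where "N = length ?w"
    have b: "b < N" using bnd_less_word by (simp add: b_def N_def)
    have is_b: "c < N \<Longrightarrow> is_bnd ?w c \<longleftrightarrow> c = b" for c using is_bnd_word by (simp add: b_def N_def)
    have sep: "c < N \<Longrightarrow> ?w ! c = 3 \<longleftrightarrow> c = length x" for c using word_sep by (simp add: N_def)
    have N: "length x + 1 + b * b * b * b * b = N" by (simp add: N_def b_def)
    have b0: "1 \<le> b" using bnd_pos[of x] unfolding b_def by linarith
    have mono: "u \<le> u * b" for u using b0 by simp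
    let ?p = "(((e t * b + e i) * b + e j) * b + e k) * b + e l"
    have p: "?p < b * b * b * b * b" "cert x R ! ?p = R (e t) (e i) (e j) (e k) (e l)"
      using cert_nth(1)[of "e t" b "e i" "e j" "e k" "e l" x] cert_nth(2)[of "e t" b "e i" "e j" "e k" "e l" x R] e
      by (auto simp: b_def)
    have "(((e t * b + e i) * b + e j) * b + e k) \<le> ?p" "((e t * b + e i) * b + e j) \<le> ((e t * b + e i) * b + e j) * b + e k"
      "e t * b + e i \<le> (e t * b + e i) * b + e j"
      using mono by (meson trans_le_add1)+
    then have lt: "e t * b < N" "e t * b + e i < N" "(e t * b + e i) * b < N" "(e t * b + e i) * b + e j < N"
      "((e t * b + e i) * b + e j) * b < N" "((e t * b + e i) * b + e j) * b + e k < N"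
      "(((e t * b + e i) * b + e j) * b + e k) * b < N" "?p < N" "length x + 1 + ?p < N" "length x + 1 < N" "length x < N" "1 < N"
      using p(1) N b0 by linarith+
    have w: "?w ! (length x + 1 + ?p) = 2 \<longleftrightarrow> R (e t) (e i) (e j) (e k) (e l)"
      using word_right[of ?p "cert x R" x] p by (simp add: b_def)
    show "(\<exists>b<length ?w. is_bnd ?w b \<and> (\<exists>n<length ?w. ?w ! n = 3 \<and> (\<exists>n'<length ?w. (\<exists>v<length ?w. v = 1 \<and> n + v = n') \<and>
     (\<exists>a1<length ?w. e t * b = a1 \<and> (\<exists>a2<length ?w. a1 + e i = a2 \<and> (\<exists>a3<length ?w. a2 * b = a3 \<and>
     (\<exists>a4<length ?w. a3 + e j = a4 \<and> (\<exists>a5<length ?w. a4 * b = a5 \<and> (\<exists>a6<length ?w. a5 + e k = a6 \<and>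
     (\<exists>a7<length ?w. a6 * b = a7 \<and> (\<exists>a8<length ?w. a7 + e l = a8 \<and> (\<exists>q<length ?w. n' + a8 = q \<and> ?w ! q = 2))))))))))))
     = R (e t) (e i) (e j) (e k) (e l)"
      unfolding N_def[symmetric] ex_eq_less
    proof
      assume "R (e t) (e i) (e j) (e k) (e l)"
      then show "\<exists>b<N. is_bnd ?w b \<and> (\<exists>n<N. ?w ! n = 3 \<and> (\<exists>n'<N. (\<exists>v<N. v = 1 \<and> n + v = n') \<and>
          e t * b < N \<and> e t * b + e i < N \<and> (e t * b + e i) * b < N \<and> (e t * b + e i) * b + e j < N \<and>
          ((e t * b + e i) * b + e j) * b < N \<and> ((e t * b + e i) * b + e j) * b + e k < N \<and>
          (((e t * b + e i) * b + e j) * b + e k) * b < N \<and> (((e t * b + e i) * b + e j) * b + e k) * b + e l < N \<and>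
          n' + ((((e t * b + e i) * b + e j) * b + e k) * b + e l) < N \<and>
          ?w ! (n' + ((((e t * b + e i) * b + e j) * b + e k) * b + e l)) = 2))"
        using lt w is_b[of b, OF b, simplified] b sep[of "length x", OF lt(11), simplified]
        by blast
    next
      assume "\<exists>b<N. is_bnd ?w b \<and> (\<exists>n<N. ?w ! n = 3 \<and> (\<exists>n'<N. (\<exists>v<N. v = 1 \<and> n + v = n') \<and>
          e t * b < N \<and> e t * b + e i < N \<and> (e t * b + e i) * b < N \<and> (e t * b + e i) * b + e j < N \<and>
          ((e t * b + e i) * b + e j) * b < N \<and> ((e t * b + e i) * b + e j) * b + e k < N \<and>
          (((e t * b + e i) * b + e j) * b + e k) * b < N \<and> (((e t * b + e i) * b + e j) * b + e k) * b + e l < N \<and>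
          n' + ((((e t * b + e i) * b + e j) * b + e k) * b + e l) < N \<and>
          ?w ! (n' + ((((e t * b + e i) * b + e j) * b + e k) * b + e l)) = 2))"
      then obtain b' n n' where *: "b' < N" "is_bnd ?w b'" "n < N" "?w ! n = 3" "n' = n + 1"
         "?w ! (n' + ((((e t * b' + e i) * b' + e j) * b' + e k) * b' + e l)) = 2" by blast
      then have "b' = b" "n = length x" using is_b sep by blast+
      then show "R (e t) (e i) (e j) (e k) (e l)" using * w by blast
    qed
  qed
qed

text \<open>A word cannot speak about its length directly; instead, the position
  \<open>n + b5\<close> is required to exist and to be the last one.\<close>

definition full_length :: "nat list \<Rightarrow> bool" where
  "full_length w \<longleftrightarrow> (\<exists>b<length w. is_bnd w b \<and> (\<exists>n<length w. w ! n = 3 \<and> (\<exists>b2<length w. b * b = b2 \<and>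
     (\<exists>b3<length w. b2 * b = b3 \<and> (\<exists>b4<length w. b3 * b = b4 \<and> (\<exists>b5<length w. b4 * b = b5 \<and> (\<exists>p<length w. n + b5 = p \<and>
       \<not> (\<exists>q<length w. p < q))))))))"

lemma full_length_word: "full_length (word x y) \<longleftrightarrow> length y = bnd x * bnd x * bnd x * bnd x * bnd x"
proof -
  define b where "b = bnd x"
  define N where "N = length (word x y)"
  have N: "N = length x + 1 + length y" by (simp add: N_def)
  have is_b: "c < N \<Longrightarrow> is_bnd (word x y) c \<longleftrightarrow> c = b" for c using is_bnd_word by (simp add: b_def N_def)
  have sep: "c < N \<Longrightarrow> word x y ! c = 3 \<longleftrightarrow> c = length x" for c using word_sep by (simp add: N_def)
  have b0: "1 \<le> b" using bnd_pos[of x] unfolding b_def by linarith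
  have mono: "u \<le> u * b" for u using b0 by simp
  have le: "b \<le> b * b" "b * b \<le> b * b * b" "b * b * b \<le> b * b * b * b" "b * b * b * b \<le> b * b * b * b * b"
    using mono by blast+
  have "full_length (word x y) \<longleftrightarrow> (\<exists>b<N. is_bnd (word x y) b \<and> (\<exists>n<N. word x y ! n = 3 \<and> b * b < N \<and> b * b * b < N \<and>
     b * b * b * b < N \<and> b * b * b * b * b < N \<and> n + b * b * b * b * b < N \<and> \<not> (\<exists>q<N. n + b * b * b * b * b < q)))"
    unfolding full_length_def N_def[symmetric] ex_eq_less ..
  also have "\<dots> \<longleftrightarrow> length y = b * b * b * b * b"
  proof
    assume "\<exists>b<N. is_bnd (word x y) b \<and> (\<exists>n<N. word x y ! n = 3 \<and> b * b < N \<and> b * b * b < N \<and>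
     b * b * b * b < N \<and> b * b * b * b * b < N \<and> n + b * b * b * b * b < N \<and> \<not> (\<exists>q<N. n + b * b * b * b * b < q))"
    then obtain b' n where *: "b' < N" "is_bnd (word x y) b'" "n < N" "word x y ! n = 3" 
      "n + b' * b' * b' * b' * b' < N" "\<not> (\<exists>q<N. n + b' * b' * b' * b' * b' < q)" by blast
    then have "b' = b" "n = length x" using is_b sep by blast+
    then have "length x + b * b * b * b * b < N" "\<not> length x + b * b * b * b * b < length x + length y"
      using * N by auto
    then show "length y = b * b * b * b * b" using N by linarith
  next
    assume y: "length y = b * b * b * b * b"
    then have lt: "b < N" "length x < N" using N le by linarith+
    show "\<exists>b<N. is_bnd (word x y) b \<and> (\<exists>n<N. word x y ! n = 3 \<and> b * b < N \<and> b * b * b < N \<and>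
     b * b * b * b < N \<and> b * b * b * b * b < N \<and> n + b * b * b * b * b < N \<and> \<not> (\<exists>q<N. n + b * b * b * b * b < q))"
    proof -
      have 1: "is_bnd (word x y) b" "word x y ! length x = 3" using is_b sep lt by blast+
      have 2: "b * b < N" "b * b * b < N" "b * b * b * b < N" "b * b * b * b * b < N" "length x + b * b * b * b * b < N"
        using N le y by linarith+
      have 3: "\<not> (\<exists>q<N. length x + b * b * b * b * b < q)" using N y by auto
      show ?thesis using 1 2 3 lt by blast
    qed
  qed
  finally show ?thesis by (simp add: b_def)
qed

lemma accepts_within_mono:
  assumes "accepts_within M w m" "m \<le> m'" shows "accepts_within M w m'"
proof -
  obtain T i where T: "(tm_step M ^^ m) (0, init_tape w, 0) = (1, T, i)"
    using assms(1) unfolding accepts_within_def by (metis prod.collapse)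
  have "(tm_step M ^^ k) (1, T, i) = (1, T, i)" for k by (induction k) (auto simp: tm_step_def)
  then have "(tm_step M ^^ ((m' - m) + m)) (0, init_tape w, 0) = (1, T, i)"
    unfolding funpow_add using T by simp
  then show ?thesis using assms(2) by (simp add: accepts_within_def)
qed

text \<open>For guesses of the form \<open>cert x R\<close> the running time is polynomial in the
  input. The definition of NP also admits longer guesses, on which the machine may run out of time;
  those are never certificates, so it suffices that the machine does not accept them at all.\<close>

theorem so_in_NP:
  assumes "so_definable P"
  shows "in_NP {x. \<exists>R. P x R (\<lambda>_. 0)}"
proof -
  obtain f where f: "\<And>x R e. (\<forall>i. e i < bnd x) \<Longrightarrow> sat (word x (cert x R)) e f \<longleftrightarrow> P x R e"
    using assms unfolding so_definable_def by blast
  have "fo_definable (\<lambda>w e. full_length w)"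
    unfolding full_length_def by (intro fo_ex fo_conj fo_not fo_is_bnd fo_atoms fo_const fo_less)
  then obtain h where h: "\<And>w e. (\<forall>i. e i < length w) \<Longrightarrow> sat w e h \<longleftrightarrow> full_length w"
    unfolding fo_definable_def by blast
  obtain M C k where M: "wf_tm M" "\<And>w m. good_word w \<Longrightarrow> C * length w ^ k \<le> m \<Longrightarrow>
      accepts_within M w m \<longleftrightarrow> sat w (\<lambda>_. 0) (FAnd h f)"
    using fm_decidable[of "FAnd h f"] by blast
  have accept: "accepts_within M (word x y) m \<longleftrightarrow> (\<exists>R. y = cert x R \<and> P x R (\<lambda>_. 0))"
    if "C * length (word x y) ^ k \<le> m" for x y m
  proof -
    have "accepts_within M (word x y) m \<longleftrightarrow> full_length (word x y) \<and> sat (word x y) (\<lambda>_. 0) f"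
      using M(2)[OF good_word_word that] h[of "\<lambda>_. 0" "word x y"] by simp
    also have "\<dots> \<longleftrightarrow> (\<exists>R. y = cert x R) \<and> sat (word x y) (\<lambda>_. 0) f"
      unfolding full_length_word by (metis cert_surj length_cert)
    also have "\<dots> \<longleftrightarrow> (\<exists>R. y = cert x R \<and> P x R (\<lambda>_. 0))"
      using f[of "\<lambda>_. 0" x] by auto
    finally show ?thesis .
  qed
  \<comment> \<open>From \<open>bnd x \<le> 33 * (length x + 1)\<close> the whole word has length at
    most \<open>(33 ^ 5 + 1) * (length x + 1) ^ 5\<close>. The constant is chosen so that
    \<open>c * (length x + 1) ^ ?K\<close> is \<open>C + 1\<close> times the power
    \<open>k + 1\<close> of that bound.\<close>
  define c where "c = (C + 1) * (33 ^ 5 + 1) ^ (k + 1)"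
  let ?K = "5 * (k + 1)"
  have len: "length (word x (cert x R)) \<le> (33 ^ 5 + 1) * (length x + 1) ^ 5" for x R
  proof -
    let ?n = "length x + 1"
    have "bnd x \<le> 33 * ?n" by (simp add: bnd_def)
    then have "bnd x ^ 5 \<le> (33 * ?n) ^ 5" by (rule power_mono) simp
    also have "\<dots> = 33 ^ 5 * ?n ^ 5" by (simp only: power_mult_distrib)
    finally have "bnd x ^ 5 \<le> 33 ^ 5 * ?n ^ 5" .
    moreover have "?n ^ 1 \<le> ?n ^ 5" by (rule power_increasing) auto
    moreover have "length (word x (cert x R)) = ?n + bnd x ^ 5" by (simp add: eval_nat_numeral mult.assoc)
    ultimately show ?thesis unfolding add_mult_distrib by simp
  qed
  have bound: "length (cert x R) \<le> c * (length x + 1) ^ ?K" "C * length (word x (cert x R)) ^ k \<le> c * (length x + 1) ^ ?K" for x R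
  proof -
    let ?L = "(33 ^ 5 + 1) * (length x + 1) ^ 5 :: nat"
    have L: "1 \<le> ?L" by simp
    have c: "c * (length x + 1) ^ ?K = (C + 1) * ?L ^ (k + 1)"
      by (simp only: c_def power_mult_distrib power_mult mult.assoc)
    have "length (cert x R) \<le> ?L" using len[of x R] by simp
    also have "\<dots> \<le> (C + 1) * ?L ^ (k + 1)"
    proof -
      have "?L ^ 1 \<le> ?L ^ (k + 1)" using L by (intro power_increasing) auto
      then have "1 * ?L \<le> (C + 1) * ?L ^ (k + 1)" by (intro mult_le_mono) auto
      then show ?thesis by simp
    qed
    finally show "length (cert x R) \<le> c * (length x + 1) ^ ?K" unfolding c .
    have "length (word x (cert x R)) ^ k \<le> ?L ^ k" by (rule power_mono[OF len]) simp
    also have "\<dots> \<le> ?L ^ (k + 1)" using L by (intro power_increasing) auto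
    finally show "C * length (word x (cert x R)) ^ k \<le> c * (length x + 1) ^ ?K"
      unfolding c by (intro mult_le_mono) auto
  qed
  show ?thesis unfolding in_NP_def
  proof (rule exI[of _ M], rule exI[of _ c], rule exI[of _ ?K], intro conjI allI M(1))
    fix x
    show "x \<in> {x. \<exists>R. P x R (\<lambda>_. 0)} \<longleftrightarrow> (\<exists>y. length y \<le> c * (length x + 1) ^ ?K \<and>
         accepts_within M (map bit_sym x @ [3] @ map bit_sym y) (c * (length x + 1) ^ ?K))"
      unfolding word_def[symmetric]
    proof
      assume "x \<in> {x. \<exists>R. P x R (\<lambda>_. 0)}"
      then obtain R where "P x R (\<lambda>_. 0)" by blast
      then have "accepts_within M (word x (cert x R)) (c * (length x + 1) ^ ?K)"
        using accept[OF bound(2)] by blast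
      then show "\<exists>y. length y \<le> c * (length x + 1) ^ ?K \<and> accepts_within M (word x y) (c * (length x + 1) ^ ?K)"
        using bound(1) by blast
    next
      assume "\<exists>y. length y \<le> c * (length x + 1) ^ ?K \<and> accepts_within M (word x y) (c * (length x + 1) ^ ?K)"
      then obtain y where "accepts_within M (word x y) (c * (length x + 1) ^ ?K)" by blast
      \<comment> \<open>Acceptance persists, so the budget may be enlarged until it covers this
        particular guess; then \<open>accept\<close> shows that the guess is a certificate.\<close>
      then have "accepts_within M (word x y) (c * (length x + 1) ^ ?K + C * length (word x y) ^ k)"
        by (rule accepts_within_mono) simp
      then show "x \<in> {x. \<exists>R. P x R (\<lambda>_. 0)}" by (subst (asm) accept) auto
    qed
  qed
qed

section \<open>Winning triples\<close>

text \<open>The state of smaller rank lies in \<open>W\<close> by the safety clause. No clause ties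
  rank 0 to the target: in a well-formed game a state outside the target cannot have rank 0, because
  the opponent has an action there and the last clause would fail.\<close>

definition win :: "raw_game \<Rightarrow> nat set \<Rightarrow> (nat \<Rightarrow> nat \<Rightarrow> nat set) \<Rightarrow> (nat \<Rightarrow> nat) \<Rightarrow> bool" where
  "win g W D r \<longleftrightarrow> rg_s0 g \<in> W \<and> W \<subseteq> {..<rg_ns g} \<and> (\<forall>s\<in>W - set (rg_T g).
     (\<forall>p<rg_m g. D p s \<subseteq> av g p s) \<and>
     (\<forall>a\<in>profiles g s. (\<forall>p<rg_m g. a ! p \<in> D p s) \<longrightarrow> (\<forall>s'<rg_ns g. dlt g s a s' > 0 \<longrightarrow> s' \<in> W)) \<and>
     (\<forall>b\<in>av g (rg_m g) s. \<exists>a\<in>profiles g s. (\<forall>p<rg_m g. a ! p \<in> D p s) \<and> a ! rg_m g = b \<and>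
        (\<exists>s'<rg_ns g. dlt g s a s' > 0 \<and> r s' < r s)))"

lemma profiles_eq_image:
  "profiles g s = (\<lambda>f. map f [0..<Suc (rg_m g)]) ` (\<Pi>\<^sub>E p\<in>{..<Suc (rg_m g)}. av g p s)"
proof (intro equalityI subsetI)
  fix a assume a: "a \<in> profiles g s"
  then have "a = map (\<lambda>p\<in>{..<Suc (rg_m g)}. a ! p) [0..<Suc (rg_m g)]"
    by (intro nth_equalityI) (auto simp: profiles_def simp del: upt_Suc)
  moreover have "(\<lambda>p\<in>{..<Suc (rg_m g)}. a ! p) \<in> (\<Pi>\<^sub>E p\<in>{..<Suc (rg_m g)}. av g p s)"
    using a by (auto simp: profiles_def)
  ultimately show "a \<in> (\<lambda>f. map f [0..<Suc (rg_m g)]) ` (\<Pi>\<^sub>E p\<in>{..<Suc (rg_m g)}. av g p s)" by blast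
qed (auto simp: profiles_def PiE_def Pi_def simp del: upt_Suc)

lemma finite_av [simp]: "finite (av g p s)"
  by (simp add: av_def)

lemma finite_profiles [simp]: "finite (profiles g s)"
  unfolding profiles_eq_image by (intro finite_imageI finite_PiE) auto

text \<open>Distributivity turns the sum over profiles into a product over players; this is where
  independent randomisation enters.\<close>

lemma sum_profiles_prod:
  fixes f :: "nat \<Rightarrow> nat \<Rightarrow> real"
  shows "(\<Sum>a\<in>profiles g s. \<Prod>p<Suc (rg_m g). f p (a ! p)) = (\<Prod>p<Suc (rg_m g). \<Sum>c\<in>av g p s. f p c)"
proof -
  let ?F = "\<Pi>\<^sub>E p\<in>{..<Suc (rg_m g)}. av g p s"
  have inj: "inj_on (\<lambda>f. map f [0..<Suc (rg_m g)]) ?F"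
    by (rule inj_onI, rule PiE_ext) (auto simp del: upt_Suc)
  have "(\<Prod>p<Suc (rg_m g). \<Sum>c\<in>av g p s. f p c) = (\<Sum>h\<in>?F. \<Prod>p<Suc (rg_m g). f p (h p))"
    by (rule prod_sum_PiE) auto
  also have "\<dots> = (\<Sum>h\<in>?F. \<Prod>p<Suc (rg_m g). f p (map h [0..<Suc (rg_m g)] ! p))"
    by (intro sum.cong prod.cong) (auto simp del: upt_Suc)
  also have "\<dots> = (\<Sum>a\<in>profiles g s. \<Prod>p<Suc (rg_m g). f p (a ! p))"
    unfolding profiles_eq_image by (simp add: sum.reindex[OF inj] del: upt_Suc)
  finally show ?thesis by simp
qed

text \<open>The pointwise bound is demanded only after multiplication by the weight, so successors
  of weight zero, which may lie outside the winning set, need no bound.\<close>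

lemma weighted_average_le:
  fixes w f :: "'a \<Rightarrow> real"
  assumes "finite S" "G \<subseteq> S" "sum w S = 1" "\<epsilon> \<le> sum w G" "v \<le> V" "0 \<le> c"
    and "\<And>x. x \<in> S \<Longrightarrow> w x * f x \<le> w x * (c * (if x \<in> G then v else V))"
  shows "(\<Sum>x\<in>S. w x * f x) \<le> c * (V - \<epsilon> * (V - v))"
proof -
  have "(\<Sum>x\<in>S. w x * f x) \<le> (\<Sum>x\<in>S. w x * (c * (if x \<in> G then v else V)))"
    using assms(7) by (rule sum_mono)
  also have "\<dots> = (\<Sum>x\<in>S. c * V * w x - c * (V - v) * (if x \<in> G then w x else 0))"
    by (intro sum.cong) (auto simp: algebra_simps)
  also have "\<dots> = c * V * sum w S - c * (V - v) * (\<Sum>x\<in>S. if x \<in> G then w x else 0)"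
    by (simp add: sum_subtractf sum_distrib_left)
  also have "(\<Sum>x\<in>S. if x \<in> G then w x else 0) = sum w G"
    using assms(1,2) by (simp add: sum.If_cases Int_absorb1)
  also have "c * V * sum w S - c * (V - v) * sum w G \<le> c * V * 1 - c * (V - v) * \<epsilon>"
    unfolding assms(3) using assms(4-6) by (intro diff_left_mono mult_left_mono) auto
  finally show ?thesis by (simp add: algebra_simps)
qed

locale game =
  fixes g :: raw_game
  assumes wf: "wf_game g"
begin

abbreviation "m \<equiv> rg_m g"
abbreviation "ns \<equiv> rg_ns g"
abbreviation "T \<equiv> set (rg_T g)"

lemma av_nonempty: "p \<le> m \<Longrightarrow> s < ns \<Longrightarrow> av g p s \<noteq> {}"
  using wf by (auto simp: wf_game_def av_def less_Suc_eq_le)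

lemma s0: "rg_s0 g < ns" and T_sub: "T \<subseteq> {..<ns}"
  using wf by (auto simp: wf_game_def)

lemma dlt_distr:
  assumes "s < ns" "a \<in> profiles g s"
  shows "(\<forall>s'<ns. 0 \<le> dlt g s a s') \<and> (\<Sum>s'<ns. dlt g s a s') = 1"
proof -
  have "\<exists>e\<in>set (rg_delta g). fst e = s \<and> fst (snd e) = a"
    using wf assms by (auto simp: wf_game_def)
  then have "\<exists>e\<in>set (rg_delta g). (\<lambda>(s1, a1, _). s1 = s \<and> a1 = a) e" by (auto split: prod.split)
  then have "find (\<lambda>(s1, a1, _). s1 = s \<and> a1 = a) (rg_delta g) \<noteq> None"
    by (auto simp: find_None_iff)
  then obtain e where e: "find (\<lambda>(s1, a1, _). s1 = s \<and> a1 = a) (rg_delta g) = Some e" by auto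
  obtain s1 a1 d where d: "e = (s1, a1, d)" by (cases e)
  have "e \<in> set (rg_delta g)" using e nth_mem unfolding find_Some_iff by blast
  then have *: "length d = ns" "\<forall>q\<in>set d. q \<ge> 0" "sum_list d = 1"
    using wf d by (auto simp: wf_game_def)
  have dlt: "dlt g s a s' = of_rat (d ! s')" for s' unfolding dlt_def e by (simp add: d)
  have "(\<Sum>s'<ns. of_rat (d ! s')) = (of_rat (\<Sum>s'<ns. d ! s') :: real)" by (simp add: of_rat_sum)
  also have "(\<Sum>s'<ns. d ! s') = 1" using * by (simp add: sum_list_sum_nth atLeast0LessThan)
  finally show ?thesis using * by (auto simp: dlt)
qed

lemma dlt_nonneg: "s < ns \<Longrightarrow> a \<in> profiles g s \<Longrightarrow> s' < ns \<Longrightarrow> 0 \<le> dlt g s a s'"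
  and sum_dlt: "s < ns \<Longrightarrow> a \<in> profiles g s \<Longrightarrow> (\<Sum>s'<ns. dlt g s a s') = 1"
  using dlt_distr by auto

definition hist :: "nat list \<Rightarrow> bool" where
  "hist h \<longleftrightarrow> h \<noteq> [] \<and> set h \<subseteq> {..<ns}"

lemma hist_last: "hist h \<Longrightarrow> last h < ns"
  unfolding hist_def by (meson last_in_set lessThan_iff subsetD)

lemma hist_snoc: "hist h \<Longrightarrow> s' < ns \<Longrightarrow> hist (h @ [s'])"
  by (auto simp: hist_def)

section \<open>One-step probabilities and the recursion for the failure probability\<close>

definition weight :: "(nat \<Rightarrow> nat list \<Rightarrow> nat \<Rightarrow> real) \<Rightarrow> (nat list \<Rightarrow> nat \<Rightarrow> real) \<Rightarrow> nat list \<Rightarrow> nat list \<Rightarrow> nat \<Rightarrow> real" where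
  "weight \<sigma> \<tau> h a s' = (\<Prod>p<m. \<sigma> p h (a ! p)) * \<tau> h (a ! m) * dlt g (last h) a s'"

definition strats :: "(nat \<Rightarrow> nat list \<Rightarrow> nat \<Rightarrow> real) \<Rightarrow> (nat list \<Rightarrow> nat \<Rightarrow> real) \<Rightarrow> bool" where
  "strats \<sigma> \<tau> \<longleftrightarrow> (\<forall>p<m. is_strat g p (\<sigma> p)) \<and> is_strat g m \<tau>"

abbreviation succs :: "nat list \<Rightarrow> (nat list \<times> nat) set" where
  "succs h \<equiv> profiles g (last h) \<times> {..<ns}"

lemma strats_nonneg:
  assumes "strats \<sigma> \<tau>" "hist h"
  shows "p < m \<Longrightarrow> 0 \<le> \<sigma> p h c" "0 \<le> \<tau> h c"
  using assms by (auto simp: strats_def is_strat_def hist_def)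

lemma weight_nonneg:
  assumes "strats \<sigma> \<tau>" "hist h" "(a, s') \<in> succs h"
  shows "0 \<le> weight \<sigma> \<tau> h a s'"
  using assms strats_nonneg[OF assms(1,2)] dlt_nonneg[OF hist_last[OF assms(2)]]
  by (auto simp: weight_def intro!: mult_nonneg_nonneg prod_nonneg)

lemma sum_weight:
  assumes "strats \<sigma> \<tau>" "hist h"
  shows "(\<Sum>(a, s')\<in>succs h. weight \<sigma> \<tau> h a s') = 1"
proof -
  let ?f = "\<lambda>p. if p < m then \<sigma> p h else \<tau> h"
  have "(\<Sum>(a, s')\<in>succs h. weight \<sigma> \<tau> h a s') = (\<Sum>a\<in>profiles g (last h). \<Sum>s'<ns. weight \<sigma> \<tau> h a s')"
    by (simp add: sum.cartesian_product)
  also have "\<dots> = (\<Sum>a\<in>profiles g (last h). \<Prod>p<Suc m. ?f p (a ! p))"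
    using sum_dlt[OF hist_last[OF assms(2)]] by (intro sum.cong) (simp_all add: weight_def flip: sum_distrib_left)
  also have "\<dots> = (\<Prod>p<Suc m. \<Sum>c\<in>av g p (last h). ?f p c)"
    by (rule sum_profiles_prod)
  also have "\<dots> = 1"
    using assms by (intro prod.neutral) (auto simp: strats_def is_strat_def hist_def less_Suc_eq)
  finally show ?thesis .
qed

abbreviation "fail \<sigma> \<tau> n h \<equiv> 1 - reach_n g \<sigma> \<tau> n h"

lemma fail_T: "last h \<in> T \<Longrightarrow> fail \<sigma> \<tau> n h = 0"
  by (cases n) auto

lemma reach_Suc:
  assumes "last h \<notin> T"
  shows "reach_n g \<sigma> \<tau> (Suc n) h = (\<Sum>(a, s')\<in>succs h. weight \<sigma> \<tau> h a s' * reach_n g \<sigma> \<tau> n (h @ [s']))"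
  using assms by (simp add: weight_def sum_distrib_left sum.cartesian_product[symmetric] mult.assoc)

text \<open>The weights sum to 1, so failure obeys a linear recursion like reaching. Outside the
  target it is a weighted average of nonnegative terms, which suits both directions of the
  proof.\<close>

lemma fail_Suc:
  assumes "strats \<sigma> \<tau>" "hist h" "last h \<notin> T"
  shows "fail \<sigma> \<tau> (Suc n) h = (\<Sum>(a, s')\<in>succs h. weight \<sigma> \<tau> h a s' * fail \<sigma> \<tau> n (h @ [s']))"
proof -
  have "(\<Sum>(a, s')\<in>succs h. weight \<sigma> \<tau> h a s' * fail \<sigma> \<tau> n (h @ [s'])) =
      (\<Sum>(a, s')\<in>succs h. weight \<sigma> \<tau> h a s') - reach_n g \<sigma> \<tau> (Suc n) h"
    unfolding reach_Suc[OF assms(3)] by (simp add: right_diff_distrib sum_subtractf split_def)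
  then show ?thesis using sum_weight[OF assms(1,2)] by simp
qed

lemma fail_nonneg: "strats \<sigma> \<tau> \<Longrightarrow> hist h \<Longrightarrow> 0 \<le> fail \<sigma> \<tau> n h"
proof (induction n arbitrary: h)
  case (Suc n)
  show ?case
  proof (cases "last h \<in> T")
    case False
    have "0 \<le> weight \<sigma> \<tau> h a s' * fail \<sigma> \<tau> n (h @ [s'])" if "(a, s') \<in> succs h" for a s'
      using Suc.IH[OF Suc.prems(1) hist_snoc[OF Suc.prems(2)]] weight_nonneg[OF Suc.prems that] that
      by (intro mult_nonneg_nonneg) auto
    then show ?thesis unfolding fail_Suc[OF Suc.prems False] by (intro sum_nonneg) auto
  qed simp
qed simp

definition point :: "nat \<Rightarrow> nat \<Rightarrow> real" where
  "point b = (\<lambda>a. if a = b then 1 else 0)"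

lemma is_strat_point:
  assumes "\<And>h. hist h \<Longrightarrow> f h \<in> av g p (last h)"
  shows "is_strat g p (\<lambda>h. point (f h))"
  using assms by (auto simp: is_strat_def point_def hist_def)

subsection \<open>Positive supports suffice\<close>

context
  fixes W D r
  assumes win: "win g W D r"
begin

text \<open>Depends on the last state only. The second branch is there because
  \<open>is_strat\<close> demands a distribution after every history.\<close>

definition unif :: "nat \<Rightarrow> nat list \<Rightarrow> nat \<Rightarrow> real" where
  "unif p h = (let A = (if last h \<in> W - T then D p (last h) else av g p (last h))
     in (\<lambda>a. if a \<in> A then 1 / card A else 0))"

text \<open>The opponent has some action, and the progress clause of \<open>win\<close> answers it
  with a profile from the supports.\<close>

lemma D_nonempty:
  assumes "s \<in> W - T" "p < m"
  shows "D p s \<noteq> {}"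
proof -
  have "s < ns" using assms win by (auto simp: win_def)
  then obtain b where "b \<in> av g m s" using av_nonempty by blast
  then obtain a where "\<forall>p<m. a ! p \<in> D p s" using assms(1) win unfolding win_def by blast
  then show ?thesis using assms(2) by blast
qed

lemma is_strat_unif:
  assumes "p < m" shows "is_strat g p (unif p)"
  unfolding is_strat_def
proof (intro allI impI)
  fix h assume "h \<noteq> [] \<and> set h \<subseteq> {..<ns}"
  then have s: "last h < ns" using hist_last by (simp add: hist_def)
  define A where "A = (if last h \<in> W - T then D p (last h) else av g p (last h))"
  have A: "A \<subseteq> av g p (last h)" "A \<noteq> {}"
    using D_nonempty[of "last h" p] win assms av_nonempty[of p "last h"] s unfolding A_def win_def by auto
  then have finA: "finite A" "0 < card A" by (auto intro: finite_subset simp: card_gt_0_iff)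
  have u: "unif p h = (\<lambda>a. if a \<in> A then 1 / card A else 0)" unfolding unif_def A_def[symmetric] Let_def ..
  have "(\<Sum>a\<in>av g p (last h). unif p h a) = (\<Sum>a\<in>A. 1 / card A)"
    unfolding u using A by (simp add: sum.If_cases Int_absorb1)
  also have "\<dots> = 1" using finA(2) by simp
  finally have 1: "sum (unif p h) (av g p (last h)) = 1" .
  have 2: "\<forall>a. 0 \<le> unif p h a" "\<forall>a. a \<notin> av g p (last h) \<longrightarrow> unif p h a = 0"
    unfolding u using A(1) by auto
  show "(\<forall>a. 0 \<le> unif p h a) \<and> (\<forall>a. a \<notin> av g p (last h) \<longrightarrow> unif p h a = 0) \<and> sum (unif p h) (av g p (last h)) = 1"
    by (rule conjI[OF 2(1) conjI[OF 2(2) 1]])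
qed

lemma unif_pos:
  assumes "last h \<in> W - T" "p < m"
  shows "0 < unif p h c \<longleftrightarrow> c \<in> D p (last h)"
proof -
  have "D p (last h) \<subseteq> av g p (last h)" using win assms unfolding win_def by blast
  then have "finite (D p (last h))" by (rule finite_subset) simp
  then have "0 < card (D p (last h))" using D_nonempty[OF assms] by (simp add: card_gt_0_iff)
  then show ?thesis unfolding unif_def if_P[OF assms(1)] Let_def by simp
qed

text \<open>\<open>unif\<close> looks at the last state only, so histories of length one already
  produce all values that occur. Finitely many of them are positive, and their minimum, capped at 1,
  is the required bound.\<close>

lemma step_probability:
  obtains \<epsilon> where "0 < \<epsilon>" "\<epsilon> \<le> 1"
    "\<And>h b. last h \<in> W - T \<Longrightarrow> b \<in> av g m (last h) \<Longrightarrow> \<exists>a\<in>profiles g (last h). a ! m = b \<and>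
       (\<exists>s'<ns. r s' < r (last h) \<and> \<epsilon> \<le> (\<Prod>p<m. unif p h (a ! p)) * dlt g (last h) a s')"
proof -
  let ?u = "\<lambda>s a s'. (\<Prod>p<m. unif p [s] (a ! p)) * dlt g s a s'"
  define P where "P = {x. \<exists>s\<in>W - T. \<exists>a\<in>profiles g s. \<exists>s'<ns. x = ?u s a s' \<and> 0 < x}"
  have "W - T \<subseteq> {..<ns}" using win by (auto simp: win_def)
  then have finW: "finite (W - T)" by (rule finite_subset) simp
  have "P \<subseteq> (\<Union>s\<in>W - T. \<Union>a\<in>profiles g s. (\<lambda>s'. ?u s a s') ` {..<ns})"
    by (auto simp: P_def)
  then have finP: "finite P" by (rule finite_subset) (use finW in auto)
  define \<epsilon> where "\<epsilon> = Min (insert 1 P)"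
  have "0 < \<epsilon>" unfolding \<epsilon>_def using finP by (subst Min_gr_iff) (auto simp: P_def)
  moreover have "\<epsilon> \<le> 1" unfolding \<epsilon>_def using finP by simp
  moreover have "\<exists>a\<in>profiles g (last h). a ! m = b \<and>
       (\<exists>s'<ns. r s' < r (last h) \<and> \<epsilon> \<le> (\<Prod>p<m. unif p h (a ! p)) * dlt g (last h) a s')"
    if h: "last h \<in> W - T" and b: "b \<in> av g m (last h)" for h b
  proof -
    obtain a s' where a: "a \<in> profiles g (last h)" "\<forall>p<m. a ! p \<in> D p (last h)" "a ! m = b" "s' < ns"
      "dlt g (last h) a s' > 0" "r s' < r (last h)"
      using win h b unfolding win_def by blast
    have "0 < (\<Prod>p<m. unif p [last h] (a ! p))" using a(2) h by (intro prod_pos) (simp add: unif_pos)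
    then have "?u (last h) a s' \<in> P" using a h by (auto simp: P_def)
    then have "\<epsilon> \<le> ?u (last h) a s'" unfolding \<epsilon>_def using finP by simp
    moreover have "unif p [last h] = unif p h" for p by (simp add: unif_def)
    ultimately show ?thesis using a by auto
  qed
  ultimately show ?thesis using that by blast
qed

text \<open>The function 1 - \<eta>^(r + 1) of the rank r shrinks in expectation by a constant factor
  outside the target, whatever the opponent does.\<close>

lemma fail_decays:
  obtains C lam where "0 \<le> lam" "lam < 1"
    "\<And>\<tau> h n. is_strat g m \<tau> \<Longrightarrow> hist h \<Longrightarrow> last h \<in> W \<Longrightarrow> fail unif \<tau> n h \<le> C * lam ^ n"
proof -
  obtain \<epsilon> where \<epsilon>: "0 < \<epsilon>" "\<epsilon> \<le> 1"
    "\<And>h b. last h \<in> W - T \<Longrightarrow> b \<in> av g m (last h) \<Longrightarrow> \<exists>a\<in>profiles g (last h). a ! m = b \<and>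
       (\<exists>s'<ns. r s' < r (last h) \<and> \<epsilon> \<le> (\<Prod>p<m. unif p h (a ! p)) * dlt g (last h) a s')"
    using step_probability by blast
  define R where "R = Max (insert 0 (r ` {..<ns}))"
  have rR: "r s \<le> R" if "s < ns" for s using that by (simp add: R_def)
  \<comment> \<open>From rank \<open>Suc k\<close> the expected value after one step is at most
    \<open>1 - \<epsilon> * \<eta> ^ Suc k\<close>, whereas \<open>V (Suc k)\<close> equals
    \<open>1 - \<epsilon> * \<eta> ^ Suc k / 2\<close> for this choice of \<open>\<eta>\<close>. The
    difference is at least \<open>\<epsilon> * \<eta> ^ R / 2\<close>, which is where
    \<open>lam\<close> comes from.\<close>
  define \<eta> where "\<eta> = \<epsilon> / 2"
  have \<eta>: "0 < \<eta>" "\<eta> < 1" using \<epsilon> by (auto simp: \<eta>_def)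
  define V where "V = (\<lambda>k. 1 - \<eta> ^ (k + 1))"
  have V_mono: "V j \<le> V k" if "j \<le> k" for j k
    using \<eta> that by (simp add: V_def power_decreasing)
  have V_pos: "1 - \<eta> \<le> V k" for k using V_mono[of 0 k] by (simp add: V_def)
  have V01: "0 \<le> V k" "V k \<le> 1" for k using V_pos[of k] \<eta> by (linarith, simp add: V_def)
  define lam where "lam = 1 - \<epsilon> * \<eta> ^ R / 2"
  have \<eta>R: "0 < \<eta> ^ R" "\<eta> ^ R \<le> 1" using \<eta> by (auto intro: power_le_one)
  have "\<epsilon> * \<eta> ^ R \<le> 1" using mult_mono[OF \<epsilon>(2) \<eta>R(2)] \<epsilon>(1) \<eta>R by simp
  then have lam: "0 \<le> lam" "lam < 1" using \<epsilon> \<eta>R by (auto simp: lam_def)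
  have contract: "V R - \<epsilon> * (V R - V k) \<le> lam * V (Suc k)" if "Suc k \<le> R" for k
  proof -
    have pw: "\<eta> ^ R \<le> \<eta> ^ Suc k" using \<eta> that by (intro power_decreasing) auto
    have eR: "0 \<le> \<eta> ^ (R + 1)" using \<eta> by simp
    have "V R - \<epsilon> * (V R - V k) = 1 - (1 - \<epsilon>) * \<eta> ^ (R + 1) - \<epsilon> * \<eta> ^ Suc k"
      by (simp add: V_def algebra_simps)
    also have "\<dots> \<le> 1 - \<epsilon> * \<eta> ^ Suc k" using \<epsilon> eR by simp
    also have "\<dots> = 1 - \<eta> ^ Suc (Suc k) - \<epsilon> * \<eta> ^ Suc k / 2" by (simp add: \<eta>_def)
    also have "\<dots> \<le> 1 - \<eta> ^ Suc (Suc k) - \<epsilon> * \<eta> ^ R / 2" using \<epsilon>(1) pw by simp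
    also have "\<dots> = lam - \<eta> ^ Suc (Suc k)" by (simp add: lam_def)
    also have "\<dots> \<le> lam - lam * \<eta> ^ Suc (Suc k)"
      using lam \<eta> by (simp add: mult_left_le_one_le)
    also have "\<dots> = lam * V (Suc k)" by (simp add: V_def algebra_simps)
    finally show ?thesis .
  qed
  \<comment> \<open>Since \<open>V\<close> is at least \<open>1 - \<eta>\<close> everywhere, this
    factor lifts it above the trivial bound 1 on the failure probability, as the induction base
    requires.\<close>
  define C where "C = 1 / (1 - \<eta>)"
  have C: "0 < C" "1 \<le> C * V k" for k
    using V_pos[of k] \<eta> by (auto simp: C_def field_simps)
  have main: "fail unif \<tau> n h \<le> C * lam ^ n * V (r (last h))"
    if \<tau>: "is_strat g m \<tau>" and h: "hist h" "last h \<in> W" for \<tau> n h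
    using h
  proof (induction n arbitrary: h)
    case 0
    have "fail unif \<tau> 0 h \<le> 1" by simp
    also have "\<dots> \<le> C * V (r (last h))" by (rule C(2))
    finally show ?case by simp
  next
    case (Suc n)
    have st: "strats unif \<tau>" using \<tau> is_strat_unif by (simp add: strats_def)
    have s: "last h < ns" using hist_last[OF Suc.prems(1)] .
    show ?case
    proof (cases "last h \<in> T")
      case True
      then show ?thesis using C V01 lam by (simp add: fail_T)
    next
      case False
      let ?s = "last h"
      let ?w = "\<lambda>(a, s'). weight unif \<tau> h a s'"
      let ?c = "C * lam ^ n"
      have c: "0 \<le> ?c" using C(1) lam by simp
      have sW: "?s \<in> W - T" using Suc.prems False by simp
      define G where "G = {(a, s') \<in> succs h. r s' < r ?s}"
      define k where "k = r ?s - 1"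
      have w0: "0 \<le> ?w x" if "x \<in> succs h" for x
        using weight_nonneg[OF st Suc.prems(1)] that by (cases x) auto
      have G: "\<epsilon> \<le> sum ?w G" and Gne: "r ?s > 0"
      proof -
        \<comment> \<open>Each opponent action \<open>b\<close> gets one good pair of profile and
          successor. Pairs for different actions differ in the last coordinate of the profile, so
          their weights add up, and averaging \<open>\<epsilon>\<close> over the opponent's
          distribution gives \<open>\<epsilon>\<close> again.\<close>
        let ?Q = "\<lambda>b x. fst x \<in> profiles g ?s \<and> fst x ! m = b \<and> snd x < ns \<and>
            r (snd x) < r ?s \<and> \<epsilon> \<le> (\<Prod>p<m. unif p h (fst x ! p)) * dlt g ?s (fst x) (snd x)"
        have "\<forall>b\<in>av g m ?s. \<exists>x. ?Q b x"
        proof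
          fix b assume "b \<in> av g m ?s"
          from \<epsilon>(3)[OF sW this] obtain a s' where "?Q b (a, s')" by auto
          then show "\<exists>x. ?Q b x" ..
        qed
        then obtain F where "\<forall>b\<in>av g m ?s. ?Q b (F b)" by (rule bchoice[THEN exE])
        then have F: "?Q b (F b)" if "b \<in> av g m ?s" for b using that by blast
        obtain b where "b \<in> av g m ?s" using av_nonempty s by blast
        with F[of b] show "r ?s > 0" by auto
        have inj: "inj_on F (av g m ?s)" using F by (intro inj_onI) metis
        have sub: "F ` av g m ?s \<subseteq> G" 
        proof
          fix x assume "x \<in> F ` av g m ?s"
          then obtain b where "b \<in> av g m ?s" "x = F b" by blast
          with F[of b] show "x \<in> G" by (simp add: G_def split_def mem_Times_iff)
        qed
        have "\<epsilon> = (\<Sum>b\<in>av g m ?s. \<tau> h b * \<epsilon>)"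
          unfolding sum_distrib_right[symmetric] using st Suc.prems(1) by (simp add: strats_def is_strat_def hist_def)
        also have "\<dots> \<le> (\<Sum>b\<in>av g m ?s. ?w (F b))"
        proof (rule sum_mono)
          fix b assume b: "b \<in> av g m ?s"
          have "\<tau> h b * \<epsilon> \<le> \<tau> h b * ((\<Prod>p<m. unif p h (fst (F b) ! p)) * dlt g ?s (fst (F b)) (snd (F b)))"
            using F[OF b] strats_nonneg[OF st Suc.prems(1)] by (intro mult_left_mono) auto
          also have "\<dots> = ?w (F b)" using F[OF b] by (simp add: weight_def split_def)
          finally show "\<tau> h b * \<epsilon> \<le> ?w (F b)" .
        qed
        also have "\<dots> = sum ?w (F ` av g m ?s)" by (simp add: sum.reindex[OF inj])
        also have "\<dots> \<le> sum ?w G"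
        proof (rule sum_mono2[OF _ sub])
          have *: "G \<subseteq> succs h" by (auto simp: G_def)
          then show "finite G" by (rule finite_subset) simp
          show "0 \<le> ?w x" if "x \<in> G - F ` av g m ?s" for x using w0 that * by blast
        qed
        finally show "\<epsilon> \<le> sum ?w G" .
      qed
      have rs: "r ?s = Suc k" "Suc k \<le> R" using Gne rR[OF s] by (auto simp: k_def)
      let ?b = "\<lambda>x. if x \<in> G then V k else V R"
      have step: "?w (a, s') * fail unif \<tau> n (h @ [s']) \<le> ?w (a, s') * (?c * ?b (a, s'))" if x: "(a, s') \<in> succs h" for a s'
      proof (cases "?w (a, s') = 0")
        case True
        then show ?thesis by simp
      next
        case False
        have b0: "0 \<le> ?b (a, s')" using V01 by auto
        have s': "s' < ns" "a \<in> profiles g ?s" using x by auto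
        have "\<forall>p<m. unif p h (a ! p) \<noteq> 0" "dlt g ?s a s' \<noteq> 0"
          using False by (auto simp: weight_def)
        then have "\<forall>p<m. a ! p \<in> D p ?s" "0 < dlt g ?s a s'"
          using sW unif_pos[OF sW] strats_nonneg(1)[OF st Suc.prems(1)] dlt_nonneg[OF s s'(2,1)]
          by (metis order_le_less)+
        then have "s' \<in> W" using win sW s' by (auto simp: win_def)
        then have "fail unif \<tau> n (h @ [s']) \<le> ?c * V (r s')"
          using Suc.IH[of "h @ [s']"] hist_snoc[OF Suc.prems(1) s'(1)] by simp
        also have "\<dots> \<le> ?c * ?b (a, s')"
          using x rR[OF s'(1)] rs by (intro mult_left_mono c) (auto simp: G_def intro!: V_mono)
        finally show ?thesis using w0[OF x] by (intro mult_left_mono) auto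
      qed
      have "fail unif \<tau> (Suc n) h = (\<Sum>x\<in>succs h. ?w x * fail unif \<tau> n (h @ [snd x]))"
        unfolding fail_Suc[OF st Suc.prems(1) False] by (simp add: split_def)
      also have "\<dots> \<le> ?c * (V R - \<epsilon> * (V R - V k))"
      proof (rule weighted_average_le[OF _ _ _ G _ c])
        show "G \<subseteq> succs h" by (auto simp: G_def)
        show "sum ?w (succs h) = 1" using sum_weight[OF st Suc.prems(1)] .
        show "V k \<le> V R" using V_mono rs by simp
        show "?w x * fail unif \<tau> n (h @ [snd x]) \<le> ?w x * (?c * ?b x)" if "x \<in> succs h" for x
          using step[of "fst x" "snd x"] that by (simp only: prod.collapse)
      qed simp
      also have "\<dots> \<le> ?c * (lam * V (Suc k))"
        using contract[OF rs(2)] by (intro mult_left_mono c)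
      finally show ?thesis using rs by (simp add: mult_ac)
    qed
  qed
  have "fail unif \<tau> n h \<le> C * lam ^ n" if "is_strat g m \<tau>" "hist h" "last h \<in> W" for \<tau> n h
  proof -
    have "C * lam ^ n * V (r (last h)) \<le> C * lam ^ n * 1"
      using C(1) lam V01 by (intro mult_left_mono) auto
    then show ?thesis using main[OF that, of n] by linarith
  qed
  then show ?thesis by (rule that[of lam C, OF lam])
qed

lemma win_imp_almost_sure: "almost_sure g"
  unfolding almost_sure_def
proof (intro exI[of _ unif] conjI allI impI)
  fix \<tau> assume \<tau>: "is_strat g m \<tau>"
  obtain lam C where C: "0 \<le> lam" "lam < 1"
    "\<And>\<tau> h n. is_strat g m \<tau> \<Longrightarrow> hist h \<Longrightarrow> last h \<in> W \<Longrightarrow> fail unif \<tau> n h \<le> C * lam ^ n"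
    by (rule fail_decays, rule that, assumption+)
  have h: "hist [rg_s0 g]" using s0 by (simp add: hist_def)
  have st: "strats unif \<tau>" using \<tau> is_strat_unif by (simp add: strats_def)
  have W: "rg_s0 g \<in> W" using win by (simp add: win_def)
  have "(\<lambda>n. C * lam ^ n) \<longlonglongrightarrow> C * 0"
    by (intro tendsto_mult tendsto_const LIMSEQ_power_zero) (use C in simp)
  then have "(\<lambda>n. C * lam ^ n) \<longlonglongrightarrow> 0" by simp
  then have "(\<lambda>n. fail unif \<tau> n [rg_s0 g]) \<longlonglongrightarrow> 0"
    by (rule tendsto_sandwich[OF _ _ tendsto_const, rotated 2])
      (use C(3)[OF \<tau> h] W fail_nonneg[OF st h] in auto)
  from tendsto_diff[OF tendsto_const[of 1] this] show "(\<lambda>n. reach_n g unif \<tau> n [rg_s0 g]) \<longlonglongrightarrow> 1"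
    by simp
qed (rule is_strat_unif)

end

subsection \<open>Winning histories\<close>

context
  fixes \<sigma>
  assumes team: "\<And>p. p < m \<Longrightarrow> is_strat g p (\<sigma> p)"
begin

definition winning :: "nat list \<Rightarrow> bool" where
  "winning h \<longleftrightarrow> hist h \<and> (\<forall>\<tau>. is_strat g m \<tau> \<longrightarrow> (\<lambda>n. reach_n g \<sigma> \<tau> n h) \<longlonglongrightarrow> 1)"

lemma reach_cong:
  "(\<And>h'. \<tau> (h @ h') = \<tau>' (h @ h')) \<Longrightarrow> reach_n g \<sigma> \<tau> n h = reach_n g \<sigma> \<tau>' n h"
proof (induction n arbitrary: h)
  case (Suc n)
  have "reach_n g \<sigma> \<tau> n (h @ [s']) = reach_n g \<sigma> \<tau>' n (h @ [s'])" for s'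
    by (rule Suc.IH) (use Suc.prems in simp)
  moreover have "\<tau> h = \<tau>' h" using Suc.prems[of "[]"] by simp
  ultimately show ?case unfolding reach_n.simps by (simp only:)
qed simp

text \<open>Let the opponent play \<open>a ! m\<close> at \<open>h\<close> and then follow any
  strategy. The successor has positive weight \<open>c\<close>, so the failure probability after it
  is at most \<open>1 / c\<close> times the one from \<open>h\<close>, which tends to 0.\<close>

lemma winning_step:
  assumes h: "winning h" "last h \<notin> T" and a: "a \<in> profiles g (last h)" "\<forall>p<m. 0 < \<sigma> p h (a ! p)"
    and s': "s' < ns" "0 < dlt g (last h) a s'"
  shows "winning (h @ [s'])"
  unfolding winning_def
proof (intro conjI allI impI)
  have hist: "hist h" using h by (simp add: winning_def)
  show "hist (h @ [s'])" using hist s' by (simp add: hist_snoc)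
  fix \<tau> assume \<tau>: "is_strat g m \<tau>"
  define \<tau>' where "\<tau>' = \<tau>(h := point (a ! m))"
  have "a ! m \<in> av g m (last h)" using a by (simp add: profiles_def)
  then have st': "is_strat g m \<tau>'" using \<tau> by (auto simp: is_strat_def \<tau>'_def point_def)
  then have ss: "strats \<sigma> \<tau>'" using team by (simp add: strats_def)
  have ss0: "strats \<sigma> \<tau>" using team \<tau> by (simp add: strats_def)
  define c where "c = weight \<sigma> \<tau>' h a s'"
  have "0 < (\<Prod>p<m. \<sigma> p h (a ! p))" using a by (intro prod_pos) auto
  then have c: "0 < c" using s' by (simp add: c_def weight_def \<tau>'_def point_def)
  have lim: "(\<lambda>n. fail \<sigma> \<tau>' (Suc n) h / c) \<longlonglongrightarrow> (1 - 1) / c"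
    using h st' c unfolding winning_def by (intro tendsto_intros LIMSEQ_Suc) auto
  \<comment> \<open>The modification concerns the history \<open>h\<close> alone, and every history
    read from here on properly extends \<open>h\<close>.\<close>
  have eq: "reach_n g \<sigma> \<tau>' n (h @ [s']) = reach_n g \<sigma> \<tau> n (h @ [s'])" for n
    by (rule reach_cong) (simp add: \<tau>'_def)
  have "fail \<sigma> \<tau> n (h @ [s']) \<le> fail \<sigma> \<tau>' (Suc n) h / c" for n
  proof -
    have "c * fail \<sigma> \<tau>' n (h @ [s']) = (case (a, s') of (a, s') \<Rightarrow> weight \<sigma> \<tau>' h a s' * fail \<sigma> \<tau>' n (h @ [s']))"
      by (simp add: c_def)
    also have "\<dots> \<le> (\<Sum>(a, s')\<in>succs h. weight \<sigma> \<tau>' h a s' * fail \<sigma> \<tau>' n (h @ [s']))"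
    proof (rule member_le_sum)
      fix x assume "x \<in> succs h - {(a, s')}"
      then show "0 \<le> (case x of (a, s') \<Rightarrow> weight \<sigma> \<tau>' h a s' * fail \<sigma> \<tau>' n (h @ [s']))"
        using weight_nonneg[OF ss hist, of "fst x" "snd x"] fail_nonneg[OF ss hist_snoc[OF hist], of "snd x"]
        by (auto simp: split_def intro!: mult_nonneg_nonneg)
    qed (use a s' in auto)
    also have "\<dots> = fail \<sigma> \<tau>' (Suc n) h" by (rule fail_Suc[OF ss hist h(2), symmetric])
    finally show ?thesis using c by (simp add: eq field_simps)
  qed
  note le = this
  have "(\<lambda>n. fail \<sigma> \<tau> n (h @ [s'])) \<longlonglongrightarrow> 0"
  proof (rule tendsto_sandwich[OF _ _ tendsto_const])
    show "\<forall>\<^sub>F n in sequentially. 0 \<le> fail \<sigma> \<tau> n (h @ [s'])"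
      by (intro always_eventually allI fail_nonneg[OF ss0 hist_snoc[OF hist s'(1)]])
    show "\<forall>\<^sub>F n in sequentially. fail \<sigma> \<tau> n (h @ [s']) \<le> fail \<sigma> \<tau>' (Suc n) h / c"
      by (intro always_eventually allI le)
    show "(\<lambda>n. fail \<sigma> \<tau>' (Suc n) h / c) \<longlonglongrightarrow> 0" using lim by (simp del: reach_n.simps)
  qed
  from tendsto_diff[OF tendsto_const[of 1] this] show "(\<lambda>n. reach_n g \<sigma> \<tau> n (h @ [s'])) \<longlonglongrightarrow> 1"
    by simp
qed

definition Wset :: "nat set" where
  "Wset = {last h | h. winning h}"

text \<open>Safety refers to the fixed set \<open>Wset\<close>, progress to the current layer
  \<open>Y\<close>. This split makes the layers grow while the final supports still stay inside
  \<open>Wset\<close>.\<close>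

definition attracts :: "nat set \<Rightarrow> (nat \<Rightarrow> nat set) \<Rightarrow> nat \<Rightarrow> bool" where
  "attracts Y D s \<longleftrightarrow> (\<forall>p<m. D p \<subseteq> av g p s) \<and>
     (\<forall>a\<in>profiles g s. (\<forall>p<m. a ! p \<in> D p) \<longrightarrow> (\<forall>s'<ns. dlt g s a s' > 0 \<longrightarrow> s' \<in> Wset)) \<and>
     (\<forall>b\<in>av g m s. \<exists>a\<in>profiles g s. (\<forall>p<m. a ! p \<in> D p) \<and> a ! m = b \<and>
        (\<exists>s'<ns. dlt g s a s' > 0 \<and> s' \<in> Y))"

fun attr :: "nat \<Rightarrow> nat set" where
  "attr 0 = T"
| "attr (Suc k) = attr k \<union> {s \<in> Wset. \<exists>D. attracts (attr k) D s}"

lemma attr_mono: "j \<le> k \<Longrightarrow> attr j \<subseteq> attr k"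
  by (induction k) (auto simp: le_Suc_eq)

text \<open>Each of the finitely many states that ever enters has a first layer; the largest of
  these layers contains them all.\<close>

lemma attr_stable: "\<exists>k. \<forall>j. attr j \<inter> {..<ns} \<subseteq> attr k"
proof -
  define f where "f s = (LEAST k. s \<in> attr k)" for s
  have "attr j \<inter> {..<ns} \<subseteq> attr (Max (insert 0 (f ` {..<ns})))" for j
  proof
    fix s assume s: "s \<in> attr j \<inter> {..<ns}"
    then have "s \<in> attr (f s)" unfolding f_def by (auto intro: LeastI)
    moreover have "f s \<le> Max (insert 0 (f ` {..<ns}))" using s by simp
    ultimately show "s \<in> attr (Max (insert 0 (f ` {..<ns})))" using attr_mono by blast
  qed
  then show ?thesis by blast
qed

text \<open>If the attractor missed a winning history, the opponent could avoid it forever by answering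
  the support that the team uses at each history.\<close>

lemma Wset_attracted: "\<exists>k. Wset \<subseteq> attr k"
proof -
  obtain k where k: "\<And>j. attr j \<inter> {..<ns} \<subseteq> attr k" using attr_stable by blast
  define supp where "supp h p = {c. 0 < \<sigma> p h c}" for h p
  let ?esc = "\<lambda>h b. b \<in> av g m (last h) \<and> (\<forall>a\<in>profiles g (last h). (\<forall>p<m. a ! p \<in> supp h p) \<and> a ! m = b \<longrightarrow>
      (\<forall>s'<ns. dlt g (last h) a s' > 0 \<longrightarrow> s' \<notin> attr k))"
  have T: "T \<subseteq> attr k" using attr_mono[of 0 k] by simp
  have esc: "\<exists>b. ?esc h b" if h: "winning h" "last h \<notin> attr k" for h
  proof (rule ccontr)
    assume no: "\<not> ?thesis"
    have hist: "hist h" using h by (simp add: winning_def)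
    have hT: "last h \<notin> T" using h T by blast
    have "supp h p \<subseteq> av g p (last h)" if "p < m" for p
      using team[OF that] hist unfolding is_strat_def hist_def supp_def by force
    moreover have "s' \<in> Wset" if "a\<in>profiles g (last h)" "\<forall>p<m. a ! p \<in> supp h p" "s' < ns" "dlt g (last h) a s' > 0" for a s'
      using winning_step[OF h(1) hT that(1) _ that(3,4)] that(2) unfolding Wset_def supp_def by force
    \<comment> \<open>Without an escaping action, the supports played after \<open>h\<close> would
      put its last state into layer \<open>Suc k\<close>, which adds no new state to layer
      \<open>k\<close>.\<close>
    ultimately have "attracts (attr k) (supp h) (last h)"
      using no unfolding attracts_def by blast
    moreover have "last h \<in> Wset" using h by (auto simp: Wset_def)
    ultimately have "last h \<in> attr (Suc k)" by auto
    then show False using k[of "Suc k"] h(2) hist_last[OF hist] by blast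
  qed
  \<comment> \<open>Where no escaping action exists, any available action serves as the default,
    since a strategy must be defined after every history.\<close>
  define pick where "pick h = (if \<exists>b. ?esc h b then SOME b. ?esc h b else SOME b. b \<in> av g m (last h))" for h
  have pick: "?esc h (pick h)" if "winning h" "last h \<notin> attr k" for h
    unfolding pick_def if_P[OF esc[OF that]] by (rule someI_ex[OF esc[OF that]])
  have pick_av: "pick h \<in> av g m (last h)" if "hist h" for h
  proof (cases "\<exists>b. ?esc h b")
    case True
    then show ?thesis unfolding pick_def if_P[OF True] by (rule someI_ex[THEN conjunct1])
  next
    case False
    have "\<exists>b. b \<in> av g m (last h)" using av_nonempty hist_last[OF that] by blast
    then show ?thesis unfolding pick_def if_not_P[OF False] by (rule someI_ex)
  qed
  define \<tau> where "\<tau> h = point (pick h)" for h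
  have \<tau>: "is_strat g m \<tau>" unfolding \<tau>_def by (rule is_strat_point) (rule pick_av)
  then have ss: "strats \<sigma> \<tau>" using team by (simp add: strats_def)
  \<comment> \<open>A successor of positive weight is again a winning history and again outside
    \<open>attr k\<close>, which contains the target; so the opponent can repeat the argument at
    every step.\<close>
  have zero: "reach_n g \<sigma> \<tau> n h = 0" if "winning h" "last h \<notin> attr k" for n h
    using that
  proof (induction n arbitrary: h)
    case 0
    then show ?case using T by auto
  next
    case (Suc n)
    have hT: "last h \<notin> T" using Suc.prems T by blast
    have hist: "hist h" using Suc.prems by (simp add: winning_def)
    have "weight \<sigma> \<tau> h a s' * reach_n g \<sigma> \<tau> n (h @ [s']) = 0" if x: "(a, s') \<in> succs h" for a s'
    proof (cases "weight \<sigma> \<tau> h a s' = 0")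
      case False
      have *: "\<forall>p<m. 0 < \<sigma> p h (a ! p)" "a ! m = pick h" "0 < dlt g (last h) a s'"
        using False strats_nonneg(1)[OF ss hist] dlt_nonneg[OF hist_last[OF hist], of a s'] x
        by (auto simp: weight_def \<tau>_def point_def order_less_le split: if_splits)
      have "winning (h @ [s'])" using winning_step[OF Suc.prems(1) hT _ *(1) _ *(3)] x by auto
      moreover have "s' \<notin> attr k" using pick[OF Suc.prems] * x by (auto simp: supp_def)
      ultimately show ?thesis using Suc.IH[of "h @ [s']"] by simp
    qed simp
    then show ?case unfolding reach_Suc[OF hT] by (intro sum.neutral) auto
  qed
  have "Wset \<subseteq> attr k"
  proof
    fix s assume "s \<in> Wset"
    then obtain h where h: "winning h" "s = last h" by (auto simp: Wset_def)
    show "s \<in> attr k"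
    proof (rule ccontr)
      assume "s \<notin> attr k"
      then have "(\<lambda>n. reach_n g \<sigma> \<tau> n h) = (\<lambda>n. 0)" using zero h by auto
      moreover have "(\<lambda>n. reach_n g \<sigma> \<tau> n h) \<longlonglongrightarrow> 1" using h \<tau> by (simp add: winning_def)
      ultimately show False using LIMSEQ_unique[OF tendsto_const] by fastforce
    qed
  qed
  then show ?thesis ..
qed

text \<open>The rank of a state is its first layer. Outside the target that layer is positive and
  was entered through \<open>attracts\<close>, whose support becomes the support at that
  state.\<close>

lemma win_of_winning:
  assumes "winning [rg_s0 g]"
  shows "\<exists>W D r. win g W D r"
proof -
  from Wset_attracted obtain k where k: "Wset \<subseteq> attr k" ..
  define r where "r s = (LEAST j. s \<in> attr j)" for s
  have r: "s \<in> attr (r s)" "s \<in> attr j \<Longrightarrow> r s \<le> j" if "s \<in> Wset" for s j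
  proof -
    have "s \<in> attr k" using that k by blast
    then show "s \<in> attr (r s)" unfolding r_def by (rule LeastI)
    show "r s \<le> j" if "s \<in> attr j" using that unfolding r_def by (rule Least_le)
  qed
  have "\<exists>D. s \<notin> T \<longrightarrow> attracts (attr (r s - 1)) D s \<and> 0 < r s" if s: "s \<in> Wset" for s
  proof (cases "s \<in> T")
    case False
    then have "r s \<noteq> 0" using r(1)[OF s] by (intro notI) simp
    then obtain j where j: "r s = Suc j" using not0_implies_Suc by blast
    have "s \<notin> attr j" using r(2)[OF s, of j] j by auto
    then show ?thesis using r(1)[OF s] j by auto
  qed simp
  then have "\<forall>s\<in>Wset. \<exists>D. s \<notin> T \<longrightarrow> attracts (attr (r s - 1)) D s \<and> 0 < r s" ..
  from bchoice[OF this] obtain D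
    where D: "\<forall>s\<in>Wset. s \<notin> T \<longrightarrow> attracts (attr (r s - 1)) (D s) s \<and> 0 < r s" ..
  have sub: "Wset \<subseteq> {..<ns}" using hist_last by (auto simp: Wset_def winning_def)
  have "win g Wset (\<lambda>p s. D s p) r"
    unfolding win_def
  proof (intro conjI ballI)
    show "rg_s0 g \<in> Wset" using assms by (force simp: Wset_def)
    show "Wset \<subseteq> {..<ns}" by (rule sub)
    fix s assume s: "s \<in> Wset - T"
    have at: "attracts (attr (r s - 1)) (D s) s" "0 < r s" using D s by auto
    show "\<forall>p<m. D s p \<subseteq> av g p s" using at by (simp add: attracts_def)
    { fix a assume a: "a \<in> profiles g s"
      show "(\<forall>p<m. a ! p \<in> D s p) \<longrightarrow> (\<forall>s'<ns. 0 < dlt g s a s' \<longrightarrow> s' \<in> Wset)"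
        using at a by (simp add: attracts_def) }
    fix b assume b: "b \<in> av g m s"
    then obtain a s' where a: "a \<in> profiles g s" "\<forall>p<m. a ! p \<in> D s p" "a ! m = b" "s' < ns" "0 < dlt g s a s'" "s' \<in> attr (r s - 1)"
      using at unfolding attracts_def by blast
    have "r s' \<le> r s - 1" unfolding r_def[of s'] using a(6) by (rule Least_le)
    then show "\<exists>a\<in>profiles g s. (\<forall>p<m. a ! p \<in> D s p) \<and> a ! m = b \<and> (\<exists>s'<ns. 0 < dlt g s a s' \<and> r s' < r s)"
      using a at(2) by (intro bexI[of _ a] conjI exI[of _ s']) auto
  qed
  then show ?thesis by blast
qed

end

theorem almost_sure_iff_win: "almost_sure g \<longleftrightarrow> (\<exists>W D r. win g W D r)"
proof
  assume "almost_sure g"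
  then obtain \<sigma> where \<sigma>: "\<And>p. p < m \<Longrightarrow> is_strat g p (\<sigma> p)"
     "\<And>\<tau>. is_strat g m \<tau> \<Longrightarrow> (\<lambda>n. reach_n g \<sigma> \<tau> n [rg_s0 g]) \<longlonglongrightarrow> 1"
    by (auto simp: almost_sure_def)
  then have "winning \<sigma> [rg_s0 g]" using s0 by (simp add: winning_def[OF \<sigma>(1)] hist_def)
  then show "\<exists>W D r. win g W D r" using win_of_winning[of \<sigma>] \<sigma>(1) by blast
qed (auto intro: win_imp_almost_sure)

end

section \<open>Serialised objects inside a word\<close>

definition occ :: "bool list \<Rightarrow> nat \<Rightarrow> nat \<Rightarrow> bool list \<Rightarrow> bool" where
  "occ x i j w \<longleftrightarrow> (\<exists>u v. x = u @ w @ v \<and> length u = i \<and> j = i + length w)"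

text \<open>Values can be exponential in the length of \<open>x\<close>, so formulas name an object
  by the position at which its code starts; for a prefix code that position determines the
  object.\<close>

definition val :: "('a \<Rightarrow> bool list) \<Rightarrow> bool list \<Rightarrow> nat \<Rightarrow> 'a \<Rightarrow> bool" where
  "val f x i a \<longleftrightarrow> (\<exists>j. occ x i j (f a))"

definition prefix_code :: "('a \<Rightarrow> bool list) \<Rightarrow> bool" where
  "prefix_code f \<longleftrightarrow> (\<forall>a b u v. f a @ u = f b @ v \<longrightarrow> a = b)"

lemma occ_Nil [simp]: "occ x i j [] \<longleftrightarrow> i = j \<and> j \<le> length x"
proof
  assume "i = j \<and> j \<le> length x"
  then show "occ x i j []" unfolding occ_def by (intro exI[of _ "take i x"] exI[of _ "drop i x"]) simp
qed (auto simp: occ_def)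

lemma occ_length: "occ x i j w \<Longrightarrow> j = i + length w \<and> j \<le> length x"
  by (auto simp: occ_def)

lemma occ_drop: "occ x i j w \<longleftrightarrow> j = i + length w \<and> (\<exists>r. drop i x = w @ r) \<and> j \<le> length x"
proof
  assume a: "j = i + length w \<and> (\<exists>r. drop i x = w @ r) \<and> j \<le> length x"
  then obtain r where "drop i x = w @ r" by blast
  then have "x = take i x @ w @ r" by (metis append_take_drop_id)
  moreover have "length (take i x) = i" using a by simp
  ultimately show "occ x i j w" unfolding occ_def using a by blast
qed (auto simp: occ_def)

lemma occ_append: "occ x i k (u @ v) \<longleftrightarrow> (\<exists>j. occ x i j u \<and> occ x j k v)"
proof
  assume "occ x i k (u @ v)"
  then obtain p s where x: "x = p @ (u @ v) @ s" "length p = i" "k = i + length (u @ v)" unfolding occ_def by blast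
  have "occ x i (i + length u) u" unfolding occ_def by (intro exI[of _ p] exI[of _ "v @ s"]) (simp add: x)
  moreover have "occ x (i + length u) k v" unfolding occ_def by (intro exI[of _ "p @ u"] exI[of _ s]) (simp add: x)
  ultimately show "\<exists>j. occ x i j u \<and> occ x j k v" by blast
next
  assume "\<exists>j. occ x i j u \<and> occ x j k v"
  then obtain j where j: "occ x i j u" "occ x j k v" by blast
  from j(1) obtain p s where p: "x = p @ u @ s" "length p = i" "j = i + length u" unfolding occ_def by blast
  from j(2) obtain p' s' where p': "x = p' @ v @ s'" "length p' = j" "k = j + length v" unfolding occ_def by blast
  note x = p(1,2) p'(1) p'(2,3)[unfolded p(3)]
  have "(p @ u) @ s = p' @ v @ s'" "length (p @ u) = length p'" using x(1,3) x(2,4) by simp_all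
  then have "s = v @ s'" by (metis append_eq_append_conv)
  then show "occ x i k (u @ v)" unfolding occ_def using x by (intro exI[of _ p] exI[of _ s']) simp
qed

lemma occ_single: "occ x i k [b] \<longleftrightarrow> k = Suc i \<and> i < length x \<and> x ! i = b"
proof
  assume *: "k = Suc i \<and> i < length x \<and> x ! i = b"
  then have "x = take i x @ [b] @ drop (Suc i) x" using id_take_nth_drop[of i x] by simp
  then show "occ x i k [b]" unfolding occ_def using * by (intro exI[of _ "take i x"] exI[of _ "drop (Suc i) x"]) simp
qed (auto simp: occ_def nth_append)

lemma occ_Cons: "occ x i j (b # w) \<longleftrightarrow> i < length x \<and> x ! i = b \<and> occ x (Suc i) j w"
  using occ_append[of x i j "[b]" w] by (auto simp: occ_single)

lemma occ_nth: "occ x i j w \<Longrightarrow> l < length w \<Longrightarrow> x ! (i + l) = w ! l"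
  by (auto simp: occ_def nth_append)

lemma occ_prefix: "prefix_code f \<Longrightarrow> occ x i j (f a) \<Longrightarrow> occ x i k (f b) \<Longrightarrow> a = b \<and> j = k"
  unfolding occ_drop prefix_code_def by metis

lemma val_unique:
  assumes "prefix_code f" "val f x i a" "val f x i b" shows "a = b"
proof -
  obtain j k where "occ x i j (f a)" "occ x i k (f b)" using assms(2,3) unfolding val_def by (elim exE) rule
  then show ?thesis using occ_prefix[OF assms(1)] by simp
qed

lemma val_occ: "val f x i a \<longleftrightarrow> occ x i (i + length (f a)) (f a)"
  unfolding val_def using occ_length by blast

declare ser_nat.simps [simp del]

lemma ser_nat_0: "ser_nat 0 = [False]"
  by (simp add: ser_nat.simps)

lemma ser_nat_pos: "0 < n \<Longrightarrow> ser_nat n = True # odd n # ser_nat (n div 2)"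
  by (simp add: ser_nat.simps[of n])

lemma prefix_ser_nat: "prefix_code ser_nat"
proof -
  have "ser_nat a @ u = ser_nat b @ v \<Longrightarrow> a = b" for a b u v
  proof (induction a arbitrary: b rule: less_induct)
    case (less a)
    show ?case
    proof (cases "a = 0 \<or> b = 0")
      case True
      then show ?thesis using less.prems ser_nat_pos[of a] ser_nat_pos[of b]
        by (cases "a = 0"; cases "b = 0"; simp add: ser_nat_0)
    next
      case False
      then have "odd a = odd b" "a div 2 = b div 2"
        using less.prems less.IH[of "a div 2" "b div 2"] ser_nat_pos[of a] ser_nat_pos[of b] by auto
      then show ?thesis by presburger
    qed
  qed
  then show ?thesis unfolding prefix_code_def by blast
qed

text \<open>\<open>ser_list\<close> without the closing False, so that concatenation of lists
  becomes concatenation of words.\<close>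

definition enc :: "('a \<Rightarrow> bool list) \<Rightarrow> 'a list \<Rightarrow> bool list" where
  "enc f xs = concat (map (\<lambda>x. True # f x) xs)"

lemma enc_simps [simp]: "enc f [] = []" "enc f (a # as) = True # f a @ enc f as" "enc f (as @ bs) = enc f as @ enc f bs"
  by (simp_all add: enc_def)

lemma ser_list_enc: "ser_list f xs = enc f xs @ [False]"
  by (simp add: ser_list_def enc_def)

text \<open>Elements begin with True while the list ends with False, so a parse of \<open>as\<close>
  cannot run past the end of \<open>bs\<close>, and the prefix code forces the elements to agree one
  by one.\<close>

lemma enc_prefix:
  assumes "prefix_code f" "enc f as @ u = enc f bs @ False # v"
  shows "length as \<le> length bs \<and> as = take (length as) bs"
  using assms(2)
proof (induction as arbitrary: bs)
  case (Cons a as)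
  then obtain b bs' where bs: "bs = b # bs'" by (cases bs) auto
  then have eq: "f a @ enc f as @ u = f b @ enc f bs' @ False # v" using Cons.prems by simp
  then have "a = b" using assms(1) unfolding prefix_code_def by blast
  then show ?case using Cons.IH[of bs'] eq bs by simp
qed simp

lemma prefix_ser_list:
  assumes "prefix_code f" shows "prefix_code (ser_list f)"
  unfolding prefix_code_def
proof (intro allI impI)
  fix a b u v assume "ser_list f a @ u = ser_list f b @ v"
  then have "enc f a @ False # u = enc f b @ False # v" by (simp add: ser_list_enc)
  from enc_prefix[OF assms this] enc_prefix[OF assms this[symmetric]] show "a = b"
    by (metis le_antisym take_all)
qed

text \<open>Parsing a list of unbounded length is an iteration. Its recursion equations
  \<open>skip_0\<close> and \<open>skip_Suc\<close> are what a guessed relation is checked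
  against.\<close>

definition skip :: "('a \<Rightarrow> bool list) \<Rightarrow> bool list \<Rightarrow> nat \<Rightarrow> nat \<Rightarrow> nat \<Rightarrow> bool" where
  "skip f x i k j \<longleftrightarrow> (\<exists>vs. length vs = k \<and> occ x i j (enc f vs))"

lemma skip_0: "skip f x i 0 j \<longleftrightarrow> i = j \<and> j \<le> length x"
  by (auto simp: skip_def)

lemma skip_Suc: "skip f x i (Suc k) j \<longleftrightarrow> (\<exists>j'. skip f x i k j' \<and> j' < length x \<and> x ! j' \<and> (\<exists>v. occ x (Suc j') j (f v)))"
proof -
  have "skip f x i (Suc k) j \<longleftrightarrow> (\<exists>vs v. length vs = k \<and> occ x i j (enc f (vs @ [v])))"
    unfolding skip_def by (metis length_append_singleton length_Suc_conv_rev)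
  also have "\<dots> \<longleftrightarrow> (\<exists>j'. skip f x i k j' \<and> j' < length x \<and> x ! j' \<and> (\<exists>v. occ x (Suc j') j (f v)))"
  proof -
    have "enc f (vs @ [v]) = enc f vs @ True # f v" for vs v by simp
    then show ?thesis unfolding skip_def by (auto simp: occ_append occ_Cons)
  qed
  finally show ?thesis .
qed

lemma skip_bounds: "skip f x i k j \<Longrightarrow> i + k \<le> j \<and> j \<le> length x"
proof -
  have "length vs \<le> length (enc f vs)" for vs :: "'a list" by (induction vs) auto
  then show "skip f x i k j \<Longrightarrow> i + k \<le> j \<and> j \<le> length x"
    unfolding skip_def using occ_length add_le_cancel_left by metis
qed

text \<open>The successor steps over the marker True that precedes every element.\<close>

definition elem_pos :: "('a \<Rightarrow> bool list) \<Rightarrow> nat \<Rightarrow> 'a list \<Rightarrow> nat \<Rightarrow> nat" where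
  "elem_pos f i vs k = Suc (i + length (enc f (take k vs)))"

lemma skip_val:
  assumes "prefix_code f" "val (ser_list f) x i vs"
  shows "skip f x i k j \<longleftrightarrow> k \<le> length vs \<and> j = i + length (enc f (take k vs))"
proof -
  obtain r where r: "drop i x = enc f vs @ False # r" "i + length (enc f vs) + 1 \<le> length x"
    using assms(2) by (auto simp: val_occ occ_drop ser_list_enc)
  show ?thesis
  proof
    assume "skip f x i k j"
    then obtain ws u where ws: "length ws = k" "drop i x = enc f ws @ u" "j = i + length (enc f ws)"
      by (auto simp: skip_def occ_drop)
    then show "k \<le> length vs \<and> j = i + length (enc f (take k vs))"
      using enc_prefix[OF assms(1), of ws u vs r] r by auto
  next
    assume k: "k \<le> length vs \<and> j = i + length (enc f (take k vs))"
    have "enc f vs = enc f (take k vs) @ enc f (drop k vs)" by (metis append_take_drop_id enc_simps(3))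
    then show "skip f x i k j" unfolding skip_def occ_drop using k r
      by (intro exI[of _ "take k vs"]) auto
  qed
qed

lemma elem_val:
  assumes "val (ser_list f) x i vs" "k < length vs"
  shows "val f x (elem_pos f i vs k) (vs ! k)" "x ! (elem_pos f i vs k - 1)" "elem_pos f i vs k \<le> length x"
proof -
  have "enc f vs = enc f (take k vs) @ True # f (vs ! k) @ enc f (drop (Suc k) vs)"
    using id_take_nth_drop[OF assms(2)] enc_simps by metis
  then obtain j where "occ x i j (enc f (take k vs) @ True # f (vs ! k) @ enc f (drop (Suc k) vs) @ [False])"
    using assms(1) unfolding val_def ser_list_enc by auto
  then obtain j1 j2 where j: "occ x i j1 (enc f (take k vs))" "j1 < length x" "x ! j1" "occ x (Suc j1) j2 (f (vs ! k))"
    unfolding occ_append occ_Cons by auto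
  moreover have "elem_pos f i vs k = Suc j1" using occ_length[OF j(1)] by (simp add: elem_pos_def)
  ultimately show "val f x (elem_pos f i vs k) (vs ! k)" "x ! (elem_pos f i vs k - 1)" "elem_pos f i vs k \<le> length x"
    unfolding val_def by auto
qed

lemma list_end_val:
  assumes "val (ser_list f) x i vs"
  shows "i + length (enc f vs) < length x" "\<not> x ! (i + length (enc f vs))"
  using assms unfolding val_occ ser_list_enc occ_append by (auto simp: occ_Cons dest: occ_length)

lemma ex_less_eq: "(\<exists>a<n. a = t \<and> P a) \<longleftrightarrow> t < n \<and> P t" for n t :: nat
  by auto

section \<open>Binary numerals at a position of the word\<close>

definition bitx :: "bool list \<Rightarrow> nat \<Rightarrow> bool" where "bitx x i \<longleftrightarrow> i < length x \<and> x ! i"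
definition zerox :: "bool list \<Rightarrow> nat \<Rightarrow> bool" where "zerox x i \<longleftrightarrow> i < length x \<and> \<not> x ! i"

lemma so_bitx: "so_definable (\<lambda>x R e. bitx x (e i))"
  unfolding bitx_def by (rule so_bit)

lemma so_below_length: "so_definable (\<lambda>x R e. e i < length x)"
proof -
  have "so_definable (\<lambda>x R e. \<exists>n<bnd x. n = length x \<and> e i < n)" by (intro so_ex so_conj so_length so_less)
  then show ?thesis by (rule so_cong) (auto simp: bnd_def)
qed

lemma so_zerox: "so_definable (\<lambda>x R e. zerox x (e i))"
proof -
  have "so_definable (\<lambda>x R e. e i < length x \<and> \<not> bitx x (e i))"
    by (intro so_conj so_not so_bitx so_below_length)
  then show ?thesis by (rule so_cong) (auto simp: bitx_def zerox_def)
qed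

lemmas so_rules = so_ex so_all so_conj so_disj so_imp so_not so_eq so_add so_less so_le so_Suc so_const so_length
  so_bitx so_zerox so_below_length

text \<open>A numeral consists of \<open>K\<close> pairs of a marker True and a digit, lowest digit
  first, closed by False. The last digit must be 1, because \<open>ser_nat\<close> writes no leading
  zeros and other numerals are not in its range.\<close>

definition NatWidth :: "bool list \<Rightarrow> nat \<Rightarrow> nat \<Rightarrow> bool" where
  "NatWidth x i K \<longleftrightarrow> (\<forall>k<bnd x. k < K \<longrightarrow> (\<exists>q<bnd x. i + k = q \<and> (\<exists>p<bnd x. q + k = p \<and> bitx x p))) \<and>
     (\<exists>q<bnd x. i + K = q \<and> (\<exists>p<bnd x. q + K = p \<and> zerox x p \<and> (K = 0 \<or> (\<exists>r<bnd x. p = Suc r \<and> bitx x r))))"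

lemma so_NatWidth: "so_definable (\<lambda>x R e. NatWidth x (e i) (e j))"
  unfolding NatWidth_def by (intro so_rules)

lemma NatWidth_iff:
  assumes "K < bnd x"
  shows "NatWidth x i K \<longleftrightarrow> (\<forall>k<K. bitx x (i + 2 * k)) \<and> zerox x (i + 2 * K) \<and> (K = 0 \<or> bitx x (i + 2 * K - 1))"
proof -
  have b: "bitx x p \<Longrightarrow> p < bnd x" "zerox x p \<Longrightarrow> p < bnd x" for p by (auto simp: bitx_def zerox_def bnd_def)
  have 1: "(\<exists>q<bnd x. i + k = q \<and> (\<exists>p<bnd x. q + k = p \<and> bitx x p)) \<longleftrightarrow> bitx x (i + 2 * k)" for k
  proof -
    have eq: "i + k + k = i + 2 * k" by simp
    show ?thesis unfolding ex_eq_less eq using b(1)[of "i + 2 * k"] by auto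
  qed
  have "(\<exists>r<bnd x. p = Suc r \<and> bitx x r) \<longleftrightarrow> bitx x (p - 1)" if "0 < p" for p
    using b(1)[of "p - 1"] that by (cases p) auto
  note pred = this
  have 2: "(\<exists>q<bnd x. i + K = q \<and> (\<exists>p<bnd x. q + K = p \<and> zerox x p \<and> (K = 0 \<or> (\<exists>r<bnd x. p = Suc r \<and> bitx x r)))) \<longleftrightarrow>
      zerox x (i + 2 * K) \<and> (K = 0 \<or> bitx x (i + 2 * K - 1))"
  proof (cases "zerox x (i + 2 * K)")
    case True
    then have lt: "i + K < bnd x" "i + K + K < bnd x" using b(2)[OF True] by simp_all
    have eq: "i + K + K = i + 2 * K" by simp
    have "K = 0 \<or> (\<exists>r<bnd x. i + 2 * K = Suc r \<and> bitx x r) \<longleftrightarrow> K = 0 \<or> bitx x (i + 2 * K - 1)"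
      using pred[of "i + 2 * K"] by (cases "K = 0") simp_all
    then show ?thesis unfolding ex_eq_less using lt True unfolding eq by blast
  next
    case False
    have eq: "i + K + K = i + 2 * K" by simp
    show ?thesis unfolding ex_eq_less eq using False by blast
  qed
  show ?thesis unfolding NatWidth_def 1 2 using assms by auto
qed

definition nbits :: "nat \<Rightarrow> nat" where "nbits v = length (ser_nat v) div 2"

lemma length_ser_nat: "length (ser_nat v) = 2 * nbits v + 1"
proof -
  have "odd (length (ser_nat v))"
  proof (induction v rule: less_induct)
    case (less v)
    show ?case by (cases "v = 0") (auto simp: ser_nat_0 ser_nat_pos less)
  qed
  then show ?thesis unfolding nbits_def by simp
qed

lemma nbits_simps: "nbits 0 = 0" "0 < v \<Longrightarrow> nbits v = Suc (nbits (v div 2))"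
  by (simp_all add: nbits_def ser_nat_0 ser_nat_pos)

lemma less_two_power_nbits: "v < 2 ^ nbits v"
proof (induction v rule: less_induct)
  case (less v)
  show ?case
  proof (cases "v = 0")
    case False
    then have "v div 2 < 2 ^ nbits (v div 2)" using less by simp
    then show ?thesis using False by (simp add: nbits_simps)
  qed (simp add: nbits_simps)
qed

lemma ser_nat_nth: "k < nbits v \<Longrightarrow> ser_nat v ! (2 * k + 1) = bit v k"
proof (induction v arbitrary: k rule: less_induct)
  case (less v)
  then have v: "0 < v" using nbits_simps(1) by (cases "v = 0") auto
  show ?case
  proof (cases k)
    case 0
    then show ?thesis using v by (simp add: ser_nat_pos bit_0)
  next
    case (Suc l)
    then have "l < nbits (v div 2)" using less.prems v by (simp add: nbits_simps)
    then have "ser_nat (v div 2) ! (2 * l + 1) = bit (v div 2) l" using less.IH v by simp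
    then show ?thesis using v Suc by (simp add: ser_nat_pos bit_Suc)
  qed
qed

lemma bit_less_nbits: "bit (v :: nat) k \<Longrightarrow> k < nbits v"
proof (rule ccontr)
  assume "bit v k" "\<not> k < nbits v"
  then have "2 ^ nbits v \<le> (2 :: nat) ^ k" by (intro power_increasing) auto
  from less_le_trans[OF less_two_power_nbits this] have "v < 2 ^ k" .
  then show False using \<open>bit v k\<close> by (simp add: bit_iff_odd)
qed

lemma NatWidth_ex:
  "(\<forall>k<K. bitx x (i + 2 * k)) \<and> zerox x (i + 2 * K) \<and> (K = 0 \<or> bitx x (i + 2 * K - 1)) \<longleftrightarrow> (\<exists>v. nbits v = K \<and> val ser_nat x i v)"
proof (induction K arbitrary: i)
  case 0
  have "nbits v = 0 \<longleftrightarrow> v = 0" for v by (metis Zero_not_Suc nbits_simps neq0_conv)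
  moreover have "val ser_nat x i 0 \<longleftrightarrow> zerox x i" by (auto simp: val_def ser_nat_0 occ_single zerox_def)
  ultimately show ?case by simp
next
  case (Suc K)
  let ?A = "\<forall>k<K. bitx x (i + 2 + 2 * k)"
  have 1: "(\<forall>k<Suc K. bitx x (i + 2 * k)) \<longleftrightarrow> bitx x i \<and> ?A"
    by (auto simp: less_Suc_eq_0_disj)
  have 2: "(Suc K = 0 \<or> bitx x (i + 2 * Suc K - 1)) \<longleftrightarrow> (if K = 0 then bitx x (Suc i) else bitx x (i + 2 + 2 * K - 1))"
    by simp
  have 3: "i + 2 * Suc K = i + 2 + 2 * K" by simp
  have "K = 0 \<Longrightarrow> ?A" by simp
  then have "((\<forall>k<Suc K. bitx x (i + 2 * k)) \<and> zerox x (i + 2 * Suc K) \<and> (Suc K = 0 \<or> bitx x (i + 2 * Suc K - 1))) \<longleftrightarrow>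
      bitx x i \<and> (K = 0 \<longrightarrow> bitx x (Suc i)) \<and> (?A \<and> zerox x (i + 2 + 2 * K) \<and> (K = 0 \<or> bitx x (i + 2 + 2 * K - 1)))"
    unfolding 1 2 unfolding 3 if_bool_eq_conj by blast
  also have "\<dots> \<longleftrightarrow> bitx x i \<and> (K = 0 \<longrightarrow> bitx x (Suc i)) \<and> (\<exists>v. nbits v = K \<and> val ser_nat x (i + 2) v)"
    by (simp only: Suc.IH)
  also have "\<dots> \<longleftrightarrow> (\<exists>v. nbits v = Suc K \<and> val ser_nat x i v)"
  proof
    assume a: "bitx x i \<and> (K = 0 \<longrightarrow> bitx x (Suc i)) \<and> (\<exists>v. nbits v = K \<and> val ser_nat x (i + 2) v)"
    then obtain v where v: "nbits v = K" "val ser_nat x (i + 2) v" by blast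
    \<comment> \<open>Prepending the lowest digit. The side condition for \<open>K = 0\<close>
      forces this digit to be 1 when \<open>v\<close> is 0, so that \<open>u\<close> is positive and
      really begins with a digit pair.\<close>
    define u where "u = 2 * v + of_bool (x ! Suc i)"
    have len: "Suc i < length x" using v(2) occ_length by (fastforce simp: val_def)
    have "0 < u"
    proof (cases "v = 0")
      case True
      then have "K = 0" using v nbits_simps(1) by simp
      then show ?thesis using a by (simp add: u_def bitx_def)
    qed (simp add: u_def)
    then have u: "nbits u = Suc (nbits (u div 2))" "ser_nat u = True # odd u # ser_nat (u div 2)"
      by (rule nbits_simps ser_nat_pos)+
    have d: "u div 2 = v" "odd u = x ! Suc i" by (auto simp: u_def)
    have "val ser_nat x i u" using a v len unfolding val_def u(2) d by (simp add: occ_Cons bitx_def)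
    moreover have "nbits u = Suc K" using u(1) d v by simp
    ultimately show "\<exists>v. nbits v = Suc K \<and> val ser_nat x i v" by blast
  next
    assume "\<exists>v. nbits v = Suc K \<and> val ser_nat x i v"
    then obtain u where u: "nbits u = Suc K" "val ser_nat x i u" by blast
    then have u0: "0 < u" using nbits_simps(1) by (cases "u = 0") auto
    then have "nbits (u div 2) = K" using u nbits_simps(2) by simp
    moreover have odd: "K = 0 \<longrightarrow> odd u"
    proof
      assume "K = 0"
      then have "u < 2" using u less_two_power_nbits[of u] by simp
      then show "odd u" using u0 by (cases "u = 1") auto
    qed
    ultimately show "bitx x i \<and> (K = 0 \<longrightarrow> bitx x (Suc i)) \<and> (\<exists>v. nbits v = K \<and> val ser_nat x (i + 2) v)"
    proof -
      obtain j where "occ x i j (True # odd u # ser_nat (u div 2))"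
        using u(2) ser_nat_pos[OF u0] unfolding val_def by auto
      then have "bitx x i" "bitx x (Suc i) \<longleftrightarrow> odd u" "occ x (i + 2) j (ser_nat (u div 2))"
        by (auto simp: occ_Cons bitx_def)
      then show ?thesis using odd \<open>nbits (u div 2) = K\<close> unfolding val_def by blast
    qed
  qed
  finally show ?case .
qed

lemma NatWidth_val:
  assumes "K < bnd x" "val ser_nat x i v"
  shows "NatWidth x i K \<longleftrightarrow> K = nbits v"
  unfolding NatWidth_iff[OF assms(1)] NatWidth_ex using assms(2) val_unique[OF prefix_ser_nat] by blast

lemma nbits_bound: "val ser_nat x i v \<Longrightarrow> i + 2 * nbits v + 1 \<le> length x"
  unfolding val_occ using occ_length length_ser_nat by fastforce

definition IsNat :: "bool list \<Rightarrow> nat \<Rightarrow> nat \<Rightarrow> bool" where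
  "IsNat x i j \<longleftrightarrow> (\<exists>K<bnd x. NatWidth x i K \<and> (\<exists>q<bnd x. i + K = q \<and> (\<exists>p<bnd x. q + K = p \<and> j = Suc p)))"

lemma so_IsNat: "so_definable (\<lambda>x R e. IsNat x (e i) (e j))"
  unfolding IsNat_def by (intro so_rules so_NatWidth)

lemma IsNat_iff: "IsNat x i j \<longleftrightarrow> (\<exists>v. occ x i j (ser_nat v))"
proof
  assume "IsNat x i j"
  then obtain K where K: "K < bnd x" "NatWidth x i K" "j = i + 2 * K + 1" by (auto simp: IsNat_def)
  then obtain v where "nbits v = K" "val ser_nat x i v" using K(2) unfolding NatWidth_iff[OF K(1)] NatWidth_ex by blast
  then show "\<exists>v. occ x i j (ser_nat v)" using K(3) unfolding val_occ length_ser_nat by auto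
next
  assume "\<exists>v. occ x i j (ser_nat v)"
  then obtain v where v: "val ser_nat x i v" "j = i + 2 * nbits v + 1"
    using occ_length by (fastforce simp: val_def length_ser_nat)
  have "nbits v < bnd x" "i + 2 * nbits v < bnd x" using nbits_bound[OF v(1)] by (auto simp: bnd_def)
  then show "IsNat x i j" unfolding IsNat_def using v NatWidth_val[of "nbits v" x i v]
    by (intro exI[of _ "nbits v"]) auto
qed

text \<open>Digits beyond the width count as 0, so numerals of different widths can be compared
  digit by digit.\<close>

definition NatBit :: "bool list \<Rightarrow> nat \<Rightarrow> nat \<Rightarrow> bool" where
  "NatBit x i k \<longleftrightarrow> (\<exists>K<bnd x. NatWidth x i K \<and> k < K \<and> (\<exists>q<bnd x. i + k = q \<and> (\<exists>r<bnd x. q + k = r \<and> (\<exists>p<bnd x. p = Suc r \<and> bitx x p))))"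

lemma so_NatBit: "so_definable (\<lambda>x R e. NatBit x (e i) (e j))"
  unfolding NatBit_def by (intro so_rules so_NatWidth)

lemma NatBit_iff:
  assumes "val ser_nat x i v" shows "NatBit x i k \<longleftrightarrow> bit v k"
proof -
  have len: "i + 2 * nbits v + 1 \<le> length x" by (rule nbits_bound[OF assms])
  have "NatBit x i k \<longleftrightarrow> k < nbits v \<and> x ! (i + 2 * k + 1)"
  proof -
    have *: "nbits v < bnd x" using len by (auto simp: bnd_def)
    have "NatBit x i k \<longleftrightarrow> k < nbits v \<and> (\<exists>q<bnd x. i + k = q \<and> (\<exists>r<bnd x. q + k = r \<and> (\<exists>p<bnd x. p = Suc r \<and> bitx x p)))"
      unfolding NatBit_def using NatWidth_val[OF _ assms] * by blast
    also have "\<dots> \<longleftrightarrow> k < nbits v \<and> x ! (i + 2 * k + 1)"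
    proof (cases "k < nbits v")
      case True
      have eq: "Suc (i + k + k) = i + 2 * k + 1" by simp
      have "i + k < bnd x" "i + k + k < bnd x" "i + 2 * k + 1 < bnd x" "i + 2 * k + 1 < length x"
        using len True by (simp_all add: bnd_def)
      then show ?thesis unfolding ex_eq_less ex_less_eq bitx_def eq by blast
    qed simp
    finally show ?thesis .
  qed
  also have "\<dots> \<longleftrightarrow> k < nbits v \<and> bit v k"
    using occ_nth[of x i _ "ser_nat v" "2 * k + 1"] assms ser_nat_nth[of k v]
    by (auto simp: val_occ length_ser_nat add.assoc)
  finally show ?thesis using bit_less_nbits by blast
qed

definition NatEq :: "bool list \<Rightarrow> nat \<Rightarrow> nat \<Rightarrow> bool" where
  "NatEq x i j \<longleftrightarrow> (\<forall>k<bnd x. NatBit x i k \<longleftrightarrow> NatBit x j k)"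

lemma so_NatEq: "so_definable (\<lambda>x R e. NatEq x (e i) (e j))"
  unfolding NatEq_def by (intro so_rules so_iff so_NatBit)

lemma NatEq_iff:
  assumes "val ser_nat x i u" "val ser_nat x j v" shows "NatEq x i j \<longleftrightarrow> u = v"
proof -
  have "nbits u < bnd x" "nbits v < bnd x" using nbits_bound assms by (fastforce simp: bnd_def)+
  then have "NatEq x i j \<longleftrightarrow> (\<forall>k. bit u k \<longleftrightarrow> bit v k)"
    unfolding NatEq_def NatBit_iff[OF assms(1)] NatBit_iff[OF assms(2)] using bit_less_nbits less_trans by blast
  then show ?thesis by (simp add: bit_eq_iff)
qed

definition NatLess :: "bool list \<Rightarrow> nat \<Rightarrow> nat \<Rightarrow> bool" where
  "NatLess x i j \<longleftrightarrow> (\<exists>k<bnd x. \<not> NatBit x i k \<and> NatBit x j k \<and> (\<forall>l<bnd x. k < l \<longrightarrow> (NatBit x i l \<longleftrightarrow> NatBit x j l)))"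

lemma so_NatLess: "so_definable (\<lambda>x R e. NatLess x (e i) (e j))"
  unfolding NatLess_def by (intro so_rules so_iff so_NatBit)

lemma less_nat_bitsI:
  fixes u v :: nat
  assumes "\<not> bit u k" "bit v k" "\<And>l. k < l \<Longrightarrow> bit u l \<longleftrightarrow> bit v l"
  shows "u < v"
proof -
  have "drop_bit (Suc k) u = drop_bit (Suc k) v"
    by (rule bit_eqI) (simp add: bit_drop_bit_eq assms(3))
  then have "push_bit (Suc k) (drop_bit (Suc k) u) = push_bit (Suc k) (drop_bit (Suc k) v)" by (rule arg_cong)
  moreover have "take_bit (Suc k) u < 2 ^ k" "2 ^ k \<le> take_bit (Suc k) v"
    using assms(1,2) by (simp_all add: take_bit_Suc_from_most)
  ultimately show ?thesis
    using bits_ident[of "Suc k" u] bits_ident[of "Suc k" v] by linarith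
qed

text \<open>The highest position at which the numbers differ decides the order; it exists because
  only finitely many bits are set.\<close>

lemma less_nat_bits: "u < v \<longleftrightarrow> (\<exists>k. \<not> bit u k \<and> bit v k \<and> (\<forall>l>k. bit u l \<longleftrightarrow> bit v l))" for u v :: nat
proof
  assume uv: "u < v"
  define X where "X = {k. bit u k \<noteq> bit v k}"
  have "X \<subseteq> {..<nbits u} \<union> {..<nbits v}" using bit_less_nbits by (auto simp: X_def)
  then have X: "finite X" by (rule finite_subset) simp
  moreover have "X \<noteq> {}" using uv bit_eq_iff[of u v] unfolding X_def by blast
  ultimately have k: "Max X \<in> X" by (rule Max_in)
  have above: "bit u l \<longleftrightarrow> bit v l" if "Max X < l" for l
  proof -
    have "l \<notin> X" using Max_ge[OF X, of l] that by linarith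
    then show ?thesis unfolding X_def by blast
  qed
  have "bit u (Max X) \<noteq> bit v (Max X)" using k unfolding X_def by (rule CollectD)
  moreover have "\<not> (\<not> bit v (Max X) \<and> bit u (Max X))"
    using less_nat_bitsI[of v "Max X" u] above uv by (metis less_asym)
  ultimately have "\<not> bit u (Max X)" "bit v (Max X)" by blast+
  then show "\<exists>k. \<not> bit u k \<and> bit v k \<and> (\<forall>l>k. bit u l \<longleftrightarrow> bit v l)" using above by blast
qed (blast intro: less_nat_bitsI)

lemma NatLess_iff:
  assumes "val ser_nat x i u" "val ser_nat x j v" shows "NatLess x i j \<longleftrightarrow> u < v"
proof -
  have "nbits u < bnd x" "nbits v < bnd x" using nbits_bound assms by (fastforce simp: bnd_def)+
  then have small: "bit u k \<Longrightarrow> k < bnd x" "bit v k \<Longrightarrow> k < bnd x" for k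
    using bit_less_nbits less_trans by blast+
  then have "(\<forall>l<bnd x. k < l \<longrightarrow> (bit u l \<longleftrightarrow> bit v l)) \<longleftrightarrow> (\<forall>l>k. bit u l \<longleftrightarrow> bit v l)" for k by blast
  then show ?thesis
    unfolding NatLess_def NatBit_iff[OF assms(1)] NatBit_iff[OF assms(2)] less_nat_bits[of u v] using small(2) by blast
qed

section \<open>Arithmetic on bit relations\<close>

text \<open>Variables and tags are the only arguments that the guessed relation receives below.
  Constants under 32 are always below \<open>bnd x\<close>, so a bounded quantifier can introduce
  them.\<close>

definition simple_term :: "((nat \<Rightarrow> nat) \<Rightarrow> nat) \<Rightarrow> bool" where
  "simple_term a \<longleftrightarrow> (\<exists>i. a = (\<lambda>e. e i)) \<or> (\<exists>c<32. a = (\<lambda>e. c))"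

lemma simple_term_var: "simple_term (\<lambda>e. e i)" and simple_term_const: "c < 32 \<Longrightarrow> simple_term (\<lambda>e. c)"
  by (auto simp: simple_term_def)

lemma so_simple_term:
  assumes "simple_term a" "so_definable (\<lambda>x R e. P x R (\<lambda>i. e (Suc i)) (e 0))"
  shows "so_definable (\<lambda>x R e. P x R e (a e))"
proof (cases "\<exists>i. a = (\<lambda>e. e i)")
  case True
  then obtain i where a: "a = (\<lambda>e. e i)" by blast
  have "so_definable (\<lambda>x R e. \<exists>v<bnd x. v = e i \<and> P x R e v)"
    by (intro so_ex so_conj so_eq assms(2))
  then show ?thesis by (rule so_cong) (simp add: ex_less_eq a)
next
  case False
  then obtain c where c: "c < 32" and a: "a = (\<lambda>e. c)" using assms(1) by (auto simp: simple_term_def)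
  have "so_definable (\<lambda>x R e. \<exists>v<bnd x. v = c \<and> P x R e v)"
    by (intro so_ex so_conj so_const assms(2))
  then show ?thesis by (rule so_cong) (use c in \<open>simp add: ex_less_eq a bnd_def\<close>)
qed

text \<open>The variables in \<open>so_R\<close> are replaced by terms one argument at a time, from
  the last to the first.\<close>

lemma so_rel:
  assumes "simple_term t" "simple_term a" "simple_term b" "simple_term c" "simple_term d"
  shows "so_definable (\<lambda>x R e. R (t e) (a e) (b e) (c e) (d e))"
proof -
  have shift: "simple_term u \<Longrightarrow> simple_term (\<lambda>e. u (\<lambda>i. e (Suc i)))" for u by (auto simp: simple_term_def)
  have 1: "simple_term d \<Longrightarrow> so_definable (\<lambda>x R e. R (e i) (e j) (e k) (e l) (d e))" for i j k l d
    by (rule so_simple_term[of d "\<lambda>x R e v. R (e i) (e j) (e k) (e l) v"]) (assumption, rule so_R)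
  have 2: "simple_term c \<Longrightarrow> simple_term d \<Longrightarrow> so_definable (\<lambda>x R e. R (e i) (e j) (e k) (c e) (d e))" for i j k c d
    by (rule so_simple_term[of c "\<lambda>x R e v. R (e i) (e j) (e k) v (d e)"]) (assumption, rule 1, erule shift)
  have 3: "simple_term b \<Longrightarrow> simple_term c \<Longrightarrow> simple_term d \<Longrightarrow> so_definable (\<lambda>x R e. R (e i) (e j) (b e) (c e) (d e))" for i j b c d
    by (rule so_simple_term[of b "\<lambda>x R e v. R (e i) (e j) v (c e) (d e)"]) (assumption, (rule 2; erule shift))
  have 4: "simple_term a \<Longrightarrow> simple_term b \<Longrightarrow> simple_term c \<Longrightarrow> simple_term d \<Longrightarrow> so_definable (\<lambda>x R e. R (e i) (a e) (b e) (c e) (d e))" for i a b c d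
    by (rule so_simple_term[of a "\<lambda>x R e v. R (e i) v (b e) (c e) (d e)"]) (assumption, (rule 3; erule shift))
  show ?thesis
    by (rule so_simple_term[of t "\<lambda>x R e v. R v (a e) (b e) (c e) (d e)"]) (rule assms, (rule 4; rule shift, rule assms))
qed

text \<open>A carry into bit j arises at some k < j and passes through all bits in between.\<close>

definition add_bits :: "bool list \<Rightarrow> (nat \<Rightarrow> bool) \<Rightarrow> (nat \<Rightarrow> bool) \<Rightarrow> nat \<Rightarrow> bool" where
  "add_bits x f g j \<longleftrightarrow> ((f j \<longleftrightarrow> g j) \<longleftrightarrow>
     (\<exists>k<bnd x. k < j \<and> f k \<and> g k \<and> (\<forall>l<bnd x. k < l \<longrightarrow> l < j \<longrightarrow> f l \<or> g l)))"

definition shift_bits :: "bool list \<Rightarrow> nat \<Rightarrow> (nat \<Rightarrow> bool) \<Rightarrow> nat \<Rightarrow> bool" where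
  "shift_bits x r f j \<longleftrightarrow> (\<exists>i<bnd x. i + r = j \<and> f i)"

text \<open>Row r of A is the product of X with the lowest r bits of Y.\<close>

definition mul_bits :: "bool list \<Rightarrow> (nat \<Rightarrow> nat \<Rightarrow> bool) \<Rightarrow> (nat \<Rightarrow> bool) \<Rightarrow> (nat \<Rightarrow> bool) \<Rightarrow> bool" where
  "mul_bits x A X Y \<longleftrightarrow> (\<forall>z<bnd x. z = 0 \<longrightarrow> (\<forall>j<bnd x. \<not> A z j)) \<and>
     (\<forall>r<bnd x. r < length x \<longrightarrow> (\<forall>r'<bnd x. r' = Suc r \<longrightarrow> (\<forall>j<bnd x.
        A r' j \<longleftrightarrow> (Y r \<and> add_bits x (A r) (shift_bits x r X) j) \<or> (\<not> Y r \<and> A r j))))"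

text \<open>This fixes \<open>v\<close> only modulo \<open>2 ^ B\<close>; equalities between numbers
  need separate size bounds, as in \<open>bitrel_inject\<close>.\<close>

definition bitrel :: "nat \<Rightarrow> (nat \<Rightarrow> bool) \<Rightarrow> nat \<Rightarrow> bool" where
  "bitrel B f v \<longleftrightarrow> (\<forall>j<B. f j \<longleftrightarrow> bit v j)"

text \<open>Both lower parts are below \<open>2 ^ j\<close>, so the left side says that a carry
  enters position \<open>j\<close>. A carry out of a position is either generated there or passed on
  from below, which is the induction step.\<close>

lemma carry_iff:
  fixes a b :: nat
  shows "2 ^ j \<le> take_bit j a + take_bit j b \<longleftrightarrow> (\<exists>k<j. bit a k \<and> bit b k \<and> (\<forall>l. k < l \<longrightarrow> l < j \<longrightarrow> bit a l \<or> bit b l))"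
proof (induction j)
  case (Suc j)
  let ?c = "\<exists>k<j. bit a k \<and> bit b k \<and> (\<forall>l. k < l \<longrightarrow> l < j \<longrightarrow> bit a l \<or> bit b l)"
  have lt: "take_bit j a < 2 ^ j" "take_bit j b < 2 ^ j" by simp_all
  have "2 ^ Suc j \<le> take_bit (Suc j) a + take_bit (Suc j) b \<longleftrightarrow> (bit a j \<and> bit b j) \<or> ((bit a j \<or> bit b j) \<and> 2 ^ j \<le> take_bit j a + take_bit j b)"
  proof -
    have "\<not> 2 * 2 ^ j \<le> take_bit j a + take_bit j b" using lt by linarith
    then show ?thesis by (cases "bit a j"; cases "bit b j") (simp_all add: take_bit_Suc_from_most)
  qed
  also have "\<dots> \<longleftrightarrow> (bit a j \<and> bit b j) \<or> ((bit a j \<or> bit b j) \<and> ?c)" unfolding Suc.IH ..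
  also have "\<dots> \<longleftrightarrow> (\<exists>k<Suc j. bit a k \<and> bit b k \<and> (\<forall>l. k < l \<longrightarrow> l < Suc j \<longrightarrow> bit a l \<or> bit b l))"
  proof
    assume "(bit a j \<and> bit b j) \<or> ((bit a j \<or> bit b j) \<and> ?c)"
    then show "\<exists>k<Suc j. bit a k \<and> bit b k \<and> (\<forall>l. k < l \<longrightarrow> l < Suc j \<longrightarrow> bit a l \<or> bit b l)"
    proof
      assume "bit a j \<and> bit b j"
      then show ?thesis by (intro exI[of _ j]) auto
    next
      assume *: "(bit a j \<or> bit b j) \<and> ?c"
      then obtain k where "k < j" "bit a k" "bit b k" "\<forall>l. k < l \<longrightarrow> l < j \<longrightarrow> bit a l \<or> bit b l" by blast
      then show ?thesis using * by (intro exI[of _ k]) (auto simp: less_Suc_eq)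
    qed
  next
    assume "\<exists>k<Suc j. bit a k \<and> bit b k \<and> (\<forall>l. k < l \<longrightarrow> l < Suc j \<longrightarrow> bit a l \<or> bit b l)"
    then obtain k where k: "k < Suc j" "bit a k" "bit b k" "\<And>l. k < l \<Longrightarrow> l < Suc j \<Longrightarrow> bit a l \<or> bit b l" by blast
    show "(bit a j \<and> bit b j) \<or> ((bit a j \<or> bit b j) \<and> ?c)"
    proof (cases "k = j")
      case False
      then have "k < j" using k by simp
      moreover have "bit a j \<or> bit b j" using k(4)[of j] \<open>k < j\<close> by simp
      moreover have "\<forall>l. k < l \<longrightarrow> l < j \<longrightarrow> bit a l \<or> bit b l" using k(4) less_SucI by blast
      ultimately show ?thesis using k(2,3) by blast
    qed (use k in auto)
  qed
  finally show ?case .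
qed simp

text \<open>Both numbers are split at bit \<open>j\<close>: the wanted bit is the parity of the two
  high parts plus the carry from the low parts.\<close>

lemma bit_add_iff:
  fixes a b :: nat
  shows "bit (a + b) j \<longleftrightarrow> ((bit a j \<longleftrightarrow> bit b j) \<longleftrightarrow> (\<exists>k<j. bit a k \<and> bit b k \<and> (\<forall>l. k < l \<longrightarrow> l < j \<longrightarrow> bit a l \<or> bit b l)))"
proof -
  have lt: "take_bit j a < 2 ^ j" "take_bit j b < 2 ^ j" by simp_all
  have "(a + b) div 2 ^ j = a div 2 ^ j + b div 2 ^ j + (take_bit j a + take_bit j b) div 2 ^ j"
    by (simp add: div_add1_eq[of a b] take_bit_eq_mod)
  also have "(take_bit j a + take_bit j b) div 2 ^ j = of_bool (2 ^ j \<le> take_bit j a + take_bit j b)"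
  proof (cases "2 ^ j \<le> take_bit j a + take_bit j b")
    case True
    have "(take_bit j a + take_bit j b) div 2 ^ j = 1"
    proof (rule div_nat_eqI)
      show "take_bit j a + take_bit j b < 2 ^ j * Suc 1" using add_strict_mono[OF lt] by simp
    qed (use True in simp)
    then show ?thesis using True by simp
  qed simp
  finally have "bit (a + b) j \<longleftrightarrow> odd (a div 2 ^ j + b div 2 ^ j + of_bool (2 ^ j \<le> take_bit j a + take_bit j b) :: nat)"
    by (simp only: bit_iff_odd)
  then show ?thesis
    unfolding carry_iff[symmetric] by (cases "2 ^ j \<le> take_bit j a + take_bit j b") (simp_all add: bit_iff_odd)
qed

lemma add_bits_bitrel:
  assumes "bitrel (bnd x) f a" "bitrel (bnd x) g b" "j < bnd x"
  shows "add_bits x f g j \<longleftrightarrow> bit (a + b) j"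
proof -
  have f: "f k \<longleftrightarrow> bit a k" "g k \<longleftrightarrow> bit b k" if "k < bnd x" for k using assms that by (auto simp: bitrel_def)
  have lt: "k < j \<Longrightarrow> k < bnd x" for k using assms(3) by simp
  have "(\<exists>k<bnd x. k < j \<and> f k \<and> g k \<and> (\<forall>l<bnd x. k < l \<longrightarrow> l < j \<longrightarrow> f l \<or> g l)) \<longleftrightarrow>
     (\<exists>k<j. bit a k \<and> bit b k \<and> (\<forall>l. k < l \<longrightarrow> l < j \<longrightarrow> bit a l \<or> bit b l))"
    using f lt by (metis (no_types, lifting))
  then show ?thesis unfolding add_bits_def bit_add_iff f[OF assms(3)] by simp
qed

lemma shift_bits_bitrel:
  assumes "bitrel (bnd x) f a"
  shows "bitrel (bnd x) (shift_bits x r f) (a * 2 ^ r)"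
  unfolding bitrel_def
proof (intro allI impI)
  fix j assume j: "j < bnd x"
  have "shift_bits x r f j \<longleftrightarrow> r \<le> j \<and> f (j - r)" using j by (auto simp: shift_bits_def intro!: exI[of _ "j - r"])
  also have "\<dots> \<longleftrightarrow> r \<le> j \<and> bit a (j - r)" using assms j by (auto simp: bitrel_def)
  also have "\<dots> \<longleftrightarrow> bit (push_bit r a) j" by (simp add: bit_push_bit_iff)
  finally show "shift_bits x r f j \<longleftrightarrow> bit (a * 2 ^ r) j" by (simp add: push_bit_eq_mult)
qed

text \<open>Schoolbook multiplication: adding \<open>a * 2 ^ r\<close> exactly when bit
  \<open>r\<close> of \<open>y\<close> is set leads from \<open>take_bit r y\<close> to
  \<open>take_bit (Suc r) y\<close>. By induction on the rows, the local conditions determine every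
  row up to the bound.\<close>

lemma mul_bits_iff:
  assumes X: "bitrel (bnd x) X a" and Y: "\<And>r. r < length x \<Longrightarrow> Y r \<longleftrightarrow> bit y r"
  shows "mul_bits x A X Y \<longleftrightarrow> (\<forall>r\<le>length x. bitrel (bnd x) (A r) (a * take_bit r y))"
proof -
  have step: "(Y r \<and> add_bits x (A r) (shift_bits x r X) j) \<or> (\<not> Y r \<and> A r j) \<longleftrightarrow> bit (a * take_bit (Suc r) y) j"
    if r: "r < length x" "bitrel (bnd x) (A r) (a * take_bit r y)" "j < bnd x" for r j
  proof (cases "bit y r")
    case True
    have "a * take_bit (Suc r) y = a * take_bit r y + a * 2 ^ r"
      using True by (simp add: take_bit_Suc_from_most algebra_simps)
    then show ?thesis using add_bits_bitrel[OF r(2) shift_bits_bitrel[OF X, of r] r(3)] Y[OF r(1)] True by simp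
  next
    case False
    then show ?thesis using r Y[OF r(1)] by (simp add: take_bit_Suc_from_most bitrel_def)
  qed
  have 0: "(\<forall>z<bnd x. z = 0 \<longrightarrow> (\<forall>j<bnd x. \<not> A z j)) \<longleftrightarrow> bitrel (bnd x) (A 0) (a * take_bit 0 y)"
    by (auto simp: bitrel_def)
  have lt: "r < length x \<Longrightarrow> Suc r < bnd x" for r by (simp add: bnd_def)
  have S: "(\<forall>r<bnd x. r < length x \<longrightarrow> (\<forall>r'<bnd x. r' = Suc r \<longrightarrow> (\<forall>j<bnd x.
        A r' j \<longleftrightarrow> (Y r \<and> add_bits x (A r) (shift_bits x r X) j) \<or> (\<not> Y r \<and> A r j)))) \<longleftrightarrow>
     (\<forall>r<length x. \<forall>j<bnd x. A (Suc r) j \<longleftrightarrow> (Y r \<and> add_bits x (A r) (shift_bits x r X) j) \<or> (\<not> Y r \<and> A r j))"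
  proof -
    have "(\<forall>r<bnd x. r < length x \<longrightarrow> (\<forall>r'<bnd x. r' = Suc r \<longrightarrow> P r r')) \<longleftrightarrow> (\<forall>r<length x. P r (Suc r))" for P
      using lt Suc_lessD by blast
    then show ?thesis .
  qed
  show ?thesis unfolding mul_bits_def 0 S
  proof (rule iffI; intro conjI allI impI)
    fix r assume A: "bitrel (bnd x) (A 0) (a * take_bit 0 y) \<and>
        (\<forall>r<length x. \<forall>j<bnd x. A (Suc r) j \<longleftrightarrow> (Y r \<and> add_bits x (A r) (shift_bits x r X) j) \<or> (\<not> Y r \<and> A r j))"
      and "r \<le> length x"
    from this(2) show "bitrel (bnd x) (A r) (a * take_bit r y)"
    proof (induction r)
      case (Suc r)
      then have r: "r < length x" "bitrel (bnd x) (A r) (a * take_bit r y)" by simp_all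
      show ?case unfolding bitrel_def
      proof (intro allI impI)
        fix j assume j: "j < bnd x"
        have "A (Suc r) j \<longleftrightarrow> (Y r \<and> add_bits x (A r) (shift_bits x r X) j) \<or> (\<not> Y r \<and> A r j)"
          using A r(1) j by blast
        then show "A (Suc r) j \<longleftrightarrow> bit (a * take_bit (Suc r) y) j" unfolding step[OF r j] .
      qed
    qed (use A in blast)
  next
    assume "\<forall>r\<le>length x. bitrel (bnd x) (A r) (a * take_bit r y)"
    then show "bitrel (bnd x) (A 0) (a * take_bit 0 y)" by blast
  next
    fix r j assume A: "\<forall>r\<le>length x. bitrel (bnd x) (A r) (a * take_bit r y)" and r: "r < length x" "j < bnd x"
    then have r1: "bitrel (bnd x) (A r) (a * take_bit r y)" "bitrel (bnd x) (A (Suc r)) (a * take_bit (Suc r) y)" by simp_all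
    show "A (Suc r) j \<longleftrightarrow> (Y r \<and> add_bits x (A r) (shift_bits x r X) j) \<or> (\<not> Y r \<and> A r j)"
      unfolding step[OF r(1) r1(1) r(2)] using r1(2) r(2) unfolding bitrel_def by blast
  qed
qed

lemma bitrel_inject:
  assumes "bitrel B f v" "bitrel B f w" "v < 2 ^ B" "w < 2 ^ B" shows "v = w"
proof (rule bit_eqI)
  fix n
  show "bit v n \<longleftrightarrow> bit w n"
  proof (cases "n < B")
    case True
    then show ?thesis using assms by (auto simp: bitrel_def)
  next
    case False
    then have "(2 :: nat) ^ B \<le> 2 ^ n" by simp
    then have "v < 2 ^ n" "w < 2 ^ n" using assms(3,4) by linarith+
    then show ?thesis by (simp add: bit_iff_odd)
  qed
qed

lemma bitrel_ex: "\<exists>v. v < 2 ^ n \<and> bitrel B f v" if "\<And>j. j < B \<Longrightarrow> n \<le> j \<Longrightarrow> \<not> f j"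
proof -
  define v :: nat where "v = horner_sum of_bool 2 (map f [0..<min n B])"
  have b: "bit v j \<longleftrightarrow> j < min n B \<and> f j" for j by (auto simp: v_def bit_horner_sum_bit_iff)
  have "take_bit n v = v" by (rule bit_eqI) (auto simp: bit_take_bit_iff b)
  then have "v < 2 ^ n" by (simp add: take_bit_nat_eq_self_iff)
  moreover have "bitrel B f v" using that by (auto simp: bitrel_def b not_less[symmetric])
  ultimately show ?thesis by blast
qed

text \<open>Connects numbers used as indices, such as states, with numerals written in the input.
  Each row of the table is forced by adding 1 to the previous one.\<close>

definition SmallBits :: "bool list \<Rightarrow> rel \<Rightarrow> bool" where
  "SmallBits x R \<longleftrightarrow> (\<forall>z<bnd x. z = 0 \<longrightarrow> (\<forall>j<bnd x. \<not> R 5 z j 0 0)) \<and>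
     (\<forall>v<bnd x. \<forall>v'<bnd x. v' = Suc v \<longrightarrow> (\<forall>j<bnd x. R 5 v' j 0 0 \<longleftrightarrow> add_bits x (\<lambda>j. R 5 v j 0 0) (\<lambda>j. j = 0) j))"

lemma so_SmallBits: "so_definable (\<lambda>x R e. SmallBits x R)"
  unfolding SmallBits_def add_bits_def by (intro so_rules so_iff so_rel simple_term_var simple_term_const; simp)

lemma bitrel_one: "bitrel B (\<lambda>j. j = 0) 1"
  unfolding bitrel_def bit_1_iff by simp

lemma SmallBits_iff: "SmallBits x R \<longleftrightarrow> (\<forall>v<bnd x. bitrel (bnd x) (\<lambda>j. R 5 v j 0 0) v)"
proof
  assume A: "SmallBits x R"
  show "\<forall>v<bnd x. bitrel (bnd x) (\<lambda>j. R 5 v j 0 0) v"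
  proof (intro allI impI)
    fix v show "v < bnd x \<Longrightarrow> bitrel (bnd x) (\<lambda>j. R 5 v j 0 0) v"
    proof (induction v)
      case 0
      then show ?case using A by (simp add: SmallBits_def bitrel_def)
    next
      case (Suc v)
      then have v: "v < bnd x" "bitrel (bnd x) (\<lambda>j. R 5 v j 0 0) v" by simp_all
      show ?case unfolding bitrel_def
      proof (intro allI impI)
        fix j assume j: "j < bnd x"
        have "R 5 (Suc v) j 0 0 \<longleftrightarrow> add_bits x (\<lambda>j. R 5 v j 0 0) (\<lambda>j. j = 0) j"
          using A v(1) Suc.prems j unfolding SmallBits_def by blast
        also have "\<dots> \<longleftrightarrow> bit (Suc v) j" using add_bits_bitrel[OF v(2) bitrel_one j] by simp
        finally show "R 5 (Suc v) j 0 0 \<longleftrightarrow> bit (Suc v) j" .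
      qed
    qed
  qed
next
  assume A: "\<forall>v<bnd x. bitrel (bnd x) (\<lambda>j. R 5 v j 0 0) v"
  have "R 5 (Suc v) j 0 0 \<longleftrightarrow> add_bits x (\<lambda>j. R 5 v j 0 0) (\<lambda>j. j = 0) j" if "Suc v < bnd x" "j < bnd x" for v j
  proof -
    have v: "bitrel (bnd x) (\<lambda>j. R 5 v j 0 0) v" "bitrel (bnd x) (\<lambda>j. R 5 (Suc v) j 0 0) (Suc v)"
      using A that by simp_all
    show ?thesis using add_bits_bitrel[OF v(1) bitrel_one that(2)] v(2) that(2) by (simp add: bitrel_def)
  qed
  moreover have "\<forall>j<bnd x. \<not> R 5 0 j 0 0" using A[rule_format, of 0] by (simp add: bitrel_def)
  ultimately show "SmallBits x R" unfolding SmallBits_def by blast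
qed

definition Val :: "bool list \<Rightarrow> rel \<Rightarrow> nat \<Rightarrow> nat \<Rightarrow> bool" where
  "Val x R i v \<longleftrightarrow> (\<forall>j<bnd x. NatBit x i j \<longleftrightarrow> R 5 v j 0 0)"

lemma so_Val: "so_definable (\<lambda>x R e. Val x R (e i) (e v))"
  unfolding Val_def by (intro so_rules so_iff so_NatBit so_rel simple_term_var simple_term_const; simp)

lemma val_less_power: "val ser_nat x i u \<Longrightarrow> u < 2 ^ length x"
proof -
  assume "val ser_nat x i u"
  then have "nbits u \<le> length x" using nbits_bound by fastforce
  then have "(2 :: nat) ^ nbits u \<le> 2 ^ length x" by (intro power_increasing) auto
  with less_two_power_nbits show ?thesis by (rule less_le_trans)
qed

lemma length_less_bnd: "length x < bnd x"
  by (simp add: bnd_def)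

lemma power_length_less: "(2 :: nat) ^ length x \<le> 2 ^ bnd x"
  by (intro power_increasing) (auto simp: bnd_def)

text \<open>Both numbers are below \<open>2 ^ bnd x\<close>, so agreement of the bits below the
  bound makes them equal.\<close>

lemma Val_iff:
  assumes "\<forall>v<bnd x. bitrel (bnd x) (\<lambda>j. R 5 v j 0 0) v" "val ser_nat x i u" "v < bnd x"
  shows "Val x R i v \<longleftrightarrow> u = v"
proof -
  have v: "bitrel (bnd x) (\<lambda>j. R 5 v j 0 0) v" using assms by blast
  have "v < 2 ^ bnd x" using assms(3) less_exp[of "bnd x"] by (rule less_trans)
  moreover have "u < 2 ^ bnd x" using val_less_power[OF assms(2)] power_length_less by (rule less_le_trans)
  moreover have "Val x R i v \<longleftrightarrow> bitrel (bnd x) (\<lambda>j. R 5 v j 0 0) u"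
    unfolding Val_def bitrel_def NatBit_iff[OF assms(2)] by blast
  ultimately show ?thesis using bitrel_inject[OF v] v by blast
qed

section \<open>Checking guessed positions of list elements\<close>

definition SkipSpec :: "bool list \<Rightarrow> rel \<Rightarrow> nat \<Rightarrow> (nat \<Rightarrow> nat \<Rightarrow> bool) \<Rightarrow> bool" where
  "SkipSpec x R t E \<longleftrightarrow> (\<forall>i<bnd x. (\<forall>z<bnd x. z = 0 \<longrightarrow> (\<forall>j<bnd x. R t i z j 0 \<longleftrightarrow> i = j \<and> (j < length x \<or> j = length x))) \<and>
     (\<forall>k<bnd x. \<forall>k'<bnd x. k' = Suc k \<longrightarrow> (\<forall>j<bnd x. R t i k' j 0 \<longleftrightarrow>
        (\<exists>p<bnd x. R t i k p 0 \<and> bitx x p \<and> (\<exists>q<bnd x. q = Suc p \<and> E q j)))))"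

definition skips :: "bool list \<Rightarrow> rel \<Rightarrow> nat \<Rightarrow> ('a \<Rightarrow> bool list) \<Rightarrow> bool" where
  "skips x R t f \<longleftrightarrow> (\<forall>i<bnd x. \<forall>k<bnd x. \<forall>j<bnd x. R t i k j 0 \<longleftrightarrow> skip f x i k j)"

text \<open>The equations recurse on \<open>k\<close> alone, so they leave no freedom in a relation
  that satisfies them. Intermediate positions lie within \<open>x\<close>, so bounding the
  quantifiers loses nothing.\<close>

lemma SkipSpec_iff:
  assumes E: "\<And>q j. q < bnd x \<Longrightarrow> j < bnd x \<Longrightarrow> E q j \<longleftrightarrow> (\<exists>v. occ x q j (f v))"
  shows "SkipSpec x R t E \<longleftrightarrow> skips x R t f"
proof -
  have succ: "(\<exists>p<bnd x. Q p \<and> bitx x p \<and> (\<exists>q<bnd x. q = Suc p \<and> E q j)) \<longleftrightarrow>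
      (\<exists>p. p < bnd x \<and> Q p \<and> p < length x \<and> x ! p \<and> (\<exists>v. occ x (Suc p) j (f v)))" if "j < bnd x" for Q j
  proof -
    have *: "p < length x \<Longrightarrow> Suc p < bnd x" for p by (simp add: bnd_def)
    show ?thesis unfolding ex_less_eq bitx_def using E that * by blast
  qed
  have skip_p: "skip f x i (Suc k) j \<longleftrightarrow> (\<exists>p. p < bnd x \<and> skip f x i k p \<and> p < length x \<and> x ! p \<and> (\<exists>v. occ x (Suc p) j (f v)))" for i k j
    unfolding skip_Suc using length_less_bnd[of x] by (meson less_trans)
  show ?thesis
  proof
    assume A: "SkipSpec x R t E"
    have "R t i k j 0 \<longleftrightarrow> skip f x i k j" if "i < bnd x" "k < bnd x" "j < bnd x" for i k j
      using that
    proof (induction k arbitrary: j)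
      case 0
      have "R t i 0 j 0 \<longleftrightarrow> i = j \<and> (j < length x \<or> j = length x)"
        by (rule A[unfolded SkipSpec_def, rule_format, OF 0(1), THEN conjunct1, rule_format, OF 0(2) refl 0(3)])
      then show ?case unfolding skip_0 by auto
    next
      case (Suc k)
      have "R t i (Suc k) j 0 \<longleftrightarrow> (\<exists>p<bnd x. R t i k p 0 \<and> bitx x p \<and> (\<exists>q<bnd x. q = Suc p \<and> E q j))"
        by (rule A[unfolded SkipSpec_def, rule_format, OF Suc.prems(1), THEN conjunct2, rule_format,
              OF Suc_lessD[OF Suc.prems(2)] Suc.prems(2) refl Suc.prems(3)])
      also have "\<dots> \<longleftrightarrow> (\<exists>p. p < bnd x \<and> skip f x i k p \<and> p < length x \<and> x ! p \<and> (\<exists>v. occ x (Suc p) j (f v)))"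
        unfolding succ[OF Suc.prems(3)] using Suc.IH[OF Suc.prems(1) Suc_lessD[OF Suc.prems(2)]] by blast
      finally show ?case unfolding skip_p .
    qed
    then show "skips x R t f" unfolding skips_def by blast
  next
    assume A: "skips x R t f"
    show "SkipSpec x R t E" unfolding SkipSpec_def
    proof (intro allI impI conjI)
      fix i z j assume "i < bnd x" "z < bnd x" "z = 0" "j < bnd x"
      then show "R t i z j 0 \<longleftrightarrow> i = j \<and> (j < length x \<or> j = length x)"
        using A skip_0[of f x i j] unfolding skips_def by auto
    next
      fix i k k' j assume b: "i < bnd x" "k < bnd x" "k' < bnd x" "k' = Suc k" "j < bnd x"
      have 1: "R t i k p 0 \<longleftrightarrow> skip f x i k p" if "p < bnd x" for p using A b that unfolding skips_def by blast
      have "R t i k' j 0 \<longleftrightarrow> skip f x i (Suc k) j" using A b unfolding skips_def by blast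
      then show "R t i k' j 0 \<longleftrightarrow> (\<exists>p<bnd x. R t i k p 0 \<and> bitx x p \<and> (\<exists>q<bnd x. q = Suc p \<and> E q j))"
        unfolding succ[OF b(5)] skip_p using 1 by blast
    qed
  qed
qed

definition IsList :: "bool list \<Rightarrow> rel \<Rightarrow> nat \<Rightarrow> nat \<Rightarrow> nat \<Rightarrow> bool" where
  "IsList x R t i j \<longleftrightarrow> (\<exists>k<bnd x. \<exists>p<bnd x. R t i k p 0 \<and> zerox x p \<and> j = Suc p)"

definition HasLen :: "bool list \<Rightarrow> rel \<Rightarrow> nat \<Rightarrow> nat \<Rightarrow> nat \<Rightarrow> bool" where
  "HasLen x R t i k \<longleftrightarrow> (\<exists>p<bnd x. R t i k p 0 \<and> zerox x p)"

definition Elem :: "bool list \<Rightarrow> rel \<Rightarrow> nat \<Rightarrow> nat \<Rightarrow> nat \<Rightarrow> nat \<Rightarrow> bool" where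
  "Elem x R t i k q \<longleftrightarrow> (\<exists>p<bnd x. R t i k p 0 \<and> bitx x p \<and> q = Suc p)"

lemma so_IsList: "t < 32 \<Longrightarrow> so_definable (\<lambda>x R e. IsList x R t (e i) (e j))"
  unfolding IsList_def by (intro so_rules so_rel simple_term_var simple_term_const; simp)

lemma so_HasLen: "t < 32 \<Longrightarrow> so_definable (\<lambda>x R e. HasLen x R t (e i) (e k))"
  unfolding HasLen_def by (intro so_rules so_rel simple_term_var simple_term_const; simp)

lemma so_Elem: "t < 32 \<Longrightarrow> so_definable (\<lambda>x R e. Elem x R t (e i) (e k) (e q))"
  unfolding Elem_def by (intro so_rules so_rel simple_term_var simple_term_const; simp)

lemma IsList_iff:
  assumes "skips x R t f" "i < bnd x"
  shows "IsList x R t i j \<longleftrightarrow> (\<exists>vs. occ x i j (ser_list f vs))"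
proof
  assume "IsList x R t i j"
  then obtain k p where "k < bnd x" "p < bnd x" "R t i k p 0" "zerox x p" "j = Suc p" unfolding IsList_def by blast
  then obtain vs where "occ x i p (enc f vs)" using assms unfolding skips_def skip_def by blast
  moreover have "occ x p j [False]" using \<open>zerox x p\<close> \<open>j = Suc p\<close> by (simp add: occ_single zerox_def)
  ultimately show "\<exists>vs. occ x i j (ser_list f vs)" unfolding ser_list_enc occ_append by blast
next
  assume "\<exists>vs. occ x i j (ser_list f vs)"
  then obtain vs p where p: "occ x i p (enc f vs)" "occ x p j [False]" unfolding ser_list_enc occ_append by blast
  then have *: "j = Suc p" "zerox x p" by (simp_all add: occ_single zerox_def)
  have s: "skip f x i (length vs) p" unfolding skip_def using p(1) by blast
  have "length vs < bnd x" "p < bnd x" using skip_bounds[OF s] by (simp_all add: bnd_def)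
  then show "IsList x R t i j" unfolding IsList_def using s * assms unfolding skips_def by blast
qed

lemma val_le: "val f x i a \<Longrightarrow> i \<le> length x"
  unfolding val_occ using occ_length by fastforce

context
  fixes x R t and f :: "'a \<Rightarrow> bool list" and i vs
  assumes tag: "skips x R t f" and pf: "prefix_code f" and v: "val (ser_list f) x i vs"
begin

text \<open>Each element contributes at least its marker, so a list is no longer than its code;
  indices into encoded lists may therefore be quantified.\<close>

lemma length_list_less: "length vs < bnd x"
proof -
  have "skip f x i (length vs) (i + length (enc f vs))" unfolding skip_val[OF pf v] by simp
  from skip_bounds[OF this] show ?thesis by (simp add: bnd_def)
qed

lemma skip_tag: "k < bnd x \<Longrightarrow> j < bnd x \<Longrightarrow> R t i k j 0 \<longleftrightarrow> k \<le> length vs \<and> j = i + length (enc f (take k vs))"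
  using tag val_le[OF v] unfolding skips_def skip_val[OF pf v, symmetric] by (simp add: bnd_def)

text \<open>After fewer than all elements the next symbol is the marker True of a further element;
  only after the last one is it the closing False.\<close>

lemma HasLen_iff:
  assumes "k < bnd x" shows "HasLen x R t i k \<longleftrightarrow> k = length vs"
proof
  assume "HasLen x R t i k"
  then obtain p where p: "p < bnd x" "R t i k p 0" "zerox x p" unfolding HasLen_def by blast
  then have k: "k \<le> length vs" "p = i + length (enc f (take k vs))" using skip_tag assms by blast+
  show "k = length vs"
  proof (rule ccontr)
    assume "k \<noteq> length vs"
    then have "x ! (elem_pos f i vs k - 1)" using elem_val(2)[OF v] k by simp
    then show False using p k by (simp add: elem_pos_def zerox_def)
  qed
next
  assume k: "k = length vs"
  have "zerox x (i + length (enc f vs))" using list_end_val[OF v] by (simp add: zerox_def)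
  moreover have "i + length (enc f vs) < bnd x" using list_end_val(1)[OF v] by (simp add: bnd_def)
  ultimately show "HasLen x R t i k" unfolding HasLen_def using skip_tag[OF assms] k by (intro exI[of _ "i + length (enc f vs)"]) simp
qed

lemma Elem_iff:
  assumes "k < bnd x" shows "Elem x R t i k q \<longleftrightarrow> k < length vs \<and> q = elem_pos f i vs k"
proof
  assume "Elem x R t i k q"
  then obtain p where p: "p < bnd x" "R t i k p 0" "bitx x p" "q = Suc p" unfolding Elem_def by blast
  then have k: "k \<le> length vs" "p = i + length (enc f (take k vs))" using skip_tag assms by blast+
  have "k \<noteq> length vs"
    using list_end_val(2)[OF v] p k by (auto simp: bitx_def)
  then show "k < length vs \<and> q = elem_pos f i vs k" using k p by (simp add: elem_pos_def)
next
  assume k: "k < length vs \<and> q = elem_pos f i vs k"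
  let ?p = "i + length (enc f (take k vs))"
  have "x ! ?p" "?p < length x" using elem_val(2,3)[OF v, of k] k by (simp_all add: elem_pos_def)
  then have "?p < bnd x" "bitx x ?p" by (simp_all add: bnd_def bitx_def)
  then show "Elem x R t i k q" unfolding Elem_def using skip_tag[OF assms, of ?p] k
    by (intro exI[of _ ?p]) (simp add: elem_pos_def)
qed

lemma elem_pos_less: "k < length vs \<Longrightarrow> elem_pos f i vs k < bnd x"
  using elem_val(3)[OF v, of k] by (simp add: bnd_def)

lemma Elem_ex1:
  assumes "k < bnd x"
  shows "(\<exists>q<bnd x. Elem x R t i k q \<and> P q) \<longleftrightarrow> k < length vs \<and> P (elem_pos f i vs k)"
  unfolding Elem_iff[OF assms] using elem_pos_less by blast

lemma Elem_all1:
  assumes "k < bnd x"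
  shows "(\<forall>q<bnd x. Elem x R t i k q \<longrightarrow> P q) \<longleftrightarrow> (k < length vs \<longrightarrow> P (elem_pos f i vs k))"
  unfolding Elem_iff[OF assms] using elem_pos_less by blast

lemma Elem_ex: "(\<exists>k<bnd x. \<exists>q<bnd x. Elem x R t i k q \<and> P k q) \<longleftrightarrow> (\<exists>k<length vs. P k (elem_pos f i vs k))"
proof
  assume "\<exists>k<bnd x. \<exists>q<bnd x. Elem x R t i k q \<and> P k q"
  then obtain k where "k < bnd x" "\<exists>q<bnd x. Elem x R t i k q \<and> P k q" by blast
  then show "\<exists>k<length vs. P k (elem_pos f i vs k)" using Elem_ex1[of k "P k"] by blast
next
  assume "\<exists>k<length vs. P k (elem_pos f i vs k)"
  then obtain k where k: "k < length vs" "P k (elem_pos f i vs k)" by blast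
  have "k < bnd x" using k(1) length_list_less by (rule less_trans)
  then show "\<exists>k<bnd x. \<exists>q<bnd x. Elem x R t i k q \<and> P k q" using Elem_ex1[of k "P k"] k by blast
qed

lemma Elem_all: "(\<forall>k<bnd x. \<forall>q<bnd x. Elem x R t i k q \<longrightarrow> P k q) \<longleftrightarrow> (\<forall>k<length vs. P k (elem_pos f i vs k))"
  using Elem_ex[of "\<lambda>k q. \<not> P k q"] by blast

end

section \<open>The game as a second-order formula\<close>

text \<open>Sign, numerator and denominator as written. The parser accepts arbitrary triples;
  whether a triple is the canonical form of a rational is tested afterwards.\<close>

type_synonym frac = "bool \<times> nat \<times> nat"

definition ser_frac :: "frac \<Rightarrow> bool list" where
  "ser_frac = (\<lambda>(s, a, b). s # ser_nat a @ ser_nat b)"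

definition ser_entry :: "nat \<times> nat list \<times> frac list \<Rightarrow> bool list" where
  "ser_entry = (\<lambda>(s, a, d). ser_nat s @ ser_list ser_nat a @ ser_list ser_frac d)"

definition frac_of :: "rat \<Rightarrow> frac" where
  "frac_of q = (fst (quotient_of q) < 0, nat \<bar>fst (quotient_of q)\<bar>, nat (snd (quotient_of q)))"

lemma ser_frac_of: "ser_frac (frac_of q) = ser_rat q"
  by (cases "quotient_of q") (simp add: ser_frac_def frac_of_def ser_rat_def ser_int_def)

lemma prefix_ser_frac: "prefix_code ser_frac"
  unfolding prefix_code_def
proof (intro allI impI)
  fix p q u v assume *: "ser_frac p @ u = ser_frac q @ v"
  obtain s a b t c d where p: "p = (s, a, b)" "q = (t, c, d)" by (metis prod_cases3)
  have eq: "s = t" "ser_nat a @ ser_nat b @ u = ser_nat c @ ser_nat d @ v" using * by (simp_all add: ser_frac_def p)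
  have "a = c" using prefix_ser_nat eq(2) unfolding prefix_code_def by blast
  moreover then have "b = d" using prefix_ser_nat eq(2) unfolding prefix_code_def by (metis append_same_eq same_append_eq)
  ultimately show "p = q" using eq p by simp
qed

lemma prefix_ser_entry: "prefix_code ser_entry"
  unfolding prefix_code_def
proof (intro allI impI)
  fix p q u v assume *: "ser_entry p @ u = ser_entry q @ v"
  obtain s a b t c d where p: "p = (s, a, b)" "q = (t, c, d)" by (metis prod_cases3)
  let ?L = "ser_list ser_nat" and ?F = "ser_list ser_frac"
  have pf: "prefix_code ?L" "prefix_code ?F" by (intro prefix_ser_list prefix_ser_nat prefix_ser_frac)+
  have eq: "ser_nat s @ ?L a @ ?F b @ u = ser_nat t @ ?L c @ ?F d @ v" using * by (simp add: ser_entry_def p)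
  have 1: "s = t" using prefix_ser_nat eq unfolding prefix_code_def by blast
  then have eq2: "?L a @ ?F b @ u = ?L c @ ?F d @ v" using eq by simp
  have 2: "a = c" using pf(1) eq2 unfolding prefix_code_def by blast
  then have "?F b @ u = ?F d @ v" using eq2 by simp
  then have "b = d" using pf(2) unfolding prefix_code_def by blast
  then show "p = q" using 1 2 p by simp
qed

definition IsFrac :: "bool list \<Rightarrow> nat \<Rightarrow> nat \<Rightarrow> bool" where
  "IsFrac x i j \<longleftrightarrow> i < length x \<and> (\<exists>p<bnd x. p = Suc i \<and> (\<exists>q<bnd x. IsNat x p q \<and> IsNat x q j))"

definition IsEntry :: "bool list \<Rightarrow> rel \<Rightarrow> nat \<Rightarrow> nat \<Rightarrow> bool" where
  "IsEntry x R i j \<longleftrightarrow> (\<exists>q<bnd x. \<exists>d<bnd x. IsNat x i q \<and> IsList x R 0 q d \<and> IsList x R 3 d j)"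

lemma occ_less_bnd: "occ x i j w \<Longrightarrow> i < bnd x \<and> j < bnd x"
  using occ_length[of x i j w] by (simp add: bnd_def)

lemma IsFrac_iff: "IsFrac x i j \<longleftrightarrow> (\<exists>v. occ x i j (ser_frac v))"
proof
  assume "IsFrac x i j"
  then obtain q a b where "i < length x" "occ x (Suc i) q (ser_nat a)" "occ x q j (ser_nat b)"
    unfolding IsFrac_def IsNat_iff by blast
  then have "occ x i j (x ! i # ser_nat a @ ser_nat b)" by (auto simp: occ_Cons occ_append)
  then have "occ x i j (ser_frac (x ! i, a, b))" by (simp add: ser_frac_def)
  then show "\<exists>v. occ x i j (ser_frac v)" ..
next
  assume "\<exists>v. occ x i j (ser_frac v)"
  then obtain s a b where "occ x i j (s # ser_nat a @ ser_nat b)" by (auto simp: ser_frac_def)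
  then obtain q where q: "i < length x" "occ x (Suc i) q (ser_nat a)" "occ x q j (ser_nat b)"
    by (auto simp: occ_Cons occ_append)
  then have "IsNat x (Suc i) q" "IsNat x q j" "Suc i < bnd x" "q < bnd x"
    using occ_less_bnd unfolding IsNat_iff by blast+
  then show "IsFrac x i j" unfolding IsFrac_def using q(1) by blast
qed

lemma IsEntry_iff:
  assumes "skips x R 0 ser_nat" "skips x R 3 ser_frac"
  shows "IsEntry x R i j \<longleftrightarrow> (\<exists>v. occ x i j (ser_entry v))"
proof
  assume "IsEntry x R i j"
  then obtain q d where q: "q < bnd x" "d < bnd x" "IsNat x i q" "IsList x R 0 q d" "IsList x R 3 d j"
    unfolding IsEntry_def by blast
  obtain s a b where "occ x i q (ser_nat s)" "occ x q d (ser_list ser_nat a)" "occ x d j (ser_list ser_frac b)"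
    using q(3-5) unfolding IsNat_iff IsList_iff[OF assms(1) q(1)] IsList_iff[OF assms(2) q(2)] by blast
  then have "occ x i j (ser_entry (s, a, b))" unfolding ser_entry_def prod.case occ_append by blast
  then show "\<exists>v. occ x i j (ser_entry v)" ..
next
  assume "\<exists>v. occ x i j (ser_entry v)"
  then obtain s a b q d where o: "occ x i q (ser_nat s)" "occ x q d (ser_list ser_nat a)" "occ x d j (ser_list ser_frac b)"
    by (auto simp: ser_entry_def occ_append)
  then have lt: "q < bnd x" "d < bnd x" using occ_less_bnd by blast+
  have "IsNat x i q" "IsList x R 0 q d" "IsList x R 3 d j"
    using o unfolding IsNat_iff IsList_iff[OF assms(1) lt(1)] IsList_iff[OF assms(2) lt(2)] by blast+
  then show "IsEntry x R i j" unfolding IsEntry_def using lt by blast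
qed

definition InList :: "bool list \<Rightarrow> rel \<Rightarrow> nat \<Rightarrow> nat \<Rightarrow> bool" where
  "InList x R q j \<longleftrightarrow> (\<exists>k<bnd x. \<exists>r<bnd x. Elem x R 0 q k r \<and> NatEq x r j)"

definition ListEq :: "bool list \<Rightarrow> rel \<Rightarrow> nat \<Rightarrow> nat \<Rightarrow> bool" where
  "ListEq x R q q' \<longleftrightarrow> (\<forall>k<bnd x. (HasLen x R 0 q k \<longleftrightarrow> HasLen x R 0 q' k) \<and>
     (\<forall>r<bnd x. Elem x R 0 q k r \<longrightarrow> (\<forall>r'<bnd x. Elem x R 0 q' k r' \<longrightarrow> NatEq x r r')))"

definition AvailList :: "bool list \<Rightarrow> rel \<Rightarrow> nat \<Rightarrow> nat \<Rightarrow> nat \<Rightarrow> nat \<Rightarrow> bool" where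
  "AvailList x R iav p s q \<longleftrightarrow> (\<exists>r<bnd x. Elem x R 2 iav p r \<and> Elem x R 1 r s q)"

definition InAvail :: "bool list \<Rightarrow> rel \<Rightarrow> nat \<Rightarrow> nat \<Rightarrow> nat \<Rightarrow> nat \<Rightarrow> bool" where
  "InAvail x R iav p s j \<longleftrightarrow> (\<exists>q<bnd x. AvailList x R iav p s q \<and> InList x R q j)"

text \<open>Action names may be exponentially large, so tag 16 stores the index \<open>k\<close> of
  an available action rather than its name. The support then consists of available actions by
  construction.\<close>

definition InSupport :: "bool list \<Rightarrow> rel \<Rightarrow> nat \<Rightarrow> nat \<Rightarrow> nat \<Rightarrow> nat \<Rightarrow> bool" where
  "InSupport x R iav p s j \<longleftrightarrow> (\<exists>q<bnd x. AvailList x R iav p s q \<and>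
     (\<exists>k<bnd x. \<exists>r<bnd x. Elem x R 0 q k r \<and> R 16 p s k 0 \<and> NatEq x r j))"

definition Prof :: "bool list \<Rightarrow> rel \<Rightarrow> nat \<Rightarrow> nat \<Rightarrow> nat \<Rightarrow> nat \<Rightarrow> bool" where
  "Prof x R iav m1 s q \<longleftrightarrow> HasLen x R 0 q m1 \<and> (\<forall>k<bnd x. \<forall>r<bnd x. Elem x R 0 q k r \<longrightarrow> InAvail x R iav k s r)"

definition Avail :: "bool list \<Rightarrow> rel \<Rightarrow> nat \<Rightarrow> nat \<Rightarrow> nat \<Rightarrow> nat \<Rightarrow> nat \<Rightarrow> bool" where
  "Avail x R iav m1 s e q \<longleftrightarrow> Val x R e s \<and> Prof x R iav m1 s q"

text \<open>In the \<open>k\<close>-th entry, \<open>e\<close>, \<open>q\<close> and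
  \<open>d\<close> are the positions of state, profile and distribution; the entry starts with its
  state, so \<open>e\<close> is also its own position.\<close>

definition ExEntry :: "bool list \<Rightarrow> rel \<Rightarrow> nat \<Rightarrow> (nat \<Rightarrow> nat \<Rightarrow> nat \<Rightarrow> nat \<Rightarrow> bool) \<Rightarrow> bool" where
  "ExEntry x R i P \<longleftrightarrow> (\<exists>k<bnd x. \<exists>e<bnd x. Elem x R 4 i k e \<and>
     (\<exists>q<bnd x. \<exists>d<bnd x. IsNat x e q \<and> IsList x R 0 q d \<and> P k e q d))"

definition AllEntries :: "bool list \<Rightarrow> rel \<Rightarrow> nat \<Rightarrow> (nat \<Rightarrow> nat \<Rightarrow> nat \<Rightarrow> nat \<Rightarrow> bool) \<Rightarrow> bool" where
  "AllEntries x R i P \<longleftrightarrow> \<not> ExEntry x R i (\<lambda>k e q d. \<not> P k e q d)"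

text \<open>\<open>dlt\<close> looks up the table with \<open>find\<close>, so among entries for the
  same state and profile only the first one counts.\<close>

definition First :: "bool list \<Rightarrow> rel \<Rightarrow> nat \<Rightarrow> nat \<Rightarrow> nat \<Rightarrow> nat \<Rightarrow> bool" where
  "First x R i k e q \<longleftrightarrow> AllEntries x R i (\<lambda>k' e' q' d'. k' < k \<longrightarrow> \<not> (NatEq x e' e \<and> ListEq x R q' q))"

text \<open>The numerator follows the sign bit, and the code of a natural number begins with True
  exactly when the number is nonzero.\<close>

definition Pos :: "bool list \<Rightarrow> rel \<Rightarrow> nat \<Rightarrow> nat \<Rightarrow> bool" where
  "Pos x R d s' \<longleftrightarrow> (\<exists>r<bnd x. Elem x R 3 d s' r \<and> (\<exists>r'<bnd x. r' = Suc r \<and> bitx x r'))"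

definition InTarget :: "bool list \<Rightarrow> rel \<Rightarrow> nat \<Rightarrow> nat \<Rightarrow> bool" where
  "InTarget x R i s \<longleftrightarrow> (\<exists>k<bnd x. \<exists>r<bnd x. Elem x R 0 i k r \<and> Val x R r s)"

definition Shape :: "bool list \<Rightarrow> rel \<Rightarrow> nat \<Rightarrow> nat \<Rightarrow> nat \<Rightarrow> nat \<Rightarrow> nat \<Rightarrow> nat \<Rightarrow> bool" where
  "Shape x R iacts iav iT is0 ns m1 \<longleftrightarrow> HasLen x R 0 iacts m1 \<and> HasLen x R 2 iav m1 \<and>
     (\<forall>p<bnd x. \<forall>r<bnd x. Elem x R 2 iav p r \<longrightarrow> HasLen x R 1 r ns \<and>
        (\<forall>s<bnd x. \<forall>q<bnd x. Elem x R 1 r s q \<longrightarrow> (\<forall>z<bnd x. z = 0 \<longrightarrow> \<not> HasLen x R 0 q z) \<and>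
           (\<forall>k<bnd x. \<forall>j<bnd x. Elem x R 0 q k j \<longrightarrow> (\<forall>a<bnd x. Elem x R 0 iacts p a \<longrightarrow> NatLess x j a)))) \<and>
     (\<forall>k<bnd x. \<forall>r<bnd x. Elem x R 0 iT k r \<longrightarrow> (\<exists>v<bnd x. Val x R r v \<and> v < ns)) \<and>
     (\<exists>v<bnd x. Val x R is0 v \<and> v < ns)"

text \<open>A profile is not a number below the bound, so the quantifiers run over entries instead.
  Some entry must exist, and from any entry coordinate \<open>p\<close> can be set to any available
  \<open>c\<close> while the earlier ones are kept; later coordinates are left free.\<close>

definition Cover :: "bool list \<Rightarrow> rel \<Rightarrow> nat \<Rightarrow> nat \<Rightarrow> nat \<Rightarrow> nat \<Rightarrow> bool" where
  "Cover x R iav idel ns m1 \<longleftrightarrow> (\<forall>s<bnd x. s < ns \<longrightarrow> ExEntry x R idel (\<lambda>k e q d. Avail x R iav m1 s e q) \<and>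
     AllEntries x R idel (\<lambda>k e q d. Avail x R iav m1 s e q \<longrightarrow> (\<forall>p<bnd x. p < m1 \<longrightarrow>
       (\<forall>l<bnd x. AvailList x R iav p s l \<longrightarrow> (\<forall>k<bnd x. \<forall>c<bnd x. Elem x R 0 l k c \<longrightarrow>
          ExEntry x R idel (\<lambda>k' e' q' d'. Avail x R iav m1 s e' q' \<and>
            (\<forall>p'<bnd x. p' < p \<longrightarrow> (\<forall>r<bnd x. Elem x R 0 q p' r \<longrightarrow> (\<forall>r'<bnd x. Elem x R 0 q' p' r' \<longrightarrow> NatEq x r r'))) \<and>
            (\<forall>r<bnd x. Elem x R 0 q' p r \<longrightarrow> NatEq x r c)))))))"

definition Absorb :: "bool list \<Rightarrow> rel \<Rightarrow> nat \<Rightarrow> nat \<Rightarrow> nat \<Rightarrow> nat \<Rightarrow> nat \<Rightarrow> bool" where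
  "Absorb x R iav idel iT ns m1 \<longleftrightarrow> (\<forall>s<bnd x. s < ns \<longrightarrow> InTarget x R iT s \<longrightarrow>
     AllEntries x R idel (\<lambda>k e q d. First x R idel k e q \<and> Avail x R iav m1 s e q \<longrightarrow>
        (\<forall>s'<bnd x. s' < ns \<longrightarrow> Pos x R d s' \<longrightarrow> InTarget x R iT s')))"

definition Team :: "bool list \<Rightarrow> rel \<Rightarrow> nat \<Rightarrow> nat \<Rightarrow> nat \<Rightarrow> nat \<Rightarrow> bool" where
  "Team x R iav m s q \<longleftrightarrow> (\<forall>p<bnd x. p < m \<longrightarrow> (\<forall>r<bnd x. Elem x R 0 q p r \<longrightarrow> InSupport x R iav p s r))"

definition Move :: "bool list \<Rightarrow> rel \<Rightarrow> nat \<Rightarrow> nat \<Rightarrow> nat \<Rightarrow> nat \<Rightarrow> nat \<Rightarrow> nat \<Rightarrow> nat \<Rightarrow> nat \<Rightarrow> bool" where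
  "Move x R iav idel m m1 s k e q \<longleftrightarrow> First x R idel k e q \<and> Avail x R iav m1 s e q \<and> Team x R iav m s q"

definition RankLess :: "bool list \<Rightarrow> rel \<Rightarrow> nat \<Rightarrow> nat \<Rightarrow> bool" where
  "RankLess x R s' s \<longleftrightarrow> (\<exists>v<bnd x. \<exists>v'<bnd x. R 17 s v 0 0 \<and> R 17 s' v' 0 0 \<and> v' < v)"

text \<open>Tag 17 is required to be single-valued only; existence of the two ranks is part of
  \<open>RankLess\<close> and thus asserted where it is used.\<close>

definition Wins :: "bool list \<Rightarrow> rel \<Rightarrow> nat \<Rightarrow> nat \<Rightarrow> nat \<Rightarrow> nat \<Rightarrow> nat \<Rightarrow> nat \<Rightarrow> nat \<Rightarrow> bool" where
  "Wins x R iav idel iT is0 ns m m1 \<longleftrightarrow> (\<forall>s<bnd x. \<forall>v<bnd x. \<forall>v'<bnd x. R 17 s v 0 0 \<longrightarrow> R 17 s v' 0 0 \<longrightarrow> v = v') \<and>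
     (\<exists>v<bnd x. Val x R is0 v \<and> R 15 v 0 0 0) \<and>
     (\<forall>s<bnd x. s < ns \<longrightarrow> R 15 s 0 0 0 \<longrightarrow> \<not> InTarget x R iT s \<longrightarrow>
       AllEntries x R idel (\<lambda>k e q d. Move x R iav idel m m1 s k e q \<longrightarrow> (\<forall>s'<bnd x. s' < ns \<longrightarrow> Pos x R d s' \<longrightarrow> R 15 s' 0 0 0)) \<and>
       (\<forall>l<bnd x. AvailList x R iav m s l \<longrightarrow> (\<forall>k<bnd x. \<forall>b<bnd x. Elem x R 0 l k b \<longrightarrow>
         ExEntry x R idel (\<lambda>k e q d. Move x R iav idel m m1 s k e q \<and> (\<forall>r<bnd x. Elem x R 0 q m r \<longrightarrow> NatEq x r b) \<and>
           (\<exists>s'<bnd x. s' < ns \<and> Pos x R d s' \<and> RankLess x R s' s)))))"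

lemmas so_intros = so_rules so_iff so_rel simple_term_var simple_term_const so_IsNat so_NatBit so_NatEq so_NatLess so_Val so_IsList so_HasLen so_Elem

lemma so_IsFrac: "so_definable (\<lambda>x R e. IsFrac x (e i) (e j))"
  unfolding IsFrac_def by (intro so_intros; simp)

lemma so_IsEntry: "so_definable (\<lambda>x R e. IsEntry x R (e i) (e j))"
  unfolding IsEntry_def by (intro so_intros; simp)

lemma so_AvailList: "so_definable (\<lambda>x R e. AvailList x R (e iav) (e p) (e s) (e q))"
  unfolding AvailList_def by (intro so_intros; simp)

lemma so_InTarget: "so_definable (\<lambda>x R e. InTarget x R (e i) (e s))"
  unfolding InTarget_def by (intro so_intros; simp)

lemma so_Pos: "so_definable (\<lambda>x R e. Pos x R (e d) (e s))"
  unfolding Pos_def by (intro so_intros; simp)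

lemma so_ListEq: "so_definable (\<lambda>x R e. ListEq x R (e i) (e j))"
  unfolding ListEq_def by (intro so_intros; simp)

lemma so_Avail: "so_definable (\<lambda>x R e. Avail x R (e iav) (e m1) (e s) (e i) (e q))"
  unfolding Avail_def Prof_def InAvail_def InList_def by (intro so_intros so_AvailList; simp)

lemma so_Team: "so_definable (\<lambda>x R e. Team x R (e iav) (e m) (e s) (e q))"
  unfolding Team_def InSupport_def by (intro so_intros so_AvailList; simp)

lemma so_First: "so_definable (\<lambda>x R e. First x R (e idel) (e k) (e i) (e q))"
  unfolding First_def AllEntries_def ExEntry_def by (intro so_intros so_ListEq; simp)

lemma so_Move: "so_definable (\<lambda>x R e. Move x R (e iav) (e idel) (e m) (e m1) (e s) (e k) (e i) (e q))"
  unfolding Move_def by (intro so_intros so_First so_Avail so_Team)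

lemma so_Shape: "so_definable (\<lambda>x R e. Shape x R (e iacts) (e iav) (e iT) (e is0) (e ns) (e m1))"
  unfolding Shape_def by (intro so_intros; simp)

lemma so_Cover: "so_definable (\<lambda>x R e. Cover x R (e iav) (e idel) (e ns) (e m1))"
  unfolding Cover_def AllEntries_def ExEntry_def by (intro so_intros so_Avail so_AvailList; simp)

lemma so_Absorb: "so_definable (\<lambda>x R e. Absorb x R (e iav) (e idel) (e iT) (e ns) (e m1))"
  unfolding Absorb_def AllEntries_def ExEntry_def by (intro so_intros so_Avail so_First so_InTarget so_Pos; simp)

lemma so_Wins: "so_definable (\<lambda>x R e. Wins x R (e iav) (e idel) (e iT) (e is0) (e ns) (e m) (e m1))"
  unfolding Wins_def AllEntries_def ExEntry_def RankLess_def by (intro so_intros so_AvailList so_Move so_InTarget so_Pos; simp)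

section \<open>Meaning of the formulas\<close>

lemma all_less_cong: "(\<And>k. k < n \<Longrightarrow> P k \<longleftrightarrow> Q k) \<Longrightarrow> (\<forall>k<n. P k) \<longleftrightarrow> (\<forall>k<n. Q k)" for n :: nat
  by blast

lemma ex_less_cong: "(\<And>k. k < n \<Longrightarrow> P k \<longleftrightarrow> Q k) \<Longrightarrow> (\<exists>k<n. P k) \<longleftrightarrow> (\<exists>k<n. Q k)" for n :: nat
  by blast

lemma bounded_all: "n \<le> B \<Longrightarrow> (\<And>k. k < n \<Longrightarrow> P k \<longleftrightarrow> Q k) \<Longrightarrow> (\<forall>k<B. k < n \<longrightarrow> P k) \<longleftrightarrow> (\<forall>k<n. Q k)" for n :: nat
  by (meson less_le_trans)

lemma bounded_ex: "n \<le> B \<Longrightarrow> (\<And>k. k < n \<Longrightarrow> P k \<longleftrightarrow> Q k) \<Longrightarrow> (\<exists>k<B. k < n \<and> P k) \<longleftrightarrow> (\<exists>k<n. Q k)" for n :: nat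
  by (meson less_le_trans)

text \<open>The guessed relation is a union of relations distinguished by the tag in the first component:
  tags 0 to 4 relate a position, a number k and the position reached by skipping k list elements,
  tag 5 holds the bits of small numbers, tags 6 to 14 verify sums of rationals, and tags 15 to 17
  hold the winning set, the supports (by index into the list of available actions) and the rank.\<close>

locale tagged =
  fixes x :: "bool list" and R :: rel
  assumes tag0: "skips x R 0 ser_nat" and tag1: "skips x R 1 (ser_list ser_nat)"
    and tag2: "skips x R 2 (ser_list (ser_list ser_nat))" and tag3: "skips x R 3 ser_frac"
    and tag4: "skips x R 4 ser_entry"
    and unary: "\<forall>v<bnd x. bitrel (bnd x) (\<lambda>j. R 5 v j 0 0) v"
begin

abbreviation "B \<equiv> bnd x"

lemmas pf0 = prefix_ser_nat
lemmas pf1 = prefix_ser_list[OF pf0]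
lemmas pf2 = prefix_ser_list[OF pf1]

lemmas HasLen0 = HasLen_iff[OF tag0 pf0] and Elem0_all = Elem_all[OF tag0 pf0] and Elem0_ex = Elem_ex[OF tag0 pf0]
  and Elem0_all1 = Elem_all1[OF tag0 pf0] and len0 = length_list_less[OF tag0 pf0]

lemma Val_tag: "val ser_nat x i u \<Longrightarrow> v < B \<Longrightarrow> Val x R i v \<longleftrightarrow> u = v"
  by (rule Val_iff) (rule unary)

lemma InList_iff:
  assumes "val (ser_list ser_nat) x q vs" "val ser_nat x j c"
  shows "InList x R q j \<longleftrightarrow> c \<in> set vs"
proof -
  have "InList x R q j \<longleftrightarrow> (\<exists>k<length vs. NatEq x (elem_pos ser_nat q vs k) j)"
    unfolding InList_def by (rule Elem0_ex[OF assms(1)])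
  also have "\<dots> \<longleftrightarrow> (\<exists>k<length vs. vs ! k = c)"
    using NatEq_iff[OF elem_val(1)[OF assms(1)] assms(2)] by (intro ex_less_cong)
  finally show ?thesis by (simp add: in_set_conv_nth)
qed

lemma ListEq_iff:
  assumes u: "val (ser_list ser_nat) x q u" and v: "val (ser_list ser_nat) x q' v"
  shows "ListEq x R q q' \<longleftrightarrow> u = v"
proof -
  have "ListEq x R q q' \<longleftrightarrow> (\<forall>k<B. (k = length u \<longleftrightarrow> k = length v) \<and> (k < length u \<longrightarrow> k < length v \<longrightarrow> u ! k = v ! k))"
    unfolding ListEq_def
  proof (rule all_less_cong)
    fix k assume k: "k < B"
    show "((HasLen x R 0 q k \<longleftrightarrow> HasLen x R 0 q' k) \<and> (\<forall>r<B. Elem x R 0 q k r \<longrightarrow> (\<forall>r'<B. Elem x R 0 q' k r' \<longrightarrow> NatEq x r r'))) \<longleftrightarrow>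
      (k = length u \<longleftrightarrow> k = length v) \<and> (k < length u \<longrightarrow> k < length v \<longrightarrow> u ! k = v ! k)"
      unfolding HasLen0[OF u k] HasLen0[OF v k] Elem0_all1[OF u k] Elem0_all1[OF v k]
      using NatEq_iff[OF elem_val(1)[OF u] elem_val(1)[OF v], of k k] by blast
  qed
  also have "\<dots> \<longleftrightarrow> u = v"
  proof
    assume *: "\<forall>k<B. (k = length u \<longleftrightarrow> k = length v) \<and> (k < length u \<longrightarrow> k < length v \<longrightarrow> u ! k = v ! k)"
    then have len: "length u = length v" using len0[OF u] by blast
    show "u = v"
    proof (rule nth_equalityI[OF len])
      fix k assume "k < length u"
      then show "u ! k = v ! k" using * len len0[OF u] less_trans by metis
    qed
  qed simp
  finally show ?thesis .
qed

lemma Pos_iff: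
  assumes "val (ser_list ser_frac) x d ds" "s < B"
  shows "Pos x R d s \<longleftrightarrow> s < length ds \<and> fst (snd (ds ! s)) \<noteq> 0"
proof -
  have "Pos x R d s \<longleftrightarrow> s < length ds \<and> Suc (elem_pos ser_frac d ds s) < B \<and> bitx x (Suc (elem_pos ser_frac d ds s))"
    unfolding Pos_def ex_less_eq by (rule Elem_ex1[OF tag3 prefix_ser_frac assms])
  also have "\<dots> \<longleftrightarrow> s < length ds \<and> fst (snd (ds ! s)) \<noteq> 0"
  proof (cases "s < length ds")
    case True
    obtain t a b where ds: "ds ! s = (t, a, b)" by (metis prod_cases3)
    let ?p = "elem_pos ser_frac d ds s"
    have "val ser_frac x ?p (t, a, b)" using elem_val(1)[OF assms(1) True] ds by simp
    then obtain j where "occ x ?p j (t # ser_nat a @ ser_nat b)" by (auto simp: val_def ser_frac_def)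
    then obtain k where k: "occ x (Suc ?p) k (ser_nat a)" by (auto simp: occ_Cons occ_append)
    have "bitx x (Suc ?p) \<longleftrightarrow> a \<noteq> 0"
      using k ser_nat_pos[of a] by (cases "a = 0") (auto simp: ser_nat_0 occ_single occ_Cons bitx_def)
    moreover have "Suc ?p < B" using occ_less_bnd[OF k] by blast
    ultimately show ?thesis using True ds by simp
  qed simp
  finally show ?thesis .
qed

end

text \<open>Kept apart from any game: the formula on distributions must be understood while the
  fractions are still raw, because only afterwards can a game be read off the word.\<close>

locale entries = tagged +
  fixes del :: "(nat \<times> nat list \<times> frac list) list" and p4 :: nat
  assumes v_del: "val (ser_list ser_entry) x p4 del"
begin

definition "epos k = elem_pos ser_entry p4 del k"
definition "qpos k = epos k + length (ser_nat (fst (del ! k)))"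
definition "dpos k = qpos k + length (ser_list ser_nat (fst (snd (del ! k))))"

lemma raw_entry_vals:
  assumes "k < length del"
  shows "occ x (epos k) (qpos k) (ser_nat (fst (del ! k)))" "occ x (qpos k) (dpos k) (ser_list ser_nat (fst (snd (del ! k))))"
    "val (ser_list ser_frac) x (dpos k) (snd (snd (del ! k)))"
proof -
  have "val ser_entry x (epos k) (del ! k)" using elem_val(1)[OF v_del assms] unfolding epos_def .
  then obtain q d j where *: "occ x (epos k) q (ser_nat (fst (del ! k)))" "occ x q d (ser_list ser_nat (fst (snd (del ! k))))"
      "occ x d j (ser_list ser_frac (snd (snd (del ! k))))"
    by (auto simp: val_def ser_entry_def occ_append split_def)
  moreover have "q = qpos k" "d = dpos k"
    using occ_length[OF *(1)] occ_length[OF *(2)] unfolding qpos_def dpos_def by simp_all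
  ultimately show "occ x (epos k) (qpos k) (ser_nat (fst (del ! k)))" "occ x (qpos k) (dpos k) (ser_list ser_nat (fst (snd (del ! k))))"
    "val (ser_list ser_frac) x (dpos k) (snd (snd (del ! k)))" unfolding val_def by blast+
qed

lemma raw_ExEntry_iff: "ExEntry x R p4 P \<longleftrightarrow> (\<exists>k<length del. P k (epos k) (qpos k) (dpos k))"
proof -
  have "ExEntry x R p4 P \<longleftrightarrow> (\<exists>k<length del. \<exists>q<B. \<exists>d<B. IsNat x (epos k) q \<and> IsList x R 0 q d \<and> P k (epos k) q d)"
    unfolding ExEntry_def Elem_ex[OF tag4 prefix_ser_entry v_del] epos_def ..
  also have "\<dots> \<longleftrightarrow> (\<exists>k<length del. P k (epos k) (qpos k) (dpos k))"
  proof (rule ex_less_cong)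
    fix k assume k: "k < length del"
    note e = raw_entry_vals[OF k]
    have lt: "qpos k < B" "dpos k < B" using occ_less_bnd[OF e(2)] by blast+
    have q: "IsNat x (epos k) q \<longleftrightarrow> q = qpos k" for q
      unfolding IsNat_iff using occ_prefix[OF pf0 e(1)] e(1) by blast
    have d: "IsList x R 0 (qpos k) d \<longleftrightarrow> d = dpos k" for d
      unfolding IsList_iff[OF tag0 lt(1)] using occ_prefix[OF pf1 e(2)] e(2) by blast
    show "(\<exists>q<B. \<exists>d<B. IsNat x (epos k) q \<and> IsList x R 0 q d \<and> P k (epos k) q d) \<longleftrightarrow> P k (epos k) (qpos k) (dpos k)"
      unfolding q
    proof
      assume "\<exists>q<B. \<exists>d<B. q = qpos k \<and> IsList x R 0 q d \<and> P k (epos k) q d"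
      then obtain d' where "IsList x R 0 (qpos k) d'" "P k (epos k) (qpos k) d'" by blast
      then show "P k (epos k) (qpos k) (dpos k)" unfolding d by simp
    next
      assume P: "P k (epos k) (qpos k) (dpos k)"
      have "IsList x R 0 (qpos k) (dpos k)" unfolding d ..
      then show "\<exists>q<B. \<exists>d<B. q = qpos k \<and> IsList x R 0 q d \<and> P k (epos k) q d"
        using lt P by (intro exI[of _ "qpos k"] conjI exI[of _ "dpos k"]) simp_all
    qed
  qed
  finally show ?thesis .
qed

lemma raw_AllEntries_iff: "AllEntries x R p4 P \<longleftrightarrow> (\<forall>k<length del. P k (epos k) (qpos k) (dpos k))"
  unfolding AllEntries_def raw_ExEntry_iff by blast

end

locale coded = entries +
  fixes g :: raw_game and p1 p2 p3 p5 p6 :: nat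
  assumes v_ns: "val ser_nat x 0 (rg_ns g)" and v_m: "val ser_nat x p1 (rg_m g)"
    and v_acts: "val (ser_list ser_nat) x p2 (rg_acts g)"
    and v_av: "val (ser_list (ser_list (ser_list ser_nat))) x p3 (rg_av g)"
    and v_T: "val (ser_list ser_nat) x p5 (rg_T g)" and v_s0: "val ser_nat x p6 (rg_s0 g)"
    and del: "del = map (\<lambda>(s, a, d). (s, a, map frac_of d)) (rg_delta g)"
    and ns_less: "rg_ns g < bnd x" and m_less: "Suc (rg_m g) < bnd x"
begin

abbreviation "ns \<equiv> rg_ns g"
abbreviation "m \<equiv> rg_m g"
abbreviation "T \<equiv> set (rg_T g)"
abbreviation "N \<equiv> length (rg_delta g)"
abbreviation "es k \<equiv> fst (rg_delta g ! k)"
abbreviation "ea k \<equiv> fst (snd (rg_delta g ! k))"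
abbreviation "ed k \<equiv> snd (snd (rg_delta g ! k))"

definition "apos p = elem_pos (ser_list (ser_list ser_nat)) p3 (rg_av g) p"
definition "lpos p s = elem_pos (ser_list ser_nat) (apos p) (rg_av g ! p) s"

lemma v_apos: "p < length (rg_av g) \<Longrightarrow> val (ser_list (ser_list ser_nat)) x (apos p) (rg_av g ! p)"
  unfolding apos_def by (rule elem_val(1)[OF v_av])

lemma v_lpos: "p < length (rg_av g) \<Longrightarrow> s < length (rg_av g ! p) \<Longrightarrow> val (ser_list ser_nat) x (lpos p s) (rg_av g ! p ! s)"
  unfolding lpos_def by (rule elem_val(1)[OF v_apos])

lemma val_less: "val f x i a \<Longrightarrow> i < B"
  using val_le[of f x i a] by (simp add: bnd_def)

lemma AvailList_iff:
  assumes "p < B" "s < B"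
  shows "AvailList x R p3 p s q \<longleftrightarrow> p < length (rg_av g) \<and> s < length (rg_av g ! p) \<and> q = lpos p s"
proof -
  have "AvailList x R p3 p s q \<longleftrightarrow> p < length (rg_av g) \<and> Elem x R 1 (apos p) s q"
    unfolding AvailList_def apos_def by (rule Elem_ex1[OF tag2 pf2 v_av assms(1)])
  then show ?thesis using Elem_iff[OF tag1 pf1 v_apos assms(2), of p q] unfolding lpos_def by blast
qed

lemma AvailList_ex:
  assumes "p < B" "s < B"
  shows "(\<exists>q<B. AvailList x R p3 p s q \<and> P q) \<longleftrightarrow> p < length (rg_av g) \<and> s < length (rg_av g ! p) \<and> P (lpos p s)"
  unfolding AvailList_iff[OF assms] using val_less[OF v_lpos] by blast

lemma AvailList_all:
  assumes "p < B" "s < B" "p < length (rg_av g)" "s < length (rg_av g ! p)"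
  shows "(\<forall>q<B. AvailList x R p3 p s q \<longrightarrow> P q) \<longleftrightarrow> P (lpos p s)"
  unfolding AvailList_iff[OF assms(1,2)] using val_less[OF v_lpos] assms by blast

lemma Shape_iff:
  "Shape x R p2 p3 p5 p6 ns (Suc m) \<longleftrightarrow> length (rg_acts g) = Suc m \<and> length (rg_av g) = Suc m \<and>
     (\<forall>p<length (rg_av g). length (rg_av g ! p) = ns \<and> (\<forall>s<length (rg_av g ! p). rg_av g ! p ! s \<noteq> [] \<and>
        (p < length (rg_acts g) \<longrightarrow> set (rg_av g ! p ! s) \<subseteq> {..<rg_acts g ! p}))) \<and>
     T \<subseteq> {..<ns} \<and> rg_s0 g < ns"
proof -
  have 1: "HasLen x R 0 p2 (Suc m) \<longleftrightarrow> length (rg_acts g) = Suc m" "HasLen x R 2 p3 (Suc m) \<longleftrightarrow> length (rg_av g) = Suc m"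
    using HasLen0[OF v_acts m_less] HasLen_iff[OF tag2 pf2 v_av m_less] by auto
  have inner: "((\<forall>z<B. z = 0 \<longrightarrow> \<not> HasLen x R 0 (lpos p s) z) \<and>
           (\<forall>k<B. \<forall>j<B. Elem x R 0 (lpos p s) k j \<longrightarrow> (\<forall>a<B. Elem x R 0 p2 p a \<longrightarrow> NatLess x j a))) \<longleftrightarrow>
       rg_av g ! p ! s \<noteq> [] \<and> (p < length (rg_acts g) \<longrightarrow> set (rg_av g ! p ! s) \<subseteq> {..<rg_acts g ! p})"
    if p: "p < length (rg_av g)" and s: "s < length (rg_av g ! p)" for p s
  proof -
    note v = v_lpos[OF p s]
    have pB: "p < B" using p length_list_less[OF tag2 pf2 v_av] by simp
    have "(\<forall>z<B. z = 0 \<longrightarrow> \<not> HasLen x R 0 (lpos p s) z) \<longleftrightarrow> rg_av g ! p ! s \<noteq> []"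
      using HasLen0[OF v, of 0] by simp
    moreover have "(\<forall>k<B. \<forall>j<B. Elem x R 0 (lpos p s) k j \<longrightarrow> (\<forall>a<B. Elem x R 0 p2 p a \<longrightarrow> NatLess x j a)) \<longleftrightarrow>
        (\<forall>k<length (rg_av g ! p ! s). p < length (rg_acts g) \<longrightarrow> rg_av g ! p ! s ! k < rg_acts g ! p)"
      unfolding Elem0_all[OF v] Elem0_all1[OF v_acts pB]
      using NatLess_iff[OF elem_val(1)[OF v] elem_val(1)[OF v_acts]] by (intro all_less_cong) blast
    moreover have "\<dots> \<longleftrightarrow> (p < length (rg_acts g) \<longrightarrow> set (rg_av g ! p ! s) \<subseteq> {..<rg_acts g ! p})"
      by (auto simp: set_conv_nth)
    ultimately show ?thesis by blast
  qed
  have mid: "HasLen x R 1 (apos p) ns \<and>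
        (\<forall>s<B. \<forall>q<B. Elem x R 1 (apos p) s q \<longrightarrow> (\<forall>z<B. z = 0 \<longrightarrow> \<not> HasLen x R 0 q z) \<and>
           (\<forall>k<B. \<forall>j<B. Elem x R 0 q k j \<longrightarrow> (\<forall>a<B. Elem x R 0 p2 p a \<longrightarrow> NatLess x j a))) \<longleftrightarrow>
       length (rg_av g ! p) = ns \<and> (\<forall>s<length (rg_av g ! p). rg_av g ! p ! s \<noteq> [] \<and>
        (p < length (rg_acts g) \<longrightarrow> set (rg_av g ! p ! s) \<subseteq> {..<rg_acts g ! p}))"
    if p: "p < length (rg_av g)" for p
  proof -
    have "HasLen x R 1 (apos p) ns \<longleftrightarrow> length (rg_av g ! p) = ns"
      using HasLen_iff[OF tag1 pf1 v_apos[OF p] ns_less] by auto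
    moreover have "(\<forall>s<B. \<forall>q<B. Elem x R 1 (apos p) s q \<longrightarrow> (\<forall>z<B. z = 0 \<longrightarrow> \<not> HasLen x R 0 q z) \<and>
           (\<forall>k<B. \<forall>j<B. Elem x R 0 q k j \<longrightarrow> (\<forall>a<B. Elem x R 0 p2 p a \<longrightarrow> NatLess x j a))) \<longleftrightarrow>
        (\<forall>s<length (rg_av g ! p). rg_av g ! p ! s \<noteq> [] \<and>
        (p < length (rg_acts g) \<longrightarrow> set (rg_av g ! p ! s) \<subseteq> {..<rg_acts g ! p}))"
      unfolding Elem_all[OF tag1 pf1 v_apos[OF p]] lpos_def[symmetric]
      using inner[OF p] by (rule all_less_cong)
    ultimately show ?thesis by blast
  qed
  have 2: "(\<forall>p<B. \<forall>r<B. Elem x R 2 p3 p r \<longrightarrow> HasLen x R 1 r ns \<and>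
        (\<forall>s<B. \<forall>q<B. Elem x R 1 r s q \<longrightarrow> (\<forall>z<B. z = 0 \<longrightarrow> \<not> HasLen x R 0 q z) \<and>
           (\<forall>k<B. \<forall>j<B. Elem x R 0 q k j \<longrightarrow> (\<forall>a<B. Elem x R 0 p2 p a \<longrightarrow> NatLess x j a)))) \<longleftrightarrow>
      (\<forall>p<length (rg_av g). length (rg_av g ! p) = ns \<and> (\<forall>s<length (rg_av g ! p). rg_av g ! p ! s \<noteq> [] \<and>
        (p < length (rg_acts g) \<longrightarrow> set (rg_av g ! p ! s) \<subseteq> {..<rg_acts g ! p})))"
    unfolding Elem_all[OF tag2 pf2 v_av] apos_def[symmetric] using mid by (rule all_less_cong)
  have below: "(\<exists>v<B. Val x R r v \<and> v < ns) \<longleftrightarrow> u < ns" if "val ser_nat x r u" for r u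
    using Val_tag[OF that] ns_less less_trans by metis
  have 3: "(\<forall>k<B. \<forall>r<B. Elem x R 0 p5 k r \<longrightarrow> (\<exists>v<B. Val x R r v \<and> v < ns)) \<longleftrightarrow> T \<subseteq> {..<ns}"
  proof -
    have "(\<forall>k<B. \<forall>r<B. Elem x R 0 p5 k r \<longrightarrow> (\<exists>v<B. Val x R r v \<and> v < ns)) \<longleftrightarrow> (\<forall>k<length (rg_T g). rg_T g ! k < ns)"
      unfolding Elem0_all[OF v_T] using below[OF elem_val(1)[OF v_T]] by (intro all_less_cong)
    then show ?thesis by (auto simp: set_conv_nth)
  qed
  show ?thesis unfolding Shape_def 1 2 3 below[OF v_s0] ..
qed

lemma length_del: "length del = N"
  by (simp add: del)

lemma del_nth: "k < N \<Longrightarrow> del ! k = (es k, ea k, map frac_of (ed k))"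
  by (cases "rg_delta g ! k") (simp add: del)

lemma entry_vals:
  assumes "k < N"
  shows "occ x (epos k) (qpos k) (ser_nat (es k))" "occ x (qpos k) (dpos k) (ser_list ser_nat (ea k))"
    "val (ser_list ser_frac) x (dpos k) (map frac_of (ed k))"
  using raw_entry_vals[of k] assms by (simp_all add: length_del del_nth)

lemma v_es: "k < N \<Longrightarrow> val ser_nat x (epos k) (es k)" and v_ea: "k < N \<Longrightarrow> val (ser_list ser_nat) x (qpos k) (ea k)"
  using entry_vals unfolding val_def by blast+

lemmas ExEntry_iff = raw_ExEntry_iff[unfolded length_del] and AllEntries_iff = raw_AllEntries_iff[unfolded length_del]

definition first :: "nat \<Rightarrow> bool" where
  "first k \<longleftrightarrow> (\<forall>k'<k. \<not> (es k' = es k \<and> ea k' = ea k))"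

lemma First_iff:
  assumes "k < N" shows "First x R p4 k (epos k) (qpos k) \<longleftrightarrow> first k"
proof -
  have "First x R p4 k (epos k) (qpos k) \<longleftrightarrow> (\<forall>k'<N. k' < k \<longrightarrow> \<not> (es k' = es k \<and> ea k' = ea k))"
    unfolding First_def AllEntries_iff
    using NatEq_iff[OF v_es v_es[OF assms]] ListEq_iff[OF v_ea v_ea[OF assms]] by (intro all_less_cong) blast
  then show ?thesis unfolding first_def using assms less_trans by blast
qed

lemma InTarget_iff: "s < B \<Longrightarrow> InTarget x R p5 s \<longleftrightarrow> s \<in> T"
proof -
  assume s: "s < B"
  have "InTarget x R p5 s \<longleftrightarrow> (\<exists>k<length (rg_T g). rg_T g ! k = s)"
    unfolding InTarget_def Elem0_ex[OF v_T] using Val_tag[OF elem_val(1)[OF v_T] s] by (intro ex_less_cong)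
  then show ?thesis by (simp add: in_set_conv_nth)
qed

end

text \<open>The interpretation proceeds in stages. The formulas below read the action lists at index
  \<open>p\<close> and \<open>s\<close>, which is meaningful once \<open>Shape\<close> has fixed
  their lengths.\<close>

locale shaped = coded +
  assumes len_av: "length (rg_av g) = Suc (rg_m g)" and len_av_nth: "p < Suc (rg_m g) \<Longrightarrow> length (rg_av g ! p) = rg_ns g"
begin

lemma state_less: "s < ns \<Longrightarrow> s < B" and player_less: "p < Suc m \<Longrightarrow> p < B"
  using ns_less m_less by simp_all

lemma InAvail_iff:
  assumes "p < Suc m" "s < ns" "val ser_nat x j c"
  shows "InAvail x R p3 p s j \<longleftrightarrow> c \<in> av g p s"
proof -
  have "p < length (rg_av g)" "s < length (rg_av g ! p)" using assms len_av len_av_nth by simp_all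
  then show ?thesis
    unfolding InAvail_def AvailList_ex[OF player_less[OF assms(1)] state_less[OF assms(2)]] av_def
    using InList_iff[OF v_lpos assms(3)] by blast
qed

definition D :: "nat \<Rightarrow> nat \<Rightarrow> nat set" where
  "D p s = {rg_av g ! p ! s ! k | k. k < length (rg_av g ! p ! s) \<and> R 16 p s k 0}"

lemma InSupport_iff:
  assumes "p < Suc m" "s < ns" "val ser_nat x j c"
  shows "InSupport x R p3 p s j \<longleftrightarrow> c \<in> D p s"
proof -
  have ps: "p < length (rg_av g)" "s < length (rg_av g ! p)" using assms len_av len_av_nth by simp_all
  note v = v_lpos[OF ps]
  have "InSupport x R p3 p s j \<longleftrightarrow> (\<exists>k<length (rg_av g ! p ! s). R 16 p s k 0 \<and> NatEq x (elem_pos ser_nat (lpos p s) (rg_av g ! p ! s) k) j)"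
    unfolding InSupport_def AvailList_ex[OF player_less[OF assms(1)] state_less[OF assms(2)]] Elem0_ex[OF v] using ps by blast
  also have "\<dots> \<longleftrightarrow> (\<exists>k<length (rg_av g ! p ! s). R 16 p s k 0 \<and> rg_av g ! p ! s ! k = c)"
    using NatEq_iff[OF elem_val(1)[OF v] assms(3)] by (intro ex_less_cong) blast
  finally show ?thesis unfolding D_def by blast
qed

lemma Prof_iff:
  assumes "s < ns" "val (ser_list ser_nat) x q a"
  shows "Prof x R p3 (Suc m) s q \<longleftrightarrow> a \<in> profiles g s"
proof -
  have "Prof x R p3 (Suc m) s q \<longleftrightarrow> Suc m = length a \<and> (\<forall>k<length a. InAvail x R p3 k s (elem_pos ser_nat q a k))"
    unfolding Prof_def HasLen0[OF assms(2) m_less] Elem0_all[OF assms(2)] ..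
  also have "\<dots> \<longleftrightarrow> Suc m = length a \<and> (\<forall>k<length a. a ! k \<in> av g k s)"
    using InAvail_iff[OF _ assms(1) elem_val(1)[OF assms(2)]] by auto
  finally show ?thesis unfolding profiles_def by auto
qed

lemma Avail_iff:
  assumes "s < ns" "k < N"
  shows "Avail x R p3 (Suc m) s (epos k) (qpos k) \<longleftrightarrow> es k = s \<and> ea k \<in> profiles g s"
  unfolding Avail_def Val_tag[OF v_es[OF assms(2)] state_less[OF assms(1)]] Prof_iff[OF assms(1) v_ea[OF assms(2)]] ..

lemma Cover_iff:
  "Cover x R p3 p4 ns (Suc m) \<longleftrightarrow> (\<forall>s<ns. (\<exists>k<N. es k = s \<and> ea k \<in> profiles g s) \<and>
     (\<forall>k<N. es k = s \<and> ea k \<in> profiles g s \<longrightarrow> (\<forall>p<Suc m. \<forall>c\<in>av g p s.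
        \<exists>k'<N. (es k' = s \<and> ea k' \<in> profiles g s) \<and> (\<forall>p'<p. ea k ! p' = ea k' ! p') \<and> ea k' ! p = c)))"
  unfolding Cover_def
proof (rule bounded_all)
  show "ns \<le> B" using ns_less by simp
  fix s assume s: "s < ns"
  have 1: "ExEntry x R p4 (\<lambda>k e q d. Avail x R p3 (Suc m) s e q) \<longleftrightarrow> (\<exists>k<N. es k = s \<and> ea k \<in> profiles g s)"
    unfolding ExEntry_iff using Avail_iff[OF s] by (intro ex_less_cong)
  have agree: "((\<forall>p'<B. p' < p \<longrightarrow> (\<forall>r<B. Elem x R 0 (qpos k) p' r \<longrightarrow> (\<forall>r'<B. Elem x R 0 (qpos k') p' r' \<longrightarrow> NatEq x r r'))) \<and>
      (\<forall>r<B. Elem x R 0 (qpos k') p r \<longrightarrow> NatEq x r c)) \<longleftrightarrow> (\<forall>p'<p. ea k ! p' = ea k' ! p') \<and> ea k' ! p = u"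
    if k: "k < N" "ea k \<in> profiles g s" "k' < N" "ea k' \<in> profiles g s" and p: "p < Suc m" and c: "val ser_nat x c u" for k k' p c u
  proof -
    have len: "length (ea k) = Suc m" "length (ea k') = Suc m" using k by (auto simp: profiles_def)
    have "(\<forall>p'<B. p' < p \<longrightarrow> (\<forall>r<B. Elem x R 0 (qpos k) p' r \<longrightarrow> (\<forall>r'<B. Elem x R 0 (qpos k') p' r' \<longrightarrow> NatEq x r r'))) \<longleftrightarrow>
       (\<forall>p'<p. ea k ! p' = ea k' ! p')"
    proof (rule bounded_all)
      show "p \<le> B" using player_less[OF p] by simp
      fix p' assume p': "p' < p"
      then have p'B: "p' < B" "p' < Suc m" using player_less[OF p] p by simp_all
      show "(\<forall>r<B. Elem x R 0 (qpos k) p' r \<longrightarrow> (\<forall>r'<B. Elem x R 0 (qpos k') p' r' \<longrightarrow> NatEq x r r')) \<longleftrightarrow> ea k ! p' = ea k' ! p'"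
        unfolding Elem0_all1[OF v_ea[OF k(1)] p'B(1)] Elem0_all1[OF v_ea[OF k(3)] p'B(1)]
        using NatEq_iff[OF elem_val(1)[OF v_ea[OF k(1)]] elem_val(1)[OF v_ea[OF k(3)]], of p' p'] p'B(2) len by simp
    qed
    moreover have "(\<forall>r<B. Elem x R 0 (qpos k') p r \<longrightarrow> NatEq x r c) \<longleftrightarrow> ea k' ! p = u"
      unfolding Elem0_all1[OF v_ea[OF k(3)] player_less[OF p]]
      using NatEq_iff[OF elem_val(1)[OF v_ea[OF k(3)]] c, of p] p len by simp
    ultimately show ?thesis by blast
  qed
  have 2: "AllEntries x R p4 (\<lambda>k e q d. Avail x R p3 (Suc m) s e q \<longrightarrow> (\<forall>p<B. p < Suc m \<longrightarrow>
       (\<forall>l<B. AvailList x R p3 p s l \<longrightarrow> (\<forall>k<B. \<forall>c<B. Elem x R 0 l k c \<longrightarrow>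
          ExEntry x R p4 (\<lambda>k' e' q' d'. Avail x R p3 (Suc m) s e' q' \<and>
            (\<forall>p'<B. p' < p \<longrightarrow> (\<forall>r<B. Elem x R 0 q p' r \<longrightarrow> (\<forall>r'<B. Elem x R 0 q' p' r' \<longrightarrow> NatEq x r r'))) \<and>
            (\<forall>r<B. Elem x R 0 q' p r \<longrightarrow> NatEq x r c)))))) \<longleftrightarrow>
     (\<forall>k<N. es k = s \<and> ea k \<in> profiles g s \<longrightarrow> (\<forall>p<Suc m. \<forall>c\<in>av g p s.
        \<exists>k'<N. (es k' = s \<and> ea k' \<in> profiles g s) \<and> (\<forall>p'<p. ea k ! p' = ea k' ! p') \<and> ea k' ! p = c))"
    unfolding AllEntries_iff
  proof (rule all_less_cong)
    fix k assume k: "k < N"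
    have "(\<forall>p<B. p < Suc m \<longrightarrow>
       (\<forall>l<B. AvailList x R p3 p s l \<longrightarrow> (\<forall>kk<B. \<forall>c<B. Elem x R 0 l kk c \<longrightarrow>
          ExEntry x R p4 (\<lambda>k' e' q' d'. Avail x R p3 (Suc m) s e' q' \<and>
            (\<forall>p'<B. p' < p \<longrightarrow> (\<forall>r<B. Elem x R 0 (qpos k) p' r \<longrightarrow> (\<forall>r'<B. Elem x R 0 q' p' r' \<longrightarrow> NatEq x r r'))) \<and>
            (\<forall>r<B. Elem x R 0 q' p r \<longrightarrow> NatEq x r c))))) \<longleftrightarrow>
       (\<forall>p<Suc m. \<forall>c\<in>av g p s. \<exists>k'<N. (es k' = s \<and> ea k' \<in> profiles g s) \<and> (\<forall>p'<p. ea k ! p' = ea k' ! p') \<and> ea k' ! p = c)"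
      if prof: "ea k \<in> profiles g s"
    proof (rule bounded_all)
      show "Suc m \<le> B" using m_less by simp
      fix p assume p: "p < Suc m"
      have ps: "p < length (rg_av g)" "s < length (rg_av g ! p)" using p s len_av len_av_nth by simp_all
      note v = v_lpos[OF ps]
      have "(\<forall>l<B. AvailList x R p3 p s l \<longrightarrow> (\<forall>kk<B. \<forall>c<B. Elem x R 0 l kk c \<longrightarrow>
          ExEntry x R p4 (\<lambda>k' e' q' d'. Avail x R p3 (Suc m) s e' q' \<and>
            (\<forall>p'<B. p' < p \<longrightarrow> (\<forall>r<B. Elem x R 0 (qpos k) p' r \<longrightarrow> (\<forall>r'<B. Elem x R 0 q' p' r' \<longrightarrow> NatEq x r r'))) \<and>
            (\<forall>r<B. Elem x R 0 q' p r \<longrightarrow> NatEq x r c)))) \<longleftrightarrow>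
          (\<forall>kk<length (rg_av g ! p ! s). \<exists>k'<N. (es k' = s \<and> ea k' \<in> profiles g s) \<and> (\<forall>p'<p. ea k ! p' = ea k' ! p') \<and>
             ea k' ! p = rg_av g ! p ! s ! kk)"
        unfolding AvailList_all[OF player_less[OF p] state_less[OF s] ps] Elem0_all[OF v]
      proof (rule all_less_cong)
        fix kk assume kk: "kk < length (rg_av g ! p ! s)"
        show "ExEntry x R p4 (\<lambda>k' e' q' d'. Avail x R p3 (Suc m) s e' q' \<and>
            (\<forall>p'<B. p' < p \<longrightarrow> (\<forall>r<B. Elem x R 0 (qpos k) p' r \<longrightarrow> (\<forall>r'<B. Elem x R 0 q' p' r' \<longrightarrow> NatEq x r r'))) \<and>
            (\<forall>r<B. Elem x R 0 q' p r \<longrightarrow> NatEq x r (elem_pos ser_nat (lpos p s) (rg_av g ! p ! s) kk))) \<longleftrightarrow>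
          (\<exists>k'<N. (es k' = s \<and> ea k' \<in> profiles g s) \<and> (\<forall>p'<p. ea k ! p' = ea k' ! p') \<and> ea k' ! p = rg_av g ! p ! s ! kk)"
          unfolding ExEntry_iff
        proof (rule ex_less_cong)
          fix k' assume k': "k' < N"
          show "(Avail x R p3 (Suc m) s (epos k') (qpos k') \<and>
            (\<forall>p'<B. p' < p \<longrightarrow> (\<forall>r<B. Elem x R 0 (qpos k) p' r \<longrightarrow> (\<forall>r'<B. Elem x R 0 (qpos k') p' r' \<longrightarrow> NatEq x r r'))) \<and>
            (\<forall>r<B. Elem x R 0 (qpos k') p r \<longrightarrow> NatEq x r (elem_pos ser_nat (lpos p s) (rg_av g ! p ! s) kk))) \<longleftrightarrow>
            (es k' = s \<and> ea k' \<in> profiles g s) \<and> (\<forall>p'<p. ea k ! p' = ea k' ! p') \<and> ea k' ! p = rg_av g ! p ! s ! kk"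
            unfolding Avail_iff[OF s k'] using agree[OF k prof k' _ p elem_val(1)[OF v kk]] by blast
        qed
      qed
      then show "(\<forall>l<B. AvailList x R p3 p s l \<longrightarrow> (\<forall>kk<B. \<forall>c<B. Elem x R 0 l kk c \<longrightarrow>
          ExEntry x R p4 (\<lambda>k' e' q' d'. Avail x R p3 (Suc m) s e' q' \<and>
            (\<forall>p'<B. p' < p \<longrightarrow> (\<forall>r<B. Elem x R 0 (qpos k) p' r \<longrightarrow> (\<forall>r'<B. Elem x R 0 q' p' r' \<longrightarrow> NatEq x r r'))) \<and>
            (\<forall>r<B. Elem x R 0 q' p r \<longrightarrow> NatEq x r c)))) \<longleftrightarrow>
          (\<forall>c\<in>av g p s. \<exists>k'<N. (es k' = s \<and> ea k' \<in> profiles g s) \<and> (\<forall>p'<p. ea k ! p' = ea k' ! p') \<and> ea k' ! p = c)"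
        unfolding av_def all_set_conv_all_nth .
    qed
    then show "(Avail x R p3 (Suc m) s (epos k) (qpos k) \<longrightarrow> (\<forall>p<B. p < Suc m \<longrightarrow>
       (\<forall>l<B. AvailList x R p3 p s l \<longrightarrow> (\<forall>kk<B. \<forall>c<B. Elem x R 0 l kk c \<longrightarrow>
          ExEntry x R p4 (\<lambda>k' e' q' d'. Avail x R p3 (Suc m) s e' q' \<and>
            (\<forall>p'<B. p' < p \<longrightarrow> (\<forall>r<B. Elem x R 0 (qpos k) p' r \<longrightarrow> (\<forall>r'<B. Elem x R 0 q' p' r' \<longrightarrow> NatEq x r r'))) \<and>
            (\<forall>r<B. Elem x R 0 q' p r \<longrightarrow> NatEq x r c)))))) \<longleftrightarrow>
       (es k = s \<and> ea k \<in> profiles g s \<longrightarrow> (\<forall>p<Suc m. \<forall>c\<in>av g p s.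
        \<exists>k'<N. (es k' = s \<and> ea k' \<in> profiles g s) \<and> (\<forall>p'<p. ea k ! p' = ea k' ! p') \<and> ea k' ! p = c))"
      unfolding Avail_iff[OF s k] by blast
  qed
  show "ExEntry x R p4 (\<lambda>k e q d. Avail x R p3 (Suc m) s e q) \<and> AllEntries x R p4 (\<lambda>k e q d. Avail x R p3 (Suc m) s e q \<longrightarrow> (\<forall>p<B. p < Suc m \<longrightarrow>
       (\<forall>l<B. AvailList x R p3 p s l \<longrightarrow> (\<forall>k<B. \<forall>c<B. Elem x R 0 l k c \<longrightarrow>
          ExEntry x R p4 (\<lambda>k' e' q' d'. Avail x R p3 (Suc m) s e' q' \<and>
            (\<forall>p'<B. p' < p \<longrightarrow> (\<forall>r<B. Elem x R 0 q p' r \<longrightarrow> (\<forall>r'<B. Elem x R 0 q' p' r' \<longrightarrow> NatEq x r r'))) \<and>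
            (\<forall>r<B. Elem x R 0 q' p r \<longrightarrow> NatEq x r c)))))) \<longleftrightarrow>
     (\<exists>k<N. es k = s \<and> ea k \<in> profiles g s) \<and>
     (\<forall>k<N. es k = s \<and> ea k \<in> profiles g s \<longrightarrow> (\<forall>p<Suc m. \<forall>c\<in>av g p s.
        \<exists>k'<N. (es k' = s \<and> ea k' \<in> profiles g s) \<and> (\<forall>p'<p. ea k ! p' = ea k' ! p') \<and> ea k' ! p = c))"
    unfolding 1 2 ..
qed

end

lemma frac_of_zero: "fst (snd (frac_of q)) = 0 \<longleftrightarrow> q = 0"
proof -
  obtain a b where ab: "quotient_of q = (a, b)" by (cases "quotient_of q")
  then have "q = of_int a / of_int b" "b > 0" by (auto dest: quotient_of_div quotient_of_denom_pos)
  then show ?thesis unfolding frac_of_def ab by simp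
qed

context shaped
begin

text \<open>The entries must be closed under changing one coordinate of a profile that agrees on all
  earlier coordinates; that is how coverage of exponentially many profiles is tested locally.\<close>

lemma cover_closure:
  assumes ne: "\<And>p. p < Suc m \<Longrightarrow> av g p s \<noteq> {}"
  shows "(\<forall>a\<in>profiles g s. \<exists>e\<in>set (rg_delta g). fst e = s \<and> fst (snd e) = a) \<longleftrightarrow>
     (\<exists>k<N. es k = s \<and> ea k \<in> profiles g s) \<and>
     (\<forall>k<N. es k = s \<and> ea k \<in> profiles g s \<longrightarrow> (\<forall>p<Suc m. \<forall>c\<in>av g p s.
        \<exists>k'<N. (es k' = s \<and> ea k' \<in> profiles g s) \<and> (\<forall>p'<p. ea k ! p' = ea k' ! p') \<and> ea k' ! p = c))"
proof -
  have index: "(\<exists>e\<in>set (rg_delta g). fst e = s \<and> fst (snd e) = a) \<longleftrightarrow> (\<exists>k<N. es k = s \<and> ea k = a)" for a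
    by (metis in_set_conv_nth)
  show ?thesis unfolding index
  proof (rule iffI; (elim conjE)?)
    assume cov: "\<forall>a\<in>profiles g s. \<exists>k<N. es k = s \<and> ea k = a"
    \<comment> \<open>Any profile yields the required first entry; one exists because all action
      sets at \<open>s\<close> are nonempty.\<close>
    define a0 where "a0 = map (\<lambda>p. SOME c. c \<in> av g p s) [0..<Suc m]"
    have a0: "a0 \<in> profiles g s"
      using ne by (auto simp: profiles_def a0_def some_in_eq simp del: upt_Suc)
    then obtain k where "k < N" "es k = s" "ea k = a0" using cov[rule_format, OF a0] by (elim exE conjE)
    then have 1: "\<exists>k<N. es k = s \<and> ea k \<in> profiles g s" using a0 by (intro exI[of _ k]) simp
    have 2: "\<exists>k'<N. (es k' = s \<and> ea k' \<in> profiles g s) \<and> (\<forall>p'<p. ea k ! p' = ea k' ! p') \<and> ea k' ! p = c"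
      if k: "k < N" "es k = s" "ea k \<in> profiles g s" "p < Suc m" "c \<in> av g p s" for k p c
    proof -
      have a: "(ea k)[p := c] \<in> profiles g s"
        using k by (auto simp: profiles_def nth_list_update)
      then obtain k' where "k' < N" "es k' = s" "ea k' = (ea k)[p := c]"
        using cov[rule_format, OF a] by (elim exE conjE)
      moreover have "p < length (ea k)" using k by (auto simp: profiles_def)
      ultimately show ?thesis using a by (intro exI[of _ k']) auto
    qed
    show "(\<exists>k<N. es k = s \<and> ea k \<in> profiles g s) \<and>
     (\<forall>k<N. es k = s \<and> ea k \<in> profiles g s \<longrightarrow> (\<forall>p<Suc m. \<forall>c\<in>av g p s.
        \<exists>k'<N. (es k' = s \<and> ea k' \<in> profiles g s) \<and> (\<forall>p'<p. ea k ! p' = ea k' ! p') \<and> ea k' ! p = c))"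
      using 1 2 by blast
  next
    assume start: "\<exists>k<N. es k = s \<and> ea k \<in> profiles g s"
      and step: "\<forall>k<N. es k = s \<and> ea k \<in> profiles g s \<longrightarrow> (\<forall>p<Suc m. \<forall>c\<in>av g p s.
        \<exists>k'<N. (es k' = s \<and> ea k' \<in> profiles g s) \<and> (\<forall>p'<p. ea k ! p' = ea k' ! p') \<and> ea k' ! p = c)"
    show "\<forall>a\<in>profiles g s. \<exists>k<N. es k = s \<and> ea k = a"
    proof
      fix a assume a: "a \<in> profiles g s"
      \<comment> \<open>The target profile is approached from the left: setting coordinate
        \<open>l\<close> may spoil later coordinates, but never those already correct.\<close>
      have "l \<le> Suc m \<Longrightarrow> \<exists>k<N. es k = s \<and> ea k \<in> profiles g s \<and> (\<forall>p<l. ea k ! p = a ! p)" for l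
      proof (induction l)
        case 0
        then show ?case using start by auto
      next
        case (Suc l)
        then obtain k where k: "k < N" "es k = s" "ea k \<in> profiles g s" "\<forall>p<l. ea k ! p = a ! p" by auto
        have "a ! l \<in> av g l s" using a Suc.prems by (auto simp: profiles_def)
        then obtain k' where "k' < N" "es k' = s" "ea k' \<in> profiles g s" "\<forall>p'<l. ea k ! p' = ea k' ! p'" "ea k' ! l = a ! l"
          using step[rule_format, OF k(1) conjI[OF k(2,3)] Suc_le_lessD[OF Suc.prems] \<open>a ! l \<in> av g l s\<close>]
          by (elim exE conjE)
        then show ?case using k(4) by (intro exI[of _ k']) (auto simp: less_Suc_eq)
      qed
      from this[OF order_refl] obtain k where k: "k < N" "es k = s" "ea k \<in> profiles g s" "\<forall>p<Suc m. ea k ! p = a ! p" by blast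
      then have "ea k = a" using a by (intro nth_equalityI) (auto simp: profiles_def)
      then show "\<exists>k<N. es k = s \<and> ea k = a" using k by blast
    qed
  qed
qed

definition move :: "nat \<Rightarrow> nat \<Rightarrow> bool" where
  "move s k \<longleftrightarrow> first k \<and> es k = s \<and> ea k \<in> profiles g s \<and> (\<forall>p<m. ea k ! p \<in> D p s)"

lemma Team_iff:
  assumes "s < ns" "k < N" "ea k \<in> profiles g s"
  shows "Team x R p3 m s (qpos k) \<longleftrightarrow> (\<forall>p<m. ea k ! p \<in> D p s)"
  unfolding Team_def
proof (rule bounded_all)
  show "m \<le> B" using m_less by simp
  fix p assume p: "p < m"
  have "p < length (ea k)" using p assms(3) by (auto simp: profiles_def)
  moreover have "p < Suc m" using p by simp
  ultimately show "(\<forall>r<B. Elem x R 0 (qpos k) p r \<longrightarrow> InSupport x R p3 p s r) \<longleftrightarrow> ea k ! p \<in> D p s"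
    unfolding Elem0_all1[OF v_ea[OF assms(2)] player_less[OF \<open>p < Suc m\<close>]]
    using InSupport_iff[OF _ assms(1) elem_val(1)[OF v_ea[OF assms(2)]], of p p] by simp
qed

lemma Move_iff:
  assumes "s < ns" "k < N"
  shows "Move x R p3 p4 m (Suc m) s k (epos k) (qpos k) \<longleftrightarrow> move s k"
  unfolding Move_def move_def First_iff[OF assms(2)] Avail_iff[OF assms] using Team_iff[OF assms] by blast

end

locale distributed = shaped +
  assumes dist_len: "k < length (rg_delta g) \<Longrightarrow> length (snd (snd (rg_delta g ! k))) = rg_ns g"
    and dist_nonneg: "k < length (rg_delta g) \<Longrightarrow> q \<in> set (snd (snd (rg_delta g ! k))) \<Longrightarrow> 0 \<le> q"
begin

lemma Pos_entry:
  assumes "k < N" "s < ns"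
  shows "Pos x R (dpos k) s \<longleftrightarrow> ed k ! s \<noteq> 0"
  using Pos_iff[OF entry_vals(3)[OF assms(1)] state_less[OF assms(2)]] dist_len[OF assms(1)] assms(2)
  by (simp add: frac_of_zero)

lemma dlt_nonneg': "s' < ns \<Longrightarrow> 0 \<le> dlt g s a s'"
proof (cases "find (\<lambda>(s1, a1, _). s1 = s \<and> a1 = a) (rg_delta g)")
  case (Some e)
  assume s': "s' < ns"
  obtain k where "k < N" "e = rg_delta g ! k" using Some unfolding find_Some_iff by blast
  then have "0 \<le> snd (snd e) ! s'" using dist_nonneg dist_len s' by (metis nth_mem)
  then show ?thesis unfolding dlt_def Some by (simp add: split_def)
qed (simp add: dlt_def)

text \<open>The lookup finds precisely the \<open>first\<close> entry for state and profile, and as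
  its probabilities are nonnegative, nonzero means positive.\<close>

lemma dlt_pos:
  assumes s': "s' < ns"
  shows "0 < dlt g s a s' \<longleftrightarrow> (\<exists>k<N. first k \<and> es k = s \<and> ea k = a \<and> ed k ! s' \<noteq> 0)"
proof -
  let ?P = "\<lambda>(s1, a1, _). s1 = s \<and> a1 = a"
  have P: "?P e \<longleftrightarrow> fst e = s \<and> fst (snd e) = a" for e :: "nat \<times> nat list \<times> rat list" by (auto simp: split_def)
  have some: "find ?P (rg_delta g) = Some e \<longleftrightarrow> (\<exists>k<N. first k \<and> es k = s \<and> ea k = a \<and> e = rg_delta g ! k)" for e
    unfolding find_Some_iff P first_def by (intro iffI; elim exE conjE; intro exI conjI) auto
  have dlt: "dlt g s a s' = of_rat (ed k ! s')" if "k < N" "first k" "es k = s" "ea k = a" for k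
  proof -
    have "find ?P (rg_delta g) = Some (rg_delta g ! k)" unfolding some using that by blast
    then show ?thesis unfolding dlt_def by (simp add: split_def)
  qed
  show ?thesis
  proof
    assume "0 < dlt g s a s'"
    then obtain e where "find ?P (rg_delta g) = Some e" unfolding dlt_def by (auto split: option.splits)
    then obtain k where k: "k < N" "first k" "es k = s" "ea k = a" unfolding some by blast
    then show "\<exists>k<N. first k \<and> es k = s \<and> ea k = a \<and> ed k ! s' \<noteq> 0" using \<open>0 < dlt g s a s'\<close> dlt[OF k] by auto
  next
    assume "\<exists>k<N. first k \<and> es k = s \<and> ea k = a \<and> ed k ! s' \<noteq> 0"
    then obtain k where k: "k < N" "first k" "es k = s" "ea k = a" "ed k ! s' \<noteq> 0" by blast
    have "0 \<le> ed k ! s'" using dist_nonneg[OF k(1)] dist_len[OF k(1)] s' by simp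
    then show "0 < dlt g s a s'" unfolding dlt[OF k(1-4)] using k(5) by simp
  qed
qed

text \<open>The formula only sees which probabilities are nonzero. By nonnegativity of
  \<open>dlt\<close>, having no positive transition out of the target is the same as having only
  transitions of probability 0.\<close>

lemma Absorb_iff:
  assumes "T \<subseteq> {..<ns}"
  shows "Absorb x R p3 p4 p5 ns (Suc m) \<longleftrightarrow> (\<forall>s\<in>T. \<forall>a\<in>profiles g s. \<forall>s'<ns. s' \<notin> T \<longrightarrow> dlt g s a s' = 0)"
proof -
  have "Absorb x R p3 p4 p5 ns (Suc m) \<longleftrightarrow> (\<forall>s<ns. s \<in> T \<longrightarrow>
      (\<forall>k<N. first k \<and> es k = s \<and> ea k \<in> profiles g s \<longrightarrow> (\<forall>s'<ns. ed k ! s' \<noteq> 0 \<longrightarrow> s' \<in> T)))"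
    unfolding Absorb_def
  proof (rule bounded_all)
    show "ns \<le> B" using ns_less by simp
    fix s assume s: "s < ns"
    have "AllEntries x R p4 (\<lambda>k e q d. First x R p4 k e q \<and> Avail x R p3 (Suc m) s e q \<longrightarrow>
        (\<forall>s'<B. s' < ns \<longrightarrow> Pos x R d s' \<longrightarrow> InTarget x R p5 s')) \<longleftrightarrow>
      (\<forall>k<N. first k \<and> es k = s \<and> ea k \<in> profiles g s \<longrightarrow> (\<forall>s'<ns. ed k ! s' \<noteq> 0 \<longrightarrow> s' \<in> T))"
      unfolding AllEntries_iff
    proof (rule all_less_cong)
      fix k assume k: "k < N"
      have "(\<forall>s'<B. s' < ns \<longrightarrow> Pos x R (dpos k) s' \<longrightarrow> InTarget x R p5 s') \<longleftrightarrow> (\<forall>s'<ns. ed k ! s' \<noteq> 0 \<longrightarrow> s' \<in> T)"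
      proof (rule bounded_all)
        show "ns \<le> B" using ns_less by simp
        fix s' assume s': "s' < ns"
        show "(Pos x R (dpos k) s' \<longrightarrow> InTarget x R p5 s') \<longleftrightarrow> (ed k ! s' \<noteq> 0 \<longrightarrow> s' \<in> T)"
          unfolding Pos_entry[OF k s'] InTarget_iff[OF state_less[OF s']] ..
      qed
      then show "(First x R p4 k (epos k) (qpos k) \<and> Avail x R p3 (Suc m) s (epos k) (qpos k) \<longrightarrow>
        (\<forall>s'<B. s' < ns \<longrightarrow> Pos x R (dpos k) s' \<longrightarrow> InTarget x R p5 s')) \<longleftrightarrow>
       (first k \<and> es k = s \<and> ea k \<in> profiles g s \<longrightarrow> (\<forall>s'<ns. ed k ! s' \<noteq> 0 \<longrightarrow> s' \<in> T))"
        unfolding First_iff[OF k] Avail_iff[OF s k] by blast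
    qed
    then show "(InTarget x R p5 s \<longrightarrow> AllEntries x R p4 (\<lambda>k e q d. First x R p4 k e q \<and> Avail x R p3 (Suc m) s e q \<longrightarrow>
        (\<forall>s'<B. s' < ns \<longrightarrow> Pos x R d s' \<longrightarrow> InTarget x R p5 s'))) \<longleftrightarrow>
      (s \<in> T \<longrightarrow> (\<forall>k<N. first k \<and> es k = s \<and> ea k \<in> profiles g s \<longrightarrow> (\<forall>s'<ns. ed k ! s' \<noteq> 0 \<longrightarrow> s' \<in> T)))"
      unfolding InTarget_iff[OF state_less[OF s]] by blast
  qed
  also have "\<dots> \<longleftrightarrow> (\<forall>s\<in>T. \<forall>a\<in>profiles g s. \<forall>s'<ns. 0 < dlt g s a s' \<longrightarrow> s' \<in> T)"
  proof
    assume L: "\<forall>s<ns. s \<in> T \<longrightarrow> (\<forall>k<N. first k \<and> es k = s \<and> ea k \<in> profiles g s \<longrightarrow> (\<forall>s'<ns. ed k ! s' \<noteq> 0 \<longrightarrow> s' \<in> T))"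
    show "\<forall>s\<in>T. \<forall>a\<in>profiles g s. \<forall>s'<ns. 0 < dlt g s a s' \<longrightarrow> s' \<in> T"
    proof (intro ballI allI impI)
      fix s a s' assume *: "s \<in> T" "a \<in> profiles g s" "s' < ns" "0 < dlt g s a s'"
      then obtain k where "k < N" "first k" "es k = s" "ea k = a" "ed k ! s' \<noteq> 0" unfolding dlt_pos[OF *(3)] by blast
      then show "s' \<in> T" using L * assms by blast
    qed
  next
    assume L: "\<forall>s\<in>T. \<forall>a\<in>profiles g s. \<forall>s'<ns. 0 < dlt g s a s' \<longrightarrow> s' \<in> T"
    show "\<forall>s<ns. s \<in> T \<longrightarrow> (\<forall>k<N. first k \<and> es k = s \<and> ea k \<in> profiles g s \<longrightarrow> (\<forall>s'<ns. ed k ! s' \<noteq> 0 \<longrightarrow> s' \<in> T))"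
    proof (intro allI impI)
      fix s k s' assume *: "s \<in> T" "k < N" "first k \<and> es k = s \<and> ea k \<in> profiles g s" "s' < ns" "ed k ! s' \<noteq> 0"
      then have "0 < dlt g s (ea k) s'" unfolding dlt_pos[OF *(4)] by blast
      then show "s' \<in> T" using L * by blast
    qed
  qed
  also have "\<dots> \<longleftrightarrow> (\<forall>s\<in>T. \<forall>a\<in>profiles g s. \<forall>s'<ns. s' \<notin> T \<longrightarrow> dlt g s a s' = 0)"
  proof -
    have "0 < dlt g s a s' \<longleftrightarrow> dlt g s a s' \<noteq> 0" if "s' < ns" for s a s'
      using dlt_nonneg'[OF that, of s a] by linarith
    then show ?thesis by blast
  qed
  finally show ?thesis .
qed

lemma Wins_iff:
  assumes s0: "rg_s0 g < ns"
  shows "Wins x R p3 p4 p5 p6 ns m (Suc m) \<longleftrightarrow> (\<forall>s<B. \<forall>v<B. \<forall>v'<B. R 17 s v 0 0 \<longrightarrow> R 17 s v' 0 0 \<longrightarrow> v = v') \<and>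
     R 15 (rg_s0 g) 0 0 0 \<and>
     (\<forall>s<ns. R 15 s 0 0 0 \<longrightarrow> s \<notin> T \<longrightarrow>
       (\<forall>a\<in>profiles g s. (\<forall>p<m. a ! p \<in> D p s) \<longrightarrow> (\<forall>s'<ns. 0 < dlt g s a s' \<longrightarrow> R 15 s' 0 0 0)) \<and>
       (\<forall>b\<in>av g m s. \<exists>a\<in>profiles g s. (\<forall>p<m. a ! p \<in> D p s) \<and> a ! m = b \<and>
          (\<exists>s'<ns. 0 < dlt g s a s' \<and> RankLess x R s' s)))"
proof -
  have init: "(\<exists>v<B. Val x R p6 v \<and> R 15 v 0 0 0) \<longleftrightarrow> R 15 (rg_s0 g) 0 0 0"
    using Val_tag[OF v_s0] state_less[OF s0] by blast
  have safe: "AllEntries x R p4 (\<lambda>k e q d. Move x R p3 p4 m (Suc m) s k e q \<longrightarrow> (\<forall>s'<B. s' < ns \<longrightarrow> Pos x R d s' \<longrightarrow> R 15 s' 0 0 0)) \<longleftrightarrow>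
      (\<forall>a\<in>profiles g s. (\<forall>p<m. a ! p \<in> D p s) \<longrightarrow> (\<forall>s'<ns. 0 < dlt g s a s' \<longrightarrow> R 15 s' 0 0 0))" if s: "s < ns" for s
  proof -
    have "AllEntries x R p4 (\<lambda>k e q d. Move x R p3 p4 m (Suc m) s k e q \<longrightarrow> (\<forall>s'<B. s' < ns \<longrightarrow> Pos x R d s' \<longrightarrow> R 15 s' 0 0 0)) \<longleftrightarrow>
       (\<forall>k<N. move s k \<longrightarrow> (\<forall>s'<ns. ed k ! s' \<noteq> 0 \<longrightarrow> R 15 s' 0 0 0))"
      unfolding AllEntries_iff
    proof (rule all_less_cong)
      fix k assume k: "k < N"
      have "(\<forall>s'<B. s' < ns \<longrightarrow> Pos x R (dpos k) s' \<longrightarrow> R 15 s' 0 0 0) \<longleftrightarrow> (\<forall>s'<ns. ed k ! s' \<noteq> 0 \<longrightarrow> R 15 s' 0 0 0)"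
        using Pos_entry[OF k] ns_less by (intro bounded_all) auto
      then show "(Move x R p3 p4 m (Suc m) s k (epos k) (qpos k) \<longrightarrow> (\<forall>s'<B. s' < ns \<longrightarrow> Pos x R (dpos k) s' \<longrightarrow> R 15 s' 0 0 0)) \<longleftrightarrow>
        (move s k \<longrightarrow> (\<forall>s'<ns. ed k ! s' \<noteq> 0 \<longrightarrow> R 15 s' 0 0 0))"
        unfolding Move_iff[OF s k] by blast
    qed
    also have "\<dots> \<longleftrightarrow> (\<forall>a\<in>profiles g s. (\<forall>p<m. a ! p \<in> D p s) \<longrightarrow> (\<forall>s'<ns. 0 < dlt g s a s' \<longrightarrow> R 15 s' 0 0 0))"
    proof (intro iffI ballI allI impI)
      fix a s' assume L: "\<forall>k<N. move s k \<longrightarrow> (\<forall>s'<ns. ed k ! s' \<noteq> 0 \<longrightarrow> R 15 s' 0 0 0)"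
        and *: "a \<in> profiles g s" "\<forall>p<m. a ! p \<in> D p s" "s' < ns" "0 < dlt g s a s'"
      then obtain k where k: "k < N" "first k" "es k = s" "ea k = a" "ed k ! s' \<noteq> 0" unfolding dlt_pos[OF *(3)] by blast
      then have "move s k" using * unfolding move_def by simp
      then show "R 15 s' 0 0 0" using L k * by blast
    next
      fix k s' assume L: "\<forall>a\<in>profiles g s. (\<forall>p<m. a ! p \<in> D p s) \<longrightarrow> (\<forall>s'<ns. 0 < dlt g s a s' \<longrightarrow> R 15 s' 0 0 0)"
        and *: "k < N" "move s k" "s' < ns" "ed k ! s' \<noteq> 0"
      then have "0 < dlt g s (ea k) s'" unfolding dlt_pos[OF *(3)] move_def by blast
      then show "R 15 s' 0 0 0" using L * unfolding move_def by blast
    qed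
    finally show ?thesis .
  qed
  have prog: "(\<forall>l<B. AvailList x R p3 m s l \<longrightarrow> (\<forall>k<B. \<forall>b<B. Elem x R 0 l k b \<longrightarrow>
         ExEntry x R p4 (\<lambda>k e q d. Move x R p3 p4 m (Suc m) s k e q \<and> (\<forall>r<B. Elem x R 0 q m r \<longrightarrow> NatEq x r b) \<and>
           (\<exists>s'<B. s' < ns \<and> Pos x R d s' \<and> RankLess x R s' s)))) \<longleftrightarrow>
      (\<forall>b\<in>av g m s. \<exists>a\<in>profiles g s. (\<forall>p<m. a ! p \<in> D p s) \<and> a ! m = b \<and>
          (\<exists>s'<ns. 0 < dlt g s a s' \<and> RankLess x R s' s))" if s: "s < ns" for s
  proof -
    have m: "m < Suc m" "m < length (rg_av g)" "s < length (rg_av g ! m)" using s len_av len_av_nth by simp_all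
    note v = v_lpos[OF m(2,3)]
    have "ExEntry x R p4 (\<lambda>k e q d. Move x R p3 p4 m (Suc m) s k e q \<and>
           (\<forall>r<B. Elem x R 0 q m r \<longrightarrow> NatEq x r (elem_pos ser_nat (lpos m s) (rg_av g ! m ! s) kk)) \<and>
           (\<exists>s'<B. s' < ns \<and> Pos x R d s' \<and> RankLess x R s' s)) \<longleftrightarrow>
        (\<exists>k<N. move s k \<and> ea k ! m = rg_av g ! m ! s ! kk \<and> (\<exists>s'<ns. ed k ! s' \<noteq> 0 \<and> RankLess x R s' s))"
      if kk: "kk < length (rg_av g ! m ! s)" for kk
      unfolding ExEntry_iff
    proof (rule ex_less_cong)
      fix k assume k: "k < N"
      have 1: "(\<exists>s'<B. s' < ns \<and> Pos x R (dpos k) s' \<and> RankLess x R s' s) \<longleftrightarrow> (\<exists>s'<ns. ed k ! s' \<noteq> 0 \<and> RankLess x R s' s)"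
        using Pos_entry[OF k] ns_less by (intro bounded_ex) auto
      have 2: "(\<forall>r<B. Elem x R 0 (qpos k) m r \<longrightarrow> NatEq x r (elem_pos ser_nat (lpos m s) (rg_av g ! m ! s) kk)) \<longleftrightarrow>
          ea k ! m = rg_av g ! m ! s ! kk" if "move s k"
      proof -
        have "m < length (ea k)" using that by (auto simp: move_def profiles_def)
        then show ?thesis unfolding Elem0_all1[OF v_ea[OF k] player_less[OF m(1)]]
          using NatEq_iff[OF elem_val(1)[OF v_ea[OF k]] elem_val(1)[OF v kk], of m] by simp
      qed
      show "(Move x R p3 p4 m (Suc m) s k (epos k) (qpos k) \<and>
           (\<forall>r<B. Elem x R 0 (qpos k) m r \<longrightarrow> NatEq x r (elem_pos ser_nat (lpos m s) (rg_av g ! m ! s) kk)) \<and>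
           (\<exists>s'<B. s' < ns \<and> Pos x R (dpos k) s' \<and> RankLess x R s' s)) \<longleftrightarrow>
        (move s k \<and> ea k ! m = rg_av g ! m ! s ! kk \<and> (\<exists>s'<ns. ed k ! s' \<noteq> 0 \<and> RankLess x R s' s))"
        unfolding Move_iff[OF s k] 1 using 2 by blast
    qed
    then have "(\<forall>l<B. AvailList x R p3 m s l \<longrightarrow> (\<forall>k<B. \<forall>b<B. Elem x R 0 l k b \<longrightarrow>
         ExEntry x R p4 (\<lambda>k e q d. Move x R p3 p4 m (Suc m) s k e q \<and> (\<forall>r<B. Elem x R 0 q m r \<longrightarrow> NatEq x r b) \<and>
           (\<exists>s'<B. s' < ns \<and> Pos x R d s' \<and> RankLess x R s' s)))) \<longleftrightarrow>
       (\<forall>b\<in>av g m s. \<exists>k<N. move s k \<and> ea k ! m = b \<and> (\<exists>s'<ns. ed k ! s' \<noteq> 0 \<and> RankLess x R s' s))"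
      unfolding AvailList_all[OF player_less[OF m(1)] state_less[OF s] m(2,3)] Elem0_all[OF v] av_def all_set_conv_all_nth
      by (rule all_less_cong)
    also have "\<dots> \<longleftrightarrow> (\<forall>b\<in>av g m s. \<exists>a\<in>profiles g s. (\<forall>p<m. a ! p \<in> D p s) \<and> a ! m = b \<and>
          (\<exists>s'<ns. 0 < dlt g s a s' \<and> RankLess x R s' s))"
    proof (rule ball_cong[OF refl])
      fix b
      show "(\<exists>k<N. move s k \<and> ea k ! m = b \<and> (\<exists>s'<ns. ed k ! s' \<noteq> 0 \<and> RankLess x R s' s)) \<longleftrightarrow>
        (\<exists>a\<in>profiles g s. (\<forall>p<m. a ! p \<in> D p s) \<and> a ! m = b \<and> (\<exists>s'<ns. 0 < dlt g s a s' \<and> RankLess x R s' s))"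
      proof
        assume "\<exists>k<N. move s k \<and> ea k ! m = b \<and> (\<exists>s'<ns. ed k ! s' \<noteq> 0 \<and> RankLess x R s' s)"
        then obtain k s' where k: "k < N" "move s k" "ea k ! m = b" "s' < ns" "ed k ! s' \<noteq> 0" "RankLess x R s' s" by blast
        then have "0 < dlt g s (ea k) s'" unfolding dlt_pos[OF k(4)] move_def by blast
        then show "\<exists>a\<in>profiles g s. (\<forall>p<m. a ! p \<in> D p s) \<and> a ! m = b \<and> (\<exists>s'<ns. 0 < dlt g s a s' \<and> RankLess x R s' s)"
          using k unfolding move_def by blast
      next
        assume "\<exists>a\<in>profiles g s. (\<forall>p<m. a ! p \<in> D p s) \<and> a ! m = b \<and> (\<exists>s'<ns. 0 < dlt g s a s' \<and> RankLess x R s' s)"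
        then obtain a s' where a: "a \<in> profiles g s" "\<forall>p<m. a ! p \<in> D p s" "a ! m = b" "s' < ns" "0 < dlt g s a s'" "RankLess x R s' s" by blast
        then obtain k where k: "k < N" "first k" "es k = s" "ea k = a" "ed k ! s' \<noteq> 0" unfolding dlt_pos[OF a(4)] by blast
        then have "move s k" using a unfolding move_def by simp
        then show "\<exists>k<N. move s k \<and> ea k ! m = b \<and> (\<exists>s'<ns. ed k ! s' \<noteq> 0 \<and> RankLess x R s' s)"
          using k a by blast
      qed
    qed
    finally show ?thesis .
  qed
  have "(\<forall>s<B. s < ns \<longrightarrow> R 15 s 0 0 0 \<longrightarrow> \<not> InTarget x R p5 s \<longrightarrow>
       AllEntries x R p4 (\<lambda>k e q d. Move x R p3 p4 m (Suc m) s k e q \<longrightarrow> (\<forall>s'<B. s' < ns \<longrightarrow> Pos x R d s' \<longrightarrow> R 15 s' 0 0 0)) \<and>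
       (\<forall>l<B. AvailList x R p3 m s l \<longrightarrow> (\<forall>k<B. \<forall>b<B. Elem x R 0 l k b \<longrightarrow>
         ExEntry x R p4 (\<lambda>k e q d. Move x R p3 p4 m (Suc m) s k e q \<and> (\<forall>r<B. Elem x R 0 q m r \<longrightarrow> NatEq x r b) \<and>
           (\<exists>s'<B. s' < ns \<and> Pos x R d s' \<and> RankLess x R s' s))))) \<longleftrightarrow>
     (\<forall>s<ns. R 15 s 0 0 0 \<longrightarrow> s \<notin> T \<longrightarrow>
       (\<forall>a\<in>profiles g s. (\<forall>p<m. a ! p \<in> D p s) \<longrightarrow> (\<forall>s'<ns. 0 < dlt g s a s' \<longrightarrow> R 15 s' 0 0 0)) \<and>
       (\<forall>b\<in>av g m s. \<exists>a\<in>profiles g s. (\<forall>p<m. a ! p \<in> D p s) \<and> a ! m = b \<and>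
          (\<exists>s'<ns. 0 < dlt g s a s' \<and> RankLess x R s' s)))"
  proof (rule bounded_all)
    show "ns \<le> B" using ns_less by simp
  qed (simp only: InTarget_iff[OF state_less] safe prog)
  then show ?thesis unfolding Wins_def init by (simp only:)
qed

text \<open>Choosing some rank from tag 17 is unambiguous wherever \<open>RankLess\<close> holds,
  because the relation is single-valued.\<close>

lemma Wins_sound:
  assumes "rg_s0 g < ns" "Wins x R p3 p4 p5 p6 ns m (Suc m)"
  shows "win g {s. s < ns \<and> R 15 s 0 0 0} D (\<lambda>s. SOME v. v < B \<and> R 17 s v 0 0)"
proof -
  let ?r = "\<lambda>s. SOME v. v < B \<and> R 17 s v 0 0"
  note * = assms(2)[unfolded Wins_iff[OF assms(1)]]
  have rank: "?r s' < ?r s" if less: "RankLess x R s' s" and s: "s < ns" "s' < ns" for s s'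
  proof -
    obtain v v' where v: "v < B" "v' < B" "R 17 s v 0 0" "R 17 s' v' 0 0" "v' < v" using less unfolding RankLess_def by blast
    have "?r s = v" using * v state_less[OF s(1)] by (intro some_equality) blast+
    moreover have "?r s' = v'" using * v state_less[OF s(2)] by (intro some_equality) blast+
    ultimately show ?thesis using v(5) by simp
  qed
  have "D p s \<subseteq> av g p s" for p s unfolding D_def av_def by auto
  note Dav = this
  show ?thesis unfolding win_def
  proof (intro conjI ballI)
    show "rg_s0 g \<in> {s. s < ns \<and> R 15 s 0 0 0}" using * assms(1) by blast
    show "{s. s < ns \<and> R 15 s 0 0 0} \<subseteq> {..<ns}" by blast
    fix s assume "s \<in> {s. s < ns \<and> R 15 s 0 0 0} - T"
    then have s: "s < ns" "R 15 s 0 0 0" "s \<notin> T" by blast+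
    note step = *[THEN conjunct2, THEN conjunct2, rule_format, OF s]
    show "\<forall>p<m. D p s \<subseteq> av g p s" using Dav by blast
    { fix a assume a: "a \<in> profiles g s"
      show "(\<forall>p<m. a ! p \<in> D p s) \<longrightarrow> (\<forall>s'<ns. 0 < dlt g s a s' \<longrightarrow> s' \<in> {s. s < ns \<and> R 15 s 0 0 0})"
        using step[THEN conjunct1] a by blast }
    fix b assume "b \<in> av g m s"
    then obtain a s' where "a \<in> profiles g s" "\<forall>p<m. a ! p \<in> D p s" "a ! m = b" "s' < ns" "0 < dlt g s a s'" "RankLess x R s' s"
      using step[THEN conjunct2] by blast
    then show "\<exists>a\<in>profiles g s. (\<forall>p<m. a ! p \<in> D p s) \<and> a ! m = b \<and> (\<exists>s'<ns. 0 < dlt g s a s' \<and> ?r s' < ?r s)"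
      using rank[OF _ s(1)] by blast
  qed
qed

lemma Wins_complete:
  assumes w: "win g W D0 r" and s0: "rg_s0 g < ns"
    and W: "\<And>s. s < B \<Longrightarrow> R 15 s 0 0 0 \<longleftrightarrow> s \<in> W"
    and D0: "\<And>p s k. p < Suc m \<Longrightarrow> s < ns \<Longrightarrow> k < length (rg_av g ! p ! s) \<Longrightarrow> R 16 p s k 0 \<longleftrightarrow> rg_av g ! p ! s ! k \<in> D0 p s"
    and r: "\<And>s v. s < B \<Longrightarrow> v < B \<Longrightarrow> R 17 s v 0 0 \<longleftrightarrow> v = r s" and r_less: "\<And>s. s < ns \<Longrightarrow> r s < B"
  shows "Wins x R p3 p4 p5 p6 ns m (Suc m)"
proof -
  have less: "RankLess x R s' s \<longleftrightarrow> r s' < r s" if "s < ns" "s' < ns" for s s'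
    unfolding RankLess_def using r r_less state_less that by blast
  \<comment> \<open>The set recovered from indices contains available actions only. It equals the
    given support on \<open>W - T\<close>, where \<open>win\<close> guarantees that the support is
    available.\<close>
  have D: "D p s = D0 p s" if "p < m" "s \<in> W - T" for p s
  proof -
    have s: "s < ns" using w that unfolding win_def by blast
    have sub: "D0 p s \<subseteq> av g p s" using w that unfolding win_def by blast
    show ?thesis
    proof (intro equalityI subsetI)
      fix c assume "c \<in> D p s"
      then show "c \<in> D0 p s" using D0[of p s] s that unfolding D_def by auto
    next
      fix c assume c: "c \<in> D0 p s"
      then obtain k where "k < length (rg_av g ! p ! s)" "rg_av g ! p ! s ! k = c"
        using sub unfolding av_def by (metis in_set_conv_nth subsetD)
      then show "c \<in> D p s" using D0[of p s k] s that c unfolding D_def by auto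
    qed
  qed
  show ?thesis unfolding Wins_iff[OF s0]
  proof (intro conjI allI impI)
    show "v = v'" if "s < B" "v < B" "v' < B" "R 17 s v 0 0" "R 17 s v' 0 0" for s v v' using r that by blast
    show "R 15 (rg_s0 g) 0 0 0" using W[OF state_less[OF s0]] w unfolding win_def by blast
    fix s assume s: "s < ns" "R 15 s 0 0 0" "s \<notin> T"
    then have sW: "s \<in> W - T" using W state_less by blast
    show "\<forall>a\<in>profiles g s. (\<forall>p<m. a ! p \<in> D p s) \<longrightarrow> (\<forall>s'<ns. 0 < dlt g s a s' \<longrightarrow> R 15 s' 0 0 0)"
    proof (intro ballI allI impI)
      fix a s' assume "a \<in> profiles g s" "\<forall>p<m. a ! p \<in> D p s" "s' < ns" "0 < dlt g s a s'"
      then have "s' \<in> W" using w sW D[OF _ sW] unfolding win_def by blast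
      then show "R 15 s' 0 0 0" using W[OF state_less[OF \<open>s' < ns\<close>]] by blast
    qed
    show "\<forall>b\<in>av g m s. \<exists>a\<in>profiles g s. (\<forall>p<m. a ! p \<in> D p s) \<and> a ! m = b \<and> (\<exists>s'<ns. 0 < dlt g s a s' \<and> RankLess x R s' s)"
    proof
      fix b assume "b \<in> av g m s"
      then obtain a s' where "a \<in> profiles g s" "\<forall>p<m. a ! p \<in> D0 p s" "a ! m = b" "s' < ns" "0 < dlt g s a s'" "r s' < r s"
        using w sW unfolding win_def by blast
      then show "\<exists>a\<in>profiles g s. (\<forall>p<m. a ! p \<in> D p s) \<and> a ! m = b \<and> (\<exists>s'<ns. 0 < dlt g s a s' \<and> RankLess x R s' s)"
        using less[OF s(1)] D[OF _ sW] by blast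
    qed
  qed
qed

end

section \<open>Rational distributions\<close>

text \<open>Here p1 and p2 are the positions of numerator a and denominator b of the k-th rational. Tags 11 and
  12 hold the denominator P and the numerator N of the k-th partial sum, tags 13 and 14 coefficients
  with v * b = u * a + 1: the encoding admits only rationals in lowest terms. Tags 6 to 10 hold
  the intermediate rows of the products P * a, N * b, P * b, u * a and v * b.\<close>

definition RatStep :: "bool list \<Rightarrow> rel \<Rightarrow> nat \<Rightarrow> nat \<Rightarrow> nat \<Rightarrow> nat \<Rightarrow> bool" where
  "RatStep x R r k p1 p2 \<longleftrightarrow>
     mul_bits x (\<lambda>i j. R 6 r k i j) (\<lambda>j. R 11 r k j 0) (\<lambda>i. NatBit x p1 i) \<and>
     mul_bits x (\<lambda>i j. R 7 r k i j) (\<lambda>j. R 12 r k j 0) (\<lambda>i. NatBit x p2 i) \<and>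
     mul_bits x (\<lambda>i j. R 8 r k i j) (\<lambda>j. R 11 r k j 0) (\<lambda>i. NatBit x p2 i) \<and>
     mul_bits x (\<lambda>i j. R 9 r k i j) (\<lambda>j. R 13 r k j 0) (\<lambda>i. NatBit x p1 i) \<and>
     mul_bits x (\<lambda>i j. R 10 r k i j) (\<lambda>j. R 14 r k j 0) (\<lambda>i. NatBit x p2 i) \<and>
     (\<forall>n<bnd x. n = length x \<longrightarrow>
        (\<forall>j<bnd x. n \<le> j \<longrightarrow> \<not> R 13 r k j 0 \<and> \<not> R 14 r k j 0) \<and>
        (\<forall>j<bnd x. R 10 r k n j \<longleftrightarrow> add_bits x (\<lambda>j. R 9 r k n j) (\<lambda>j. j = 0) j) \<and>
        (\<forall>k'<bnd x. k' = Suc k \<longrightarrow> (\<forall>j<bnd x. R 11 r k' j 0 \<longleftrightarrow> R 8 r k n j) \<and>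
           (\<forall>j<bnd x. R 12 r k' j 0 \<longleftrightarrow> add_bits x (\<lambda>j. R 6 r k n j) (\<lambda>j. R 7 r k n j) j)))"

text \<open>The position \<open>r\<close> of the list is an index of the tags, so the computations
  for all distributions coexist in one relation. The empty sum is 0 over 1, the bit at
  \<open>p\<close> is the sign, and the total is 1 when numerator and denominator coincide.\<close>

definition SumsToOne :: "bool list \<Rightarrow> rel \<Rightarrow> nat \<Rightarrow> bool" where
  "SumsToOne x R r \<longleftrightarrow> (\<forall>z<bnd x. z = 0 \<longrightarrow> (\<forall>j<bnd x. (R 11 r z j 0 \<longleftrightarrow> j = 0) \<and> \<not> R 12 r z j 0)) \<and>
     (\<forall>k<bnd x. \<forall>p<bnd x. Elem x R 3 r k p \<longrightarrow> zerox x p \<and>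
        (\<exists>p1<bnd x. p1 = Suc p \<and> (\<exists>p2<bnd x. IsNat x p1 p2 \<and> RatStep x R r k p1 p2))) \<and>
     (\<forall>k<bnd x. HasLen x R 3 r k \<longrightarrow> (\<forall>j<bnd x. R 11 r k j 0 \<longleftrightarrow> R 12 r k j 0))"

definition Distributions :: "bool list \<Rightarrow> rel \<Rightarrow> nat \<Rightarrow> nat \<Rightarrow> bool" where
  "Distributions x R idel ns \<longleftrightarrow> AllEntries x R idel (\<lambda>k e q d. HasLen x R 3 d ns \<and> SumsToOne x R d)"

lemma so_SumsToOne: "so_definable (\<lambda>x R e. SumsToOne x R (e r))"
  unfolding SumsToOne_def RatStep_def mul_bits_def add_bits_def shift_bits_def by (intro so_intros; simp)

lemma so_Distributions: "so_definable (\<lambda>x R e. Distributions x R (e i) (e n))"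
  unfolding Distributions_def AllEntries_def ExEntry_def by (intro so_intros so_SumsToOne; simp)

fun fnum :: "frac \<Rightarrow> nat" where "fnum (s, a, b) = a"
fun fden :: "frac \<Rightarrow> nat" where "fden (s, a, b) = b"

text \<open>Partial sums are kept over the product of the denominators, without cancelling; their bit length
  is still bounded by the length of the encoded list.\<close>

definition pden :: "frac list \<Rightarrow> nat \<Rightarrow> nat" where
  "pden ds k = (\<Prod>l<k. fden (ds ! l))"

primrec pnum :: "frac list \<Rightarrow> nat \<Rightarrow> nat" where
  "pnum ds 0 = 0"
| "pnum ds (Suc k) = pden ds k * fnum (ds ! k) + pnum ds k * fden (ds ! k)"

lemma pden_Suc: "pden ds (Suc k) = pden ds k * fden (ds ! k)"
  by (simp add: pden_def)

lemma partial_sum: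
  assumes "\<And>l. l < k \<Longrightarrow> fden (ds ! l) \<noteq> 0"
  shows "(\<Sum>l<k. rat_of_nat (fnum (ds ! l)) / rat_of_nat (fden (ds ! l))) = rat_of_nat (pnum ds k) / rat_of_nat (pden ds k)" "pden ds k \<noteq> 0"
proof -
  have "(\<Sum>l<k. rat_of_nat (fnum (ds ! l)) / rat_of_nat (fden (ds ! l))) = rat_of_nat (pnum ds k) / rat_of_nat (pden ds k) \<and> pden ds k \<noteq> 0"
    using assms
  proof (induction k)
    case (Suc k)
    then have IH: "(\<Sum>l<k. rat_of_nat (fnum (ds ! l)) / rat_of_nat (fden (ds ! l))) = rat_of_nat (pnum ds k) / rat_of_nat (pden ds k)"
      "pden ds k \<noteq> 0" "fden (ds ! k) \<noteq> 0" by auto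
    then show ?case by (simp add: pden_Suc field_simps)
  qed (simp add: pden_def)
  then show "(\<Sum>l<k. rat_of_nat (fnum (ds ! l)) / rat_of_nat (fden (ds ! l))) = rat_of_nat (pnum ds k) / rat_of_nat (pden ds k)" "pden ds k \<noteq> 0"
    by blast+
qed

text \<open>The code of an element with numerator \<open>a\<close> and denominator \<open>b\<close>
  has at least \<open>nbits a + nbits b\<close> symbols, and both \<open>a + b\<close> and
  \<open>b\<close> are at most 2 to that power, since \<open>(a + 1) * (b + 1)\<close> is. So each
  step multiplies the bound by no more than its code allows.\<close>

lemma partial_bound:
  assumes "k \<le> length ds"
  shows "pden ds k \<le> 2 ^ length (enc ser_frac (take k ds))" "pnum ds k \<le> 2 ^ length (enc ser_frac (take k ds))"
proof -
  have "pden ds k \<le> 2 ^ length (enc ser_frac (take k ds)) \<and> pnum ds k \<le> 2 ^ length (enc ser_frac (take k ds))"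
    using assms
  proof (induction k)
    case (Suc k)
    let ?L = "\<lambda>k. length (enc ser_frac (take k ds))"
    have k: "k < length ds" using Suc.prems by simp
    obtain s a b where d: "ds ! k = (s, a, b)" by (metis prod_cases3)
    have L: "?L k + (nbits a + nbits b) \<le> ?L (Suc k)"
      unfolding take_Suc_conv_app_nth[OF k] d by (simp add: ser_frac_def length_ser_nat)
    have "a + 1 \<le> 2 ^ nbits a" "b + 1 \<le> 2 ^ nbits b"
      using less_two_power_nbits[of a] less_two_power_nbits[of b] by simp_all
    then have "(a + 1) * (b + 1) \<le> 2 ^ nbits a * 2 ^ nbits b" by (rule mult_le_mono)
    then have ab: "a + b \<le> 2 ^ (nbits a + nbits b)" "b \<le> 2 ^ (nbits a + nbits b)" by (simp_all add: power_add)
    have IH: "pden ds k \<le> 2 ^ ?L k" "pnum ds k \<le> 2 ^ ?L k" using Suc by simp_all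
    have "pnum ds (Suc k) = pden ds k * a + pnum ds k * b" by (simp add: d)
    also have "\<dots> \<le> 2 ^ ?L k * a + 2 ^ ?L k * b" by (intro add_mono mult_le_mono IH order_refl)
    also have "\<dots> = 2 ^ ?L k * (a + b)" by (simp add: algebra_simps)
    also have "\<dots> \<le> 2 ^ ?L k * 2 ^ (nbits a + nbits b)" by (intro mult_le_mono order_refl ab)
    also have "\<dots> \<le> 2 ^ ?L (Suc k)" unfolding power_add[symmetric] using L by (intro power_increasing) simp_all
    finally have 1: "pnum ds (Suc k) \<le> 2 ^ ?L (Suc k)" .
    have "pden ds (Suc k) = pden ds k * b" by (simp add: d pden_Suc)
    also have "\<dots> \<le> 2 ^ ?L k * 2 ^ (nbits a + nbits b)" by (intro mult_le_mono IH ab)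
    also have "\<dots> \<le> 2 ^ ?L (Suc k)" unfolding power_add[symmetric] using L by (intro power_increasing) simp_all
    finally show ?case using 1 by blast
  qed (simp add: pden_def)
  then show "pden ds k \<le> 2 ^ length (enc ser_frac (take k ds))" "pnum ds k \<le> 2 ^ length (enc ser_frac (take k ds))" by blast+
qed

text \<open>From any solution of \<open>b * x = a * y + 1\<close>, replacing \<open>y\<close> by
  \<open>y mod b\<close> and \<open>x\<close> by \<open>x - a * (y div b)\<close> gives another one;
  then \<open>u < b\<close> forces \<open>v \<le> a + 1\<close>. Small coefficients are needed so
  that they fit into the guessed relation.\<close>

lemma bezout_small:
  fixes a b :: nat
  assumes "coprime a b" "0 < b"
  shows "\<exists>u v. v * b = u * a + 1 \<and> u < b \<and> v \<le> a + 1"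
proof -
  obtain x y where xy: "b * x = a * y + gcd b a" using bezout_nat[of b a] assms(2) by auto
  have g: "gcd b a = 1" using assms(1) by (simp add: gcd.commute)
  have y: "a * y = a * (y mod b) + b * (a * (y div b))"
    by (metis (no_types) distrib_left mod_mult_div_eq mult.left_commute)
  have le: "a * (y div b) \<le> x"
  proof (rule ccontr)
    assume "\<not> a * (y div b) \<le> x"
    then have "b * x \<le> b * (a * (y div b))" by simp
    then show False using xy g y by simp
  qed
  define v where "v = x - a * (y div b)"
  have "b * x = b * v + b * (a * (y div b))" using le by (simp add: v_def diff_mult_distrib2)
  then have eq: "v * b = (y mod b) * a + 1" using xy g y by (simp add: mult.commute)
  have "y mod b < b" using assms(2) by simp
  moreover have "v \<le> a + 1"
  proof (rule ccontr)
    assume "\<not> v \<le> a + 1"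
    then have "(a + 2) * b \<le> v * b" by (intro mult_le_mono1) simp
    moreover have "(y mod b) * a \<le> b * a" using \<open>y mod b < b\<close> by (intro mult_le_mono1) simp
    moreover have "(a + 2) * b = b * a + b + b" by (simp add: algebra_simps)
    ultimately show False using eq assms(2) by linarith
  qed
  ultimately show ?thesis using eq by blast
qed

context tagged
begin

lemma frac_parts:
  assumes "val ser_frac x p (s, a, b)"
  obtains p2 where "p2 < B" "Suc p < B" "occ x (Suc p) p2 (ser_nat a)" "val ser_nat x p2 b" "p < length x" "x ! p = s"
proof -
  obtain j where "occ x p j (s # ser_nat a @ ser_nat b)" using assms by (auto simp: val_def ser_frac_def)
  then obtain p2 where p2: "p < length x" "x ! p = s" "occ x (Suc p) p2 (ser_nat a)" "occ x p2 j (ser_nat b)"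
    by (auto simp: occ_Cons occ_append)
  show ?thesis using that[of p2] p2 occ_less_bnd[OF p2(3)] unfolding val_def by blast
qed

text \<open>A number written inside \<open>x\<close> has fewer than \<open>length x\<close> digits,
  so row \<open>length x\<close> already contains the full product.\<close>

lemma mul_bits_val:
  assumes "bitrel B X a" "val ser_nat x p y" "mul_bits x A X (\<lambda>i. NatBit x p i)"
  shows "bitrel B (A (length x)) (a * y)"
proof -
  have "bitrel B (A (length x)) (a * take_bit (length x) y)"
    using assms(3) unfolding mul_bits_iff[OF assms(1) NatBit_iff[OF assms(2)]] by blast
  moreover have "take_bit (length x) y = y"
    using val_less_power[OF assms(2)] by (simp add: take_bit_nat_eq_self_iff)
  ultimately show ?thesis by simp
qed

lemma bitrel_add_bits:
  assumes "bitrel B f a" "bitrel B g b" "\<forall>j<B. h j \<longleftrightarrow> add_bits x f g j"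
  shows "bitrel B h (a + b)"
  unfolding bitrel_def using add_bits_bitrel[OF assms(1,2)] assms(3) by blast

lemma bitrel_cong: "\<forall>j<B. h j \<longleftrightarrow> f j \<Longrightarrow> bitrel B f a \<Longrightarrow> bitrel B h a"
  unfolding bitrel_def by blast

text \<open>The equation \<open>v * b = u * a + 1\<close> is a short witness of coprimality, since a
  common divisor of \<open>a\<close> and \<open>b\<close> divides 1; it also excludes
  \<open>b = 0\<close>.\<close>

lemma RatStep_sound:
  assumes step: "RatStep x R r k p1 p2" and k: "Suc k < B"
    and a: "val ser_nat x p1 a" and b: "val ser_nat x p2 b"
    and P: "bitrel B (\<lambda>j. R 11 r k j 0) P" and N: "bitrel B (\<lambda>j. R 12 r k j 0) N"
  shows "bitrel B (\<lambda>j. R 11 r (Suc k) j 0) (P * b)" "bitrel B (\<lambda>j. R 12 r (Suc k) j 0) (P * a + N * b)"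
    "coprime a b \<and> b \<noteq> 0"
proof -
  let ?n = "length x"
  note s = step[unfolded RatStep_def]
  have m: "mul_bits x (\<lambda>i j. R 6 r k i j) (\<lambda>j. R 11 r k j 0) (\<lambda>i. NatBit x p1 i)"
     "mul_bits x (\<lambda>i j. R 7 r k i j) (\<lambda>j. R 12 r k j 0) (\<lambda>i. NatBit x p2 i)"
     "mul_bits x (\<lambda>i j. R 8 r k i j) (\<lambda>j. R 11 r k j 0) (\<lambda>i. NatBit x p2 i)"
     "mul_bits x (\<lambda>i j. R 9 r k i j) (\<lambda>j. R 13 r k j 0) (\<lambda>i. NatBit x p1 i)"
     "mul_bits x (\<lambda>i j. R 10 r k i j) (\<lambda>j. R 14 r k j 0) (\<lambda>i. NatBit x p2 i)"
    using s by blast+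
  have e: "\<And>j. j < B \<Longrightarrow> ?n \<le> j \<Longrightarrow> \<not> R 13 r k j 0" "\<And>j. j < B \<Longrightarrow> ?n \<le> j \<Longrightarrow> \<not> R 14 r k j 0"
    "\<forall>j<B. R 10 r k ?n j \<longleftrightarrow> add_bits x (\<lambda>j. R 9 r k ?n j) (\<lambda>j. j = 0) j"
    "\<forall>j<B. R 11 r (Suc k) j 0 \<longleftrightarrow> R 8 r k ?n j"
    "\<forall>j<B. R 12 r (Suc k) j 0 \<longleftrightarrow> add_bits x (\<lambda>j. R 6 r k ?n j) (\<lambda>j. R 7 r k ?n j) j"
    using s length_less_bnd[of x] k by blast+
  show "bitrel B (\<lambda>j. R 11 r (Suc k) j 0) (P * b)"
    by (rule bitrel_cong[OF e(4) mul_bits_val[OF P b m(3)]])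
  show "bitrel B (\<lambda>j. R 12 r (Suc k) j 0) (P * a + N * b)"
    by (rule bitrel_add_bits[OF mul_bits_val[OF P a m(1)] mul_bits_val[OF N b m(2)] e(5)])
  obtain u where u: "u < 2 ^ ?n" "bitrel B (\<lambda>j. R 13 r k j 0) u" using bitrel_ex[of B ?n "\<lambda>j. R 13 r k j 0"] e(1) by blast
  obtain v where v: "v < 2 ^ ?n" "bitrel B (\<lambda>j. R 14 r k j 0) v" using bitrel_ex[of B ?n "\<lambda>j. R 14 r k j 0"] e(2) by blast
  have 1: "bitrel B (\<lambda>j. R 10 r k ?n j) (v * b)" by (rule mul_bits_val[OF v(2) b m(5)])
  have 2: "bitrel B (\<lambda>j. R 10 r k ?n j) (u * a + 1)"
    by (rule bitrel_add_bits[OF mul_bits_val[OF u(2) a m(4)] bitrel_one e(3)])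
  \<comment> \<open>Bit relations fix products only modulo \<open>2 ^ B\<close>. All factors are
    below \<open>2 ^ length x\<close> and \<open>bnd x\<close> exceeds \<open>2 * length x\<close>,
    so nothing wraps around and the equation holds for the numbers themselves.\<close>
  have bd: "w * c < 2 ^ (?n + ?n)" if "w < 2 ^ ?n" "c < 2 ^ ?n" for w c :: nat
    unfolding power_add using that by (rule mult_strict_mono') simp_all
  have "(2 :: nat) ^ (?n + ?n) < 2 ^ B" by (rule power_strict_increasing) (simp_all add: bnd_def)
  then have "v * b < 2 ^ B" "u * a + 1 < 2 ^ B"
    using bd[OF v(1) val_less_power[OF b]] bd[OF u(1) val_less_power[OF a]] by linarith+
  then have eq: "v * b = u * a + 1" using bitrel_inject[OF 1 2] by blast
  have "coprime a b"
  proof (rule coprimeI)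
    fix d assume "d dvd a" "d dvd b"
    then have "d dvd u * a" "d dvd u * a + 1" using eq by (metis dvd_mult)+
    then show "is_unit d" using dvd_add_right_iff[of d "u * a" 1] by blast
  qed
  moreover have "b \<noteq> 0" using eq by (cases "b = 0") simp_all
  ultimately show "coprime a b \<and> b \<noteq> 0" by blast
qed

lemma SumsToOne_sound:
  assumes v: "val (ser_list ser_frac) x r ds" and sum: "SumsToOne x R r"
  shows "k < length ds \<Longrightarrow> \<not> fst (ds ! k) \<and> coprime (fnum (ds ! k)) (fden (ds ! k)) \<and> fden (ds ! k) \<noteq> 0"
    "(\<Sum>k<length ds. rat_of_nat (fnum (ds ! k)) / rat_of_nat (fden (ds ! k))) = 1"
proof -
  note L = length_list_less[OF tag3 prefix_ser_frac v]
  have base: "bitrel B (\<lambda>j. R 11 r 0 j 0) 1" "bitrel B (\<lambda>j. R 12 r 0 j 0) 0"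
  proof -
    have 0: "\<forall>j<B. (R 11 r 0 j 0 \<longleftrightarrow> j = 0) \<and> \<not> R 12 r 0 j 0"
      using sum length_less_bnd[of x] unfolding SumsToOne_def by (metis gr_zeroI not_less_zero)
    show "bitrel B (\<lambda>j. R 11 r 0 j 0) 1" by (rule bitrel_cong[OF _ bitrel_one]) (use 0 in blast)
    show "bitrel B (\<lambda>j. R 12 r 0 j 0) 0" using 0 by (simp add: bitrel_def)
  qed
  have "\<forall>k<length ds. zerox x (elem_pos ser_frac r ds k) \<and> (\<exists>p1<B. p1 = Suc (elem_pos ser_frac r ds k) \<and>
      (\<exists>p2<B. IsNat x p1 p2 \<and> RatStep x R r k p1 p2))"
    using sum unfolding SumsToOne_def Elem_all[OF tag3 prefix_ser_frac v] by blast
  then have step: "zerox x (elem_pos ser_frac r ds k)"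
    "\<exists>p2. IsNat x (Suc (elem_pos ser_frac r ds k)) p2 \<and> RatStep x R r k (Suc (elem_pos ser_frac r ds k)) p2"
    if "k < length ds" for k using that by blast+
  have one: "bitrel B (\<lambda>j. R 11 r (Suc k) j 0) (P * fden (ds ! k)) \<and> bitrel B (\<lambda>j. R 12 r (Suc k) j 0) (P * fnum (ds ! k) + N * fden (ds ! k)) \<and>
      \<not> fst (ds ! k) \<and> coprime (fnum (ds ! k)) (fden (ds ! k)) \<and> fden (ds ! k) \<noteq> 0"
    if k: "k < length ds" and PN: "bitrel B (\<lambda>j. R 11 r k j 0) P" "bitrel B (\<lambda>j. R 12 r k j 0) N" for k P N
  proof -
    obtain s a b where d: "ds ! k = (s, a, b)" by (metis prod_cases3)
    let ?p = "elem_pos ser_frac r ds k"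
    have "val ser_frac x ?p (s, a, b)" using elem_val(1)[OF v k] d by simp
    then obtain p2 where p2: "occ x (Suc ?p) p2 (ser_nat a)" "val ser_nat x p2 b" "x ! ?p = s" by (rule frac_parts)
    obtain p2' where p2': "IsNat x (Suc ?p) p2'" "RatStep x R r k (Suc ?p) p2'" using step(2)[OF k] by blast
    then have "p2' = p2" using occ_prefix[OF pf0 p2(1)] unfolding IsNat_iff by blast
    then have st: "RatStep x R r k (Suc ?p) p2" using p2' by simp
    have a: "val ser_nat x (Suc ?p) a" using p2(1) unfolding val_def by blast
    have k1: "Suc k < B" using k L by simp
    show ?thesis using RatStep_sound[OF st k1 a p2(2) PN] step(1)[OF k] p2(3) d by (simp add: zerox_def)
  qed
  have PN: "k \<le> length ds \<Longrightarrow> bitrel B (\<lambda>j. R 11 r k j 0) (pden ds k) \<and> bitrel B (\<lambda>j. R 12 r k j 0) (pnum ds k)" for k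
  proof (induction k)
    case 0
    then show ?case using base by (simp add: pden_def)
  next
    case (Suc k)
    then show ?case using one[of k "pden ds k" "pnum ds k"] by (simp add: pden_Suc)
  qed
  have all: "\<not> fst (ds ! k) \<and> coprime (fnum (ds ! k)) (fden (ds ! k)) \<and> fden (ds ! k) \<noteq> 0" if "k < length ds" for k
  proof -
    have "bitrel B (\<lambda>j. R 11 r k j 0) (pden ds k)" "bitrel B (\<lambda>j. R 12 r k j 0) (pnum ds k)"
      using PN[of k] that by simp_all
    from one[OF that this] show ?thesis by blast
  qed
  then show "k < length ds \<Longrightarrow> \<not> fst (ds ! k) \<and> coprime (fnum (ds ! k)) (fden (ds ! k)) \<and> fden (ds ! k) \<noteq> 0" .
  have "HasLen x R 3 r (length ds)" using HasLen_iff[OF tag3 prefix_ser_frac v L] by blast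
  then have "\<forall>j<B. R 11 r (length ds) j 0 \<longleftrightarrow> R 12 r (length ds) j 0" using sum L unfolding SumsToOne_def by blast
  from bitrel_cong[OF this PN[OF order_refl, THEN conjunct2]]
  have 1: "bitrel B (\<lambda>j. R 11 r (length ds) j 0) (pnum ds (length ds))" .
  \<comment> \<open>The tags determine the two final numbers modulo \<open>2 ^ B\<close>. As both
    are bounded by 2 to the length of the encoded list, which is part of \<open>x\<close>, they are
    truly equal.\<close>
  have "length (enc ser_frac ds) \<le> length x" using list_end_val(1)[OF v] by simp
  then have lt: "(2 :: nat) ^ length (enc ser_frac ds) < 2 ^ B" by (intro power_strict_increasing) (simp_all add: bnd_def)
  have "pden ds (length ds) < 2 ^ B" "pnum ds (length ds) < 2 ^ B"
    using partial_bound[of "length ds" ds] le_less_trans[OF _ lt] by simp_all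
  then have "pden ds (length ds) = pnum ds (length ds)" using bitrel_inject[OF PN[OF order_refl, THEN conjunct1] 1] by blast
  then show "(\<Sum>k<length ds. rat_of_nat (fnum (ds ! k)) / rat_of_nat (fden (ds ! k))) = 1"
    using partial_sum[of "length ds" ds] all by simp
qed

lemma SumsToOne_complete:
  assumes v: "val (ser_list ser_frac) x r ds"
    and frac: "\<And>k. k < length ds \<Longrightarrow> \<not> fst (ds ! k) \<and> vv k * fden (ds ! k) = uu k * fnum (ds ! k) + 1 \<and> uu k < 2 ^ length x \<and> vv k < 2 ^ length x"
    and sum: "pden ds (length ds) = pnum ds (length ds)"
    and R: "\<And>k j. k \<le> length ds \<Longrightarrow> R 11 r k j 0 \<longleftrightarrow> bit (pden ds k) j" "\<And>k j. k \<le> length ds \<Longrightarrow> R 12 r k j 0 \<longleftrightarrow> bit (pnum ds k) j"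
      "\<And>k j. k < length ds \<Longrightarrow> R 13 r k j 0 \<longleftrightarrow> bit (uu k) j" "\<And>k j. k < length ds \<Longrightarrow> R 14 r k j 0 \<longleftrightarrow> bit (vv k) j"
      "\<And>k i j. k < length ds \<Longrightarrow> R 6 r k i j \<longleftrightarrow> bit (pden ds k * take_bit i (fnum (ds ! k))) j"
      "\<And>k i j. k < length ds \<Longrightarrow> R 7 r k i j \<longleftrightarrow> bit (pnum ds k * take_bit i (fden (ds ! k))) j"
      "\<And>k i j. k < length ds \<Longrightarrow> R 8 r k i j \<longleftrightarrow> bit (pden ds k * take_bit i (fden (ds ! k))) j"
      "\<And>k i j. k < length ds \<Longrightarrow> R 9 r k i j \<longleftrightarrow> bit (uu k * take_bit i (fnum (ds ! k))) j"
      "\<And>k i j. k < length ds \<Longrightarrow> R 10 r k i j \<longleftrightarrow> bit (vv k * take_bit i (fden (ds ! k))) j"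
  shows "SumsToOne x R r"
proof -
  let ?n = "length x"
  have step: "zerox x (elem_pos ser_frac r ds k) \<and> (\<exists>p1<B. p1 = Suc (elem_pos ser_frac r ds k) \<and>
      (\<exists>p2<B. IsNat x p1 p2 \<and> RatStep x R r k p1 p2))" if k: "k < length ds" for k
  proof -
    obtain s a b where d: "ds ! k = (s, a, b)" by (metis prod_cases3)
    let ?p = "elem_pos ser_frac r ds k"
    have "val ser_frac x ?p (s, a, b)" using elem_val(1)[OF v k] d by simp
    then obtain p2 where p2: "p2 < B" "Suc ?p < B" "occ x (Suc ?p) p2 (ser_nat a)" "val ser_nat x p2 b" "?p < length x" "x ! ?p = s"
      by (rule frac_parts)
    have va: "val ser_nat x (Suc ?p) a" using p2(3) unfolding val_def by blast
    have ta: "take_bit ?n a = a" "take_bit ?n b = b"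
      using val_less_power[OF va] val_less_power[OF p2(4)] by (simp_all add: take_bit_nat_eq_self_iff)
    have f: "fnum (ds ! k) = a" "fden (ds ! k) = b" by (simp_all add: d)
    note R' = R(5-9)[OF k, unfolded f]
    have kle: "k \<le> length ds" "Suc k \<le> length ds" using k by simp_all
    have rel: "bitrel B (\<lambda>j. R 11 r k j 0) (pden ds k)" "bitrel B (\<lambda>j. R 12 r k j 0) (pnum ds k)"
      "bitrel B (\<lambda>j. R 13 r k j 0) (uu k)" "bitrel B (\<lambda>j. R 14 r k j 0) (vv k)"
      unfolding bitrel_def using R(1,2)[OF kle(1)] R(3,4)[OF k] by blast+
    have m: "mul_bits x (\<lambda>i j. R 6 r k i j) (\<lambda>j. R 11 r k j 0) (\<lambda>i. NatBit x (Suc ?p) i)"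
       "mul_bits x (\<lambda>i j. R 7 r k i j) (\<lambda>j. R 12 r k j 0) (\<lambda>i. NatBit x p2 i)"
       "mul_bits x (\<lambda>i j. R 8 r k i j) (\<lambda>j. R 11 r k j 0) (\<lambda>i. NatBit x p2 i)"
       "mul_bits x (\<lambda>i j. R 9 r k i j) (\<lambda>j. R 13 r k j 0) (\<lambda>i. NatBit x (Suc ?p) i)"
       "mul_bits x (\<lambda>i j. R 10 r k i j) (\<lambda>j. R 14 r k j 0) (\<lambda>i. NatBit x p2 i)"
      unfolding mul_bits_iff[OF rel(1) NatBit_iff[OF va]] mul_bits_iff[OF rel(2) NatBit_iff[OF p2(4)]] mul_bits_iff[OF rel(1) NatBit_iff[OF p2(4)]]
        mul_bits_iff[OF rel(3) NatBit_iff[OF va]] mul_bits_iff[OF rel(4) NatBit_iff[OF p2(4)]]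
      by (simp_all add: bitrel_def R')
    have n: "bitrel B (\<lambda>j. R 6 r k ?n j) (pden ds k * a)" "bitrel B (\<lambda>j. R 7 r k ?n j) (pnum ds k * b)" "bitrel B (\<lambda>j. R 9 r k ?n j) (uu k * a)"
      by (simp_all add: bitrel_def R' ta)
    have high: "\<not> bit w j" if "w < 2 ^ ?n" "?n \<le> j" for w j :: nat
    proof -
      have "(2 :: nat) ^ ?n \<le> 2 ^ j" using that(2) by simp
      then have "w < 2 ^ j" using that(1) by linarith
      then show ?thesis by (simp add: bit_iff_odd)
    qed
    have fk: "\<not> s" "vv k * b = uu k * a + 1" "uu k < 2 ^ ?n" "vv k < 2 ^ ?n" using frac[OF k] by (simp_all add: d)
    have h: "\<forall>j<B. ?n \<le> j \<longrightarrow> \<not> R 13 r k j 0 \<and> \<not> R 14 r k j 0"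
      using R(3,4)[OF k] high fk by blast
    have bez: "\<forall>j<B. R 10 r k ?n j \<longleftrightarrow> add_bits x (\<lambda>j. R 9 r k ?n j) (\<lambda>j. j = 0) j"
      using add_bits_bitrel[OF n(3) bitrel_one] by (simp add: R' ta fk(2))
    have P: "\<forall>j<B. R 11 r (Suc k) j 0 \<longleftrightarrow> R 8 r k ?n j" by (simp add: R' R(1)[OF kle(2)] ta pden_Suc f)
    have N: "\<forall>j<B. R 12 r (Suc k) j 0 \<longleftrightarrow> add_bits x (\<lambda>j. R 6 r k ?n j) (\<lambda>j. R 7 r k ?n j) j"
      using add_bits_bitrel[OF n(1,2)] by (simp add: R(2)[OF kle(2)] f)
    have "RatStep x R r k (Suc ?p) p2" unfolding RatStep_def using m h bez P N by simp
    moreover have "IsNat x (Suc ?p) p2" unfolding IsNat_iff using p2(3) by blast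
    moreover have "zerox x ?p" using p2 fk by (simp add: zerox_def)
    ultimately show ?thesis using p2(1,2) by blast
  qed
  have base: "\<forall>z<B. z = 0 \<longrightarrow> (\<forall>j<B. (R 11 r z j 0 \<longleftrightarrow> j = 0) \<and> \<not> R 12 r z j 0)"
  proof (intro allI impI)
    fix z j assume "z = (0 :: nat)" "j < B"
    then show "(R 11 r z j 0 \<longleftrightarrow> j = 0) \<and> \<not> R 12 r z j 0"
      using R(1,2)[of 0 j] bitrel_one[of B] by (auto simp: pden_def bitrel_def)
  qed
  have final: "\<forall>k<B. HasLen x R 3 r k \<longrightarrow> (\<forall>j<B. R 11 r k j 0 \<longleftrightarrow> R 12 r k j 0)"
    using HasLen_iff[OF tag3 prefix_ser_frac v] R(1,2)[of "length ds"] sum by simp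
  show ?thesis unfolding SumsToOne_def Elem_all[OF tag3 prefix_ser_frac v] using step base final by blast
qed

end

section \<open>Certified words\<close>

text \<open>The recognisers are stacked: tag 1 relies on tag 0, tag 2 on tag 1, and tag 4 on tags 0
  and 3. Checked in this order there is no circularity.\<close>

definition Tags :: "bool list \<Rightarrow> rel \<Rightarrow> bool" where
  "Tags x R \<longleftrightarrow> SkipSpec x R 0 (IsNat x) \<and> SkipSpec x R 1 (IsList x R 0) \<and> SkipSpec x R 2 (IsList x R 1) \<and>
     SkipSpec x R 3 (IsFrac x) \<and> SkipSpec x R 4 (IsEntry x R) \<and> SmallBits x R"

text \<open>The positions 0 and \<open>length x\<close> appear as variables \<open>z\<close> and
  \<open>n\<close>, because the definability rules for \<open>IsNat\<close> and
  \<open>IsList\<close> take variables as positions.\<close>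

definition Split :: "bool list \<Rightarrow> rel \<Rightarrow> nat \<Rightarrow> nat \<Rightarrow> nat \<Rightarrow> nat \<Rightarrow> nat \<Rightarrow> nat \<Rightarrow> nat \<Rightarrow> nat \<Rightarrow> bool" where
  "Split x R z p1 p2 p3 p4 p5 p6 n \<longleftrightarrow> z = 0 \<and> n = length x \<and> IsNat x z p1 \<and> IsNat x p1 p2 \<and> IsList x R 0 p2 p3 \<and>
     IsList x R 2 p3 p4 \<and> IsList x R 4 p4 p5 \<and> IsList x R 0 p5 p6 \<and> IsNat x p6 n"

definition Game :: "bool list \<Rightarrow> rel \<Rightarrow> nat \<Rightarrow> nat \<Rightarrow> nat \<Rightarrow> nat \<Rightarrow> nat \<Rightarrow> nat \<Rightarrow> nat \<Rightarrow> nat \<Rightarrow> nat \<Rightarrow> nat \<Rightarrow> bool" where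
  "Game x R z p1 p2 p3 p4 p5 p6 ns m m1 \<longleftrightarrow> Val x R z ns \<and> Val x R p1 m \<and> m1 = Suc m \<and>
     Shape x R p2 p3 p5 p6 ns m1 \<and> Distributions x R p4 ns \<and> Cover x R p3 p4 ns m1 \<and> Absorb x R p3 p4 p5 ns m1 \<and>
     Wins x R p3 p4 p5 p6 ns m m1"

definition Certified :: "bool list \<Rightarrow> rel \<Rightarrow> bool" where
  "Certified x R \<longleftrightarrow> Tags x R \<and> (\<exists>z<bnd x. \<exists>p1<bnd x. \<exists>p2<bnd x. \<exists>p3<bnd x. \<exists>p4<bnd x. \<exists>p5<bnd x. \<exists>p6<bnd x. \<exists>n<bnd x.
     Split x R z p1 p2 p3 p4 p5 p6 n \<and> (\<exists>ns<bnd x. \<exists>m<bnd x. \<exists>m1<bnd x. Game x R z p1 p2 p3 p4 p5 p6 ns m m1))"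

lemma so_Tags: "so_definable (\<lambda>x R e. Tags x R)"
  unfolding Tags_def SkipSpec_def by (intro so_intros so_IsFrac so_IsEntry so_SmallBits; simp)

lemma so_Certified: "so_definable (\<lambda>x R e. Certified x R)"
  unfolding Certified_def Split_def Game_def
  by (intro so_intros so_Tags so_Shape so_Distributions so_Cover so_Absorb so_Wins; simp)

lemma Tags_iff: "Tags x R \<longleftrightarrow> tagged x R"
proof -
  have 0: "SkipSpec x R 0 (IsNat x) \<longleftrightarrow> skips x R 0 ser_nat" by (rule SkipSpec_iff) (rule IsNat_iff)
  have 1: "SkipSpec x R 1 (IsList x R 0) \<longleftrightarrow> skips x R 1 (ser_list ser_nat)" if "skips x R 0 ser_nat"
    by (rule SkipSpec_iff) (rule IsList_iff[OF that])
  have 2: "SkipSpec x R 2 (IsList x R 1) \<longleftrightarrow> skips x R 2 (ser_list (ser_list ser_nat))" if "skips x R 1 (ser_list ser_nat)"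
    by (rule SkipSpec_iff) (rule IsList_iff[OF that])
  have 3: "SkipSpec x R 3 (IsFrac x) \<longleftrightarrow> skips x R 3 ser_frac" by (rule SkipSpec_iff) (rule IsFrac_iff)
  have 4: "SkipSpec x R 4 (IsEntry x R) \<longleftrightarrow> skips x R 4 ser_entry" if "skips x R 0 ser_nat" "skips x R 3 ser_frac"
    by (rule SkipSpec_iff) (rule IsEntry_iff[OF that])
  show ?thesis unfolding Tags_def tagged_def SmallBits_iff 0 3 using 1 2 4 by blast
qed

text \<open>The sign is dropped, as certified fractions are nonnegative.\<close>

definition rat_of :: "frac \<Rightarrow> rat" where
  "rat_of f = rat_of_nat (fnum f) / rat_of_nat (fden f)"

text \<open>A triple in lowest terms is what \<open>quotient_of\<close> returns for its value. This
  makes the game read off a word encode back to exactly that word.\<close>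

lemma frac_of_rat_of:
  assumes "\<not> fst f" "coprime (fnum f) (fden f)" "fden f \<noteq> 0" shows "frac_of (rat_of f) = f"
proof -
  obtain s a b where f: "f = (s, a, b)" by (metis prod_cases3)
  have "rat_of f = Fract (int a) (int b)" by (simp add: rat_of_def f Fract_of_int_quotient)
  then have "quotient_of (rat_of f) = (int a, int b)"
    using assms by (simp add: quotient_of_Fract normalize_stable f)
  then show ?thesis using assms by (simp add: frac_of_def f)
qed

lemma frac_of_nonneg:
  assumes "0 \<le> q"
  shows "\<not> fst (frac_of q)" "coprime (fnum (frac_of q)) (fden (frac_of q))" "fden (frac_of q) \<noteq> 0" "rat_of (frac_of q) = q"
proof -
  obtain a b where ab: "quotient_of q = (a, b)" by (cases "quotient_of q")
  then have q: "q = of_int a / of_int b" "b > 0" "coprime a b"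
    by (auto dest: quotient_of_div quotient_of_denom_pos quotient_of_coprime)
  have a: "0 \<le> a" using assms q(1,2) by (simp add: zero_le_divide_iff)
  have f: "frac_of q = (False, nat a, nat b)" unfolding frac_of_def ab using a by simp
  show "\<not> fst (frac_of q)" "fden (frac_of q) \<noteq> 0" using q(2) by (simp_all add: f)
  show "coprime (fnum (frac_of q)) (fden (frac_of q))"
    using q(3) a q(2) by (simp add: f coprime_int_iff[symmetric])
  show "rat_of (frac_of q) = q" using q(1,2) a unfolding rat_of_def f fnum.simps fden.simps by simp
qed

lemma sum_list_rat_of: "sum_list (map rat_of ds) = (\<Sum>k<length ds. rat_of_nat (fnum (ds ! k)) / rat_of_nat (fden (ds ! k)))"
  by (simp add: sum_list_sum_nth rat_of_def atLeast0LessThan)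

lemma ser_list_map: "ser_list f (map h xs) = ser_list (\<lambda>a. f (h a)) xs"
  by (simp add: ser_list_def comp_def)

definition raw_delta :: "raw_game \<Rightarrow> (nat \<times> nat list \<times> frac list) list" where
  "raw_delta g = map (\<lambda>(s, a, d). (s, a, map frac_of d)) (rg_delta g)"

lemma ser_game_raw: "ser_game g = ser_nat (rg_ns g) @ ser_nat (rg_m g) @ ser_list ser_nat (rg_acts g) @
     ser_list (ser_list (ser_list ser_nat)) (rg_av g) @ ser_list ser_entry (raw_delta g) @
     ser_list ser_nat (rg_T g) @ ser_nat (rg_s0 g)"
proof -
  have "ser_list ser_rat = (\<lambda>d. ser_list ser_frac (map frac_of d))"
    by (simp add: ser_list_map ser_frac_of)
  then have "ser_list ser_entry (raw_delta g) = ser_list (\<lambda>(s, a, d). ser_nat s @ ser_list ser_nat a @ ser_list ser_rat d) (rg_delta g)"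
    by (simp add: raw_delta_def ser_list_map ser_entry_def split_def)
  then show ?thesis unfolding ser_game_def by simp
qed

lemma occ_whole: "occ x 0 (length x) w \<longleftrightarrow> x = w"
  by (auto simp: occ_drop)

section \<open>Reading a game off a certified word\<close>

context tagged
begin

lemma Split_iff:
  assumes "p2 < B" "p3 < B" "p4 < B" "p5 < B"
  shows "Split x R z p1 p2 p3 p4 p5 p6 n \<longleftrightarrow> z = 0 \<and> n = length x \<and> (\<exists>ns m acts avl del T s0.
     occ x 0 p1 (ser_nat ns) \<and> occ x p1 p2 (ser_nat m) \<and> occ x p2 p3 (ser_list ser_nat acts) \<and>
     occ x p3 p4 (ser_list (ser_list (ser_list ser_nat)) avl) \<and> occ x p4 p5 (ser_list ser_entry del) \<and>
     occ x p5 p6 (ser_list ser_nat T) \<and> occ x p6 (length x) (ser_nat s0))"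
  unfolding Split_def IsNat_iff IsList_iff[OF tag0 assms(1)] IsList_iff[OF tag2 assms(2)] IsList_iff[OF tag4 assms(3)]
    IsList_iff[OF tag0 assms(4)] by blast

end

context entries
begin

lemma Distributions_iff: "Distributions x R p4 n \<longleftrightarrow> (\<forall>k<length del. HasLen x R 3 (dpos k) n \<and> SumsToOne x R (dpos k))"
  unfolding Distributions_def by (rule raw_AllEntries_iff)

lemma Distributions_sound:
  assumes dist: "Distributions x R p4 n" and n: "n < B" and e: "(s, a, d) \<in> set del"
  shows "length d = n" "map (\<lambda>f. frac_of (rat_of f)) d = d" "sum_list (map rat_of d) = 1"
proof -
  obtain k where k: "k < length del" "del ! k = (s, a, d)" using e by (metis in_set_conv_nth)
  have v: "val (ser_list ser_frac) x (dpos k) d" using raw_entry_vals(3)[OF k(1)] k(2) by simp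
  have D: "HasLen x R 3 (dpos k) n" "SumsToOne x R (dpos k)" using dist k(1) unfolding Distributions_iff by blast+
  show "length d = n" using D(1) HasLen_iff[OF tag3 prefix_ser_frac v n] by simp
  show "map (\<lambda>f. frac_of (rat_of f)) d = d"
  proof (rule map_idI)
    fix f assume "f \<in> set d"
    then obtain l where "l < length d" "f = d ! l" by (metis in_set_conv_nth)
    then show "frac_of (rat_of f) = f" using SumsToOne_sound(1)[OF v D(2)] frac_of_rat_of by blast
  qed
  show "sum_list (map rat_of d) = 1" unfolding sum_list_rat_of by (rule SumsToOne_sound(2)[OF v D(2)])
qed

end

text \<open>The parse yields components of a game whose encoding is the whole of \<open>x\<close>.
  Each remaining formula then contributes one clause of \<open>wf_game\<close>, and the last one a
  winning triple.\<close>

lemma Certified_sound: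
  assumes "Certified x R" shows "x \<in> almost_sure_lang"
proof -
  note cert = assms[unfolded Certified_def Tags_iff]
  interpret tagged x R by (rule cert[THEN conjunct1])
  obtain z p1 p2 p3 p4 p5 p6 n ns m m1
    where split: "Split x R z p1 p2 p3 p4 p5 p6 n" and game: "Game x R z p1 p2 p3 p4 p5 p6 ns m m1"
    and p: "p2 < B" "p3 < B" "p4 < B" "p5 < B" and b: "ns < B" "m < B" "m1 < B"
    using cert[THEN conjunct2] by (elim exE conjE) (rule that)
  have z: "z = 0" using split unfolding Split_def by blast
  obtain ns' m' acts avl del T s0 where o:
     "occ x 0 p1 (ser_nat ns')" "occ x p1 p2 (ser_nat m')" "occ x p2 p3 (ser_list ser_nat acts)"
     "occ x p3 p4 (ser_list (ser_list (ser_list ser_nat)) avl)" "occ x p4 p5 (ser_list ser_entry del)"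
     "occ x p5 p6 (ser_list ser_nat T)" "occ x p6 (length x) (ser_nat s0)"
    using split unfolding Split_iff[OF p] by (elim exE conjE) (rule that)
  note G = game[unfolded Game_def z]
  have ns: "ns' = ns" using G Val_tag[OF _ b(1)] o(1) unfolding val_def by blast
  have m: "m' = m" using G Val_tag[OF _ b(2)] o(2) unfolding val_def by blast
  have m1: "m1 = Suc m" using G by blast
  interpret entries x R del p4 by unfold_locales (use o(5) in \<open>auto simp: val_def\<close>)
  have dist: "Distributions x R p4 ns" using G by blast
  \<comment> \<open>Fractions are turned into rationals here. That this loses nothing is the next
    goal, \<open>raw_delta g = del\<close>, which rests on the lowest-terms test.\<close>
  define g where "g = RawGame ns m acts avl (map (\<lambda>(s, a, d). (s, a, map rat_of d)) del) T s0"
  have g: "rg_ns g = ns" "rg_m g = m" "rg_acts g = acts" "rg_av g = avl" "rg_T g = T" "rg_s0 g = s0"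
    "rg_delta g = map (\<lambda>(s, a, d). (s, a, map rat_of d)) del" by (simp_all add: g_def)
  have del: "raw_delta g = del"
  proof -
    have "map (\<lambda>e. (fst e, fst (snd e), map (\<lambda>f. frac_of (rat_of f)) (snd (snd e)))) del = del"
    proof (rule map_idI)
      fix e assume "e \<in> set del"
      then show "(fst e, fst (snd e), map (\<lambda>f. frac_of (rat_of f)) (snd (snd e))) = e"
        using Distributions_sound(2)[OF dist b(1), of "fst e" "fst (snd e)" "snd (snd e)"] by simp
    qed
    then show ?thesis by (simp add: raw_delta_def g(7) split_def comp_def)
  qed
  have "occ x 0 (length x) (ser_game g)"
    unfolding ser_game_raw del g occ_append using o unfolding ns m by blast
  then have x: "x = ser_game g" by (simp add: occ_whole)
  interpret coded x R del p4 g p1 p2 p3 p5 p6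
  proof unfold_locales
    show "val ser_nat x 0 (rg_ns g)" "val ser_nat x p1 (rg_m g)" "val (ser_list ser_nat) x p2 (rg_acts g)"
      "val (ser_list (ser_list (ser_list ser_nat))) x p3 (rg_av g)" "val (ser_list ser_nat) x p5 (rg_T g)" "val ser_nat x p6 (rg_s0 g)"
      using o unfolding g val_def ns m by blast+
    show "del = map (\<lambda>(s, a, d). (s, a, map frac_of d)) (rg_delta g)" using del unfolding raw_delta_def by simp
    show "rg_ns g < bnd x" "Suc (rg_m g) < bnd x" using b m1 by (simp_all add: g)
  qed
  have "Shape x R p2 p3 p5 p6 (rg_ns g) (Suc (rg_m g))" using G unfolding g m1 by blast
  note shape = this[unfolded Shape_iff]
  interpret shaped x R del p4 g p1 p2 p3 p5 p6 by unfold_locales (use shape in auto)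
  have entry: "length d = rg_ns g \<and> (\<forall>q\<in>set d. q \<ge> 0) \<and> sum_list d = 1" if e: "(s, a, d) \<in> set (rg_delta g)" for s a d
  proof -
    obtain d' where d: "(s, a, d') \<in> set del" "d = map rat_of d'" using e unfolding g by auto
    have "\<forall>q\<in>set d. q \<ge> 0" by (auto simp: d(2) rat_of_def)
    then show ?thesis using Distributions_sound(1,3)[OF dist b(1) d(1)] by (simp add: d(2) g)
  qed
  interpret distributed x R del p4 g p1 p2 p3 p5 p6
  proof unfold_locales
    fix k assume k: "k < length (rg_delta g)"
    have e: "(fst (rg_delta g ! k), fst (snd (rg_delta g ! k)), snd (snd (rg_delta g ! k))) \<in> set (rg_delta g)" using k by simp
    show "length (snd (snd (rg_delta g ! k))) = rg_ns g" using entry[OF e] by blast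
    fix q assume "q \<in> set (snd (snd (rg_delta g ! k)))"
    then show "0 \<le> q" using entry[OF e] by blast
  qed
  have av: "av g p s \<noteq> {}" if "p < Suc (rg_m g)" "s < rg_ns g" for p s
    using shape that unfolding av_def by auto
  have T: "set (rg_T g) \<subseteq> {..<rg_ns g}" "rg_s0 g < rg_ns g" using shape by blast+
  have "Cover x R p3 p4 (rg_ns g) (Suc (rg_m g))" using G unfolding g m1 by blast
  note this_cover = this[unfolded Cover_iff]
  have cover: "\<forall>s<rg_ns g. \<forall>a\<in>profiles g s. \<exists>e\<in>set (rg_delta g). fst e = s \<and> fst (snd e) = a"
  proof (intro allI impI)
    fix s assume s: "s < rg_ns g"
    note c = this_cover[THEN spec, THEN mp, OF s]
    show "\<forall>a\<in>profiles g s. \<exists>e\<in>set (rg_delta g). fst e = s \<and> fst (snd e) = a"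
      by (rule cover_closure[OF av[OF _ s], THEN iffD2]) (assumption, rule c)
  qed
  have "Absorb x R p3 p4 p5 (rg_ns g) (Suc (rg_m g))" using G unfolding g m1 by blast
  note absorb = this[unfolded Absorb_iff[OF T(1)]]
  have wf: "wf_game g" unfolding wf_game_def
  proof (intro conjI)
    show "\<forall>(s, a, d)\<in>set (rg_delta g). length d = rg_ns g \<and> (\<forall>q\<in>set d. 0 \<le> q) \<and> sum_list d = 1"
      by (intro ballI, clarify) (rule entry)
    show "\<forall>p<Suc (rg_m g). length (rg_av g ! p) = rg_ns g \<and>
        (\<forall>s<rg_ns g. rg_av g ! p ! s \<noteq> [] \<and> set (rg_av g ! p ! s) \<subseteq> {..<rg_acts g ! p})"
      using shape by simp
  qed (use shape cover absorb in blast)+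
  have "Wins x R p3 p4 p5 p6 (rg_ns g) (rg_m g) (Suc (rg_m g))" using G unfolding g m1 by blast
  from Wins_sound[OF T(2) this] have "almost_sure g"
    using game.almost_sure_iff_win[OF game.intro[OF wf]] by blast
  then show ?thesis unfolding almost_sure_lang_def using wf x by blast
qed

text \<open>Only the order of ranks matters. Counting the states of smaller rank preserves strict
  inequality and is bounded by the number of states, so the rank fits into the guessed
  relation.\<close>

lemma win_rank:
  assumes "win g W D r"
  shows "win g W D (\<lambda>s. card {u. u < rg_ns g \<and> r u < r s})"
proof -
  have less: "card {u. u < rg_ns g \<and> r u < r s'} < card {u. u < rg_ns g \<and> r u < r s}" if "r s' < r s" "s' < rg_ns g" for s s'
  proof (rule psubset_card_mono)
    show "{u. u < rg_ns g \<and> r u < r s'} \<subset> {u. u < rg_ns g \<and> r u < r s}" using that by fastforce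
  qed simp
  show ?thesis unfolding win_def
  proof (intro conjI ballI)
    fix s assume s: "s \<in> W - set (rg_T g)"
    note ws = assms[unfolded win_def, THEN conjunct2, THEN conjunct2, rule_format, OF s]
    show "\<forall>p<rg_m g. D p s \<subseteq> av g p s" using ws by blast
    { fix a assume "a \<in> profiles g s"
      then show "(\<forall>p<rg_m g. a ! p \<in> D p s) \<longrightarrow> (\<forall>s'<rg_ns g. dlt g s a s' > 0 \<longrightarrow> s' \<in> W)" using ws by blast }
    fix b assume "b \<in> av g (rg_m g) s"
    then obtain a s' where "a \<in> profiles g s" "\<forall>p<rg_m g. a ! p \<in> D p s" "a ! rg_m g = b" "s' < rg_ns g" "dlt g s a s' > 0" "r s' < r s"
      using ws by blast
    then show "\<exists>a\<in>profiles g s. (\<forall>p<rg_m g. a ! p \<in> D p s) \<and> a ! rg_m g = b \<and>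
        (\<exists>s'<rg_ns g. dlt g s a s' > 0 \<and> card {u. u < rg_ns g \<and> r u < r s'} < card {u. u < rg_ns g \<and> r u < r s})"
      using less[of s' s] by blast
  qed (use assms[unfolded win_def] in blast)+
qed

section \<open>Building a certificate for a winning game\<close>

definition bezout :: "frac \<Rightarrow> nat \<times> nat" where
  "bezout f = (SOME (u, v). v * fden f = u * fnum f + 1 \<and> u < fden f \<and> v \<le> fnum f + 1)"

text \<open>Tags 6 to 14 decode the list of rationals that starts at position i; their values do not matter
  where no such list starts.\<close>

definition certificate :: "bool list \<Rightarrow> raw_game \<Rightarrow> nat set \<Rightarrow> (nat \<Rightarrow> nat \<Rightarrow> nat set) \<Rightarrow> (nat \<Rightarrow> nat) \<Rightarrow> rel" where
  "certificate x g W D r t i k j l = (let ds = (SOME ds. val (ser_list ser_frac) x i ds) in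
     if t = 0 then skip ser_nat x i k j
     else if t = 1 then skip (ser_list ser_nat) x i k j
     else if t = 2 then skip (ser_list (ser_list ser_nat)) x i k j
     else if t = 3 then skip ser_frac x i k j
     else if t = 4 then skip ser_entry x i k j
     else if t = 5 then bit i k
     else if t = 6 then bit (pden ds k * take_bit j (fnum (ds ! k))) l
     else if t = 7 then bit (pnum ds k * take_bit j (fden (ds ! k))) l
     else if t = 8 then bit (pden ds k * take_bit j (fden (ds ! k))) l
     else if t = 9 then bit (fst (bezout (ds ! k)) * take_bit j (fnum (ds ! k))) l
     else if t = 10 then bit (snd (bezout (ds ! k)) * take_bit j (fden (ds ! k))) l
     else if t = 11 then bit (pden ds k) j
     else if t = 12 then bit (pnum ds k) j
     else if t = 13 then bit (fst (bezout (ds ! k))) j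
     else if t = 14 then bit (snd (bezout (ds ! k))) j
     else if t = 15 then i \<in> W
     else if t = 16 then rg_av g ! i ! k ! j \<in> D i k
     else k = r i)"

lemma bezout:
  assumes "coprime (fnum f) (fden f)" "fden f \<noteq> 0"
  shows "snd (bezout f) * fden f = fst (bezout f) * fnum f + 1" "fst (bezout f) < fden f" "snd (bezout f) \<le> fnum f + 1"
proof -
  have "\<exists>uv. case uv of (u, v) \<Rightarrow> v * fden f = u * fnum f + 1 \<and> u < fden f \<and> v \<le> fnum f + 1"
    using bezout_small[of "fnum f" "fden f"] assms by auto
  from someI_ex[OF this] show "snd (bezout f) * fden f = fst (bezout f) * fnum f + 1" "fst (bezout f) < fden f" "snd (bezout f) \<le> fnum f + 1"
    unfolding bezout_def by (simp_all add: split_def)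
qed

lemma tagged_certificate: "tagged x (certificate x g W D r)"
  unfolding tagged_def skips_def bitrel_def by (simp add: certificate_def)

lemma Distributions_certificate:
  assumes "distributed x (certificate x g W D r) del p4 g p1 p2 p3 p5 p6"
    and wf: "wf_game g"
  shows "Distributions x (certificate x g W D r) p4 (rg_ns g)"
proof -
  interpret distributed x "certificate x g W D r" del p4 g p1 p2 p3 p5 p6 by (rule assms(1))
  let ?R = "certificate x g W D r"
  show ?thesis unfolding Distributions_iff length_del
  proof (intro allI impI conjI)
    fix k assume k: "k < N"
    define ds where "ds = map frac_of (ed k)"
    have v: "val (ser_list ser_frac) x (dpos k) ds" unfolding ds_def by (rule entry_vals(3)[OF k])
    have len: "length ds = ns" using dist_len[OF k] by (simp add: ds_def)
    then show "HasLen x ?R 3 (dpos k) ns" using HasLen_iff[OF tag3 prefix_ser_frac v ns_less] by simp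
    \<comment> \<open>By unique decoding, the list that the certificate chooses at this position is
      the distribution actually written there.\<close>
    have some: "(SOME ds. val (ser_list ser_frac) x (dpos k) ds) = ds"
      using val_unique[OF prefix_ser_list[OF prefix_ser_frac] _ v] v by (intro some_equality) blast+
    have nonneg: "0 \<le> q" if "q \<in> set (ed k)" for q by (rule dist_nonneg[OF k that])
    have canonical: "\<not> fst (ds ! l)" "coprime (fnum (ds ! l)) (fden (ds ! l))" "fden (ds ! l) \<noteq> 0"
      if "l < length ds" for l
      using frac_of_nonneg(1-3)[OF nonneg, of "ed k ! l"] that by (simp_all add: ds_def)
    have small: "fst (bezout (ds ! l)) < 2 ^ length x" "snd (bezout (ds ! l)) < 2 ^ length x" if l: "l < length ds" for l
    proof -
      obtain s a b where d: "ds ! l = (s, a, b)" by (metis prod_cases3)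
      have "val ser_frac x (elem_pos ser_frac (dpos k) ds l) (s, a, b)" using elem_val(1)[OF v l] d by simp
      then obtain q where q: "occ x (Suc (elem_pos ser_frac (dpos k) ds l)) q (ser_nat a)" "val ser_nat x q b" by (rule frac_parts)
      note bz = bezout[OF canonical(2,3)[OF l], unfolded d fnum.simps fden.simps]
      show "fst (bezout (ds ! l)) < 2 ^ length x" using bz(2) val_less_power[OF q(2)] unfolding d by simp
      \<comment> \<open>The coefficient can reach \<open>a + 1\<close>, for which
        \<open>a < 2 ^ length x\<close> is one short. The numeral has \<open>2 * nbits a + 1\<close>
        symbols, so \<open>nbits a\<close> is strictly below \<open>length x\<close> and leaves the
        room.\<close>
      have "val ser_nat x (Suc (elem_pos ser_frac (dpos k) ds l)) a" using q(1) unfolding val_def by blast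
      from nbits_bound[OF this] have "(2 :: nat) ^ nbits a < 2 ^ length x" by (intro power_strict_increasing) simp_all
      then show "snd (bezout (ds ! l)) < 2 ^ length x" using bz(3) less_two_power_nbits[of a] unfolding d by linarith
    qed
    have "sum_list (ed k) = 1"
      using wf nth_mem[OF k] unfolding wf_game_def by (auto simp: split_def)
    moreover have "map rat_of ds = ed k"
      unfolding ds_def map_map comp_def by (rule map_idI) (rule frac_of_nonneg(4)[OF nonneg])
    ultimately have "(\<Sum>l<length ds. rat_of_nat (fnum (ds ! l)) / rat_of_nat (fden (ds ! l))) = 1"
      unfolding sum_list_rat_of[symmetric] by simp
    then have sum: "pden ds (length ds) = pnum ds (length ds)"
      using partial_sum[of "length ds" ds] canonical(3) by simp
    show "SumsToOne x ?R (dpos k)"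
      by (rule SumsToOne_complete[OF v, where uu = "\<lambda>l. fst (bezout (ds ! l))" and vv = "\<lambda>l. snd (bezout (ds ! l))"])
        (use canonical bezout small sum in \<open>auto simp: certificate_def some\<close>)
  qed
qed

lemma Certified_complete:
  assumes wf: "wf_game g" and "almost_sure g"
  shows "\<exists>R. Certified (ser_game g) R"
proof -
  obtain W D r0 where w0: "win g W D r0" using game.almost_sure_iff_win[OF game.intro[OF wf]] assms(2) by blast
  define r where "r = (\<lambda>s. card {u. u < rg_ns g \<and> r0 u < r0 s})"
  have w: "win g W D r" unfolding r_def by (rule win_rank[OF w0])
  have r_le: "r s \<le> rg_ns g" for s
    unfolding r_def using card_mono[of "{..<rg_ns g}" "{u. u < rg_ns g \<and> r0 u < r0 s}"] by auto
  define x where "x = ser_game g"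
  define R where "R = certificate x g W D r"
  interpret tagged x R unfolding R_def by (rule tagged_certificate)
  have "occ x 0 (length x) (ser_game g)" unfolding occ_whole x_def ..
  then obtain p1 p2 p3 p4 p5 p6 where o:
     "occ x 0 p1 (ser_nat (rg_ns g))" "occ x p1 p2 (ser_nat (rg_m g))" "occ x p2 p3 (ser_list ser_nat (rg_acts g))"
     "occ x p3 p4 (ser_list (ser_list (ser_list ser_nat)) (rg_av g))" "occ x p4 p5 (ser_list ser_entry (raw_delta g))"
     "occ x p5 p6 (ser_list ser_nat (rg_T g))" "occ x p6 (length x) (ser_nat (rg_s0 g))"
    unfolding ser_game_raw occ_append by (elim exE conjE) (rule that)
  have vals: "val ser_nat x 0 (rg_ns g)" "val ser_nat x p1 (rg_m g)" "val (ser_list ser_nat) x p2 (rg_acts g)"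
      "val (ser_list (ser_list (ser_list ser_nat))) x p3 (rg_av g)" "val (ser_list ser_entry) x p4 (raw_delta g)"
      "val (ser_list ser_nat) x p5 (rg_T g)" "val ser_nat x p6 (rg_s0 g)"
    using o unfolding val_def by blast+
  note wf' = wf[unfolded wf_game_def]
  have len: "length (rg_acts g) = Suc (rg_m g)" "length (rg_av g) = Suc (rg_m g)"
    "\<And>p. p < Suc (rg_m g) \<Longrightarrow> length (rg_av g ! p) = rg_ns g" using wf' by blast+
  \<comment> \<open>Numbers of players and states are written in binary and could be exponential.
    Well-formedness puts lists of these lengths into the encoding, the action counts for players and
    the first player's availability lists for states, so both stay below the bound.\<close>
  have m: "Suc (rg_m g) < B" using len0[OF vals(3)] len by simp
  have "val (ser_list (ser_list ser_nat)) x (elem_pos (ser_list (ser_list ser_nat)) p3 (rg_av g) 0) (rg_av g ! 0)"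
    using elem_val(1)[OF vals(4), of 0] len by simp
  from length_list_less[OF tag1 pf1 this] have ns: "rg_ns g < B" using len(3)[of 0] by simp
  have entry: "length (snd (snd (rg_delta g ! k))) = rg_ns g \<and> (\<forall>q\<in>set (snd (snd (rg_delta g ! k))). 0 \<le> q)"
    if "k < length (rg_delta g)" for k
  proof -
    have "\<forall>(s, a, d)\<in>set (rg_delta g). length d = rg_ns g \<and> (\<forall>q\<in>set d. q \<ge> 0) \<and> sum_list d = 1" using wf' by blast
    then show ?thesis using nth_mem[OF that] by (auto simp: split_def)
  qed
  interpret distributed x R "raw_delta g" p4 g p1 p2 p3 p5 p6
  proof unfold_locales
    show "raw_delta g = map (\<lambda>(s, a, d). (s, a, map frac_of d)) (rg_delta g)" by (simp add: raw_delta_def)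
  qed (use vals m ns len entry in blast)+
  have T: "set (rg_T g) \<subseteq> {..<rg_ns g}" "rg_s0 g < rg_ns g" using wf' by blast+
  have ne: "rg_av g ! p ! s \<noteq> []" "set (rg_av g ! p ! s) \<subseteq> {..<rg_acts g ! p}" if "p < Suc (rg_m g)" "s < rg_ns g" for p s
    using wf' that by blast+
  have shape: "Shape x R p2 p3 p5 p6 (rg_ns g) (Suc (rg_m g))"
    unfolding Shape_iff using T ne len by simp
  have cover: "Cover x R p3 p4 (rg_ns g) (Suc (rg_m g))"
    unfolding Cover_iff
  proof (intro allI impI)
    fix s assume s: "s < rg_ns g"
    have "\<forall>a\<in>profiles g s. \<exists>e\<in>set (rg_delta g). fst e = s \<and> fst (snd e) = a" using wf' s by blast
    moreover have "\<And>p. p < Suc (rg_m g) \<Longrightarrow> av g p s \<noteq> {}" using ne(1) s unfolding av_def by simp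
    ultimately show "(\<exists>k<N. es k = s \<and> ea k \<in> profiles g s) \<and>
       (\<forall>k<N. es k = s \<and> ea k \<in> profiles g s \<longrightarrow> (\<forall>p<Suc (rg_m g). \<forall>c\<in>av g p s.
          \<exists>k'<N. (es k' = s \<and> ea k' \<in> profiles g s) \<and> (\<forall>p'<p. ea k ! p' = ea k' ! p') \<and> ea k' ! p = c))"
      using cover_closure by blast
  qed
  have absorb: "Absorb x R p3 p4 p5 (rg_ns g) (Suc (rg_m g))"
    unfolding Absorb_iff[OF T(1)] using wf' by blast
  have dist: "Distributions x R p4 (rg_ns g)"
    unfolding R_def by (rule Distributions_certificate[OF _ wf]) (fold R_def, rule distributed_axioms)
  have win: "Wins x R p3 p4 p5 p6 (rg_ns g) (rg_m g) (Suc (rg_m g))"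
    by (rule Wins_complete[OF w T(2)]) (use r_le ns in \<open>auto simp: R_def certificate_def intro: le_less_trans\<close>)
  have "p1 < B" "p2 < B" "p3 < B" "p4 < B" "p5 < B" "p6 < B" using occ_less_bnd o by blast+
  note p = this
  have split: "Split x R 0 p1 p2 p3 p4 p5 p6 (length x)"
    unfolding Split_iff[OF p(2-5)] using o by blast
  have game: "Game x R 0 p1 p2 p3 p4 p5 p6 (rg_ns g) (rg_m g) (Suc (rg_m g))"
    unfolding Game_def using Val_tag[OF vals(1) ns] Val_tag[OF vals(2)] m shape dist cover absorb win by simp
  have b: "rg_m g < B" "0 < B" "length x < B" using m by (simp_all add: bnd_def)
  have "Certified x R"
    unfolding Certified_def Tags_iff
    by (rule conjI[OF tagged_axioms],
      rule exI[of _ 0], rule conjI[OF b(2)], rule exI[of _ p1], rule conjI[OF p(1)], rule exI[of _ p2], rule conjI[OF p(2)], rule exI[of _ p3], rule conjI[OF p(3)], rule exI[of _ p4], rule conjI[OF p(4)], rule exI[of _ p5], rule conjI[OF p(5)], rule exI[of _ p6], rule conjI[OF p(6)], rule exI[of _ "length x"], rule conjI[OF b(3)],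
      rule conjI[OF split], rule exI[of _ "rg_ns g"], rule conjI[OF ns], rule exI[of _ "rg_m g"], rule conjI[OF b(1)],
      rule exI[of _ "Suc (rg_m g)"], rule conjI[OF m], rule game)
  then show ?thesis unfolding x_def by blast
qed

theorem theorem6:
  shows "in_NP almost_sure_lang"
proof -
  have "almost_sure_lang = {x. \<exists>R. Certified x R}"
    using Certified_sound Certified_complete unfolding almost_sure_lang_def by blast
  then show ?thesis using so_in_NP[OF so_Certified] by simp
qed

end
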